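(* Let $s>\tfrac32$. For all $\Gamma\in\mathfrak{H}^s$ and $f\in H^s(\mathbb{R}^3,\mathbb{C})$, the products $\Gamma f$ and $f\Gamma$ define elements of $\mathfrak{H}^s$. Moreover, for every $s'$ with $\tfrac32<s'\le s$ there exists a constant $c>0$ such that for all $f\in H^s(\mathbb{R}^3,\mathbb{C})$ and all $\Gamma\in\mathfrak{H}^s$, satisfying additionally $\Gamma\ge0$ if $s'<s$, we have $$\|f\Gamma\|_{\mathfrak{H}^s}+\|\Gamma f\|_{\mathfrak{H}^s}\le c\Big(\|f\|_{H^s}\|\Gamma\|_{\mathfrak{H}^s}^{1/2}\|\Gamma\|_{\mathfrak{H}^{s'}}^{1/2}+\|f\|_{L^\infty}\|\Gamma\|_{\mathfrak{H}^s}\Big).$$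
   Context: For $s\ge0$, $\mathfrak{H}^s$ is the Banach space of bounded operators $\Gamma:H^{-s}(\mathbb{R}^3,\mathbb{C}^4)\to H^s(\mathbb{R}^3,\mathbb{C}^4)$ such that $(1-\Delta)^{s/2}\Gamma(1-\Delta)^{s/2}$ is Hilbert-Schmidt on $L^2(\mathbb{R}^3,\mathbb{C}^4)$, with norm $\|\Gamma\|_{\mathfrak{H}^s}=\|(1-\Delta)^{s/2}\Gamma(1-\Delta)^{s/2}\|_{\mathfrak{S}^2}$, where $\mathfrak{S}^2$ is the Hilbert-Schmidt class. In the products $f\Gamma$ and $\Gamma f$, $f$ denotes the operator of multiplication by the function $f$. $\Gamma\ge0$ means non-negative as an operator on $L^2(\mathbb{R}^3,\mathbb{C}^4)$. *)

theory Defs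
  imports "HOL-Analysis.Analysis" "HOL-Probability.Essential_Supremum"
begin

section \<open>Tempered distributions on three-dimensional space\<close>

type_synonym space = "real^3"

text \<open>
  Scalar distributions are functionals on Schwartz functions.  They are normalised to vanish
  outside the Schwartz space, so that equality of distributions is equality in HOL.  A
  distribution with values in the space of complex 4-vectors is the vector of its components.
\<close>

type_synonym distr = "(space \<Rightarrow> complex) \<Rightarrow> complex"
type_synonym distr4 = "distr^4"

primrec partials :: "3 list \<Rightarrow> (space \<Rightarrow> complex) \<Rightarrow> space \<Rightarrow> complex" where
  "partials [] \<phi> = \<phi>"
| "partials (i # is) \<phi> = (\<lambda>x. frechet_derivative (partials is \<phi>) (at x) (axis i 1))"

definition schwartz :: "(space \<Rightarrow> complex) set" where
  "schwartz = {\<phi>. \<forall>is. (\<forall>x. partials is \<phi> differentiable (at x)) \<and>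
     (\<forall>k::nat. \<exists>C. \<forall>x. (1 + norm x) ^ k * norm (partials is \<phi> x) \<le> C)}"

text \<open>
  In the continuity clause the number \<open>B\<close> ranges over the upper bounds of the \<open>N\<close>-th Schwartz
  seminorm of \<open>\<phi>\<close>.
\<close>

definition tempered :: "distr \<Rightarrow> bool" where
  "tempered T \<longleftrightarrow>
     (\<forall>\<phi>. \<phi> \<notin> schwartz \<longrightarrow> T \<phi> = 0) \<and>
     (\<forall>\<phi>\<in>schwartz. \<forall>\<psi>\<in>schwartz. \<forall>a b. T (\<lambda>x. a * \<phi> x + b * \<psi> x) = a * T \<phi> + b * T \<psi>) \<and>
     (\<exists>C N. \<forall>\<phi>\<in>schwartz. \<forall>B.
        (\<forall>is x. length is \<le> N \<longrightarrow> (1 + norm x) ^ N * norm (partials is \<phi> x) \<le> B) \<longrightarrow>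
        norm (T \<phi>) \<le> C * B)"

definition fun_distr :: "(space \<Rightarrow> complex) \<Rightarrow> distr" where
  "fun_distr g = (\<lambda>\<phi>. if \<phi> \<in> schwartz then LINT x|lborel. g x * \<phi> x else 0)"

definition is_density :: "(space \<Rightarrow> complex) \<Rightarrow> distr \<Rightarrow> bool" where
  "is_density g T \<longleftrightarrow> g \<in> borel_measurable lborel \<and>
     (\<forall>\<phi>\<in>schwartz. integrable lborel (\<lambda>x. g x * \<phi> x)) \<and> T = fun_distr g"

text \<open>A density is unique only up to null sets; \<open>density_of\<close> picks a representative.\<close>

definition density_of :: "distr \<Rightarrow> space \<Rightarrow> complex" where
  "density_of T = (SOME g. is_density g T)"


section \<open>Fourier transform and Bessel potentials\<close>

text \<open>The Fourier transform is normalised to be unitary on square-integrable functions.\<close>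

definition fourier :: "(space \<Rightarrow> complex) \<Rightarrow> space \<Rightarrow> complex" where
  "fourier \<phi> \<xi> = complex_of_real ((2 * pi) powr (- 3/2)) *
     (LINT x|lborel. cis (- (x \<bullet> \<xi>)) * \<phi> x)"

definition inv_fourier :: "(space \<Rightarrow> complex) \<Rightarrow> space \<Rightarrow> complex" where
  "inv_fourier \<psi> x = complex_of_real ((2 * pi) powr (- 3/2)) *
     (LINT \<xi>|lborel. cis (x \<bullet> \<xi>) * \<psi> \<xi>)"

definition fourier_distr :: "distr \<Rightarrow> distr" where
  "fourier_distr T = (\<lambda>\<phi>. if \<phi> \<in> schwartz then T (fourier \<phi>) else 0)"

text \<open>
  \<open>bessel r\<close> is the operator $(1-\Delta)^{r/2}$, that is, the Fourier multiplier with symbol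
  $(1+|\xi|^2)^{r/2}$.  The symbol is even, so on distributions the operator is the transpose of
  the same operator on Schwartz functions.
\<close>

definition bessel_schwartz :: "real \<Rightarrow> (space \<Rightarrow> complex) \<Rightarrow> space \<Rightarrow> complex" where
  "bessel_schwartz r \<phi> =
     inv_fourier (\<lambda>\<xi>. complex_of_real ((1 + (norm \<xi>)\<^sup>2) powr (r / 2)) * fourier \<phi> \<xi>)"

definition bessel :: "real \<Rightarrow> distr \<Rightarrow> distr" where
  "bessel r T = (\<lambda>\<phi>. if \<phi> \<in> schwartz then T (bessel_schwartz r \<phi>) else 0)"

definition bessel4 :: "real \<Rightarrow> distr4 \<Rightarrow> distr4" where
  "bessel4 r u = (\<chi> i. bessel r (u $ i))"


section \<open>Lebesgue and Sobolev spaces\<close>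

definition L2_fun :: "(space \<Rightarrow> complex) set" where
  "L2_fun = {g. g \<in> borel_measurable lborel \<and> integrable lborel (\<lambda>x. (norm (g x))\<^sup>2)}"

definition L2 :: "distr set" where
  "L2 = fun_distr ` L2_fun"

definition L2_4 :: "distr4 set" where
  "L2_4 = {u. \<forall>i. u $ i \<in> L2}"

definition L2_inner :: "distr4 \<Rightarrow> distr4 \<Rightarrow> complex" where
  "L2_inner u v =
     (\<Sum>i\<in>UNIV. LINT x|lborel. cnj (density_of (u $ i) x) * density_of (v $ i) x)"

definition L2_norm :: "distr4 \<Rightarrow> real" where
  "L2_norm u = sqrt (\<Sum>i\<in>UNIV. LINT x|lborel. (norm (density_of (u $ i) x))\<^sup>2)"

definition Linf_norm :: "(space \<Rightarrow> complex) \<Rightarrow> real" where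
  "Linf_norm f = real_of_ereal (esssup lborel (\<lambda>x. ereal (norm (f x))))"

definition sobolev :: "real \<Rightarrow> distr set" where
  "sobolev t = {T. tempered T \<and> (\<exists>g. is_density g (fourier_distr T) \<and>
     integrable lborel (\<lambda>\<xi>. (1 + (norm \<xi>)\<^sup>2) powr t * (norm (g \<xi>))\<^sup>2))}"

definition sobolev_norm :: "real \<Rightarrow> distr \<Rightarrow> real" where
  "sobolev_norm t T = sqrt (LINT \<xi>|lborel.
     (1 + (norm \<xi>)\<^sup>2) powr t * (norm (density_of (fourier_distr T) \<xi>))\<^sup>2)"

definition sobolev4 :: "real \<Rightarrow> distr4 set" where
  "sobolev4 t = {u. \<forall>i. u $ i \<in> sobolev t}"

definition sobolev4_norm :: "real \<Rightarrow> distr4 \<Rightarrow> real" where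
  "sobolev4_norm t u = sqrt (\<Sum>i\<in>UNIV. (sobolev_norm t (u $ i))\<^sup>2)"

text \<open>For \<open>s \<ge> 0\<close>: the functions (representatives) belonging to the scalar Sobolev space.\<close>

definition sobolev_fun :: "real \<Rightarrow> (space \<Rightarrow> complex) set" where
  "sobolev_fun s = {f \<in> L2_fun. fun_distr f \<in> sobolev s}"


section \<open>Multiplication by a function\<close>

text \<open>
  For \<open>T\<close> in $H^{-s}$ and \<open>v\<close> an integrable function in $H^s$, \<open>pairing T v\<close> is the duality
  bracket $\int \hat T(\xi)\, \hat v(-\xi)\, d\xi$, the continuous extension of \<open>T \<phi>\<close> from Schwartz
  functions \<open>\<phi>\<close> to $H^s$.
\<close>

definition pairing :: "distr \<Rightarrow> (space \<Rightarrow> complex) \<Rightarrow> complex" where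
  "pairing T v = (LINT \<xi>|lborel. density_of (fourier_distr T) \<xi> * fourier v (- \<xi>))"

text \<open>
  Multiplication by \<open>f\<close> is pointwise on square-integrable functions.  On the remaining elements
  of $H^{-s}$, for \<open>f\<close> in $H^s$ with $s > 3/2$, it is the transpose: the bracket of \<open>f T\<close> with
  \<open>\<phi>\<close> is the bracket of \<open>T\<close> with \<open>f \<phi>\<close>.  (Here \<open>f \<phi>\<close> is integrable and lies in $H^s$, and the
  second clause would give the pointwise product on square-integrable functions as well.)
\<close>

definition mult :: "(space \<Rightarrow> complex) \<Rightarrow> distr \<Rightarrow> distr" where
  "mult f T =
     (if T \<in> L2 then fun_distr (\<lambda>x. f x * density_of T x)
      else (\<lambda>\<phi>. if \<phi> \<in> schwartz then pairing T (\<lambda>x. f x * \<phi> x) else 0))"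

definition mult4 :: "(space \<Rightarrow> complex) \<Rightarrow> distr4 \<Rightarrow> distr4" where
  "mult4 f u = (\<chi> i. mult f (u $ i))"


section \<open>Operators\<close>

definition lincomb :: "complex \<Rightarrow> distr4 \<Rightarrow> complex \<Rightarrow> distr4 \<Rightarrow> distr4" where
  "lincomb a u b v = (\<chi> i. (\<lambda>\<phi>. a * (u $ i) \<phi> + b * (v $ i) \<phi>))"

definition bounded_operator ::
  "distr4 set \<Rightarrow> (distr4 \<Rightarrow> real) \<Rightarrow> distr4 set \<Rightarrow> (distr4 \<Rightarrow> real) \<Rightarrow> (distr4 \<Rightarrow> distr4) \<Rightarrow> bool"
where
  "bounded_operator X nX Y nY A \<longleftrightarrow>
     A ` X \<subseteq> Y \<and>
     (\<forall>u\<in>X. \<forall>v\<in>X. \<forall>a b. A (lincomb a u b v) = lincomb a (A u) b (A v)) \<and>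
     (\<exists>C. \<forall>u\<in>X. nY (A u) \<le> C * nX u)"

definition orthonormal_basis :: "distr4 set \<Rightarrow> bool" where
  "orthonormal_basis E \<longleftrightarrow> E \<subseteq> L2_4 \<and>
     (\<forall>e\<in>E. \<forall>e'\<in>E. L2_inner e e' = (if e = e' then 1 else 0)) \<and>
     (\<forall>u\<in>L2_4. (\<forall>e\<in>E. L2_inner e u = 0) \<longrightarrow> u = (\<chi> i. (\<lambda>\<phi>. 0)))"

definition hilbert_schmidt :: "(distr4 \<Rightarrow> distr4) \<Rightarrow> bool" where
  "hilbert_schmidt A \<longleftrightarrow> bounded_operator L2_4 L2_norm L2_4 L2_norm A \<and>
     (\<exists>E. orthonormal_basis E \<and> (\<lambda>e. (L2_norm (A e))\<^sup>2) summable_on E)"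

text \<open>The value does not depend on the choice of the basis.\<close>

definition hilbert_schmidt_norm :: "(distr4 \<Rightarrow> distr4) \<Rightarrow> real" where
  "hilbert_schmidt_norm A = sqrt (\<Sum>\<^sub>\<infinity>e\<in>(SOME E. orthonormal_basis E). (L2_norm (A e))\<^sup>2)"

text \<open>
  Elements of the space $\mathfrak{H}^s$ are HOL functions on distributions of which only the values on
  $H^{-s}$ matter.  As $H^{-s'} \subseteq H^{-s}$ and $H^s \subseteq H^{s'}$ hold literally for
  $s' \le s$, \<open>frakH_norm s' \<Gamma>\<close> applies to elements of $\mathfrak{H}^s$ as they are.
\<close>

definition frakH :: "real \<Rightarrow> (distr4 \<Rightarrow> distr4) set" where
  "frakH s = {\<Gamma>.
     bounded_operator (sobolev4 (- s)) (sobolev4_norm (- s)) (sobolev4 s) (sobolev4_norm s) \<Gamma> \<and>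
     hilbert_schmidt (bessel4 s \<circ> \<Gamma> \<circ> bessel4 s)}"

definition frakH_norm :: "real \<Rightarrow> (distr4 \<Rightarrow> distr4) \<Rightarrow> real" where
  "frakH_norm s \<Gamma> = hilbert_schmidt_norm (bessel4 s \<circ> \<Gamma> \<circ> bessel4 s)"

definition nonneg_operator :: "(distr4 \<Rightarrow> distr4) \<Rightarrow> bool" where
  "nonneg_operator \<Gamma> \<longleftrightarrow>
     (\<forall>u\<in>L2_4. Im (L2_inner u (\<Gamma> u)) = 0 \<and> Re (L2_inner u (\<Gamma> u)) \<ge> 0)"

end

theory Submission
  imports Defs "HOL-Probability.Probability"
begin

text \<open>
  On the Fourier side, multiplication by \<open>f\<close> is convolution with the Fourier transform \<open>F\<close> of \<open>f\<close>.
  Put \<open>A = (1-\<Delta>)\<^bsup>s/2\<^esup> \<Gamma> (1-\<Delta>)\<^bsup>s/2\<^esup>\<close> and \<open>R f = (1-\<Delta>)\<^bsup>s/2\<^esup> f (1-\<Delta>)\<^bsup>-s/2\<^esup>\<close>.  The norm of \<open>f \<Gamma>\<close> is the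
  Hilbert-Schmidt norm of \<open>R f A\<close>, and that of \<open>\<Gamma> f\<close> is the Hilbert-Schmidt norm of \<open>R (cnj f) A\<^sup>*\<close>,
  by passing to the adjoint.  With \<open>D = (1-\<Delta>)\<^bsup>(s'-s)/2\<^esup>\<close>, an estimate of Kato-Ponce type gives
  \<open>|R f u| \<le> C (|f|\<^bsub>H^s\<^esub> |D u| + |f|\<^sub>\<infinity> |u|)\<close>.  Summing its square over an orthonormal basis leaves
  \<open>|D A|\<^sup>2 \<le> |A| |D A D|\<close> for Hilbert-Schmidt norms, which is trivial for \<open>s' = s\<close> and for \<open>A \<ge> 0\<close>
  follows from the Schur product theorem.

  In the Kato-Ponce estimate, write \<open>\<langle>\<xi>\<rangle> = (1+|\<xi>|\<^sup>2)\<^bsup>1/2\<^esup>\<close>.  In the region \<open>|\<xi> - \<eta>| \<le> \<langle>\<eta>\<rangle>/4\<close> the weight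
  \<open>\<langle>\<xi>\<rangle>\<^sup>s \<langle>\<eta>\<rangle>\<^bsup>-s\<^esup>\<close> is replaced by a bounded Schur multiplier \<open>\<integral> A y \<xi> B y \<eta> dy\<close> that agrees with it
  there, so this part is controlled by \<open>|f|\<^sub>\<infinity>\<close>.  In the remaining region \<open>\<langle>\<xi>\<rangle> \<le> 5 |\<xi> - \<eta>|\<close>, so that all
  derivatives fall on \<open>f\<close>, and Young's inequality applies because \<open>s' > 3/2\<close>.
\<close>

subsection \<open>The Schwartz space\<close>

text \<open>The supremum norm of \<open>f\<close> cannot be read off from the absolute values of its
  Fourier transform, whereas weights are usually distributed over a convolution by taking absolute
  values. This conflict is the reason for the Schur multiplier: it changes the weight near the
  diagonal without taking absolute values.

  The inequality for \<open>D A\<close> fails for general operators. For the rank-one operator that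
  maps \<open>x\<close> to \<langle>v, x\<rangle> u it reads |D u| |v| \<le> |u| |D v|, and for its
  adjoint it is the reverse. This is where positivity enters when s' < s. But \<Gamma> is
  non-negative only on square-integrable functions, and this has to be carried over to
  \<open>A\<close> by density.

  Densities are chosen only up to null sets, and the basis in the Hilbert-Schmidt norm is an
  arbitrary one. Therefore every distribution that occurs is written as \<open>lift g\<close> with a
  concrete function \<open>g\<close>, which turns norms, inner products, Bessel potentials and
  products into explicit integrals; and Hilbert-Schmidt sums are shown to be the same in all
  bases.\<close>

definition pd :: "3 \<Rightarrow> (space \<Rightarrow> complex) \<Rightarrow> space \<Rightarrow> complex" where
  "pd i \<phi> x = frechet_derivative \<phi> (at x) (axis i 1)"

definition rapid :: "(space \<Rightarrow> complex) \<Rightarrow> bool" where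
  "rapid \<phi> \<longleftrightarrow> (\<forall>k::nat. \<exists>C. \<forall>x. (1 + norm x) ^ k * norm (\<phi> x) \<le> C)"

lemma partials_Cons: "partials (i # is) \<phi> = pd i (partials is \<phi>)"
  by (simp add: pd_def fun_eq_iff)

text \<open>The recursion of \<open>partials\<close> adds the outermost derivative. Closure of the
  Schwartz space under \<open>pd\<close> needs the innermost one, at the other end of the
  list.\<close>

lemma partials_snoc: "partials (is @ [i]) \<phi> = partials is (pd i \<phi>)"
  by (induction "is") (simp_all add: pd_def[abs_def])

text \<open>The Schwartz space is the largest class of differentiable rapidly decreasing functions
  that is closed under partial derivatives. To prove membership it is enough to exhibit one such
  class, without any formula for higher derivatives.\<close>

lemma schwartz_coinduct:
  assumes "P \<phi>"
    and "\<And>\<phi> x. P \<phi> \<Longrightarrow> \<phi> differentiable (at x)"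
    and "\<And>\<phi>. P \<phi> \<Longrightarrow> rapid \<phi>"
    and "\<And>\<phi> i. P \<phi> \<Longrightarrow> P (pd i \<phi>)"
  shows "\<phi> \<in> schwartz"
proof -
  have "P (partials is \<phi>)" for "is"
    by (induction "is") (use assms(1,4) in \<open>simp_all add: partials_Cons del: partials.simps(2)\<close>)
  then show ?thesis
    using assms(2,3) unfolding schwartz_def rapid_def by blast
qed

lemma schwartz_iff:
  "\<phi> \<in> schwartz \<longleftrightarrow> (\<forall>is. (\<forall>x. partials is \<phi> differentiable (at x)) \<and> rapid (partials is \<phi>))"
  by (simp add: schwartz_def rapid_def)

lemma schwartz_differentiable: "\<phi> \<in> schwartz \<Longrightarrow> \<phi> differentiable (at x)"
  unfolding schwartz_iff by (drule spec[of _ "[]"]) simp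

lemma schwartz_rapid: "\<phi> \<in> schwartz \<Longrightarrow> rapid \<phi>"
  unfolding schwartz_iff by (drule spec[of _ "[]"]) simp

lemma schwartz_pd:
  assumes "\<phi> \<in> schwartz"
  shows "pd i \<phi> \<in> schwartz"
  unfolding schwartz_iff
proof
  fix "is"
  show "(\<forall>x. partials is (pd i \<phi>) differentiable at x) \<and> rapid (partials is (pd i \<phi>))"
    using assms unfolding schwartz_iff partials_snoc[symmetric] by (rule spec)
qed

lemma schwartz_partials: "\<phi> \<in> schwartz \<Longrightarrow> partials is \<phi> \<in> schwartz"
  by (induction "is") (simp_all add: partials_Cons schwartz_pd del: partials.simps(2))

lemma schwartz_bound:
  assumes "\<phi> \<in> schwartz"
  obtains C where "C > 0" "\<And>x. (1 + norm x) ^ k * norm (\<phi> x) \<le> C"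
proof -
  obtain C where C: "\<And>x. (1 + norm x) ^ k * norm (\<phi> x) \<le> C"
    using schwartz_rapid[OF assms] unfolding rapid_def by meson
  have "(1 + norm x) ^ k * norm (\<phi> x) \<le> max 1 C" for x
    using C[of x] by simp
  then show thesis
    using that[of "max 1 C"] by auto
qed

lemma pd_eqI: "(\<phi> has_derivative \<phi>') (at x) \<Longrightarrow> pd i \<phi> x = \<phi>' (axis i 1)"
  using frechet_derivative_at pd_def by metis

lemma differentiable_frechet:
  "\<phi> differentiable (at x) \<Longrightarrow> (\<phi> has_derivative frechet_derivative \<phi> (at x)) (at x)"
  by (simp add: frechet_derivative_works[symmetric])

lemma pd_add:
  assumes "\<And>x. \<phi> differentiable (at x)" "\<And>x. \<psi> differentiable (at x)"
  shows "pd i (\<lambda>x. \<phi> x + \<psi> x) = (\<lambda>x. pd i \<phi> x + pd i \<psi> x)"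
proof
  fix x
  show "pd i (\<lambda>x. \<phi> x + \<psi> x) x = pd i \<phi> x + pd i \<psi> x"
    by (subst pd_eqI[OF has_derivative_add[OF assms[THEN differentiable_frechet]]]) (simp add: pd_def)
qed

lemma pd_mult:
  assumes "\<And>x. \<phi> differentiable (at x)" "\<And>x. \<psi> differentiable (at x)"
  shows "pd i (\<lambda>x. \<phi> x * \<psi> x) = (\<lambda>x. \<phi> x * pd i \<psi> x + pd i \<phi> x * \<psi> x)"
proof
  fix x
  show "pd i (\<lambda>x. \<phi> x * \<psi> x) x = \<phi> x * pd i \<psi> x + pd i \<phi> x * \<psi> x"
    by (subst pd_eqI[OF has_derivative_mult[OF assms[THEN differentiable_frechet]]]) (simp add: pd_def)
qed

lemma pd_const: "pd i (\<lambda>x. c) = (\<lambda>x. 0)"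
  using pd_eqI[OF has_derivative_const] by (simp add: fun_eq_iff)

lemma pd_bounded_linear_compose:
  assumes "bounded_linear L" "\<And>x. \<phi> differentiable (at x)"
  shows "pd i (\<lambda>x. L (\<phi> x)) = (\<lambda>x. L (pd i \<phi> x))"
proof
  fix x
  show "pd i (\<lambda>x. L (\<phi> x)) x = L (pd i \<phi> x)"
    by (subst pd_eqI[OF bounded_linear.has_derivative[OF assms(1) assms(2)[THEN differentiable_frechet]]])
       (simp add: pd_def)
qed

lemma pd_affine:
  assumes "\<And>x. \<phi> differentiable (at x)"
  shows "pd i (\<lambda>x. \<phi> (c *\<^sub>R x + a)) = (\<lambda>x. of_real c * pd i \<phi> (c *\<^sub>R x + a))"
proof
  fix x :: space
  have A: "((\<lambda>x. c *\<^sub>R x + a) has_derivative (\<lambda>h. c *\<^sub>R h)) (at x)"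
    by (auto intro!: derivative_eq_intros)
  have "pd i (\<lambda>x. \<phi> (c *\<^sub>R x + a)) x = frechet_derivative \<phi> (at (c *\<^sub>R x + a)) (c *\<^sub>R axis i 1)"
    by (subst pd_eqI[OF has_derivative_compose[OF A assms[THEN differentiable_frechet]]]) simp
  also have "\<dots> = of_real c * pd i \<phi> (c *\<^sub>R x + a)"
    by (simp add: linear_cmul[OF linear_frechet_derivative[OF assms]] pd_def scaleR_conv_of_real[where 'a=complex])
  finally show "pd i (\<lambda>x. \<phi> (c *\<^sub>R x + a)) x = of_real c * pd i \<phi> (c *\<^sub>R x + a)" .
qed

text \<open>
  Smooth functions of polynomial growth, generated by rules so that closure under differentiation
  can be proved by rule induction.
\<close>

inductive slow :: "(space \<Rightarrow> complex) \<Rightarrow> bool" where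
  slow_const: "slow (\<lambda>x. c)"
| slow_coord: "slow (\<lambda>x. of_real (x $ i))"
| slow_cis: "slow (\<lambda>x. cis (x \<bullet> a))"
| slow_add: "slow m \<Longrightarrow> slow m' \<Longrightarrow> slow (\<lambda>x. m x + m' x)"
| slow_mult: "slow m \<Longrightarrow> slow m' \<Longrightarrow> slow (\<lambda>x. m x * m' x)"
| slow_powr: "slow (\<lambda>x. of_real (q x)) \<Longrightarrow> (\<And>x. q x \<ge> 1) \<Longrightarrow> slow (\<lambda>x. of_real (q x powr r))"

lemma coord_has_derivative:
  "((\<lambda>x::space. complex_of_real (x $ i)) has_derivative (\<lambda>h. of_real (h $ i))) (at x)"
  by (intro bounded_linear_imp_has_derivative bounded_linear_compose[OF bounded_linear_of_real] bounded_linear_vec_nth)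

lemma cis_has_derivative:
  "((\<lambda>x::space. cis (x \<bullet> a)) has_derivative (\<lambda>h. \<i> * of_real (h \<bullet> a) * cis (x \<bullet> a))) (at x)"
proof -
  have "((\<lambda>x. exp (\<i> * of_real (x \<bullet> a))) has_derivative (\<lambda>h. exp (\<i> * of_real (x \<bullet> a)) * (\<i> * of_real (h \<bullet> a)))) (at x)"
    using has_derivative_compose[of "\<lambda>x. \<i> * of_real (x \<bullet> a)" "\<lambda>h. \<i> * of_real (h \<bullet> a)" x UNIV exp]
      DERIV_exp[of "\<i> * of_real (x \<bullet> a)", THEN has_field_derivative_imp_has_derivative]
    by (force intro!: derivative_eq_intros)
  then show ?thesis
    by (simp add: cis_conv_exp mult_ac)
qed

lemma powr_has_derivative:
  assumes "(\<lambda>x::space. complex_of_real (q x)) differentiable (at x)" "q x \<ge> 1"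
  shows "((\<lambda>x. complex_of_real (q x powr r)) has_derivative
    (\<lambda>h. of_real (r * q x powr (r - 1)) * frechet_derivative (\<lambda>x. complex_of_real (q x)) (at x) h)) (at x)"
proof -
  define Q' where "Q' = frechet_derivative (\<lambda>x. complex_of_real (q x)) (at x)"
  have d: "((\<lambda>x. complex_of_real (q x)) has_derivative Q') (at x)"
    unfolding Q'_def by (rule differentiable_frechet[OF assms(1)])
  have re: "(q has_derivative (\<lambda>h. Re (Q' h))) (at x)"
    using has_derivative_Re[OF d] by simp
  \<comment> \<open>The rules of \<open>slow\<close> know \<open>q\<close> only as a complex-valued
    function. Its derivative is real because the real part, embedded again, is a derivative as well,
    and derivatives are unique.\<close>
  have "((\<lambda>x. complex_of_real (q x)) has_derivative (\<lambda>h. of_real (Re (Q' h)))) (at x)"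
    using bounded_linear.has_derivative[OF bounded_linear_of_real re] .
  then have eq: "Q' = (\<lambda>h. of_real (Re (Q' h)))"
    using d has_derivative_unique by blast
  have "((\<lambda>x. q x powr r) has_derivative (\<lambda>h. Re (Q' h) * (r * q x powr (r - 1)))) (at x)"
    using has_derivative_compose[OF re, of "\<lambda>y. y powr r" "\<lambda>h. h * (r * q x powr (r - 1))"]
      has_real_derivative_powr[of "q x" r] assms(2)
    by (simp add: has_field_derivative_def mult.commute[of _ "r * _"])
  from bounded_linear.has_derivative[OF bounded_linear_of_real this]
  have "((\<lambda>x. complex_of_real (q x powr r)) has_derivative
      (\<lambda>h. complex_of_real (r * q x powr (r - 1)) * of_real (Re (Q' h)))) (at x)"
    by (simp add: mult.commute)
  moreover have "(\<lambda>h. complex_of_real (r * q x powr (r - 1)) * of_real (Re (Q' h))) = (\<lambda>h. complex_of_real (r * q x powr (r - 1)) * Q' h)"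
    using eq by metis
  ultimately show ?thesis
    unfolding Q'_def[symmetric] by simp
qed

lemma slow_differentiable: "slow m \<Longrightarrow> m differentiable (at x)"
proof (induction arbitrary: x rule: slow.induct)
  case (slow_coord i)
  show ?case using coord_has_derivative differentiableI by blast
next
  case (slow_cis a)
  show ?case using cis_has_derivative differentiableI by blast
next
  case (slow_powr q r)
  then show ?case using powr_has_derivative differentiableI by metis
qed auto

lemma slow_pd: "slow m \<Longrightarrow> slow (pd i m)"
proof (induction rule: slow.induct)
  case (slow_const c)
  then show ?case by (simp add: pd_const slow.slow_const)
next
  case (slow_coord j)
  have "pd i (\<lambda>x. complex_of_real (x $ j)) = (\<lambda>x. of_real (axis i 1 $ j))"
    using pd_eqI[OF coord_has_derivative] by blast
  then show ?case by (simp add: slow.slow_const)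
next
  case (slow_cis a)
  have "pd i (\<lambda>x. cis (x \<bullet> a)) = (\<lambda>x. (\<i> * of_real (axis i 1 \<bullet> a)) * cis (x \<bullet> a))"
    using pd_eqI[OF cis_has_derivative] by blast
  then show ?case
    using slow.slow_mult[OF slow.slow_const slow.slow_cis] by simp
next
  case (slow_add m m')
  then show ?case by (simp add: pd_add slow_differentiable slow.slow_add)
next
  case (slow_mult m m')
  then show ?case by (simp add: pd_mult slow_differentiable slow.slow_add slow.slow_mult)
next
  case (slow_powr q r)
  have "pd i (\<lambda>x. complex_of_real (q x powr r))
      = (\<lambda>x. (of_real r * of_real (q x powr (r - 1))) * pd i (\<lambda>x. complex_of_real (q x)) x)"
    using pd_eqI[OF powr_has_derivative[OF slow_differentiable[OF slow_powr.hyps(1)] slow_powr.hyps(2)]]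
    by (force simp: fun_eq_iff pd_def)
  moreover have "slow (\<lambda>x. (of_real r * of_real (q x powr (r - 1))) * pd i (\<lambda>x. complex_of_real (q x)) x)"
    by (intro slow.slow_mult slow.slow_const slow_powr.IH slow.slow_powr slow_powr.hyps)
  ultimately show ?case by simp
qed

lemma slow_growth: "slow m \<Longrightarrow> \<exists>C k. \<forall>x. norm (m x) \<le> C * (1 + norm x) ^ k"
proof (induction rule: slow.induct)
  case (slow_const c)
  show ?case by (rule exI[of _ "norm c"], rule exI[of _ 0]) simp
next
  case (slow_coord i)
  have "norm (complex_of_real (x $ i)) \<le> 1 * (1 + norm x) ^ 1" for x :: space
    using component_le_norm_cart[of x i] by simp
  then show ?case by blast
next
  case (slow_cis a)
  show ?case by (rule exI[of _ 1], rule exI[of _ 0]) simp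
next
  case (slow_add m m')
  then obtain C k C' k' where *: "\<And>x. norm (m x) \<le> C * (1 + norm x) ^ k" "\<And>x. norm (m' x) \<le> C' * (1 + norm x) ^ k'"
    by blast
  have "norm (m x + m' x) \<le> (\<bar>C\<bar> + \<bar>C'\<bar>) * (1 + norm x) ^ (k + k')" for x
  proof -
    have "norm (m x) \<le> \<bar>C\<bar> * (1 + norm x) ^ k"
      using *(1)[of x] by (smt (verit) mult_right_mono norm_ge_zero zero_le_power)
    also have "\<dots> \<le> \<bar>C\<bar> * (1 + norm x) ^ (k + k')"
      by (intro mult_left_mono power_increasing) auto
    finally have 1: "norm (m x) \<le> \<bar>C\<bar> * (1 + norm x) ^ (k + k')" .
    have "norm (m' x) \<le> \<bar>C'\<bar> * (1 + norm x) ^ k'"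
      using *(2)[of x] by (smt (verit) mult_right_mono norm_ge_zero zero_le_power)
    also have "\<dots> \<le> \<bar>C'\<bar> * (1 + norm x) ^ (k + k')"
      by (intro mult_left_mono power_increasing) auto
    finally show ?thesis
      using 1 norm_triangle_ineq[of "m x" "m' x"] by (simp add: distrib_right)
  qed
  then show ?case by blast
next
  case (slow_mult m m')
  then obtain C k C' k' where *: "\<And>x. norm (m x) \<le> C * (1 + norm x) ^ k" "\<And>x. norm (m' x) \<le> C' * (1 + norm x) ^ k'"
    by blast
  have "norm (m x * m' x) \<le> (C * C') * (1 + norm x) ^ (k + k')" for x
    using mult_mono[OF *(1)[of x] *(2)[of x]] order_trans[OF norm_ge_zero *(1)[of x]]
    by (simp add: norm_mult power_add mult_ac)
  then show ?case by blast
next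
  case (slow_powr q r)
  then obtain C k where *: "\<And>x. norm (complex_of_real (q x)) \<le> C * (1 + norm x) ^ k"
    by blast
  \<comment> \<open>As \<open>q x \<ge> 1\<close>, raising the exponent to a natural number only
    enlarges the power, and the \<open>n\<close>-th power of a polynomial bound is again
    one.\<close>
  obtain n :: nat where n: "r \<le> real n"
    using real_arch_simple by blast
  have "norm (complex_of_real (q x powr r)) \<le> C ^ n * (1 + norm x) ^ (k * n)" for x
  proof -
    have "q x powr r \<le> q x powr real n"
      using slow_powr.hyps(2) n by (intro powr_mono) auto
    also have "\<dots> = q x ^ n"
      using slow_powr.hyps(2)[of x] by (simp add: powr_realpow)
    also have "\<dots> \<le> (C * (1 + norm x) ^ k) ^ n"
      using *[of x] slow_powr.hyps(2)[of x] by (intro power_mono) auto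
    finally show ?thesis by (simp add: power_mult_distrib power_mult)
  qed
  then show ?case by blast
qed

text \<open>The product rule turns one product into a sum of two. So the class used for coinduction
  has to contain sums, and not only products of a slow function and a Schwartz function.\<close>

inductive slowspan :: "(space \<Rightarrow> complex) \<Rightarrow> bool" where
  ss_base: "\<phi> \<in> schwartz \<Longrightarrow> slowspan \<phi>"
| ss_add: "slowspan \<phi> \<Longrightarrow> slowspan \<psi> \<Longrightarrow> slowspan (\<lambda>x. \<phi> x + \<psi> x)"
| ss_mult: "slow m \<Longrightarrow> slowspan \<phi> \<Longrightarrow> slowspan (\<lambda>x. m x * \<phi> x)"

lemma rapid_add:
  assumes "rapid \<phi>" "rapid \<psi>"
  shows "rapid (\<lambda>x. \<phi> x + \<psi> x)"
  unfolding rapid_def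
proof
  fix k
  obtain C D where "\<And>x. (1 + norm x) ^ k * norm (\<phi> x) \<le> C" "\<And>x. (1 + norm x) ^ k * norm (\<psi> x) \<le> D"
    using assms unfolding rapid_def by meson
  then have "(1 + norm x) ^ k * norm (\<phi> x + \<psi> x) \<le> C + D" for x
    using norm_triangle_ineq[of "\<phi> x" "\<psi> x"]
    by (smt (verit) distrib_left mult_left_mono norm_ge_zero zero_le_power)
  then show "\<exists>C. \<forall>x. (1 + norm x) ^ k * norm (\<phi> x + \<psi> x) \<le> C" by blast
qed

lemma rapid_mult:
  assumes m: "slow m" and \<phi>: "rapid \<phi>"
  shows "rapid (\<lambda>x. m x * \<phi> x)"
  unfolding rapid_def
proof
  fix k
  obtain C j where C: "\<And>x. norm (m x) \<le> C * (1 + norm x) ^ j"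
    using slow_growth[OF m] by blast
  have C0: "C \<ge> 0"
    using order_trans[OF norm_ge_zero C[of 0]] by simp
  obtain D where D: "\<And>x. (1 + norm x) ^ (k + j) * norm (\<phi> x) \<le> D"
    using \<phi> unfolding rapid_def by meson
  have "(1 + norm x) ^ k * norm (m x * \<phi> x) \<le> C * D" for x
  proof -
    have "(1 + norm x) ^ k * norm (m x * \<phi> x) \<le> (1 + norm x) ^ k * ((C * (1 + norm x) ^ j) * norm (\<phi> x))"
      unfolding norm_mult by (intro mult_left_mono mult_right_mono C) auto
    also have "\<dots> = C * ((1 + norm x) ^ (k + j) * norm (\<phi> x))"
      by (simp add: power_add)
    also have "\<dots> \<le> C * D"
      by (intro mult_left_mono D C0)
    finally show ?thesis .
  qed
  then show "\<exists>C. \<forall>x. (1 + norm x) ^ k * norm (m x * \<phi> x) \<le> C" by blast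
qed

lemma slowspan_differentiable: "slowspan \<phi> \<Longrightarrow> \<phi> differentiable (at x)"
  by (induction rule: slowspan.induct)
    (simp_all add: slow_differentiable schwartz_differentiable)

lemma slowspan_schwartz: "slowspan \<phi> \<Longrightarrow> \<phi> \<in> schwartz"
proof (erule schwartz_coinduct)
  show "\<phi> differentiable (at x)" if "slowspan \<phi>" for \<phi> x
    using that by (rule slowspan_differentiable)
  show "rapid \<phi>" if "slowspan \<phi>" for \<phi>
    using that by (induction rule: slowspan.induct) (auto intro: rapid_add rapid_mult schwartz_rapid)
  show "slowspan (pd i \<phi>)" if "slowspan \<phi>" for \<phi> i
    using that
  proof (induction rule: slowspan.induct)
    case (ss_mult m \<phi>)
    then show ?case
      using slowspan.ss_add[OF slowspan.ss_mult[OF ss_mult.hyps(1) ss_mult.IH]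
        slowspan.ss_mult[OF slow_pd[OF ss_mult.hyps(1)] ss_mult.hyps(2)]]
      by (simp add: pd_mult slow_differentiable slowspan_differentiable)
  qed (simp_all add: pd_add slowspan_differentiable ss_base ss_add schwartz_pd)
qed

lemma schwartz_add: "\<phi> \<in> schwartz \<Longrightarrow> \<psi> \<in> schwartz \<Longrightarrow> (\<lambda>x. \<phi> x + \<psi> x) \<in> schwartz"
  by (rule slowspan_schwartz[OF ss_add[OF ss_base ss_base]])

lemma schwartz_mult: "slow m \<Longrightarrow> \<phi> \<in> schwartz \<Longrightarrow> (\<lambda>x. m x * \<phi> x) \<in> schwartz"
  by (rule slowspan_schwartz[OF ss_mult[OF _ ss_base]])

lemma schwartz_cmult: "\<phi> \<in> schwartz \<Longrightarrow> (\<lambda>x. c * \<phi> x) \<in> schwartz"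
  by (intro schwartz_mult slow_const)

lemma schwartz_lc: "\<phi> \<in> schwartz \<Longrightarrow> \<psi> \<in> schwartz \<Longrightarrow> (\<lambda>x. a * \<phi> x + b * \<psi> x) \<in> schwartz"
  by (intro schwartz_add schwartz_cmult)

text \<open>Covers translations and the reflection together. The free factor \<open>b\<close> in the
  coinduction class absorbs the \<open>c\<close> that each differentiation produces.\<close>

lemma schwartz_affine:
  assumes "\<phi> \<in> schwartz" "\<bar>c\<bar> = 1"
  shows "(\<lambda>x. \<phi> (c *\<^sub>R x + a)) \<in> schwartz"
proof (rule schwartz_coinduct[where P = "\<lambda>\<psi>. \<exists>b. \<exists>\<phi>\<in>schwartz. \<psi> = (\<lambda>x. b * \<phi> (c *\<^sub>R x + a))"])
  show "\<exists>b. \<exists>\<psi>\<in>schwartz. (\<lambda>x. \<phi> (c *\<^sub>R x + a)) = (\<lambda>x. b * \<psi> (c *\<^sub>R x + a))"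
    using assms by (intro exI[of _ 1] bexI[of _ \<phi>]) auto
next
  fix \<psi> x
  assume "\<exists>b. \<exists>\<phi>\<in>schwartz. \<psi> = (\<lambda>x. b * \<phi> (c *\<^sub>R x + a))"
  then obtain b \<phi> where \<phi>: "\<phi> \<in> schwartz" "\<psi> = (\<lambda>x. b * \<phi> (c *\<^sub>R x + a))" by blast
  have "(\<lambda>x. \<phi> (c *\<^sub>R x + a)) differentiable (at x)"
    using differentiable_chain_at[of "\<lambda>x. c *\<^sub>R x + a" x \<phi>] schwartz_differentiable[OF \<phi>(1)]
    by (simp add: o_def)
  then show "\<psi> differentiable (at x)"
    unfolding \<phi>(2) by simp
next
  fix \<psi> :: "space \<Rightarrow> complex"
  assume "\<exists>b. \<exists>\<phi>\<in>schwartz. \<psi> = (\<lambda>x. b * \<phi> (c *\<^sub>R x + a))"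
  then obtain b \<phi> where \<phi>: "\<phi> \<in> schwartz" "\<psi> = (\<lambda>x. b * \<phi> (c *\<^sub>R x + a))" by blast
  show "rapid \<psi>"
    unfolding rapid_def
  proof
    fix k
    obtain C where C: "C > 0" "\<And>x. (1 + norm x) ^ k * norm (\<phi> x) \<le> C"
      using schwartz_bound[OF \<phi>(1)] by blast
    have "(1 + norm x) ^ k * norm (\<psi> x) \<le> (1 + norm a) ^ k * norm b * C" for x
    proof -
      define y where "y = c *\<^sub>R x + a"
      have "norm x = norm (c *\<^sub>R x)"
        using assms(2) by simp
      also have "\<dots> \<le> norm y + norm a"
        unfolding y_def using norm_triangle_ineq4[of "c *\<^sub>R x + a" a] by simp
      finally have nx: "1 + norm x \<le> (1 + norm a) * (1 + norm y)"
        using mult_nonneg_nonneg[OF norm_ge_zero norm_ge_zero, of a y] by (simp add: algebra_simps del: mult_nonneg_nonneg)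
      have "(1 + norm x) ^ k * norm (\<psi> x) \<le> ((1 + norm a) * (1 + norm y)) ^ k * (norm b * norm (\<phi> y))"
        unfolding \<phi>(2) y_def[symmetric] norm_mult by (intro mult_right_mono power_mono nx) auto
      also have "\<dots> = (1 + norm a) ^ k * norm b * ((1 + norm y) ^ k * norm (\<phi> y))"
        by (simp add: power_mult_distrib)
      also have "\<dots> \<le> (1 + norm a) ^ k * norm b * C"
        by (intro mult_left_mono C) auto
      finally show ?thesis .
    qed
    then show "\<exists>C. \<forall>x. (1 + norm x) ^ k * norm (\<psi> x) \<le> C" by blast
  qed
next
  fix \<psi> :: "space \<Rightarrow> complex" and i
  assume "\<exists>b. \<exists>\<phi>\<in>schwartz. \<psi> = (\<lambda>x. b * \<phi> (c *\<^sub>R x + a))"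
  then obtain b \<phi> where \<phi>: "\<phi> \<in> schwartz" "\<psi> = (\<lambda>x. b * \<phi> (c *\<^sub>R x + a))" by blast
  have d: "(\<lambda>x. \<phi> (c *\<^sub>R x + a)) differentiable (at x)" for x
    using differentiable_chain_at[of "\<lambda>x. c *\<^sub>R x + a" x \<phi>] schwartz_differentiable[OF \<phi>(1)]
    by (simp add: o_def)
  have "pd i \<psi> = (\<lambda>x. b * (of_real c * pd i \<phi> (c *\<^sub>R x + a)))"
    unfolding \<phi>(2)
    by (subst pd_bounded_linear_compose[OF bounded_linear_mult_right d])
       (simp add: pd_affine schwartz_differentiable[OF \<phi>(1)])
  then have "pd i \<psi> = (\<lambda>x. (b * of_real c) * pd i \<phi> (c *\<^sub>R x + a))"
    by (simp add: mult_ac)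
  then show "\<exists>b. \<exists>\<phi>\<in>schwartz. pd i \<psi> = (\<lambda>x. b * \<phi> (c *\<^sub>R x + a))"
    using schwartz_pd[OF \<phi>(1)] by blast
qed

lemma schwartz_reflect: "\<phi> \<in> schwartz \<Longrightarrow> (\<lambda>x. \<phi> (- x)) \<in> schwartz"
  using schwartz_affine[of \<phi> "-1" 0] by simp

lemma schwartz_translate: "\<phi> \<in> schwartz \<Longrightarrow> (\<lambda>x. \<phi> (x + a)) \<in> schwartz"
  using schwartz_affine[of \<phi> 1 a] by simp

lemma schwartz_cnj:
  assumes "\<phi> \<in> schwartz"
  shows "(\<lambda>x. cnj (\<phi> x)) \<in> schwartz"
proof (rule schwartz_coinduct[where P = "\<lambda>\<psi>. \<exists>\<phi>\<in>schwartz. \<psi> = (\<lambda>x. cnj (\<phi> x))"])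
  show "\<exists>\<psi>\<in>schwartz. (\<lambda>x. cnj (\<phi> x)) = (\<lambda>x. cnj (\<psi> x))"
    using assms by blast
  show "\<psi> differentiable (at x)" if "\<exists>\<phi>\<in>schwartz. \<psi> = (\<lambda>x. cnj (\<phi> x))" for \<psi> :: "space \<Rightarrow> complex" and x
  proof -
    obtain \<phi> where \<phi>: "\<phi> \<in> schwartz" "\<psi> = (\<lambda>x. cnj (\<phi> x))"
      using \<open>\<exists>\<phi>\<in>schwartz. \<psi> = (\<lambda>x. cnj (\<phi> x))\<close> by blast
    show ?thesis
      unfolding \<phi>(2) using schwartz_differentiable[OF \<phi>(1), of x]
        bounded_linear.has_derivative[OF bounded_linear_cnj] unfolding differentiable_def by blast
  qed
  show "rapid \<psi>" if "\<exists>\<phi>\<in>schwartz. \<psi> = (\<lambda>x. cnj (\<phi> x))" for \<psi> :: "space \<Rightarrow> complex"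
    using that schwartz_rapid by (auto simp: rapid_def)
  show "\<exists>\<phi>\<in>schwartz. pd i \<psi> = (\<lambda>x. cnj (\<phi> x))" if "\<exists>\<phi>\<in>schwartz. \<psi> = (\<lambda>x. cnj (\<phi> x))" for \<psi> :: "space \<Rightarrow> complex" and i
    using that schwartz_pd schwartz_differentiable pd_bounded_linear_compose[OF bounded_linear_cnj] by metis
qed

definition gauss :: "space \<Rightarrow> complex" where
  "gauss x = of_real (exp (- (norm x)\<^sup>2 / 2))"

lemma gauss_has_derivative:
  "(gauss has_derivative (\<lambda>h. - of_real (x \<bullet> h) * gauss x)) (at x)"
proof -
  have "((\<lambda>x. complex_of_real (exp (- (x \<bullet> x) / 2))) has_derivative
      (\<lambda>h. of_real (exp (- (x \<bullet> x) / 2) * (- (2 * (x \<bullet> h)) / 2)))) (at x)"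
    by (intro bounded_linear.has_derivative[OF bounded_linear_of_real])
       (auto intro!: derivative_eq_intros simp: inner_commute)
  then show ?thesis
    unfolding gauss_def power2_norm_eq_inner by (simp add: mult_ac)
qed

lemma pd_gauss: "pd i gauss x = - of_real (x $ i) * gauss x"
  using pd_eqI[OF gauss_has_derivative] by (simp add: inner_axis)

text \<open>The class of all slow functions times the Gaussian is closed under derivatives, since
  differentiating the Gaussian only multiplies it by a coordinate.\<close>

lemma gauss_schwartz: "gauss \<in> schwartz"
proof (rule schwartz_coinduct[where P = "\<lambda>\<psi>. \<exists>m. slow m \<and> \<psi> = (\<lambda>x. m x * gauss x)"])
  show "\<exists>m. slow m \<and> gauss = (\<lambda>x. m x * gauss x)"
    by (intro exI[of _ "\<lambda>x. 1"]) (simp add: slow_const)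
  have dg: "gauss differentiable (at x)" for x
    using gauss_has_derivative differentiableI by blast
  show "\<psi> differentiable (at x)" if "\<exists>m. slow m \<and> \<psi> = (\<lambda>x. m x * gauss x)" for \<psi> x
    using that dg slow_differentiable by auto
  have "rapid gauss"
    unfolding rapid_def
  proof
    fix k
    \<comment> \<open>One term of the exponential series gives
      \<open>(1 + t) ^ k \<le> fact k * exp (1 + t)\<close>. From (t - 1)^2 \<ge> 0 one has 1 + t
      \<le> 3/2 + t^2/2, whence the constant.\<close>
    have "(1 + norm x) ^ k * norm (gauss x) \<le> fact k * exp (3 / 2)" for x
    proof -
      define t where "t = norm x"
      have t: "t \<ge> 0" by (simp add: t_def)
      have "(1 + t) ^ k /\<^sub>R fact k \<le> exp (1 + t)"
        using sum_le_suminf[OF summable_exp_generic[of "1 + t"], of "{k}"] t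
        by (simp add: exp_def)
      then have "(1 + t) ^ k \<le> fact k * exp (1 + t)"
        by (simp add: field_simps)
      also have "\<dots> \<le> fact k * exp (3 / 2 + t\<^sup>2 / 2)"
      proof -
        have "0 \<le> (t - 1)\<^sup>2" by simp
        then have "1 + t \<le> 3 / 2 + t\<^sup>2 / 2"
          by (simp add: power2_eq_square algebra_simps)
        then show ?thesis by (intro mult_left_mono) auto
      qed
      finally have "(1 + t) ^ k * exp (- t\<^sup>2 / 2) \<le> fact k * exp (3 / 2 + t\<^sup>2 / 2) * exp (- t\<^sup>2 / 2)"
        by (intro mult_right_mono) auto
      then show ?thesis
        unfolding gauss_def t_def[symmetric] by (simp add: exp_add mult.assoc flip: exp_add)
    qed
    then show "\<exists>C. \<forall>x. (1 + norm x) ^ k * norm (gauss x) \<le> C" by blast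
  qed
  then show "rapid \<psi>" if "\<exists>m. slow m \<and> \<psi> = (\<lambda>x. m x * gauss x)" for \<psi>
    using that rapid_mult by auto
  show "\<exists>m. slow m \<and> pd i \<psi> = (\<lambda>x. m x * gauss x)" if "\<exists>m. slow m \<and> \<psi> = (\<lambda>x. m x * gauss x)" for \<psi> i
  proof -
    obtain m where m: "slow m" "\<psi> = (\<lambda>x. m x * gauss x)"
      using \<open>\<exists>m. slow m \<and> \<psi> = (\<lambda>x. m x * gauss x)\<close> by blast
    have "pd i \<psi> = (\<lambda>x. (m x * ((- 1) * of_real (x $ i)) + pd i m x) * gauss x)"
      unfolding m(2) by (subst pd_mult) (auto simp: m dg slow_differentiable pd_gauss algebra_simps fun_eq_iff)
    moreover have "slow (\<lambda>x. m x * ((- 1) * of_real (x $ i)) + pd i m x)"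
      by (intro slow_add slow_mult slow_const slow_coord m slow_pd)
    ultimately show ?thesis by blast
  qed
qed

text \<open>The symbol of the Bessel potential of order \<open>r\<close>, that is
  \<langle>\<xi>\<rangle> to the power \<open>r\<close>.\<close>

definition J :: "real \<Rightarrow> space \<Rightarrow> real" where
  "J r \<xi> = (1 + (norm \<xi>)\<^sup>2) powr (r / 2)"

lemma slow_J: "slow (\<lambda>\<xi>. of_real (J r \<xi>))"
proof -
  have "(\<lambda>\<xi>::space. complex_of_real (1 + (norm \<xi>)\<^sup>2))
      = (\<lambda>\<xi>. 1 + (of_real (\<xi> $ 1) * of_real (\<xi> $ 1) + (of_real (\<xi> $ 2) * of_real (\<xi> $ 2) + of_real (\<xi> $ 3) * of_real (\<xi> $ 3))))"
    by (rule ext) (simp add: power2_norm_eq_inner inner_vec_def sum_3 add.assoc)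
  moreover have "slow (\<lambda>\<xi>::space. 1 + (of_real (\<xi> $ 1) * of_real (\<xi> $ 1) + (of_real (\<xi> $ 2) * of_real (\<xi> $ 2) + of_real (\<xi> $ 3) * of_real (\<xi> $ 3))))"
    by (intro slow_add slow_mult slow_const slow_coord)
  ultimately have "slow (\<lambda>\<xi>::space. complex_of_real (1 + (norm \<xi>)\<^sup>2))" by simp
  then show ?thesis
    unfolding J_def by (rule slow_powr) simp
qed

subsection \<open>Integration on three-dimensional space\<close>

lemma borel_measurable_cis [measurable]: "cis \<in> borel_measurable borel"
  by (intro borel_measurable_continuous_onI continuous_on_cis continuous_on_id)

lemma lborel_distr_affine:
  fixes t :: space
  assumes "\<bar>c\<bar> = 1"
  shows "distr lborel borel (\<lambda>x. t + c *\<^sub>R x) = lborel"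
proof -
  have "c \<noteq> 0" using assms by auto
  from lborel_affine[OF this, of t] show ?thesis
    by (simp add: assms density_1)
qed

lemma nn_integral_affine:
  fixes t :: space
  assumes "\<bar>c\<bar> = 1" and [measurable]: "f \<in> borel_measurable borel"
  shows "(\<integral>\<^sup>+x. f (t + c *\<^sub>R x) \<partial>lborel) = (\<integral>\<^sup>+x. f x \<partial>lborel)"
  by (subst (2) lborel_distr_affine[OF assms(1), of t, symmetric]) (simp add: nn_integral_distr)

lemma integral_affine:
  fixes t :: space and f :: "space \<Rightarrow> 'b::{banach, second_countable_topology}"
  assumes "\<bar>c\<bar> = 1" and [measurable]: "f \<in> borel_measurable borel"
  shows "(LINT x|lborel. f (t + c *\<^sub>R x)) = (LINT x|lborel. f x)"
  by (subst (2) lborel_distr_affine[OF assms(1), of t, symmetric]) (simp add: integral_distr)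

lemma integrable_affine:
  fixes t :: space and f :: "space \<Rightarrow> 'b::{banach, second_countable_topology}"
  assumes "\<bar>c\<bar> = 1" and "integrable lborel f"
  shows "integrable lborel (\<lambda>x. f (t + c *\<^sub>R x))"
proof -
  have [measurable]: "f \<in> borel_measurable borel"
    using borel_measurable_integrable[OF assms(2)] by simp
  have "integrable (distr lborel borel (\<lambda>x. t + c *\<^sub>R x)) f"
    unfolding lborel_distr_affine[OF assms(1)] by (rule assms(2))
  then show ?thesis
    by (subst (asm) integrable_distr_eq) auto
qed

lemmas integral_reflect = integral_affine[where c = "-1" and t = 0, simplified]
lemmas integrable_reflect = integrable_affine[where c = "-1" and t = 0, simplified]
lemma J_pos: "J r \<xi> > 0"
proof -
  have "1 + (norm \<xi>)\<^sup>2 > 0"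
    by (simp add: add_pos_nonneg)
  then show ?thesis by (simp add: J_def)
qed

lemma J_nonneg [simp]: "J r \<xi> \<ge> 0"
  using J_pos[of r \<xi>] by simp

lemma J_nonzero [simp]: "J r \<xi> \<noteq> 0"
  using J_pos[of r \<xi>] by simp

lemma J_add: "J (r + q) \<xi> = J r \<xi> * J q \<xi>"
  by (simp add: J_def powr_add add_divide_distrib)

lemma J_0 [simp]: "J 0 \<xi> = 1"
  using add_pos_nonneg[of 1 "(norm \<xi>)\<^sup>2"] by (simp add: J_def del: add_pos_nonneg)

lemma J_minus_mult: "J (- r) \<xi> * J r \<xi> = 1" "J r \<xi> * J (- r) \<xi> = 1"
  using J_add[of "- r" r \<xi>] J_add[of r "- r" \<xi>] by simp_all

lemma J_minus: "J (- r) \<xi> = inverse (J r \<xi>)"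
  using J_minus_mult(1)[of r \<xi>] by (simp add: field_simps)

lemma J_uminus [simp]: "J r (- \<xi>) = J r \<xi>"
  by (simp add: J_def)

lemma J_mono: "r \<le> q \<Longrightarrow> J r \<xi> \<le> J q \<xi>"
  unfolding J_def by (intro powr_mono) auto

lemma J_sq: "(J r \<xi>)\<^sup>2 = (1 + (norm \<xi>)\<^sup>2) powr r"
  unfolding power2_eq_square[of "J r \<xi>"] J_add[symmetric] by (simp add: J_def)

lemma J_sq': "(J r \<xi>)\<^sup>2 = J (2 * r) \<xi>"
  by (simp only: J_sq) (simp add: J_def)

lemma J_measurable [measurable]: "J r \<in> borel_measurable borel"
  unfolding J_def[abs_def] by measurable

text \<open>Dyadic decomposition: the cube of half-width 2^k has volume 8 * 8^k, while the weight
  outside the ball of radius 2^(k-1) is at most of order 4^(-tk) with t = r/2. The series is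
  geometric with ratio 8 * 4^(-t), and this is below 1 exactly for r > 3.\<close>

lemma J_integrable:
  assumes "r > 3"
  shows "integrable lborel (J (- r))"
proof -
  define t where "t = r / 2"
  have t: "t > 3 / 2" using assms by (simp add: t_def)
  define q where "q = 8 * 4 powr (- t)"
  have q0: "q > 0" by (simp add: q_def)
  have q1: "q < 1"
  proof -
    have "(4::real) powr (- t) < 4 powr (- (3 / 2))"
      using t by (intro powr_less_mono) auto
    also have "(4::real) powr (- (3 / 2)) = (2 powr 2) powr (- (3 / 2))" by simp
    also have "\<dots> = 2 powr (- 3)" by (subst powr_powr) simp
    also have "\<dots> = 1 / 8" by (simp add: powr_minus powr_numeral)
    finally show ?thesis by (simp add: q_def)
  qed
  define B :: "nat \<Rightarrow> space set" where "B k = cbox (\<chi> i. - (2 ^ k)) (\<chi> i. 2 ^ k)" for k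
  \<comment> \<open>The factor \<open>4 powr t\<close> is the price of knowing only |x| > 2^(n-1) on
    the \<open>n\<close>-th shell; for n = 0 it makes the bound at least 1.\<close>
  define a where "a k = 4 powr t * (4 powr (- t)) ^ k" for k :: nat
  have a0: "a k \<ge> 0" for k by (simp add: a_def)
  have bound: "ennreal (J (- r) x) \<le> (\<Sum>k. ennreal (a k) * indicator (B k) x)" for x
  proof -
    have "\<exists>k::nat. norm x \<le> 2 ^ k"
      by (meson less_imp_le one_less_numeral_iff real_arch_pow semiring_norm(76))
    define n where "n = (LEAST k. norm x \<le> 2 ^ k)"
    have n: "norm x \<le> 2 ^ n"
      unfolding n_def by (rule LeastI_ex) fact
    have xB: "x \<in> B n"
      unfolding B_def cbox_def
      using order_trans[OF component_le_norm_cart n]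
      by (auto simp: Basis_vec_def inner_axis abs_le_iff)
         (metis minus_le_iff order_trans abs_ge_minus_self component_le_norm_cart n)
    have "J (- r) x \<le> a n"
    proof (cases n)
      case 0
      have "J (- r) x \<le> J 0 x" using assms by (intro J_mono) auto
      also have "\<dots> \<le> a n" using t 0 by (simp add: a_def ge_one_powr_ge_zero)
      finally show ?thesis .
    next
      case (Suc m)
      have "\<not> norm x \<le> 2 ^ m"
        using not_less_Least[of m "\<lambda>k. norm x \<le> 2 ^ k"] Suc unfolding n_def by simp
      then have "(2 ^ m)\<^sup>2 \<le> (norm x)\<^sup>2"
        by (intro power_mono) auto
      then have "4 ^ m \<le> 1 + (norm x)\<^sup>2"
        by (simp add: power_mult[symmetric] mult.commute[of m] power_mult)
      then have "J (- r) x \<le> (4 ^ m) powr (- t)"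
        using powr_mono2'[of "- t" "4 ^ m" "1 + (norm x)\<^sup>2"] t by (simp add: J_def t_def)
      also have "\<dots> = (4 powr (- t)) ^ m"
        by (simp add: powr_realpow[symmetric] powr_powr mult.commute)
      also have "\<dots> = a n"
        by (simp add: a_def Suc powr_minus)
      finally show ?thesis .
    qed
    then have "ennreal (J (- r) x) \<le> ennreal (a n) * indicator (B n) x"
      using xB by (simp add: ennreal_leI)
    also have "\<dots> = (\<Sum>k\<in>{n}. ennreal (a k) * indicator (B k) x)"
      by (simp only: sum.insert finite.emptyI sum.empty empty_iff add.right_neutral not_False_eq_True)
    also have "\<dots> \<le> (\<Sum>k. ennreal (a k) * indicator (B k) x)"
      by (rule sum_le_suminf) auto
    finally show ?thesis .
  qed
  have vol: "emeasure lborel (B k) = ennreal (8 * 8 ^ k)" for k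
  proof -
    have "emeasure lborel (B k) = (\<Prod>b\<in>Basis. ((\<chi> i. 2 ^ k) - (\<chi> i. - (2 ^ k)) :: space) \<bullet> b)"
      unfolding B_def by (rule emeasure_lborel_cbox) (auto simp: Basis_vec_def inner_axis)
    also have "(\<Prod>b\<in>Basis. ((\<chi> i. 2 ^ k) - (\<chi> i. - (2 ^ k)) :: space) \<bullet> b) = (\<Prod>b\<in>(Basis::space set). 2 * 2 ^ k)"
      by (rule prod.cong) (auto simp: Basis_vec_def inner_axis)
    also have "\<dots> = 8 * 8 ^ k"
      by (simp add: power_mult_distrib power_mult[symmetric] mult.commute[of k] power_mult[of 2 3 k, simplified])
    finally show ?thesis .
  qed
  have "(\<integral>\<^sup>+x. ennreal (J (- r) x) \<partial>lborel) \<le> (\<integral>\<^sup>+x. (\<Sum>k. ennreal (a k) * indicator (B k) x) \<partial>lborel)"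
    by (intro nn_integral_mono bound)
  also have "\<dots> = (\<Sum>k. ennreal (a k) * emeasure lborel (B k))"
    by (subst nn_integral_suminf) (auto simp: B_def nn_integral_cmult_indicator)
  also have "\<dots> = (\<Sum>k. ennreal (8 * 4 powr t * q ^ k))"
    by (simp add: vol ennreal_mult'[symmetric] a0 a_def q_def power_mult_distrib mult_ac)
  also have "\<dots> = ennreal (\<Sum>k. 8 * 4 powr t * q ^ k)"
    using q0 q1 by (intro suminf_ennreal2) (auto intro!: summable_mult summable_geometric)
  also have "\<dots> < \<infinity>" by simp
  finally show ?thesis
    by (intro integrableI_nonneg) auto
qed

text \<open>The least natural exponent above the dimension is 4. \<open>K4\<close> is the constant
  with which a supremum weighted by the fourth power bounds an integral.\<close>

definition K4 :: real where "K4 = (LINT x|lborel. J (- 4) x)"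

lemma K4_nonneg: "K4 \<ge> 0"
  unfolding K4_def by (rule Bochner_Integration.integral_nonneg) simp

lemma J4_bound:
  assumes "(1 + norm x) ^ 4 * y \<le> B" "y \<ge> 0"
  shows "y \<le> B * J (- 4) (x :: space)"
proof -
  have "J 4 x = (1 + (norm x)\<^sup>2)\<^sup>2"
    using powr_realpow[of "1 + (norm x)\<^sup>2" 2] by (simp add: J_def add_pos_nonneg)
  also have "\<dots> \<le> ((1 + norm x)\<^sup>2)\<^sup>2"
    by (intro power_mono) (auto simp: power2_sum)
  also have "\<dots> = (1 + norm x) ^ 4" by (simp flip: power_mult)
  finally have "J 4 x * y \<le> B"
    using assms by (meson mult_right_mono order_trans)
  then show ?thesis
    unfolding J_minus[of 4] using J_pos[of 4 x] by (simp add: field_simps)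
qed

lemma schwartz_measurable: "\<phi> \<in> schwartz \<Longrightarrow> \<phi> \<in> borel_measurable borel"
  by (intro borel_measurable_continuous_onI differentiable_imp_continuous_on)
     (auto simp: differentiable_on_def intro: differentiable_at_withinI schwartz_differentiable)

lemma rapid_integrable:
  assumes "\<phi> \<in> borel_measurable borel" "\<And>x::space. (1 + norm x) ^ 4 * norm (\<phi> x :: complex) \<le> B"
  shows "integrable lborel \<phi>" "(LINT x|lborel. norm (\<phi> x)) \<le> K4 * B"
proof -
  have b: "norm (\<phi> x) \<le> B * J (- 4) x" for x
    using J4_bound[OF assms(2)] by simp
  have i: "integrable lborel (\<lambda>x. B * J (- 4) x)"
    by (intro integrable_mult_right J_integrable) simp
  show *: "integrable lborel \<phi>"
    by (rule Bochner_Integration.integrable_bound[OF i]) (use assms(1) b in \<open>auto intro: order_trans[OF _ abs_ge_self]\<close>)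
  have "(LINT x|lborel. norm (\<phi> x)) \<le> (LINT x|lborel. B * J (- 4) x)"
    using * i b by (intro integral_mono) auto
  then show "(LINT x|lborel. norm (\<phi> x)) \<le> K4 * B"
    by (simp add: K4_def mult.commute)
qed

lemma schwartz_integrable: "\<phi> \<in> schwartz \<Longrightarrow> integrable lborel \<phi>"
  using schwartz_bound[of \<phi> 4] rapid_integrable(1)[OF schwartz_measurable] by metis

lemma schwartz_mult_integrable: "slow m \<Longrightarrow> \<phi> \<in> schwartz \<Longrightarrow> integrable lborel (\<lambda>x. m x * \<phi> x)"
  by (intro schwartz_integrable schwartz_mult)

subsection \<open>The Fourier transform on the Schwartz space\<close>

definition cF :: complex where "cF = complex_of_real ((2 * pi) powr (- 3/2))"

lemma fourier_eq: "fourier \<phi> \<xi> = cF * (LINT x|lborel. cis (- (x \<bullet> \<xi>)) * \<phi> x)"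
  by (simp add: fourier_def cF_def)

lemma inv_fourier_eq: "inv_fourier \<phi> x = cF * (LINT \<xi>|lborel. cis (x \<bullet> \<xi>) * \<phi> \<xi>)"
  by (simp add: inv_fourier_def cF_def)

lemma inv_fourier_fourier: "inv_fourier \<phi> x = fourier \<phi> (- x)"
  by (simp add: fourier_eq inv_fourier_eq inner_commute)

lemma cis_mult_integrable:
  assumes "integrable lborel (\<phi> :: space \<Rightarrow> complex)"
  shows "integrable lborel (\<lambda>x. cis (x \<bullet> a) * \<phi> x)"
  by (rule Bochner_Integration.integrable_bound[OF assms])
     (use borel_measurable_integrable[OF assms] in \<open>auto simp: norm_mult\<close>)

lemma cis_mult_integrable_minus:
  "integrable lborel (\<phi> :: space \<Rightarrow> complex) \<Longrightarrow> integrable lborel (\<lambda>x. cis (- (x \<bullet> a)) * \<phi> x)"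
  using cis_mult_integrable[of \<phi> "- a"] by simp

lemma fourier_norm_le:
  assumes "integrable lborel \<phi>"
  shows "norm (fourier \<phi> \<xi>) \<le> norm cF * (LINT x|lborel. norm (\<phi> x))"
proof -
  have "norm (LINT x|lborel. cis (- (x \<bullet> \<xi>)) * \<phi> x) \<le> (LINT x|lborel. norm (cis (- (x \<bullet> \<xi>)) * \<phi> x))"
    by (rule integral_norm_bound)
  then show ?thesis
    unfolding fourier_eq norm_mult by (intro mult_left_mono) (auto simp: norm_mult)
qed

lemma cis_taylor: "norm (cis t - 1 - \<i> * of_real t) \<le> t\<^sup>2 / 2"
  using iexp_approx1[of t 1] by (simp add: cis_conv_exp power2_eq_square algebra_simps)

lemma has_derivative_quadratic:
  fixes f :: "'a::real_normed_vector \<Rightarrow> 'b::real_normed_vector"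
  assumes "bounded_linear D" "\<And>h. norm (f (x + h) - f x - D h) \<le> K * (norm h)\<^sup>2"
  shows "(f has_derivative D) (at x)"
  unfolding has_derivative_at
proof (intro conjI assms(1))
  have lim: "((\<lambda>h. K * norm h) \<longlongrightarrow> 0) (at (0::'a))"
    by (rule tendsto_mult_right_zero[OF tendsto_norm_zero[OF tendsto_ident_at]])
  show "(\<lambda>h. norm (f (x + h) - f x - D h) / norm h) \<midarrow>0\<rightarrow> 0"
  proof (rule Lim_null_comparison[OF always_eventually lim], rule allI)
    fix h :: 'a
    show "norm (norm (f (x + h) - f x - D h) / norm h) \<le> K * norm h"
      using assms(2)[of h] by (cases "h = 0") (auto simp: field_simps power2_eq_square)
  qed
qed

text \<open>The second-order Taylor remainder of \<open>cis\<close> is at most (x \<bullet> h)^2 /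
  2, hence at most |h|^2 times \<open>J 2 x\<close>, which is integrable against a Schwartz
  function. So the remainder of the transform is quadratic in \<open>h\<close>.\<close>

lemma fourier_has_derivative:
  assumes \<phi>: "\<phi> \<in> schwartz"
  shows "(fourier \<phi> has_derivative
    (\<lambda>h. \<Sum>i\<in>UNIV. of_real (h $ i) * fourier (\<lambda>x. (- \<i> * of_real (x $ i)) * \<phi> x) \<xi>)) (at \<xi>)"
proof (rule has_derivative_quadratic)
  define D where "D h = (\<Sum>i\<in>UNIV. of_real (h $ i) * fourier (\<lambda>x. (- \<i> * of_real (x $ i)) * \<phi> x) \<xi>)" for h :: space
  show "bounded_linear (\<lambda>h::space. \<Sum>i\<in>UNIV. of_real (h $ i) * fourier (\<lambda>x. (- \<i> * of_real (x $ i)) * \<phi> x) \<xi>)"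
    by (intro bounded_linear_sum bounded_linear_compose[OF bounded_linear_mult_left]
        bounded_linear_compose[OF bounded_linear_of_real] bounded_linear_vec_nth)
  have sl: "slow (\<lambda>x. - \<i> * of_real (x $ i))" for i
    by (intro slow_mult slow_const slow_coord)
  have int0: "integrable lborel \<phi>"
    by (rule schwartz_integrable[OF \<phi>])
  have int1: "integrable lborel (\<lambda>x. (- \<i> * of_real (x $ i)) * \<phi> x)" for i
    by (rule schwartz_mult_integrable[OF sl \<phi>])
  have "integrable lborel (\<lambda>x. of_real (J 2 x) * \<phi> x)"
    by (rule schwartz_mult_integrable[OF slow_J \<phi>])
  from integrable_norm[OF this] have int2: "integrable lborel (\<lambda>x. J 2 x * norm (\<phi> x))"
    by (simp add: norm_mult)
  have Dh: "D h = cF * (LINT x|lborel. cis (- (x \<bullet> \<xi>)) * ((- \<i> * of_real (x \<bullet> h)) * \<phi> x))" for h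
  proof -
    have "D h = (\<Sum>i\<in>UNIV. cF * (LINT x|lborel. of_real (h $ i) * (cis (- (x \<bullet> \<xi>)) * ((- \<i> * of_real (x $ i)) * \<phi> x))))"
      unfolding D_def fourier_eq
      by (intro sum.cong refl, subst Bochner_Integration.integral_mult_right_zero) simp
    also have "\<dots> = cF * (LINT x|lborel. (\<Sum>i\<in>UNIV. of_real (h $ i) * (cis (- (x \<bullet> \<xi>)) * ((- \<i> * of_real (x $ i)) * \<phi> x))))"
      unfolding sum_distrib_left[symmetric]
      by (subst Bochner_Integration.integral_sum) (intro integrable_mult_right cis_mult_integrable_minus int1 refl)+
    also have "(\<lambda>x. (\<Sum>i\<in>UNIV. of_real (h $ i) * (cis (- (x \<bullet> \<xi>)) * ((- \<i> * of_real (x $ i)) * \<phi> x))))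
        = (\<lambda>x. cis (- (x \<bullet> \<xi>)) * ((- \<i> * of_real (x \<bullet> h)) * \<phi> x))"
      by (rule ext) (simp add: inner_vec_def sum_distrib_left sum_distrib_right sum_negf mult_ac)
    finally show ?thesis .
  qed
  have int3: "integrable lborel (\<lambda>x. (- \<i> * of_real (x \<bullet> h)) * \<phi> x)" for h
  proof -
    have "(\<lambda>x. (- \<i> * of_real (x \<bullet> h)) * \<phi> x) = (\<lambda>x. \<Sum>i\<in>UNIV. of_real (h $ i) * ((- \<i> * of_real (x $ i)) * \<phi> x))"
      by (rule ext) (simp add: inner_vec_def sum_distrib_left sum_distrib_right sum_negf mult_ac)
    then show ?thesis
      using int1 by (auto intro!: Bochner_Integration.integrable_sum integrable_mult_right)
  qed
  fix h :: space
  let ?g = "\<lambda>x. cis (- (x \<bullet> (\<xi> + h))) * \<phi> x - cis (- (x \<bullet> \<xi>)) * \<phi> x - cis (- (x \<bullet> \<xi>)) * ((- \<i> * of_real (x \<bullet> h)) * \<phi> x)"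
  have gi: "integrable lborel ?g"
    by (intro Bochner_Integration.integrable_diff cis_mult_integrable_minus int0 int3)
  have "fourier \<phi> (\<xi> + h) - fourier \<phi> \<xi> - D h = cF * (LINT x|lborel. ?g x)"
  proof -
    have "(LINT x|lborel. ?g x) = (LINT x|lborel. cis (- (x \<bullet> (\<xi> + h))) * \<phi> x - cis (- (x \<bullet> \<xi>)) * \<phi> x)
        - (LINT x|lborel. cis (- (x \<bullet> \<xi>)) * ((- \<i> * of_real (x \<bullet> h)) * \<phi> x))"
      by (rule Bochner_Integration.integral_diff)
        (intro Bochner_Integration.integrable_diff cis_mult_integrable_minus int0 int3)+
    moreover have "(LINT x|lborel. cis (- (x \<bullet> (\<xi> + h))) * \<phi> x - cis (- (x \<bullet> \<xi>)) * \<phi> x)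
        = (LINT x|lborel. cis (- (x \<bullet> (\<xi> + h))) * \<phi> x) - (LINT x|lborel. cis (- (x \<bullet> \<xi>)) * \<phi> x)"
      by (rule Bochner_Integration.integral_diff) (intro cis_mult_integrable_minus int0)+
    ultimately show ?thesis
      unfolding fourier_eq Dh by (simp only: right_diff_distrib)
  qed
  then have eq: "norm (fourier \<phi> (\<xi> + h) - fourier \<phi> \<xi> - D h) = norm cF * norm (LINT x|lborel. ?g x)"
    by (simp add: norm_mult)
  have "norm (LINT x|lborel. ?g x) \<le> (LINT x|lborel. norm (?g x))"
    by (rule integral_norm_bound)
  also have "\<dots> \<le> (LINT x|lborel. (norm h)\<^sup>2 * (J 2 x * norm (\<phi> x)))"
  proof (rule integral_mono)
    show "integrable lborel (\<lambda>x. norm (?g x))" by (rule integrable_norm[OF gi])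
    show "integrable lborel (\<lambda>x. (norm h)\<^sup>2 * (J 2 x * norm (\<phi> x)))"
      by (rule integrable_mult_right[OF int2])
    fix x
    have "?g x = cis (- (x \<bullet> \<xi>)) * ((cis (- (x \<bullet> h)) - 1 - \<i> * of_real (- (x \<bullet> h))) * \<phi> x)"
    proof -
      have "cis (- (x \<bullet> (\<xi> + h))) = cis (- (x \<bullet> \<xi>)) * cis (- (x \<bullet> h))"
        by (simp add: inner_add_right cis_mult)
      then show ?thesis by (simp add: algebra_simps)
    qed
    then have "norm (?g x) \<le> (x \<bullet> h)\<^sup>2 / 2 * norm (\<phi> x)"
      using mult_right_mono[OF cis_taylor[of "- (x \<bullet> h)"], of "norm (\<phi> x)"] by (simp add: norm_mult)
    also have "\<dots> \<le> ((norm h)\<^sup>2 * J 2 x) * norm (\<phi> x)"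
    proof (rule mult_right_mono)
      have "(x \<bullet> h)\<^sup>2 \<le> (norm x * norm h)\<^sup>2"
        using Cauchy_Schwarz_ineq2[of x h] by (metis abs_ge_zero power2_abs power_mono)
      also have "\<dots> \<le> (norm h)\<^sup>2 * J 2 x"
        by (simp add: J_def power_mult_distrib mult.commute mult_left_mono add_pos_nonneg distrib_left)
      finally show "(x \<bullet> h)\<^sup>2 / 2 \<le> (norm h)\<^sup>2 * J 2 x"
        using zero_le_power2[of "x \<bullet> h"] by linarith
    qed simp
    finally show "norm (?g x) \<le> (norm h)\<^sup>2 * (J 2 x * norm (\<phi> x))"
      by (simp add: mult.assoc)
  qed
  finally have "norm (LINT x|lborel. ?g x) \<le> (LINT x|lborel. (norm h)\<^sup>2 * (J 2 x * norm (\<phi> x)))" .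
  from mult_left_mono[OF this norm_ge_zero[of cF]]
  show "norm (fourier \<phi> (\<xi> + h) - fourier \<phi> \<xi> - (\<Sum>i\<in>UNIV. of_real (h $ i) * fourier (\<lambda>x. (- \<i> * of_real (x $ i)) * \<phi> x) \<xi>))
      \<le> (norm cF * (LINT x|lborel. J 2 x * norm (\<phi> x))) * (norm h)\<^sup>2"
    unfolding D_def[symmetric] eq Bochner_Integration.integral_mult_right_zero by (simp only: mult_ac)
qed

lemma pd_fourier:
  assumes "\<phi> \<in> schwartz"
  shows "pd i (fourier \<phi>) = fourier (\<lambda>x. (- \<i> * of_real (x $ i)) * \<phi> x)"
proof
  fix \<xi>
  have "pd i (fourier \<phi>) \<xi> = (\<Sum>j\<in>UNIV. of_real (axis i 1 $ j) * fourier (\<lambda>x. (- \<i> * of_real (x $ j)) * \<phi> x) \<xi>)"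
    by (rule pd_eqI[OF fourier_has_derivative[OF assms]])
  also have "\<dots> = (\<Sum>j\<in>{i}. fourier (\<lambda>x. (- \<i> * of_real (x $ j)) * \<phi> x) \<xi>)"
    by (rule sum.mono_neutral_cong_right) (auto simp: axis_def)
  finally show "pd i (fourier \<phi>) \<xi> = fourier (\<lambda>x. (- \<i> * of_real (x $ i)) * \<phi> x) \<xi>" by simp
qed

text \<open>A majorant for dominated convergence that does not depend on the step \<open>t\<close>.
  By the mean value inequality it is enough to bound the derivative on the segment from
  \<open>x\<close>; its length is at most 1, so 1 + |x| at most doubles along it, which explains
  2^4.\<close>

lemma schwartz_diff_quotient_bound:
  assumes "\<rho> \<in> schwartz"
  obtains C where "\<And>x t. 0 < t \<Longrightarrow> t \<le> 1 \<Longrightarrow> norm ((\<rho> (x + t *\<^sub>R axis i 1) - \<rho> x) / of_real t) \<le> C * J (- 4) x"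
proof -
  obtain C where C: "C > 0" "\<And>x. (1 + norm x) ^ 4 * norm (pd i \<rho> x) \<le> C"
    using schwartz_bound[OF schwartz_pd[OF assms]] by blast
  have "norm ((\<rho> (x + t *\<^sub>R axis i 1) - \<rho> x) / of_real t) \<le> (2 ^ 4 * C) * J (- 4) x" if t: "0 < t" "t \<le> 1" for x t
  proof -
    define e :: space where "e = axis i 1"
    have ne: "norm e = 1" by (simp add: e_def)
    define B where "B = (2 ^ 4 * C) * J (- 4) x"
    have pdB: "norm (pd i \<rho> (x + u *\<^sub>R e)) \<le> B" if "u \<in> {0..t}" for u
      unfolding B_def
    proof (rule J4_bound)
      have "norm (u *\<^sub>R e) \<le> 1" using that t ne by simp
      then have "norm x \<le> norm (x + u *\<^sub>R e) + 1"
        using norm_triangle_ineq4[of "x + u *\<^sub>R e" "u *\<^sub>R e"] by simp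
      moreover have "norm x \<le> norm (x + u *\<^sub>R e) + 1 \<Longrightarrow> 1 + norm x \<le> 2 * (1 + norm (x + u *\<^sub>R e))"
      proof -
        define n where "n = norm (x + u *\<^sub>R e)"
        have "n \<ge> 0" by (simp add: n_def)
        moreover assume "norm x \<le> norm (x + u *\<^sub>R e) + 1"
        ultimately show ?thesis unfolding n_def[symmetric] by argo
      qed
      ultimately have "1 + norm x \<le> 2 * (1 + norm (x + u *\<^sub>R e))" by blast
      then have "(1 + norm x) ^ 4 \<le> (2 * (1 + norm (x + u *\<^sub>R e))) ^ 4"
        by (intro power_mono) auto
      then have "(1 + norm x) ^ 4 * norm (pd i \<rho> (x + u *\<^sub>R e)) \<le> 2 ^ 4 * ((1 + norm (x + u *\<^sub>R e)) ^ 4 * norm (pd i \<rho> (x + u *\<^sub>R e)))"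
        using mult_right_mono[OF _ norm_ge_zero[of "pd i \<rho> (x + u *\<^sub>R e)"], of "(1 + norm x) ^ 4" "(2 * (1 + norm (x + u *\<^sub>R e))) ^ 4"]
        by (simp only: power_mult_distrib mult.assoc)
      also have "\<dots> \<le> 2 ^ 4 * C" by (intro mult_left_mono C) auto
      finally show "(1 + norm x) ^ 4 * norm (pd i \<rho> (x + u *\<^sub>R e)) \<le> 2 ^ 4 * C" .
    qed simp
    have der: "((\<lambda>u. \<rho> (x + u *\<^sub>R e)) has_vector_derivative pd i \<rho> (x + u *\<^sub>R e)) (at u within {0..t})" for u
    proof -
      have "((\<lambda>u. x + u *\<^sub>R e) has_derivative (\<lambda>h. h *\<^sub>R e)) (at u)"
        by (auto intro!: derivative_eq_intros)
      from has_derivative_compose[OF this differentiable_frechet[OF schwartz_differentiable[OF assms]]]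
      have "((\<lambda>u. \<rho> (x + u *\<^sub>R e)) has_derivative (\<lambda>h. h *\<^sub>R pd i \<rho> (x + u *\<^sub>R e))) (at u)"
        by (simp add: linear_cmul[OF linear_frechet_derivative[OF schwartz_differentiable[OF assms]]] pd_def e_def)
      then show ?thesis
        unfolding has_vector_derivative_def by (rule has_derivative_at_withinI)
    qed
    have "norm (\<rho> (x + t *\<^sub>R e) - \<rho> (x + 0 *\<^sub>R e)) \<le> B * norm (t - 0)"
    proof (rule differentiable_bound[where S = "{0..t}" and f' = "\<lambda>u h. h *\<^sub>R pd i \<rho> (x + u *\<^sub>R e)"])
      show "onorm (\<lambda>h. h *\<^sub>R pd i \<rho> (x + u *\<^sub>R e)) \<le> B" if "u \<in> {0..t}" for u
        by (rule onorm_le) (use mult_left_mono[OF pdB[OF that] abs_ge_zero] in \<open>auto simp: mult.commute[of B]\<close>)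
    qed (use der t in \<open>auto simp: has_vector_derivative_def\<close>)
    then have "norm (\<rho> (x + t *\<^sub>R e) - \<rho> x) / t \<le> B"
      using t by (simp add: field_simps)
    then show ?thesis
      using t unfolding B_def e_def by (simp add: norm_divide)
  qed
  then show thesis using that by blast
qed

text \<open>Every difference quotient has integral zero because Lebesgue measure is invariant under
  translations, and the quotients converge to the derivative under a common majorant.\<close>

lemma integral_pd:
  assumes "\<rho> \<in> schwartz"
  shows "(LINT x|lborel. pd i \<rho> x) = 0"
proof -
  obtain C where C: "\<And>x t. 0 < t \<Longrightarrow> t \<le> 1 \<Longrightarrow> norm ((\<rho> (x + t *\<^sub>R axis i 1) - \<rho> x) / of_real t) \<le> C * J (- 4) x"
    using schwartz_diff_quotient_bound[OF assms] by metis
  define t where "t n = inverse (real (Suc n))" for n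
  have t: "0 < t n" "t n \<le> 1" for n by (auto simp: t_def field_simps)
  define q where "q n x = (\<rho> (x + t n *\<^sub>R axis i 1) - \<rho> x) / of_real (t n)" for n x
  have [measurable]: "\<rho> \<in> borel_measurable borel" "pd i \<rho> \<in> borel_measurable borel"
    using assms schwartz_pd schwartz_measurable by auto
  have "(\<lambda>n. LINT x|lborel. q n x) \<longlonglongrightarrow> (LINT x|lborel. pd i \<rho> x)"
  proof (rule integral_dominated_convergence[where w = "\<lambda>x. C * J (- 4) x"])
    show "integrable lborel (\<lambda>x. C * J (- 4) x)"
      by (intro integrable_mult_right J_integrable) simp
    show "AE x in lborel. (\<lambda>n. q n x) \<longlonglongrightarrow> pd i \<rho> x"
    proof (rule AE_I2)
      fix x :: space
      have "((\<lambda>u. x + u *\<^sub>R axis i 1) has_derivative (\<lambda>h. h *\<^sub>R axis i 1)) (at 0)"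
        by (auto intro!: derivative_eq_intros)
      from has_derivative_compose[OF this differentiable_frechet[OF schwartz_differentiable[OF assms, of "x + 0 *\<^sub>R axis i 1"]]]
      have "((\<lambda>u. \<rho> (x + u *\<^sub>R axis i 1)) has_derivative (\<lambda>h. h *\<^sub>R pd i \<rho> x)) (at 0)"
        by (simp add: linear_cmul[OF linear_frechet_derivative[OF schwartz_differentiable[OF assms]]] pd_def)
      then have "(\<lambda>u. norm (\<rho> (x + u *\<^sub>R axis i 1) - \<rho> x - u *\<^sub>R pd i \<rho> x) / norm u) \<midarrow>0\<rightarrow> 0"
        by (simp add: has_derivative_at)
      moreover have "filterlim t (at 0) sequentially"
        unfolding filterlim_at t_def using LIMSEQ_inverse_real_of_nat by simp
      ultimately have "(\<lambda>n. norm (\<rho> (x + t n *\<^sub>R axis i 1) - \<rho> x - t n *\<^sub>R pd i \<rho> x) / norm (t n)) \<longlonglongrightarrow> 0"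
        by (rule filterlim_compose)
      moreover have "norm (\<rho> (x + t n *\<^sub>R axis i 1) - \<rho> x - t n *\<^sub>R pd i \<rho> x) / norm (t n) = norm (q n x - pd i \<rho> x)" for n
      proof -
        have "q n x - pd i \<rho> x = (\<rho> (x + t n *\<^sub>R axis i 1) - \<rho> x - t n *\<^sub>R pd i \<rho> x) / of_real (t n)"
          using t(1)[of n] by (simp add: q_def scaleR_conv_of_real field_simps)
        then show ?thesis by (simp add: norm_divide)
      qed
      ultimately have "(\<lambda>n. norm (q n x - pd i \<rho> x)) \<longlonglongrightarrow> 0"
        by (simp only:)
      then show "(\<lambda>n. q n x) \<longlonglongrightarrow> pd i \<rho> x"
        by (rule LIM_zero_cancel[OF tendsto_norm_zero_cancel])
    qed
    show "AE x in lborel. norm (q n x) \<le> C * J (- 4) x" for n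
      unfolding q_def by (intro AE_I2 C t)
  qed (auto simp: q_def[abs_def])
  moreover have "(LINT x|lborel. q n x) = 0" for n
  proof -
    have "(LINT x|lborel. \<rho> (t n *\<^sub>R axis i 1 + 1 *\<^sub>R x)) = (LINT x|lborel. \<rho> x)"
      by (rule integral_affine) auto
    moreover have "integrable lborel (\<lambda>x. \<rho> (t n *\<^sub>R axis i 1 + 1 *\<^sub>R x))"
      by (intro integrable_affine schwartz_integrable assms) simp
    ultimately show ?thesis
      unfolding q_def using schwartz_integrable[OF assms]
      by (simp add: Bochner_Integration.integral_diff add.commute)
  qed
  ultimately have "(\<lambda>n::nat. 0) \<longlonglongrightarrow> (LINT x|lborel. pd i \<rho> x)"
    by (simp only:)
  then show ?thesis
    by (simp add: LIMSEQ_const_iff)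
qed

text \<open>Integration by parts, in the form that the derivative of the Schwartz function
  \<open>cis (- (x \<bullet> \<xi>)) * \<phi> x\<close> has integral zero.\<close>

lemma fourier_pd:
  assumes \<phi>: "\<phi> \<in> schwartz"
  shows "fourier (pd i \<phi>) \<xi> = \<i> * of_real (\<xi> $ i) * fourier \<phi> \<xi>"
proof -
  define m where "m x = cis (x \<bullet> (- \<xi>))" for x :: space
  have m: "slow m" unfolding m_def[abs_def] by (rule slow_cis)
  have pdm: "pd i m x = (- \<i> * of_real (\<xi> $ i)) * m x" for x
    unfolding m_def[abs_def] by (subst pd_eqI[OF cis_has_derivative]) (simp add: inner_commute[of _ \<xi>] inner_axis)
  have "pd i (\<lambda>x. m x * \<phi> x) = (\<lambda>x. m x * pd i \<phi> x + (- \<i> * of_real (\<xi> $ i)) * (m x * \<phi> x))"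
    using pd_mult[OF slow_differentiable[OF m] schwartz_differentiable[OF \<phi>], of i] by (simp add: pdm mult.assoc)
  with integral_pd[OF schwartz_mult[OF m \<phi>], of i]
  have "(LINT x|lborel. m x * pd i \<phi> x + (- \<i> * of_real (\<xi> $ i)) * (m x * \<phi> x)) = 0" by simp
  moreover have "integrable lborel (\<lambda>x. m x * pd i \<phi> x)" "integrable lborel (\<lambda>x. m x * \<phi> x)"
    by (intro schwartz_mult_integrable m \<phi> schwartz_pd)+
  ultimately have "(LINT x|lborel. m x * pd i \<phi> x) = \<i> * of_real (\<xi> $ i) * (LINT x|lborel. m x * \<phi> x)"
    by simp
  then show ?thesis
    unfolding fourier_eq m_def by simp
qed

lemma fourier_partials_replicate:
  assumes "\<phi> \<in> schwartz"
  shows "fourier (partials (replicate k i) \<phi>) \<xi> = (\<i> * of_real (\<xi> $ i)) ^ k * fourier \<phi> \<xi>"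
  by (induction k) (simp_all add: partials_Cons fourier_pd schwartz_partials assms del: partials.simps(2))

text \<open>The bound is linear in an arbitrary upper bound \<open>B\<close> of a seminorm, as
  temperedness of \<open>lift\<close> will require. Choose the coordinate of \<xi> that is largest
  in absolute value: then 1 + |\<xi>| is at most 4 times its maximum with 1, and its
  \<open>k\<close>-th power is produced by \<open>k\<close> derivatives in that direction. The
  condition \<open>N \<ge> k\<close> admits these derivatives, and \<open>N \<ge> 4\<close> makes
  them integrable.\<close>

lemma fourier_seminorm:
  assumes \<phi>: "\<phi> \<in> schwartz" and N: "N \<ge> k" "N \<ge> 4"
    and B: "\<And>is x. length is \<le> N \<Longrightarrow> (1 + norm x) ^ N * norm (partials is \<phi> x) \<le> B"
  shows "(1 + norm \<xi>) ^ k * norm (fourier \<phi> \<xi>) \<le> (4 ^ k * norm cF * K4) * B"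
proof -
  have B4: "(1 + norm x) ^ 4 * norm (partials is \<phi> x) \<le> B" if "length is \<le> N" for "is" x
  proof -
    have "(1 + norm x) ^ 4 * norm (partials is \<phi> x) \<le> (1 + norm x) ^ N * norm (partials is \<phi> x)"
      using N by (intro mult_right_mono power_increasing) auto
    then show ?thesis using B[OF that, of x] by linarith
  qed
  have F: "norm (fourier (partials is \<phi>) \<xi>) \<le> norm cF * (K4 * B)" if "length is \<le> N" for "is"
  proof -
    note r = rapid_integrable[OF schwartz_measurable[OF schwartz_partials[OF \<phi>]] B4[OF that]]
    have "norm (fourier (partials is \<phi>) \<xi>) \<le> norm cF * (LINT x|lborel. norm (partials is \<phi> x))"
      by (rule fourier_norm_le[OF r(1)])
    also have "\<dots> \<le> norm cF * (K4 * B)"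
      by (intro mult_left_mono r(2)) simp
    finally show ?thesis .
  qed
  obtain j where j: "\<And>i. \<bar>\<xi> $ i\<bar> \<le> \<bar>\<xi> $ j\<bar>"
  proof -
    have "Max (range (\<lambda>i. \<bar>\<xi> $ i\<bar>)) \<in> range (\<lambda>i. \<bar>\<xi> $ i\<bar>)"
      by (rule Max_in) auto
    then obtain j where "Max (range (\<lambda>i. \<bar>\<xi> $ i\<bar>)) = \<bar>\<xi> $ j\<bar>" by blast
    moreover have "\<bar>\<xi> $ i\<bar> \<le> Max (range (\<lambda>i. \<bar>\<xi> $ i\<bar>))" for i
      by (rule Max_ge) auto
    ultimately show thesis using that[of j] by simp
  qed
  have "norm \<xi> \<le> (\<Sum>i\<in>UNIV. \<bar>\<xi> $ i\<bar>)" by (rule norm_le_l1_cart)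
  also have "\<dots> \<le> (\<Sum>i\<in>(UNIV::3 set). \<bar>\<xi> $ j\<bar>)" by (intro sum_mono j)
  finally have "1 + norm \<xi> \<le> 4 * max 1 \<bar>\<xi> $ j\<bar>" by simp
  then have "(1 + norm \<xi>) ^ k \<le> (4 * max 1 \<bar>\<xi> $ j\<bar>) ^ k" by (intro power_mono) auto
  then have "(1 + norm \<xi>) ^ k * norm (fourier \<phi> \<xi>) \<le> 4 ^ k * (max 1 \<bar>\<xi> $ j\<bar> ^ k * norm (fourier \<phi> \<xi>))"
    by (simp add: power_mult_distrib mult.assoc[symmetric] mult_right_mono)
  also have "max 1 \<bar>\<xi> $ j\<bar> ^ k * norm (fourier \<phi> \<xi>) \<le> norm cF * (K4 * B)"
  proof (cases "\<bar>\<xi> $ j\<bar> \<le> 1")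
    case True
    then show ?thesis using F[of "[]"] by (simp add: max_absorb1)
  next
    case False
    then show ?thesis
      using F[of "replicate k j"] N(1) by (simp add: fourier_partials_replicate[OF \<phi>] norm_mult norm_power max_absorb2)
  qed
  finally show ?thesis by (simp add: mult_ac)
qed

lemma schwartz_seminorm:
  assumes \<phi>: "\<phi> \<in> schwartz"
  obtains B where "\<And>is x. length is \<le> N \<Longrightarrow> (1 + norm x) ^ N * norm (partials is \<phi> x) \<le> B"
proof -
  have "finite {is :: 3 list. length is \<le> N}"
    using finite_lists_length_le[of "UNIV :: 3 set" N] by simp
  moreover have "\<forall>is. \<exists>C. \<forall>x. (1 + norm x) ^ N * norm (partials is \<phi> x) \<le> C"
    using schwartz_bound[OF schwartz_partials[OF \<phi>]] by metis
  then obtain C where C: "\<And>is x. (1 + norm x) ^ N * norm (partials is \<phi> x) \<le> C is"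
    by metis
  ultimately have *: "C is \<le> Max (C ` {is. length is \<le> N})" if "length is \<le> N" for "is"
    using that by (intro Max_ge finite_imageI imageI) auto
  show thesis
    by (rule that[OF order_trans[OF C *]])
qed

lemma schwartz_fourier:
  assumes "\<phi> \<in> schwartz"
  shows "fourier \<phi> \<in> schwartz"
proof (rule schwartz_coinduct[where P = "\<lambda>\<psi>. \<exists>\<phi>\<in>schwartz. \<psi> = fourier \<phi>"])
  show "\<psi> differentiable at x" if "\<exists>\<phi>\<in>schwartz. \<psi> = fourier \<phi>" for \<psi> x
  proof -
    obtain \<phi> where \<phi>: "\<phi> \<in> schwartz" "\<psi> = fourier \<phi>"
      using \<open>\<exists>\<phi>\<in>schwartz. \<psi> = fourier \<phi>\<close> by blast
    show ?thesis
      unfolding \<phi>(2) by (rule differentiableI[OF fourier_has_derivative[OF \<phi>(1)]])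
  qed
  show "rapid \<psi>" if "\<exists>\<phi>\<in>schwartz. \<psi> = fourier \<phi>" for \<psi>
    unfolding rapid_def
  proof
    fix k
    obtain \<phi> where \<phi>: "\<phi> \<in> schwartz" "\<psi> = fourier \<phi>"
      using \<open>\<exists>\<phi>\<in>schwartz. \<psi> = fourier \<phi>\<close> by blast
    obtain B where "\<And>is x. length is \<le> max k 4 \<Longrightarrow> (1 + norm x) ^ max k 4 * norm (partials is \<phi> x) \<le> B"
      by (rule schwartz_seminorm[OF \<phi>(1), where N = "max k 4"]) (blast intro: that)
    from fourier_seminorm[OF \<phi>(1) _ _ this, of k] show "\<exists>C. \<forall>x. (1 + norm x) ^ k * norm (\<psi> x) \<le> C"
      unfolding \<phi>(2) by auto
  qed
  show "\<exists>\<phi>\<in>schwartz. pd i \<psi> = fourier \<phi>" if "\<exists>\<phi>\<in>schwartz. \<psi> = fourier \<phi>" for \<psi> i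
  proof -
    obtain \<phi> where \<phi>: "\<phi> \<in> schwartz" "\<psi> = fourier \<phi>"
      using \<open>\<exists>\<phi>\<in>schwartz. \<psi> = fourier \<phi>\<close> by blast
    show ?thesis
      unfolding \<phi>(2) using pd_fourier[OF \<phi>(1)] schwartz_mult[OF slow_mult[OF slow_const slow_coord] \<phi>(1)] by blast
  qed
qed (use assms in blast)

lemma schwartz_inv_fourier: "\<phi> \<in> schwartz \<Longrightarrow> inv_fourier \<phi> \<in> schwartz"
  using schwartz_reflect[OF schwartz_fourier] by (simp add: inv_fourier_fourier[abs_def])

section \<open>Fubini's theorem for bounded kernels and Fourier inversion\<close>

lemma integrable_kernel:
  fixes \<phi> \<psi> :: "space \<Rightarrow> complex"
  assumes "integrable lborel \<phi>" "integrable lborel \<psi>"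
    and [measurable]: "k \<in> borel_measurable (borel \<Otimes>\<^sub>M borel)"
    and "\<And>x y. norm (k (x, y) :: complex) \<le> C"
  shows "integrable (lborel \<Otimes>\<^sub>M lborel) (\<lambda>(x, y). k (x, y) * (\<phi> x * \<psi> y))"
proof (rule lborel_pair.Fubini_integrable)
  have [measurable]: "\<phi> \<in> borel_measurable borel" "\<psi> \<in> borel_measurable borel"
    using assms(1,2) borel_measurable_integrable by auto
  show [measurable]: "(\<lambda>(x, y). k (x, y) * (\<phi> x * \<psi> y)) \<in> borel_measurable (lborel \<Otimes>\<^sub>M lborel)"
    by measurable
  have C: "C \<ge> 0" using order_trans[OF norm_ge_zero assms(4)] by blast
  have i: "integrable lborel (\<lambda>y. k (x, y) * (\<phi> x * \<psi> y))" for x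
  proof (rule Bochner_Integration.integrable_bound[where f = "\<lambda>y. (C * norm (\<phi> x)) * norm (\<psi> y)"])
    show "integrable lborel (\<lambda>y. (C * norm (\<phi> x)) * norm (\<psi> y))"
      by (intro integrable_mult_right integrable_norm assms)
    show "AE y in lborel. norm (k (x, y) * (\<phi> x * \<psi> y)) \<le> norm ((C * norm (\<phi> x)) * norm (\<psi> y))"
      using assms(4)[of x] C by (auto simp: norm_mult mult.assoc intro!: mult_right_mono)
  qed measurable
  then show "AE x in lborel. integrable lborel (\<lambda>y. case (x, y) of (x, y) \<Rightarrow> k (x, y) * (\<phi> x * \<psi> y))"
    by simp
  have "(LINT y|lborel. norm (k (x, y) * (\<phi> x * \<psi> y))) \<le> (C * (LINT y|lborel. norm (\<psi> y))) * norm (\<phi> x)" for x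
  proof -
    have "(LINT y|lborel. norm (k (x, y) * (\<phi> x * \<psi> y))) \<le> (LINT y|lborel. (C * norm (\<phi> x)) * norm (\<psi> y))"
    proof (rule integral_mono)
      show "integrable lborel (\<lambda>y. (C * norm (\<phi> x)) * norm (\<psi> y))"
        by (intro integrable_mult_right integrable_norm assms)
      show "norm (k (x, y) * (\<phi> x * \<psi> y)) \<le> (C * norm (\<phi> x)) * norm (\<psi> y)" for y
        using assms(4)[of x y] by (auto simp: norm_mult mult.assoc intro!: mult_right_mono)
    qed (rule integrable_norm[OF i])
    then show ?thesis by (simp add: mult_ac)
  qed
  then have b: "norm (LINT y|lborel. norm (k (x, y) * (\<phi> x * \<psi> y))) \<le> norm ((C * (LINT y|lborel. norm (\<psi> y))) * norm (\<phi> x))" for x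
  proof -
    have "0 \<le> (LINT y|lborel. norm (k (x, y) * (\<phi> x * \<psi> y)))"
      by (rule Bochner_Integration.integral_nonneg) simp
    then have "norm (LINT y|lborel. norm (k (x, y) * (\<phi> x * \<psi> y))) = (LINT y|lborel. norm (k (x, y) * (\<phi> x * \<psi> y)))"
      by simp
    also have "\<dots> \<le> (C * (LINT y|lborel. norm (\<psi> y))) * norm (\<phi> x)"
      by fact
    also have "\<dots> \<le> norm ((C * (LINT y|lborel. norm (\<psi> y))) * norm (\<phi> x))"
      unfolding real_norm_def by (rule abs_ge_self)
    finally show ?thesis .
  qed
  have "integrable lborel (\<lambda>x. LINT y|lborel. norm (k (x, y) * (\<phi> x * \<psi> y)))"
  proof (rule Bochner_Integration.integrable_bound[where f = "\<lambda>x. (C * (LINT y|lborel. norm (\<psi> y))) * norm (\<phi> x)"])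
    show "integrable lborel (\<lambda>x. (C * (LINT y|lborel. norm (\<psi> y))) * norm (\<phi> x))"
      by (intro integrable_mult_right integrable_norm assms)
    show "AE x in lborel. norm (LINT y|lborel. norm (k (x, y) * (\<phi> x * \<psi> y))) \<le> norm ((C * (LINT y|lborel. norm (\<psi> y))) * norm (\<phi> x))"
      by (intro AE_I2 b)
  qed measurable
  then show "integrable lborel (\<lambda>x. LINT y|lborel. norm (case (x, y) of (x, y) \<Rightarrow> k (x, y) * (\<phi> x * \<psi> y)))"
    by simp
qed

lemma fubini_kernel:
  fixes \<phi> \<psi> :: "space \<Rightarrow> complex"
  assumes "integrable lborel \<phi>" "integrable lborel \<psi>"
    and [measurable]: "k \<in> borel_measurable (borel \<Otimes>\<^sub>M borel)"
    and "\<And>x y. norm (k (x, y) :: complex) \<le> C"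
  shows "(LINT x|lborel. \<phi> x * (LINT y|lborel. k (x, y) * \<psi> y)) = (LINT y|lborel. (LINT x|lborel. k (x, y) * \<phi> x) * \<psi> y)"
proof -
  have "(LINT x|lborel. \<phi> x * (LINT y|lborel. k (x, y) * \<psi> y)) = (LINT x|lborel. LINT y|lborel. k (x, y) * (\<phi> x * \<psi> y))"
    by (subst Bochner_Integration.integral_mult_right_zero[symmetric]) (simp add: mult_ac)
  also have "\<dots> = (LINT y|lborel. LINT x|lborel. k (x, y) * (\<phi> x * \<psi> y))"
    using lborel_pair.Fubini_integral[OF integrable_kernel[OF assms]] by simp
  also have "\<dots> = (LINT y|lborel. (LINT x|lborel. k (x, y) * \<phi> x) * \<psi> y)"
    by (subst Bochner_Integration.integral_mult_left_zero[symmetric]) (simp add: mult_ac)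
  finally show ?thesis .
qed

lemma cis_inner_measurable [measurable]:
  "(\<lambda>p. cis (fst p \<bullet> snd p)) \<in> borel_measurable (borel \<Otimes>\<^sub>M (borel :: space measure))"
  "(\<lambda>p. cis (- (fst p \<bullet> snd p))) \<in> borel_measurable (borel \<Otimes>\<^sub>M (borel :: space measure))"
  by measurable

lemma fourier_measurable:
  assumes "integrable lborel \<phi>"
  shows "fourier \<phi> \<in> borel_measurable borel"
proof -
  have [measurable]: "\<phi> \<in> borel_measurable borel"
    using assms borel_measurable_integrable by auto
  show ?thesis
    unfolding fourier_eq[abs_def] by measurable
qed

lemma fourier_swap:
  assumes "integrable lborel \<phi>" "integrable lborel \<psi>"
  shows "(LINT x|lborel. \<phi> x * fourier \<psi> x) = (LINT x|lborel. fourier \<phi> x * \<psi> x)"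
proof -
  have "(LINT x|lborel. \<phi> x * (LINT y|lborel. cis (- (x \<bullet> y)) * \<psi> y)) = (LINT y|lborel. (LINT x|lborel. cis (- (x \<bullet> y)) * \<phi> x) * \<psi> y)"
    using fubini_kernel[OF assms cis_inner_measurable(2), of 1] by simp
  moreover have "(LINT x|lborel. \<phi> x * fourier \<psi> x) = cF * (LINT x|lborel. \<phi> x * (LINT y|lborel. cis (- (x \<bullet> y)) * \<psi> y))"
    by (subst Bochner_Integration.integral_mult_right_zero[symmetric])
       (simp add: fourier_eq mult.left_commute inner_commute[of _ "_ :: space"])
  moreover have "(LINT x|lborel. fourier \<phi> x * \<psi> x) = cF * (LINT y|lborel. (LINT x|lborel. cis (- (x \<bullet> y)) * \<phi> x) * \<psi> y)"
    by (subst Bochner_Integration.integral_mult_right_zero[symmetric]) (simp add: fourier_eq mult.assoc)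
  ultimately show ?thesis by simp
qed

text \<open>The Gaussian factorises over the coordinates, and each factor is the standard normal
  density times the square root of 2 pi.\<close>

lemma gauss_integral: "cF * (LINT x|lborel. gauss x) = 1"
proof -
  have g1: "(\<integral>\<^sup>+t. ennreal (exp (- t\<^sup>2 / 2)) \<partial>lborel) = ennreal (sqrt (2 * pi))"
  proof -
    have "has_bochner_integral lborel (\<lambda>t. sqrt (2 * pi) * (std_normal_density t * t ^ (2 * 0))) (sqrt (2 * pi) * 1)"
      using std_normal_moment_even[of 0] by (intro has_bochner_integral_mult_right) simp
    moreover have "(\<lambda>t. sqrt (2 * pi) * (std_normal_density t * t ^ (2 * 0))) = (\<lambda>t. exp (- t\<^sup>2 / 2))"
      by (simp add: std_normal_density_def fun_eq_iff)
    ultimately have "has_bochner_integral lborel (\<lambda>t::real. exp (- t\<^sup>2 / 2)) (sqrt (2 * pi))" by simp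
    then show ?thesis
      using nn_integral_eq_integral[of lborel "\<lambda>t::real. exp (- t\<^sup>2 / 2)"]
      by (simp add: has_bochner_integral_iff)
  qed
  have "(\<integral>\<^sup>+x. ennreal (exp (- (norm (x::space))\<^sup>2 / 2)) \<partial>lborel)
      = (\<integral>\<^sup>+x. (\<Prod>b\<in>(Basis::space set). ennreal (exp (- (x \<bullet> b)\<^sup>2 / 2))) \<partial>lborel)"
  proof (rule nn_integral_cong)
    fix x :: space
    have "(norm x)\<^sup>2 = (\<Sum>b\<in>Basis. (x \<bullet> b)\<^sup>2)"
      unfolding power2_norm_eq_inner by (subst euclidean_inner) (simp add: power2_eq_square)
    then have "exp (- (norm x)\<^sup>2 / 2) = (\<Prod>b\<in>Basis. exp (- (x \<bullet> b)\<^sup>2 / 2))"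
      by (simp add: exp_sum[symmetric] sum_negf sum_divide_distrib)
    then show "ennreal (exp (- (norm x)\<^sup>2 / 2)) = (\<Prod>b\<in>Basis. ennreal (exp (- (x \<bullet> b)\<^sup>2 / 2)))"
      by (simp add: prod_ennreal)
  qed
  also have "\<dots> = (\<Prod>b\<in>(Basis::space set). \<integral>\<^sup>+t. ennreal (exp (- t\<^sup>2 / 2)) \<partial>lborel)"
    by (rule nn_integral_lborel_prod[where f = "\<lambda>b t. ennreal (exp (- t\<^sup>2 / 2))"]) auto
  also have "\<dots> = ennreal (sqrt (2 * pi) ^ 3)"
    by (subst g1) (simp add: ennreal_power)
  finally have "(\<integral>\<^sup>+x. ennreal (exp (- (norm (x::space))\<^sup>2 / 2)) \<partial>lborel) = ennreal (sqrt (2 * pi) ^ 3)" .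
  then have "(LINT x|lborel. exp (- (norm (x::space))\<^sup>2 / 2)) = sqrt (2 * pi) ^ 3"
    by (intro integral_eq_nn_integral[THEN trans]) auto
  then have "(LINT x|lborel. gauss x) = of_real (sqrt (2 * pi) ^ 3)"
    unfolding gauss_def by simp
  moreover have "(2 * pi) powr (- 3/2) * sqrt (2 * pi) ^ 3 = 1"
    using pi_gt_zero by (simp add: powr_half_sqrt[symmetric] powr_realpow[symmetric] powr_powr powr_add[symmetric])
  ultimately show ?thesis
    unfolding cF_def by (metis of_real_1 of_real_mult)
qed

text \<open>Both sides solve the differential equation \<open>\<partial>\<^sub>i u = - \<xi>\<^sub>i u\<close>.\<close>

lemma fourier_gauss: "fourier gauss = gauss"
proof
  fix \<xi>
  have slc: "slow (\<lambda>x. - \<i> * of_real (x $ i))" for i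
    by (intro slow_mult slow_const slow_coord)
  have pdf: "pd i (fourier gauss) \<xi> = - of_real (\<xi> $ i) * fourier gauss \<xi>" for i \<xi>
  proof -
    have "pd i (fourier gauss) \<xi> = fourier (\<lambda>x. \<i> * pd i gauss x) \<xi>"
      by (simp add: pd_fourier[OF gauss_schwartz] pd_gauss mult.assoc)
    also have "\<dots> = \<i> * fourier (pd i gauss) \<xi>"
      unfolding fourier_eq by (simp add: mult.left_commute[of _ \<i>])
    also have "\<dots> = - of_real (\<xi> $ i) * fourier gauss \<xi>"
      by (simp add: fourier_pd[OF gauss_schwartz] flip: mult.assoc)
    finally show ?thesis .
  qed
  \<comment> \<open>\<open>u\<close> is the quotient of \<open>fourier gauss\<close> by
    \<open>gauss\<close>. Its derivative vanishes, and \<open>gauss_integral\<close> gives the value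
    1 at the origin.\<close>
  define u where "u \<xi> = fourier gauss \<xi> * of_real (exp ((norm \<xi>)\<^sup>2 / 2))" for \<xi>
  have "(u has_derivative (\<lambda>h. 0)) (at \<xi>)" for \<xi>
  proof -
    define F' where "F' = frechet_derivative (fourier gauss) (at \<xi>)"
    have diff: "fourier gauss differentiable (at \<xi>)"
      by (rule schwartz_differentiable[OF schwartz_fourier[OF gauss_schwartz]])
    have F': "(fourier gauss has_derivative F') (at \<xi>)"
      unfolding F'_def by (rule differentiable_frechet[OF diff])
    have lin: "linear F'"
      unfolding F'_def by (rule linear_frechet_derivative[OF diff])
    have F'eq: "F' h = - of_real (\<xi> \<bullet> h) * fourier gauss \<xi>" for h
    proof -
      have "F' h = F' (\<Sum>i\<in>UNIV. (h $ i) *\<^sub>R axis i 1)"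
        by (simp add: basis_expansion[of h, unfolded scalar_mult_eq_scaleR])
      also have "\<dots> = (\<Sum>i\<in>UNIV. (h $ i) *\<^sub>R F' (axis i 1))"
        by (simp add: linear_sum[OF lin] linear_cmul[OF lin])
      also have "\<dots> = (\<Sum>i\<in>UNIV. (h $ i) *\<^sub>R (- of_real (\<xi> $ i) * fourier gauss \<xi>))"
        using pdf by (simp add: F'_def pd_def)
      also have "\<dots> = - of_real (\<xi> \<bullet> h) * fourier gauss \<xi>"
        by (simp add: inner_vec_def sum_distrib_left sum_negf scaleR_conv_of_real mult_ac)
      finally show ?thesis .
    qed
    have E: "((\<lambda>\<xi>. complex_of_real (exp ((\<xi> \<bullet> \<xi>) / 2))) has_derivative
        (\<lambda>h. of_real (exp ((\<xi> \<bullet> \<xi>) / 2) * ((2 * (\<xi> \<bullet> h)) / 2)))) (at \<xi>)"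
      by (intro bounded_linear.has_derivative[OF bounded_linear_of_real])
         (auto intro!: derivative_eq_intros simp: inner_commute)
    have "((\<lambda>\<xi>. fourier gauss \<xi> * of_real (exp ((\<xi> \<bullet> \<xi>) / 2))) has_derivative
        (\<lambda>h. fourier gauss \<xi> * of_real (exp ((\<xi> \<bullet> \<xi>) / 2) * ((2 * (\<xi> \<bullet> h)) / 2)) + F' h * of_real (exp ((\<xi> \<bullet> \<xi>) / 2)))) (at \<xi>)"
      by (rule has_derivative_mult[OF F' E])
    then show ?thesis
      unfolding u_def[abs_def] power2_norm_eq_inner by (simp add: F'eq)
  qed
  then have "u \<xi> = u 0"
    using has_derivative_zero_unique[of UNIV u 0 \<xi>] by auto
  moreover have "u 0 = 1"
    using gauss_integral unfolding u_def fourier_eq by simp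
  ultimately have "fourier gauss \<xi> * of_real (exp ((norm \<xi>)\<^sup>2 / 2)) = 1"
    by (simp add: u_def)
  then show "fourier gauss \<xi> = gauss \<xi>"
    unfolding gauss_def by (simp add: exp_minus field_simps flip: of_real_mult)
qed

lemma integral_scale:
  fixes f :: "space \<Rightarrow> complex"
  assumes c: "c > 0" and [measurable]: "f \<in> borel_measurable borel"
  shows "(LINT x|lborel. f x) = of_real (c ^ 3) * (LINT x|lborel. f (c *\<^sub>R x))"
proof -
  have "(LINT x|lborel. f x) = (LINT x|density (distr lborel borel (\<lambda>x. 0 + c *\<^sub>R x)) (\<lambda>_. ennreal (\<bar>c\<bar> ^ DIM(space))). f x)"
    using c by (subst lborel_affine[of c 0]) auto
  also have "\<dots> = (LINT x|distr lborel borel (\<lambda>x. 0 + c *\<^sub>R x). (c ^ 3) *\<^sub>R f x)"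
    using c by (subst integral_density) auto
  also have "\<dots> = (LINT x|lborel. (c ^ 3) *\<^sub>R f (c *\<^sub>R x))"
    by (subst integral_distr) auto
  finally show ?thesis
    by (simp add: scaleR_conv_of_real)
qed

lemma integrable_scale:
  fixes f :: "space \<Rightarrow> complex"
  assumes c: "c > 0" and f: "integrable lborel f"
  shows "integrable lborel (\<lambda>x. f (c *\<^sub>R x))"
proof -
  have [measurable]: "f \<in> borel_measurable borel"
    using borel_measurable_integrable[OF f] by simp
  have "integrable (density (distr lborel borel (\<lambda>x. 0 + c *\<^sub>R x)) (\<lambda>_. ennreal (c ^ 3))) f"
    using f lborel_affine[of c "0 :: space"] c by simp
  then have "integrable (distr lborel borel (\<lambda>x. 0 + c *\<^sub>R x)) (\<lambda>x. (c ^ 3) *\<^sub>R f x)"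
    using c by (subst (asm) integrable_density) auto
  then have "integrable lborel (\<lambda>x. (c ^ 3) *\<^sub>R f (0 + c *\<^sub>R x))"
    by (subst (asm) integrable_distr_eq) auto
  then have "integrable lborel (\<lambda>x. inverse (c ^ 3) *\<^sub>R ((c ^ 3) *\<^sub>R f (0 + c *\<^sub>R x)))"
    by (rule integrable_scaleR_right)
  then show ?thesis using c by simp
qed

lemma fourier_translate:
  assumes "\<phi> \<in> borel_measurable borel"
  shows "fourier (\<lambda>x. \<phi> (x + a)) \<xi> = cis (a \<bullet> \<xi>) * fourier \<phi> \<xi>"
proof -
  have [measurable]: "\<phi> \<in> borel_measurable borel" by fact
  have "(LINT x|lborel. cis (- (x \<bullet> \<xi>)) * \<phi> x) = (LINT x|lborel. cis (- ((a + 1 *\<^sub>R x) \<bullet> \<xi>)) * \<phi> (a + 1 *\<^sub>R x))"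
    by (rule integral_affine[symmetric]) auto
  also have "\<dots> = (LINT x|lborel. cis (- (a \<bullet> \<xi>)) * (cis (- (x \<bullet> \<xi>)) * \<phi> (x + a)))"
    by (intro Bochner_Integration.integral_cong) (auto simp: inner_add_left cis_mult add.commute simp flip: mult.assoc)
  finally have "(LINT x|lborel. cis (- (x \<bullet> \<xi>)) * \<phi> x) = cis (- (a \<bullet> \<xi>)) * (LINT x|lborel. cis (- (x \<bullet> \<xi>)) * \<phi> (x + a))"
    by simp
  then show ?thesis
    unfolding fourier_eq by (simp add: cis_mult flip: mult.assoc)
qed

text \<open>Inversion at the origin. Pairing the transform of \<phi> with a dilated Gaussian and
  moving the transform to the Gaussian, which reproduces itself, gives two families of integrals in
  the dilation \<open>t n\<close>. As \<open>t n\<close> tends to 0, one tends to the integral of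
  the transform and the other to \<open>\<phi> 0\<close> times that of the Gaussian.\<close>

lemma fourier_integral:
  assumes \<phi>: "\<phi> \<in> schwartz"
  shows "cF * (LINT x|lborel. fourier \<phi> x) = \<phi> 0"
proof -
  have [measurable]: "\<phi> \<in> borel_measurable borel" "fourier \<phi> \<in> borel_measurable borel" "gauss \<in> borel_measurable borel"
    using \<phi> gauss_schwartz schwartz_fourier schwartz_measurable by auto
  define t where "t n = inverse (real (Suc n))" for n
  have t: "t n > 0" for n by (simp add: t_def)
  have t0: "t \<longlonglongrightarrow> 0" unfolding t_def by (rule LIMSEQ_inverse_real_of_nat)
  have gb: "norm (gauss x) \<le> 1" for x by (simp add: gauss_def)
  have cont: "isCont \<psi> x" if "\<psi> \<in> schwartz" for \<psi> x
    using schwartz_differentiable[OF that] differentiable_imp_continuous_within by blast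
  have lim: "(\<lambda>n. \<psi> (t n *\<^sub>R x)) \<longlonglongrightarrow> \<psi> 0" if "\<psi> \<in> schwartz" for \<psi> x
  proof -
    have "(\<lambda>n. t n *\<^sub>R x) \<longlonglongrightarrow> 0 *\<^sub>R x"
      by (intro tendsto_intros t0)
    then show ?thesis
      using isCont_tendsto_compose[OF cont[OF that, of 0]] by simp
  qed
  obtain C where C: "\<And>x. norm (\<phi> x) \<le> C"
    using schwartz_bound[OF \<phi>, of 0] by (metis mult_1 power_0)
  have fg: "fourier (\<lambda>x. gauss (t n *\<^sub>R x)) y = of_real (inverse (t n) ^ 3) * gauss (inverse (t n) *\<^sub>R y)" for n y
  proof -
    have "(LINT x|lborel. cis (- (x \<bullet> y)) * gauss (t n *\<^sub>R x))
        = of_real (inverse (t n) ^ 3) * (LINT x|lborel. cis (- ((inverse (t n) *\<^sub>R x) \<bullet> y)) * gauss (t n *\<^sub>R (inverse (t n) *\<^sub>R x)))"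
      by (rule integral_scale) (use t in auto)
    also have "\<dots> = of_real (inverse (t n) ^ 3) * (LINT x|lborel. cis (- (x \<bullet> (inverse (t n) *\<^sub>R y))) * gauss x)"
      using t[of n] by simp
    finally show ?thesis
      unfolding fourier_eq fun_cong[OF fourier_gauss, of "inverse (t n) *\<^sub>R y", symmetric] by simp
  qed
  have gi: "integrable lborel (\<lambda>x. gauss (t n *\<^sub>R x))" for n
    by (rule integrable_scale[OF t schwartz_integrable[OF gauss_schwartz]])
  have eq: "(LINT x|lborel. fourier \<phi> x * gauss (t n *\<^sub>R x)) = (LINT y|lborel. \<phi> (t n *\<^sub>R y) * gauss y)" for n
  proof -
    have "(LINT x|lborel. fourier \<phi> x * gauss (t n *\<^sub>R x)) = (LINT y|lborel. \<phi> y * fourier (\<lambda>x. gauss (t n *\<^sub>R x)) y)"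
      by (rule fourier_swap[symmetric]) (use schwartz_integrable[OF \<phi>] gi in auto)
    also have "\<dots> = of_real (t n ^ 3) * (LINT y|lborel. \<phi> (t n *\<^sub>R y) * (of_real (inverse (t n) ^ 3) * gauss (inverse (t n) *\<^sub>R (t n *\<^sub>R y))))"
      unfolding fg by (rule integral_scale) (use t in auto)
    also have "\<dots> = (LINT y|lborel. \<phi> (t n *\<^sub>R y) * gauss y)"
      using t[of n] by (simp add: mult.left_commute[of "\<phi> _"] power_inverse)
    finally show ?thesis .
  qed
  have "(\<lambda>n. LINT x|lborel. fourier \<phi> x * gauss (t n *\<^sub>R x)) \<longlonglongrightarrow> (LINT x|lborel. fourier \<phi> x * gauss 0)"
  proof (rule integral_dominated_convergence[where w = "\<lambda>x. norm (fourier \<phi> x)"])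
    show "integrable lborel (\<lambda>x. norm (fourier \<phi> x))"
      by (intro integrable_norm schwartz_integrable schwartz_fourier \<phi>)
    show "AE x in lborel. (\<lambda>n. fourier \<phi> x * gauss (t n *\<^sub>R x)) \<longlonglongrightarrow> fourier \<phi> x * gauss 0"
      by (intro AE_I2 tendsto_mult tendsto_const lim gauss_schwartz)
    show "AE x in lborel. norm (fourier \<phi> x * gauss (t n *\<^sub>R x)) \<le> norm (fourier \<phi> x)" for n
      using gb by (auto simp: norm_mult mult_left_le)
  qed auto
  moreover have "(\<lambda>n. LINT y|lborel. \<phi> (t n *\<^sub>R y) * gauss y) \<longlonglongrightarrow> (LINT y|lborel. \<phi> 0 * gauss y)"
  proof (rule integral_dominated_convergence[where w = "\<lambda>x. C * norm (gauss x)"])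
    show "integrable lborel (\<lambda>x. C * norm (gauss x))"
      by (intro integrable_mult_right integrable_norm schwartz_integrable gauss_schwartz)
    show "AE x in lborel. (\<lambda>n. \<phi> (t n *\<^sub>R x) * gauss x) \<longlonglongrightarrow> \<phi> 0 * gauss x"
      by (intro AE_I2 tendsto_mult tendsto_const lim \<phi>)
    show "AE x in lborel. norm (\<phi> (t n *\<^sub>R x) * gauss x) \<le> C * norm (gauss x)" for n
      using C by (auto simp: norm_mult mult_right_mono)
  qed auto
  ultimately have "(LINT x|lborel. fourier \<phi> x * gauss 0) = (LINT y|lborel. \<phi> 0 * gauss y)"
    unfolding eq by (rule LIMSEQ_unique)
  then have "(LINT x|lborel. fourier \<phi> x) = \<phi> 0 * (LINT y|lborel. gauss y)"
    by (simp add: gauss_def)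
  then show ?thesis
    using gauss_integral by (simp add: mult.left_commute)
qed

text \<open>Inversion at \<open>x\<close> is inversion at the origin for a translate.\<close>

lemma fourier_inversion:
  assumes \<phi>: "\<phi> \<in> schwartz"
  shows "inv_fourier (fourier \<phi>) = \<phi>"
proof
  fix x
  have "\<phi> x = cF * (LINT \<xi>|lborel. fourier (\<lambda>y. \<phi> (y + x)) \<xi>)"
    using fourier_integral[OF schwartz_translate[OF \<phi>]] by simp
  also have "\<dots> = inv_fourier (fourier \<phi>) x"
    unfolding inv_fourier_eq by (simp add: fourier_translate[OF schwartz_measurable[OF \<phi>]])
  finally show "inv_fourier (fourier \<phi>) x = \<phi> x" by simp
qed

lemma fourier_reflect:
  assumes "\<phi> \<in> borel_measurable borel"
  shows "fourier (\<lambda>x. \<phi> (- x)) \<xi> = fourier \<phi> (- \<xi>)"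
proof -
  have [measurable]: "\<phi> \<in> borel_measurable borel" by fact
  show ?thesis
    unfolding fourier_eq
    using integral_reflect[of "\<lambda>x. cis (- (x \<bullet> (- \<xi>))) * \<phi> x"] by simp
qed

lemma fourier_fourier:
  assumes "\<phi> \<in> schwartz"
  shows "fourier (fourier \<phi>) x = \<phi> (- x)"
  using fun_cong[OF fourier_inversion[OF assms], of "- x"] by (simp add: inv_fourier_fourier)

lemma fourier_inversion':
  assumes "\<phi> \<in> schwartz"
  shows "fourier (inv_fourier \<phi>) = \<phi>"
proof
  fix \<xi>
  have "fourier (inv_fourier \<phi>) \<xi> = fourier (\<lambda>x. fourier \<phi> (- x)) \<xi>"
    by (simp add: inv_fourier_fourier[abs_def])
  also have "\<dots> = \<phi> \<xi>"
    by (simp add: fourier_reflect[OF schwartz_measurable[OF schwartz_fourier[OF assms]]] fourier_fourier[OF assms])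
  finally show "fourier (inv_fourier \<phi>) \<xi> = \<phi> \<xi>" .
qed

lemma fourier_cnj: "fourier (\<lambda>x. cnj (\<phi> x)) \<xi> = cnj (fourier \<phi> (- \<xi>))"
proof -
  have "(LINT x|lborel. cis (- (x \<bullet> \<xi>)) * cnj (\<phi> x)) = cnj (LINT x|lborel. cis (- (x \<bullet> (- \<xi>))) * \<phi> x)"
    by (simp add: cis_cnj flip: Bochner_Integration.integral_cnj)
  then show ?thesis
    by (simp add: fourier_eq cF_def)
qed

subsection \<open>Complex inner products\<close>

text \<open>
  Vectors are given only up to null vectors, and finite combinations are described by their
  inner products with all other vectors.  So the locale applies to functions as well as to
  distributions.
\<close>

locale pre_hilbert =
  fixes H :: "'a set" and lc :: "complex \<Rightarrow> 'a \<Rightarrow> complex \<Rightarrow> 'a \<Rightarrow> 'a" and ip :: "'a \<Rightarrow> 'a \<Rightarrow> complex"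
  assumes H_nonempty: "H \<noteq> {}"
    and lc_closed: "u \<in> H \<Longrightarrow> v \<in> H \<Longrightarrow> lc a u b v \<in> H"
    and ip_lc_right: "w \<in> H \<Longrightarrow> u \<in> H \<Longrightarrow> v \<in> H \<Longrightarrow> ip w (lc a u b v) = a * ip w u + b * ip w v"
    and ip_cnj: "u \<in> H \<Longrightarrow> v \<in> H \<Longrightarrow> ip v u = cnj (ip u v)"
    and ip_nonneg: "u \<in> H \<Longrightarrow> 0 \<le> Re (ip u u)"
begin

definition nrm :: "'a \<Rightarrow> real" where "nrm u = sqrt (Re (ip u u))"
definition sub :: "'a \<Rightarrow> 'a \<Rightarrow> 'a" where "sub u v = lc 1 u (- 1) v"

lemma ip_lc_left: "w \<in> H \<Longrightarrow> u \<in> H \<Longrightarrow> v \<in> H \<Longrightarrow> ip (lc a u b v) w = cnj a * ip u w + cnj b * ip v w"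
  by (simp add: ip_cnj[of w "lc a u b v"] lc_closed ip_lc_right ip_cnj[of w u] ip_cnj[of w v])

lemma nrm_nonneg: "0 \<le> nrm u" if "u \<in> H"
  using ip_nonneg[OF that] by (simp add: nrm_def)

lemma nrm_sq: "u \<in> H \<Longrightarrow> (nrm u)\<^sup>2 = Re (ip u u)"
  using ip_nonneg by (simp add: nrm_def)

lemma ip_self: "u \<in> H \<Longrightarrow> ip u u = of_real ((nrm u)\<^sup>2)"
  using ip_cnj[of u u] by (simp add: nrm_sq complex_eq_iff)

lemma nrm_sq_lc:
  assumes "u \<in> H" "v \<in> H"
  shows "(nrm (lc a u b v))\<^sup>2 = (norm a)\<^sup>2 * (nrm u)\<^sup>2 + (norm b)\<^sup>2 * (nrm v)\<^sup>2 + 2 * Re (cnj a * b * ip u v)"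
proof -
  define z where "z = cnj a * b * ip u v"
  have cz: "cnj z = a * cnj b * ip v u"
    using assms by (simp add: z_def ip_cnj[of u v])
  have "ip (lc a u b v) (lc a u b v) = (a * cnj a) * ip u u + (b * cnj b) * ip v v + (z + cnj z)"
    unfolding cz unfolding z_def using assms by (simp add: ip_lc_left ip_lc_right lc_closed algebra_simps)
  also have "\<dots> = of_real ((norm a)\<^sup>2) * of_real ((nrm u)\<^sup>2) + of_real ((norm b)\<^sup>2) * of_real ((nrm v)\<^sup>2) + (z + cnj z)"
    unfolding ip_self[OF assms(1)] ip_self[OF assms(2)] complex_norm_square ..
  also have "\<dots> = of_real ((norm a)\<^sup>2 * (nrm u)\<^sup>2 + (norm b)\<^sup>2 * (nrm v)\<^sup>2 + 2 * Re z)"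
    unfolding complex_add_cnj by (simp only: of_real_add of_real_mult)
  finally show ?thesis
    unfolding z_def[symmetric] nrm_sq[OF lc_closed[OF assms]] by (simp only: Re_complex_of_real)
qed

lemma sub_closed: "u \<in> H \<Longrightarrow> v \<in> H \<Longrightarrow> sub u v \<in> H"
  by (simp add: sub_def lc_closed)

lemma ip_sub_right: "w \<in> H \<Longrightarrow> u \<in> H \<Longrightarrow> v \<in> H \<Longrightarrow> ip w (sub u v) = ip w u - ip w v"
  by (simp add: sub_def ip_lc_right)

lemma ip_sub_left: "w \<in> H \<Longrightarrow> u \<in> H \<Longrightarrow> v \<in> H \<Longrightarrow> ip (sub u v) w = ip u w - ip v w"
  by (simp add: sub_def ip_lc_left)

lemma nrm_sq_sub: "u \<in> H \<Longrightarrow> v \<in> H \<Longrightarrow> (nrm (sub u v))\<^sup>2 = (nrm u)\<^sup>2 + (nrm v)\<^sup>2 - 2 * Re (ip u v)"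
  by (simp add: sub_def nrm_sq_lc)

lemma Cauchy_Schwarz:
  assumes u: "u \<in> H" and v: "v \<in> H"
  shows "norm (ip u v) \<le> nrm u * nrm v"
proof -
  define c where "c = ip u v"
  define A where "A = (nrm u)\<^sup>2"
  define B where "B = (nrm v)\<^sup>2"
  \<comment> \<open>This is the squared norm of u - t * cnj c * v. Keeping \<open>t\<close> free
    settles the case \<open>B = 0\<close>, where the expression is affine in \<open>t\<close>;
    otherwise t = 1/B is optimal.\<close>
  have q: "0 \<le> A - 2 * t * (norm c)\<^sup>2 + t\<^sup>2 * (norm c)\<^sup>2 * B" for t :: real
  proof -
    have "- of_real t * cnj c * c = of_real (- t * (norm c)\<^sup>2)"
      unfolding of_real_mult complex_norm_square by (simp add: mult_ac)
    then have "Re (- of_real t * cnj c * c) = - t * (norm c)\<^sup>2"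
      by (simp only: Re_complex_of_real)
    then have "(nrm (lc 1 u (- of_real t * cnj c) v))\<^sup>2 = A - 2 * t * (norm c)\<^sup>2 + t\<^sup>2 * (norm c)\<^sup>2 * B"
      unfolding nrm_sq_lc[OF u v] by (simp add: A_def B_def c_def norm_mult power_mult_distrib)
    then show ?thesis by (metis zero_le_power2)
  qed
  have "(norm c)\<^sup>2 \<le> A * B"
  proof (cases "B = 0")
    case True
    have "(norm c)\<^sup>2 = 0"
    proof (rule ccontr)
      assume "(norm c)\<^sup>2 \<noteq> 0"
      then show False
        using q[of "(A + 1) / (norm c)\<^sup>2"] True zero_le_power2[of "nrm u"] by (simp add: A_def)
    qed
    then show ?thesis using True by simp
  next
    case False
    then have B: "B > 0" by (simp add: B_def)
    have "0 \<le> A - (norm c)\<^sup>2 / B"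
      using q[of "1 / B"] B by (simp add: power2_eq_square field_simps)
    then show ?thesis using B by (simp add: field_simps)
  qed
  then have "(norm c)\<^sup>2 \<le> (nrm u * nrm v)\<^sup>2"
    by (simp add: A_def B_def power_mult_distrib)
  then show ?thesis
    unfolding c_def by (rule power2_le_imp_le) (simp add: nrm_nonneg u v)
qed

lemma nrm_lc_le:
  assumes u: "u \<in> H" and v: "v \<in> H"
  shows "nrm (lc a u b v) \<le> norm a * nrm u + norm b * nrm v"
proof (rule power2_le_imp_le)
  define z where "z = cnj a * b * ip u v"
  have "Re z \<le> norm a * norm b * (nrm u * nrm v)"
    using complex_Re_le_cmod[of z] mult_left_mono[OF Cauchy_Schwarz[OF u v], of "norm a * norm b"]
    unfolding z_def by (simp add: norm_mult)
  then show "(nrm (lc a u b v))\<^sup>2 \<le> (norm a * nrm u + norm b * nrm v)\<^sup>2"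
    unfolding nrm_sq_lc[OF u v] z_def[symmetric] by (simp add: power2_sum power_mult_distrib mult_ac)
  show "0 \<le> norm a * nrm u + norm b * nrm v"
    using nrm_nonneg[OF u] nrm_nonneg[OF v] by simp
qed

text \<open>Here v + (u - v) need not be equal to \<open>u\<close>. Only the norms agree, which is
  seen by expanding their squares.\<close>

lemma nrm_sub_le: "u \<in> H \<Longrightarrow> v \<in> H \<Longrightarrow> nrm u \<le> nrm v + nrm (sub u v)"
proof -
  assume u: "u \<in> H" and v: "v \<in> H"
  have "Re (ip v u) = Re (ip u v)"
    by (simp add: ip_cnj[OF u v])
  then have "(nrm u)\<^sup>2 = (nrm (lc 1 v 1 (sub u v)))\<^sup>2"
    using u v by (simp add: nrm_sq_lc nrm_sq_sub sub_closed ip_sub_right nrm_sq[symmetric])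
  then have "nrm u = nrm (lc 1 v 1 (sub u v))"
    using u v by (simp add: nrm_nonneg lc_closed sub_closed)
  then show ?thesis
    using nrm_lc_le[of v "sub u v" 1 1] u v by (simp add: sub_closed)
qed

lemma ip_eq_if_null: "u \<in> H \<Longrightarrow> v \<in> H \<Longrightarrow> w \<in> H \<Longrightarrow> nrm (sub u v) = 0 \<Longrightarrow> ip w u = ip w v"
  using Cauchy_Schwarz[of w "sub u v"] by (simp add: sub_closed ip_sub_right)

definition conv :: "(nat \<Rightarrow> 'a) \<Rightarrow> 'a \<Rightarrow> bool" where
  "conv X l \<longleftrightarrow> (\<lambda>n. nrm (sub (X n) l)) \<longlonglongrightarrow> 0"

lemma conv_ip:
  assumes "conv X l" "\<And>n. X n \<in> H" "l \<in> H" "w \<in> H"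
  shows "(\<lambda>n. ip w (X n)) \<longlonglongrightarrow> ip w l"
proof -
  have "(\<lambda>n. nrm w * nrm (sub (X n) l)) \<longlonglongrightarrow> nrm w * 0"
    using assms(1) unfolding conv_def by (intro tendsto_intros)
  then have lim: "(\<lambda>n. nrm w * nrm (sub (X n) l)) \<longlonglongrightarrow> 0" by simp
  have "(\<lambda>n. ip w (X n) - ip w l) \<longlonglongrightarrow> 0"
  proof (rule Lim_null_comparison[OF always_eventually lim], rule allI)
    show "norm (ip w (X n) - ip w l) \<le> nrm w * nrm (sub (X n) l)" for n
      using Cauchy_Schwarz[OF assms(4) sub_closed[OF assms(2,3)], of n] assms by (simp add: ip_sub_right)
  qed
  then show ?thesis by (rule LIM_zero_cancel)
qed

lemma conv_nrm:
  assumes "conv X l" "\<And>n. X n \<in> H" "l \<in> H"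
  shows "(\<lambda>n. nrm (X n)) \<longlonglongrightarrow> nrm l"
proof -
  have sym: "nrm (sub l (X n)) = nrm (sub (X n) l)" for n
  proof -
    have "(nrm (sub l (X n)))\<^sup>2 = (nrm (sub (X n) l))\<^sup>2"
      using assms by (simp add: nrm_sq_sub ip_cnj[of "X n" l])
    then show ?thesis using assms by (simp add: nrm_nonneg sub_closed)
  qed
  have "\<bar>nrm (X n) - nrm l\<bar> \<le> nrm (sub (X n) l)" for n
    using nrm_sub_le[OF assms(2)[of n] assms(3)] nrm_sub_le[OF assms(3) assms(2)[of n]] sym[of n] by linarith
  then have "(\<lambda>n. nrm (X n) - nrm l) \<longlonglongrightarrow> 0"
    using assms(1) unfolding conv_def by (elim Lim_null_comparison[OF always_eventually, rotated]) simp
  then show ?thesis by (rule LIM_zero_cancel)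
qed

lemma fin_comb:
  assumes "finite F" "x ` F \<subseteq> H"
  shows "\<exists>v\<in>H. \<forall>w\<in>H. ip w v = (\<Sum>i\<in>F. c i * ip w (x i))"
  using assms
proof (induction F rule: finite_induct)
  case empty
  obtain z where "z \<in> H" using H_nonempty by blast
  then show ?case by (intro bexI[of _ "lc 0 z 0 z"]) (auto simp: ip_lc_right lc_closed)
next
  case (insert i F)
  then obtain v where "v \<in> H" "\<forall>w\<in>H. ip w v = (\<Sum>i\<in>F. c i * ip w (x i))" by auto
  then show ?case
    using insert by (intro bexI[of _ "lc 1 v (c i) (x i)"]) (auto simp: ip_lc_right lc_closed)
qed

text \<open>Vectors are not identified modulo null vectors, so completeness can only ask for
  \<open>nrm u = 0\<close>.\<close>

definition onb :: "'a set \<Rightarrow> bool" where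
  "onb E \<longleftrightarrow> E \<subseteq> H \<and> (\<forall>e\<in>E. \<forall>e'\<in>E. ip e e' = (if e = e' then 1 else 0)) \<and>
    (\<forall>u\<in>H. (\<forall>e\<in>E. ip e u = 0) \<longrightarrow> nrm u = 0)"

text \<open>Bessel's inequality together with its witness, the partial Fourier sum. Orthonormality
  makes the inner product of \<open>u\<close> with this sum equal to its squared norm, so that the
  square of the distance gives the inequality.\<close>

lemma fourier_comb:
  assumes E: "onb E" and F: "finite F" "F \<subseteq> E" and u: "u \<in> H"
  obtains v where "v \<in> H" "\<And>w. w \<in> H \<Longrightarrow> ip w v = (\<Sum>e\<in>F. ip e u * ip w e)"
    "(nrm v)\<^sup>2 = (\<Sum>e\<in>F. (norm (ip e u))\<^sup>2)" "(\<Sum>e\<in>F. (norm (ip e u))\<^sup>2) \<le> (nrm u)\<^sup>2"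
proof -
  have FH: "F \<subseteq> H" using E F by (auto simp: onb_def)
  obtain v where v: "v \<in> H" "\<And>w. w \<in> H \<Longrightarrow> ip w v = (\<Sum>e\<in>F. ip e u * ip w e)"
    using fin_comb[of F "\<lambda>e. e" "\<lambda>e. ip e u"] FH F by auto
  have ev: "ip e v = ip e u" if "e \<in> F" for e
  proof -
    have "e \<in> H" using that FH by blast
    have "ip e v = (\<Sum>e'\<in>F. ip e' u * (if e = e' then 1 else 0))"
      unfolding v(2)[OF \<open>e \<in> H\<close>] using that E F unfolding onb_def by (intro sum.cong) (auto simp: subset_iff)
    then show ?thesis using that F by (simp add: if_distrib[of "\<lambda>x. _ * x"] cong: if_cong)
  qed
  define S where "S = (\<Sum>e\<in>F. (norm (ip e u))\<^sup>2)"
  have "ip v v = (\<Sum>e\<in>F. ip e u * cnj (ip e u))"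
    unfolding v(2)[OF v(1)]
  proof (intro sum.cong refl)
    fix e assume "e \<in> F"
    then show "ip e u * ip v e = ip e u * cnj (ip e u)"
      using ev[of e] ip_cnj[of e v] FH v(1) by auto
  qed
  then have vv: "ip v v = of_real S"
    by (simp add: S_def complex_norm_square del: of_real_power)
  have "ip u v = (\<Sum>e\<in>F. ip e u * cnj (ip e u))"
    unfolding v(2)[OF u]
  proof (intro sum.cong refl)
    fix e assume "e \<in> F"
    then show "ip e u * ip u e = ip e u * cnj (ip e u)"
      using ip_cnj[of e u] FH u by auto
  qed
  then have uv: "ip u v = of_real S"
    by (simp add: S_def complex_norm_square del: of_real_power)
  have nv: "(nrm v)\<^sup>2 = S" using vv v(1) by (simp add: nrm_sq)
  have "0 \<le> (nrm (sub u v))\<^sup>2" by simp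
  then have "S \<le> (nrm u)\<^sup>2" using nrm_sq_sub[OF u v(1)] uv nv by simp
  then show thesis using that v nv unfolding S_def by blast
qed

end

text \<open>Completeness is required only for sequences with steps of norm at most 2 * 2^(-n).
  Minimizing sequences can be chosen that fast, and for such sequences of functions almost
  everywhere convergence is immediate.\<close>

locale hilbert = pre_hilbert +
  assumes complete: "(\<And>n. X n \<in> H) \<Longrightarrow>
    (\<And>n. Re (ip (lc 1 (X (Suc n)) (- 1) (X n)) (lc 1 (X (Suc n)) (- 1) (X n))) \<le> 4 * (1 / 4) ^ n) \<Longrightarrow>
    \<exists>l\<in>H. (\<lambda>n. Re (ip (lc 1 (X n) (- 1) l) (lc 1 (X n) (- 1) l))) \<longlonglongrightarrow> 0"
begin

lemma linear_coeff_zero: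
  fixes a B :: real
  assumes "\<And>t. 0 \<le> 2 * t * a + t\<^sup>2 * B" "0 \<le> B"
  shows "a = 0"
proof (rule ccontr)
  assume a: "a \<noteq> 0"
  \<comment> \<open>The minimizer would be - a / B; the shifted denominator includes the case
    \<open>B = 0\<close>.\<close>
  have "0 \<le> 2 * (- a / (B + 1)) * a + (- a / (B + 1))\<^sup>2 * B" by (rule assms(1))
  also have "\<dots> = a\<^sup>2 * (B / (B + 1) - 2) / (B + 1)"
    using assms(2) by (simp add: power2_eq_square add_nonneg_eq_0_iff field_simps)
  also have "\<dots> < 0"
  proof -
    have "B / (B + 1) - 2 < 0" using assms(2) by (simp add: field_simps)
    then show ?thesis using a assms(2) by (intro divide_neg_pos mult_pos_neg) auto
  qed
  finally show False by simp
qed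

text \<open>
  Riesz representation on a subspace that need not be closed: a minimizing sequence of
  \<open>|v|\<^sup>2 - 2 Re (\<Lambda> v)\<close> is a Cauchy sequence by the parallelogram law.
\<close>

lemma riesz:
  assumes V: "V \<subseteq> H" "V \<noteq> {}" "\<And>u v a b. u \<in> V \<Longrightarrow> v \<in> V \<Longrightarrow> lc a u b v \<in> V"
    and lin: "\<And>u v a b. u \<in> V \<Longrightarrow> v \<in> V \<Longrightarrow> \<Lambda> (lc a u b v) = a * \<Lambda> u + b * \<Lambda> v"
    and bound: "\<And>v. v \<in> V \<Longrightarrow> norm (\<Lambda> v) \<le> C * nrm v" and C: "0 \<le> C"
  obtains h where "h \<in> H" "\<And>v. v \<in> V \<Longrightarrow> ip h v = \<Lambda> v" "nrm h \<le> C"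
proof -
  define \<Phi> where "\<Phi> v = (nrm v)\<^sup>2 - 2 * Re (\<Lambda> v)" for v
  have low: "- (C\<^sup>2) \<le> \<Phi> v" if "v \<in> V" for v
  proof -
    have "Re (\<Lambda> v) \<le> C * nrm v" using bound[OF that] complex_Re_le_cmod[of "\<Lambda> v"] by linarith
    moreover have "0 \<le> (nrm v - C)\<^sup>2" by simp
    ultimately show ?thesis unfolding \<Phi>_def by (simp add: power2_diff mult.commute mult.left_commute)
  qed
  define m where "m = Inf (\<Phi> ` V)"
  have bdd: "bdd_below (\<Phi> ` V)" using low by (auto simp: bdd_below_def)
  have m: "m \<le> \<Phi> v" if "v \<in> V" for v
    unfolding m_def using that bdd by (intro cInf_lower) auto
  \<comment> \<open>With the error (1/4)^n the parallelogram law bounds the squared steps by 2 *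
    (1/4)^(n+1) + 2 * (1/4)^n, which is less than the 4 * (1/4)^n that completeness admits.\<close>
  have "\<exists>v\<in>V. \<Phi> v < m + (1 / 4) ^ n" for n :: nat
    using cInf_lessD[of "\<Phi> ` V" "m + (1 / 4) ^ n"] V(2) unfolding m_def by auto
  then obtain X where X: "\<And>n. X n \<in> V" "\<And>n::nat. \<Phi> (X n) < m + (1 / 4) ^ n" by metis
  have XH: "X n \<in> H" for n using X(1) V(1) by blast
  have par: "(nrm (sub u v))\<^sup>2 \<le> 2 * \<Phi> u + 2 * \<Phi> v - 4 * m" if "u \<in> V" "v \<in> V" for u v
  proof -
    have uv: "u \<in> H" "v \<in> H" using that V(1) by auto
    have "m \<le> \<Phi> (lc (1/2) u (1/2) v)" by (intro m V(3) that)
    also have "\<dots> = (nrm u)\<^sup>2 / 4 + (nrm v)\<^sup>2 / 4 + Re (ip u v) / 2 - Re (\<Lambda> u) - Re (\<Lambda> v)"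
      unfolding \<Phi>_def nrm_sq_lc[OF uv] lin[OF that] by (simp add: power2_eq_square)
    finally show ?thesis
      unfolding nrm_sq_sub[OF uv] \<Phi>_def by simp
  qed
  have "(nrm (sub (X (Suc n)) (X n)))\<^sup>2 \<le> 4 * (1 / 4) ^ n" for n
  proof -
    have "0 \<le> (1 / 4 :: real) ^ n" by simp
    moreover have "(1 / 4 :: real) ^ Suc n = (1 / 4) ^ n / 4" by simp
    ultimately show ?thesis
      using par[OF X(1) X(1), of "Suc n" n] X(2)[of n] X(2)[of "Suc n"] by linarith
  qed
  then have "\<exists>l\<in>H. (\<lambda>n. Re (ip (lc 1 (X n) (- 1) l) (lc 1 (X n) (- 1) l))) \<longlonglongrightarrow> 0"
    by (intro complete XH) (simp add: nrm_sq sub_closed XH lc_closed sub_def)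
  then obtain h where h: "h \<in> H" "(\<lambda>n. Re (ip (lc 1 (X n) (- 1) h) (lc 1 (X n) (- 1) h))) \<longlonglongrightarrow> 0" by blast
  from tendsto_real_sqrt[OF h(2)] have conv: "conv X h"
    unfolding conv_def nrm_def sub_def by simp
  \<comment> \<open>The limit \<open>h\<close> need not lie in \<open>V\<close>, where \<Phi> is
    known to be at least \<open>m\<close>. So the variation in direction \<open>v\<close> is taken
    at \<open>X n\<close>, and then \<open>n\<close> tends to infinity.\<close>
  have Req: "Re (ip h v) = Re (\<Lambda> v)" if v: "v \<in> V" for v
  proof -
    have vH: "v \<in> H" using v V(1) by blast
    have "0 \<le> 2 * t * (Re (ip h v) - Re (\<Lambda> v)) + t\<^sup>2 * (nrm v)\<^sup>2" for t :: real
    proof -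
      have ge: "0 \<le> (1 / 4) ^ n + (2 * t * (Re (ip v (X n)) - Re (\<Lambda> v)) + t\<^sup>2 * (nrm v)\<^sup>2)" for n
      proof -
        have "m \<le> \<Phi> (lc 1 (X n) (of_real t) v)" by (intro m V(3) X v)
        also have "\<dots> = \<Phi> (X n) + 2 * t * (Re (ip (X n) v) - Re (\<Lambda> v)) + t\<^sup>2 * (nrm v)\<^sup>2"
          unfolding \<Phi>_def nrm_sq_lc[OF XH vH] lin[OF X(1) v] by (simp add: algebra_simps)
        also have "Re (ip (X n) v) = Re (ip v (X n))"
          by (simp add: ip_cnj[OF XH vH])
        finally show ?thesis using X(2)[of n] by simp
      qed
      have "(\<lambda>n. (1 / 4) ^ n + (2 * t * (Re (ip v (X n)) - Re (\<Lambda> v)) + t\<^sup>2 * (nrm v)\<^sup>2))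
          \<longlonglongrightarrow> 0 + (2 * t * (Re (ip v h) - Re (\<Lambda> v)) + t\<^sup>2 * (nrm v)\<^sup>2)"
        by (intro tendsto_intros conv_ip[OF conv XH h(1) vH] LIMSEQ_power_zero) simp
      then have "0 \<le> 0 + (2 * t * (Re (ip v h) - Re (\<Lambda> v)) + t\<^sup>2 * (nrm v)\<^sup>2)"
        by (rule LIMSEQ_le_const) (use ge in blast)
      then show ?thesis by (simp add: ip_cnj[OF h(1) vH])
    qed
    from linear_coeff_zero[OF this] show ?thesis by simp
  qed
  \<comment> \<open>The imaginary parts follow from the real parts at \<i> times
    \<open>v\<close>.\<close>
  have eq: "ip h v = \<Lambda> v" if v: "v \<in> V" for v
  proof -
    have "v \<in> H" using v V(1) by blast
    then have "Im (ip h v) = Im (\<Lambda> v)"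
      using Req[OF V(3)[OF v v, of \<i> 0]] h(1) by (simp add: ip_lc_right lin[OF v v])
    then show ?thesis using Req[OF v] by (simp add: complex_eq_iff)
  qed
  \<comment> \<open>The bound on \<Lambda> holds on \<open>V\<close>, hence at the
    \<open>X n\<close>; both sides pass to the limit.\<close>
  have "(nrm h)\<^sup>2 \<le> C * nrm h"
  proof (rule LIMSEQ_le)
    show "(\<lambda>n. Re (ip h (X n))) \<longlonglongrightarrow> (nrm h)\<^sup>2"
      unfolding nrm_sq[OF h(1)] by (intro tendsto_intros conv_ip[OF conv XH h(1) h(1)])
    show "(\<lambda>n. C * nrm (X n)) \<longlonglongrightarrow> C * nrm h"
      by (intro tendsto_intros conv_nrm[OF conv XH h(1)])
    have "Re (ip h (X n)) \<le> C * nrm (X n)" for n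
      using bound[OF X(1)[of n]] complex_Re_le_cmod[of "\<Lambda> (X n)"] eq[OF X(1)[of n]] by simp
    then show "\<exists>N. \<forall>n\<ge>N. Re (ip h (X n)) \<le> C * nrm (X n)" by blast
  qed
  then have "nrm h \<le> C"
    using C nrm_nonneg[OF h(1)] by (cases "nrm h = 0") (auto simp: power2_eq_square)
  then show thesis using that h(1) eq by blast
qed

lemma bessel_summable:
  assumes E: "onb E" and u: "u \<in> H"
  shows "(\<lambda>e. (norm (ip e u))\<^sup>2) summable_on E"
proof (rule nonneg_bounded_partial_sums_imp_summable_on[where C = "(nrm u)\<^sup>2"])
  show "\<forall>\<^sub>F F in finite_subsets_at_top E. (\<Sum>e\<in>F. (norm (ip e u))\<^sup>2) \<le> (nrm u)\<^sup>2"
  proof (rule eventually_finite_subsets_at_top_weakI)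
    fix F assume F: "finite F" "F \<subseteq> E"
    show "(\<Sum>e\<in>F. (norm (ip e u))\<^sup>2) \<le> (nrm u)\<^sup>2"
      by (rule fourier_comb[OF E F u])
  qed
qed auto

lemma abs_summable_mult:
  fixes f g :: "'i \<Rightarrow> complex"
  assumes "(\<lambda>i. (norm (f i))\<^sup>2) summable_on I" "(\<lambda>i. (norm (g i))\<^sup>2) summable_on I"
  shows "(\<lambda>i. f i * g i) summable_on I"
proof (rule abs_summable_summable[OF summable_on_comparison_test])
  show "(\<lambda>i. (norm (f i))\<^sup>2 + (norm (g i))\<^sup>2) summable_on I"
    by (intro summable_on_add assms)
  show "norm (f i * g i) \<le> (norm (f i))\<^sup>2 + (norm (g i))\<^sup>2" for i
  proof -
    have "0 \<le> norm (f i) * norm (g i)" by simp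
    then show ?thesis
      unfolding norm_mult using sum_squares_bound[of "norm (f i)" "norm (g i)"] by linarith
  qed
qed auto

text \<open>The series defines a functional of \<open>v\<close> that is bounded, because
  \<open>fourier_comb\<close> bounds its finite partial sums. Its Riesz representative has the same
  coefficients as \<open>u\<close>, so by completeness of the basis the two differ by a null vector.
  Convergence of the Fourier series in norm is not involved.\<close>

lemma parseval:
  assumes E: "onb E" and u: "u \<in> H" and v: "v \<in> H"
  shows "((\<lambda>e. cnj (ip e u) * ip e v) has_sum ip u v) E"
proof -
  have sm: "(\<lambda>e. cnj (ip e u) * ip e w) summable_on E" if "w \<in> H" for w
    using abs_summable_mult[of "\<lambda>e. cnj (ip e u)" E "\<lambda>e. ip e w"] bessel_summable[OF E] u that by simp
  define \<Lambda> where "\<Lambda> w = (\<Sum>\<^sub>\<infinity>e\<in>E. cnj (ip e u) * ip e w)" for w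
  have hs: "((\<lambda>e. cnj (ip e u) * ip e w) has_sum \<Lambda> w) E" if "w \<in> H" for w
    unfolding \<Lambda>_def by (rule has_sum_infsum[OF sm[OF that]])
  have EH: "E \<subseteq> H" using E by (simp add: onb_def)
  obtain p where p: "p \<in> H" "\<And>w. w \<in> H \<Longrightarrow> ip p w = \<Lambda> w"
  proof (rule riesz[of H \<Lambda> "nrm u"])
    show "\<Lambda> (lc a w b x) = a * \<Lambda> w + b * \<Lambda> x" if "w \<in> H" "x \<in> H" for a b w x
    proof -
      have "((\<lambda>e. a * (cnj (ip e u) * ip e w) + b * (cnj (ip e u) * ip e x)) has_sum (a * \<Lambda> w + b * \<Lambda> x)) E"
        by (intro has_sum_add has_sum_cmult_right hs that)
      then have "((\<lambda>e. cnj (ip e u) * ip e (lc a w b x)) has_sum (a * \<Lambda> w + b * \<Lambda> x)) E"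
        by (rule has_sum_cong[THEN iffD1, rotated]) (use EH that in \<open>auto simp: ip_lc_right algebra_simps\<close>)
      then show ?thesis unfolding \<Lambda>_def by (rule infsumI)
    qed
    show "norm (\<Lambda> w) \<le> nrm u * nrm w" if w: "w \<in> H" for w
    proof -
      have "norm (\<Sum>e\<in>F. cnj (ip e u) * ip e w) \<le> nrm u * nrm w" if F: "finite F" "F \<subseteq> E" for F
      proof -
        obtain x where x: "x \<in> H" "\<And>w. w \<in> H \<Longrightarrow> ip w x = (\<Sum>e\<in>F. ip e u * ip w e)"
          "(nrm x)\<^sup>2 = (\<Sum>e\<in>F. (norm (ip e u))\<^sup>2)" "(\<Sum>e\<in>F. (norm (ip e u))\<^sup>2) \<le> (nrm u)\<^sup>2"
          using fourier_comb[OF E F u] by blast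
        have nx: "nrm x \<le> nrm u"
          by (rule power2_le_imp_le) (use x(3,4) nrm_nonneg[OF u] in auto)
        have "ip x w = (\<Sum>e\<in>F. cnj (ip e u) * ip e w)"
          using x(2)[OF w] F EH w by (simp add: ip_cnj[OF w x(1)]) (auto intro!: sum.cong simp: ip_cnj[of w])
        then have "norm (\<Sum>e\<in>F. cnj (ip e u) * ip e w) \<le> nrm x * nrm w"
          using Cauchy_Schwarz[OF x(1) w] by simp
        also have "\<dots> \<le> nrm u * nrm w"
          by (intro mult_right_mono nx nrm_nonneg w)
        finally show ?thesis .
      qed
      then show ?thesis
        using hs[OF w] unfolding has_sum_def
        by (intro Lim_norm_ubound[where f = "sum (\<lambda>e. cnj (ip e u) * ip e w)" and net = "finite_subsets_at_top E"])
           (auto intro!: eventually_finite_subsets_at_top_weakI)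
    qed
  qed (use H_nonempty lc_closed nrm_nonneg u in auto)
  have "ip e (sub p u) = 0" if e: "e \<in> E" for e
  proof -
    have "e \<in> H" using e EH by blast
    have "((\<lambda>e'. cnj (ip e' u) * ip e' e) has_sum cnj (ip e u)) E"
      using e E by (intro has_sum_finite_neutralI[of "{e}"]) (auto simp: onb_def)
    then have "ip p e = cnj (ip e u)"
      using p(2)[OF \<open>e \<in> H\<close>] by (simp add: \<Lambda>_def infsumI)
    then show ?thesis
      using p(1) u \<open>e \<in> H\<close> by (simp add: ip_sub_right ip_cnj[of p e])
  qed
  then have z: "nrm (sub p u) = 0"
    using E p(1) u by (simp add: onb_def sub_closed)
  have "ip u v = ip p v"
    using ip_eq_if_null[OF p(1) u v z] ip_cnj[of v u] ip_cnj[of v p] u v p(1) by simp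
  then show ?thesis using hs[OF v] p(2)[OF v] by simp
qed

lemma parseval_norm:
  assumes E: "onb E" and u: "u \<in> H"
  shows "((\<lambda>e. (norm (ip e u))\<^sup>2) has_sum (nrm u)\<^sup>2) E"
proof -
  have "((\<lambda>e. Re (cnj (ip e u) * ip e u)) has_sum Re (ip u u)) E"
    by (rule has_sum_Re[OF parseval[OF E u u]])
  moreover have "Re (cnj (ip e u) * ip e u) = (norm (ip e u))\<^sup>2" for e
    unfolding cmod_power2 by (simp add: power2_eq_square)
  ultimately show ?thesis by (simp add: nrm_sq[OF u])
qed

subsection \<open>Hilbert-Schmidt sums\<close>

text \<open>A relation and not a function, as adjoints are determined only up to null
  vectors.\<close>

definition adj :: "('a \<Rightarrow> 'a) \<Rightarrow> ('a \<Rightarrow> 'a) \<Rightarrow> bool" where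
  "adj A B \<longleftrightarrow> A ` H \<subseteq> H \<and> B ` H \<subseteq> H \<and> (\<forall>u\<in>H. \<forall>v\<in>H. ip (B u) v = ip u (A v))"

lemma adj_mem:
  assumes "adj A B" "u \<in> H"
  shows "A u \<in> H" "B u \<in> H"
  using assms unfolding adj_def by (simp_all add: image_subset_iff)

lemma adj_ip: "adj A B \<Longrightarrow> u \<in> H \<Longrightarrow> v \<in> H \<Longrightarrow> ip (B u) v = ip u (A v)"
  unfolding adj_def by blast

lemma adj_sym: "adj A B \<Longrightarrow> adj B A"
  unfolding adj_def using ip_cnj by (metis image_subset_iff)

lemma adj_comp: "adj A B \<Longrightarrow> adj A' B' \<Longrightarrow> adj (A \<circ> A') (B' \<circ> B)"
  unfolding adj_def by (auto simp: image_subset_iff)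

lemma adj_exists:
  assumes "A ` H \<subseteq> H" "\<And>u v a b. u \<in> H \<Longrightarrow> v \<in> H \<Longrightarrow> A (lc a u b v) = lc a (A u) b (A v)"
    "\<And>u. u \<in> H \<Longrightarrow> nrm (A u) \<le> C * nrm u"
  obtains B where "adj A B"
proof -
  have "\<exists>h\<in>H. \<forall>v\<in>H. ip h v = ip u (A v)" if u: "u \<in> H" for u
  proof -
    obtain h where "h \<in> H" "\<And>v. v \<in> H \<Longrightarrow> ip h v = ip u (A v)"
    proof (rule riesz[of H "\<lambda>v. ip u (A v)" "nrm u * \<bar>C\<bar>"])
      show "norm (ip u (A v)) \<le> nrm u * \<bar>C\<bar> * nrm v" if "v \<in> H" for v
      proof -
        have "norm (ip u (A v)) \<le> nrm u * nrm (A v)"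
          using assms(1) u that by (intro Cauchy_Schwarz) auto
        also have "\<dots> \<le> nrm u * (\<bar>C\<bar> * nrm v)"
          using assms(3)[OF that] mult_right_mono[OF abs_ge_self[of C] nrm_nonneg[OF that]]
          by (intro mult_left_mono nrm_nonneg u) linarith
        finally show ?thesis by (simp add: mult.assoc)
      qed
    qed (use H_nonempty lc_closed nrm_nonneg u assms in \<open>auto simp: ip_lc_right image_subset_iff\<close>)
    then show ?thesis by blast
  qed
  then obtain B where "\<forall>u\<in>H. B u \<in> H \<and> (\<forall>v\<in>H. ip (B u) v = ip u (A v))" by metis
  then have "adj A B" using assms(1) unfolding adj_def by auto
  then show thesis by (rule that)
qed

lemma has_sum_swap_nonneg:
  fixes f :: "'i \<Rightarrow> 'j \<Rightarrow> real"
  assumes "\<And>i j. f i j \<ge> 0" "\<And>i. i \<in> I \<Longrightarrow> (f i has_sum g i) K" "(g has_sum S) I"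
    "\<And>j. j \<in> K \<Longrightarrow> ((\<lambda>i. f i j) has_sum k j) I"
  shows "(k has_sum S) K"
proof -
  have "(\<lambda>(i, j). f i j) summable_on I \<times> K"
    using assms by (intro summable_on_SigmaI[where g = g]) (auto simp: summable_on_def)
  then have "((\<lambda>(i, j). f i j) has_sum S) (I \<times> K)"
    using assms by (intro has_sum_SigmaI[where g = g]) auto
  then have "((\<lambda>(j, i). f i j) has_sum S) (K \<times> I)"
    by (subst has_sum_swap) (simp add: case_prod_beta)
  then show ?thesis
    by (rule has_sum_SigmaD) (use assms(4) in auto)
qed

text \<open>Both sums are the sum of all squared matrix entries between the two bases, taken first
  over one index or first over the other. Passing to the adjoint in \<open>E\<close> and back into
  another basis gives independence of the basis.\<close>

lemma hs_adj:
  assumes E: "onb E" and E': "onb E'" and AB: "adj A B"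
    and A: "((\<lambda>e. (nrm (A e))\<^sup>2) has_sum S) E"
  shows "((\<lambda>e. (nrm (B e))\<^sup>2) has_sum S) E'"
proof (rule has_sum_swap_nonneg[where f = "\<lambda>e e'. (norm (ip e' (A e)))\<^sup>2", OF _ _ A])
  have sub: "E \<subseteq> H" "E' \<subseteq> H" using E E' by (auto simp: onb_def)
  show "((\<lambda>e'. (norm (ip e' (A e)))\<^sup>2) has_sum (nrm (A e))\<^sup>2) E'" if "e \<in> E" for e
    by (intro parseval_norm E' adj_mem(1)[OF AB]) (use sub that in blast)
  fix e' assume e': "e' \<in> E'"
  have "((\<lambda>e. (norm (ip e (B e')))\<^sup>2) has_sum (nrm (B e'))\<^sup>2) E"
    by (intro parseval_norm E adj_mem(2)[OF AB]) (use sub e' in blast)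
  moreover have "norm (ip e (B e')) = norm (ip e' (A e))" if "e \<in> E" for e
  proof -
    have "e \<in> H" "e' \<in> H" using that e' sub by blast+
    moreover from this have "B e' \<in> H" by (intro adj_mem(2)[OF AB])
    ultimately have "ip e (B e') = cnj (ip e' (A e))"
      using adj_ip[OF AB, of e' e] ip_cnj[of "B e'" e] by simp
    then show ?thesis by simp
  qed
  ultimately show "((\<lambda>e. (norm (ip e' (A e)))\<^sup>2) has_sum (nrm (B e'))\<^sup>2) E"
    by (simp cong: has_sum_cong)
qed simp

lemma hs_basis:
  assumes "onb E" "onb E'" "adj A B" "((\<lambda>e. (nrm (A e))\<^sup>2) has_sum S) E"
  shows "((\<lambda>e. (nrm (A e))\<^sup>2) has_sum S) E'"
  using hs_adj[OF assms(1,1,3,4)] hs_adj[OF assms(1,2) adj_sym[OF assms(3)]] by blast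

text \<open>Cyclicity of the trace, tr (A' B) = tr (B A'): both are iterated sums of one absolutely
  convergent double series. The double series stays in the conclusion because the Schur product
  theorem is applied to its finite sections.\<close>

lemma hs_trace_swap:
  assumes E: "onb E" and A: "adj A A'" and B: "adj B B'"
    and sA: "(\<lambda>e. (nrm (A e))\<^sup>2) summable_on E" and sB: "(\<lambda>e. (nrm (B e))\<^sup>2) summable_on E"
  shows "\<exists>V. ((\<lambda>(e', e). cnj (ip e (A e')) * ip e (B e')) has_sum V) (E \<times> E)
    \<and> ((\<lambda>e. ip (A e) (B e)) has_sum V) E \<and> ((\<lambda>e. ip (B' e) (A' e)) has_sum V) E"
proof -
  have sub: "E \<subseteq> H" using E by (auto simp: onb_def)
  have sq: "(\<lambda>(e', e). (norm (ip e (A e')))\<^sup>2) summable_on E \<times> E"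
    if "adj A A'" "(\<lambda>e. (nrm (A e))\<^sup>2) summable_on E" for A A'
  proof (rule summable_on_SigmaI[where g = "\<lambda>e'. (nrm (A e'))\<^sup>2"])
    show "((\<lambda>e. case (e', e) of (e', e) \<Rightarrow> (norm (ip e (A e')))\<^sup>2) has_sum (nrm (A e'))\<^sup>2) E" if "e' \<in> E" for e'
    proof -
      have "A e' \<in> H" by (intro adj_mem(1)[OF \<open>adj A A'\<close>]) (use sub that in blast)
      then show ?thesis using parseval_norm[OF E] by simp
    qed
  qed (use that in auto)
  have "(\<lambda>p. cnj (ip (snd p) (A (fst p))) * ip (snd p) (B (fst p))) summable_on E \<times> E"
    by (rule abs_summable_mult) (use sq[OF A sA] sq[OF B sB] in \<open>simp_all add: case_prod_unfold\<close>)
  then obtain V where "((\<lambda>p. cnj (ip (snd p) (A (fst p))) * ip (snd p) (B (fst p))) has_sum V) (E \<times> E)"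
    unfolding summable_on_def by blast
  then have V: "((\<lambda>(e', e). cnj (ip e (A e')) * ip e (B e')) has_sum V) (E \<times> E)"
    by (simp add: case_prod_unfold)
  have "((\<lambda>e. ip (A e) (B e)) has_sum V) E"
  proof (rule has_sum_SigmaD[OF V])
    fix e assume "e \<in> E"
    then have "e \<in> H" using sub by blast
    then show "((\<lambda>e'. case (e, e') of (e', e) \<Rightarrow> cnj (ip e (A e')) * ip e (B e')) has_sum ip (A e) (B e)) E"
      using parseval[OF E adj_mem(1)[OF A] adj_mem(1)[OF B]] by simp
  qed
  moreover have V': "((\<lambda>(e, e'). cnj (ip e (A e')) * ip e (B e')) has_sum V) (E \<times> E)"
    using V by (subst has_sum_swap) (simp add: case_prod_beta)
  have "((\<lambda>e. ip (B' e) (A' e)) has_sum V) E"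
  proof (rule has_sum_SigmaD[OF V'])
    fix e assume e: "e \<in> E"
    have "e \<in> H" using e sub by blast
    then have H: "e \<in> H" "A' e \<in> H" "B' e \<in> H"
      by (auto intro: adj_mem(2)[OF A] adj_mem(2)[OF B])
    have "((\<lambda>e'. cnj (ip e' (B' e)) * ip e' (A' e)) has_sum ip (B' e) (A' e)) E"
      by (rule parseval[OF E H(3,2)])
    moreover have "cnj (ip e (A e')) * ip e (B e') = cnj (ip e' (B' e)) * ip e' (A' e)" if "e' \<in> E" for e'
    proof -
      have "e' \<in> H" using that sub by blast
      then show ?thesis
        using H ip_cnj[of "A' e" e'] ip_cnj[of "B' e" e'] adj_ip[OF A, of e e'] adj_ip[OF B, of e e'] by simp
    qed
    ultimately show "((\<lambda>e'. case (e, e') of (e, e') \<Rightarrow> cnj (ip e (A e')) * ip e (B e')) has_sum ip (B' e) (A' e)) E"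
      by (simp cong: has_sum_cong)
  qed
  ultimately show ?thesis using V by blast
qed

end

section \<open>Positive semidefinite matrices and the Schur product theorem\<close>

definition psd :: "'i set \<Rightarrow> ('i \<Rightarrow> 'i \<Rightarrow> complex) \<Rightarrow> bool" where
  "psd F a \<longleftrightarrow> (\<forall>i\<in>F. \<forall>j\<in>F. a j i = cnj (a i j)) \<and>
    (\<forall>c. 0 \<le> Re (\<Sum>i\<in>F. \<Sum>j\<in>F. cnj (c i) * c j * a i j))"

lemma psd_herm: "psd F a \<Longrightarrow> i \<in> F \<Longrightarrow> j \<in> F \<Longrightarrow> a j i = cnj (a i j)"
  unfolding psd_def by (drule conjunct1) (drule (1) bspec)+

lemma psd_nonneg: "psd F a \<Longrightarrow> 0 \<le> Re (\<Sum>i\<in>F. \<Sum>j\<in>F. cnj (c i) * c j * a i j)"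
  unfolding psd_def by (drule conjunct2) (erule spec)

lemma psd_cnj:
  assumes "psd F a"
  shows "psd F (\<lambda>i j. cnj (a i j))"
  unfolding psd_def
proof (intro conjI ballI allI)
  show "cnj (a j i) = cnj (cnj (a i j))" if "i \<in> F" "j \<in> F" for i j
    by (simp only: psd_herm[OF assms that])
  fix c :: "'a \<Rightarrow> complex"
  have "(\<Sum>i\<in>F. \<Sum>j\<in>F. cnj (c i) * c j * cnj (a i j)) = cnj (\<Sum>i\<in>F. \<Sum>j\<in>F. cnj (cnj (c i)) * cnj (c j) * a i j)"
    by simp
  moreover have "0 \<le> Re (\<Sum>i\<in>F. \<Sum>j\<in>F. cnj (cnj (c i)) * cnj (c j) * a i j)"
    by (rule psd_nonneg[OF assms])
  ultimately show "0 \<le> Re (\<Sum>i\<in>F. \<Sum>j\<in>F. cnj (c i) * c j * cnj (a i j))"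
    by (simp only: cnj.sel)
qed

lemma psd_subset:
  assumes "psd G a" "F \<subseteq> G" "finite G"
  shows "psd F a"
  unfolding psd_def
proof (intro conjI ballI allI)
  show "a j i = cnj (a i j)" if "i \<in> F" "j \<in> F" for i j
    by (rule psd_herm[OF assms(1)]) (use assms(2) that in auto)
  fix c :: "'a \<Rightarrow> complex"
  define d where "d i = (if i \<in> F then c i else 0)" for i
  have "(\<Sum>i\<in>G. \<Sum>j\<in>G. cnj (d i) * d j * a i j) = (\<Sum>i\<in>F. \<Sum>j\<in>F. cnj (c i) * c j * a i j)"
    using assms(2,3)
    by (intro sum.mono_neutral_cong_right) (auto simp: d_def intro!: sum.mono_neutral_cong_right sum.neutral)
  then show "0 \<le> Re (\<Sum>i\<in>F. \<Sum>j\<in>F. cnj (c i) * c j * a i j)"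
    using psd_nonneg[OF assms(1), of d] by simp
qed

lemma psd_diag: "psd F a \<Longrightarrow> finite F \<Longrightarrow> i \<in> F \<Longrightarrow> Im (a i i) = 0 \<and> 0 \<le> Re (a i i)"
  using psd_herm[of F a i i] psd_nonneg[OF psd_subset[of F a "{i}"], of "\<lambda>_. 1"] by (simp add: complex_eq_iff)

lemma psd_zero_row:
  assumes "psd F a" "finite F" "i \<in> F" "j \<in> F" "a i i = 0"
  shows "a i j = 0"
proof (cases "i = j")
  case False
  have p: "psd {i, j} a" using psd_subset[OF assms(1), of "{i, j}"] assms by auto
  have ji: "a j i = cnj (a i j)" by (rule psd_herm[OF assms(1,3,4)])
  define z where "z = a i j"
  define M where "M = Re (a j j)"
  have "0 \<le> Re (\<Sum>k\<in>{i, j}. \<Sum>l\<in>{i, j}. cnj (c k) * c l * a k l)" for c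
    by (rule psd_nonneg[OF p])
  \<comment> \<open>The vector has entries - t z and 1. Since the diagonal entry at \<open>i\<close>
    vanishes, the form is affine in \<open>t\<close>, and boundedness from below forces z =
    0.\<close>
  from this[of "\<lambda>k. if k = i then - of_real t * z else 1" for t]
  have q: "0 \<le> M - 2 * t * (norm z)\<^sup>2" for t
    using False assms(5) ji unfolding z_def M_def cmod_power2
    by (simp add: power2_eq_square algebra_simps)
  show ?thesis
  proof (rule ccontr)
    assume "a i j \<noteq> 0"
    then have "(norm z)\<^sup>2 > 0" by (simp add: z_def)
    then show False
      using q[of "(M + 1) / (norm z)\<^sup>2"] q[of 0] by simp
  qed
qed (use assms in simp)

text \<open>The Schur product theorem, by elimination of one index at a time (Schur complement).\<close>

lemma schur_product:
  assumes "finite F" "psd F a" "psd F b"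
  shows "0 \<le> Re (\<Sum>i\<in>F. \<Sum>j\<in>F. a i j * b i j)"
  using assms
proof (induction F arbitrary: a rule: finite_induct)
  case (insert x F)
  let ?G = "insert x F"
  have fin: "finite ?G" using insert by simp
  have her: "a j i = cnj (a i j)" if "i \<in> ?G" "j \<in> ?G" for i j
    by (rule psd_herm[OF insert.prems(1) that])
  have pb: "psd F b" by (rule psd_subset[OF insert.prems(2)]) (use fin in auto)
  have split: "(\<Sum>i\<in>?G. \<Sum>j\<in>?G. f i j) = f x x + (\<Sum>j\<in>F. f x j) + (\<Sum>i\<in>F. f i x) + (\<Sum>i\<in>F. \<Sum>j\<in>F. f i j)"
    for f :: "'a \<Rightarrow> 'a \<Rightarrow> complex"
    using insert.hyps by (simp add: sum.distrib algebra_simps)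
  show ?case
  proof (cases "a x x = 0")
    case True
    have 0: "a x j = 0" "a j x = 0" if "j \<in> ?G" for j
      using psd_zero_row[OF insert.prems(1) fin _ that True] her[of x j] that by auto
    have "psd F a" by (rule psd_subset[OF insert.prems(1)]) (use fin in auto)
    from insert.IH[OF this pb] show ?thesis
      unfolding split using 0 by simp
  next
    case False
    define r where "r = Re (a x x)"
    have axx: "a x x = of_real r" and r: "r > 0"
      using psd_diag[OF insert.prems(1) fin, of x] False unfolding r_def by (auto simp: complex_eq_iff less_le)
    \<comment> \<open>The Schur complement: the rank-one part through the pivot is removed, which
      clears row and column \<open>x\<close>.\<close>
    define a' where "a' i j = a i j - a i x * a x j / of_real r" for i j
    have "psd F a'"
      unfolding psd_def
    proof (intro conjI ballI allI)
      show "a' j i = cnj (a' i j)" if "i \<in> F" "j \<in> F" for i j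
        using her[of i j] her[of i x] her[of x j] that by (simp add: a'_def mult.commute)
      fix c :: "'a \<Rightarrow> complex"
      define s where "s = (\<Sum>j\<in>F. c j * a x j)"
      \<comment> \<open>The value at \<open>x\<close> minimizes the form of \<open>a\<close> among
        all extensions of \<open>c\<close>. At this minimum the form of \<open>a\<close> equals that
        of the complement.\<close>
      define d where "d = c(x := - s / of_real r)"
      have dF: "d i = c i" if "i \<in> F" for i using that insert.hyps by (auto simp: d_def)
      have cs: "(\<Sum>i\<in>F. cnj (c i) * a i x) = cnj s"
        unfolding s_def by (auto intro!: sum.cong simp: her[of x] insert.hyps)
      have "(\<Sum>i\<in>?G. \<Sum>j\<in>?G. cnj (d i) * d j * a i j)
          = cnj (d x) * d x * a x x + cnj (d x) * s + d x * cnj s + (\<Sum>i\<in>F. \<Sum>j\<in>F. cnj (c i) * c j * a i j)"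
      proof -
        have "(\<Sum>j\<in>F. cnj (d x) * d j * a x j) = cnj (d x) * s"
          unfolding s_def sum_distrib_left by (auto intro!: sum.cong simp: dF)
        moreover have "(\<Sum>i\<in>F. cnj (d i) * d x * a i x) = d x * cnj s"
          unfolding cs[symmetric] sum_distrib_left by (auto intro!: sum.cong simp: dF)
        ultimately show ?thesis
          unfolding split by (auto intro!: sum.cong simp: dF)
      qed
      also have "cnj (d x) * d x * a x x + cnj (d x) * s + d x * cnj s = - (cnj s * s / of_real r)"
        using r by (simp add: d_def axx field_simps)
      also have "- (cnj s * s / of_real r) = - (\<Sum>i\<in>F. \<Sum>j\<in>F. cnj (c i) * c j * (a i x * a x j / of_real r))"
        unfolding cs[symmetric] unfolding s_def sum_product sum_divide_distrib
        by (simp add: mult_ac)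
      also have "- (\<Sum>i\<in>F. \<Sum>j\<in>F. cnj (c i) * c j * (a i x * a x j / of_real r)) + (\<Sum>i\<in>F. \<Sum>j\<in>F. cnj (c i) * c j * a i j)
          = (\<Sum>i\<in>F. \<Sum>j\<in>F. cnj (c i) * c j * a' i j)"
        unfolding a'_def by (simp add: algebra_simps sum_subtractf)
      finally show "0 \<le> Re (\<Sum>i\<in>F. \<Sum>j\<in>F. cnj (c i) * c j * a' i j)"
        using psd_nonneg[OF insert.prems(1), of d] by (simp only:)
    qed
    from insert.IH[OF this pb] have 1: "0 \<le> Re (\<Sum>i\<in>F. \<Sum>j\<in>F. a' i j * b i j)" .
    \<comment> \<open>The product of the rank-one part with \<open>b\<close> is, up to the factor
      1/r, the form of \<open>b\<close> at the vector with entries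
      \<open>cnj (a i x)\<close>.\<close>
    have 2: "0 \<le> Re (\<Sum>i\<in>?G. \<Sum>j\<in>?G. a i x * cnj (a j x) * b i j)"
    proof -
      have "0 \<le> Re (\<Sum>i\<in>?G. \<Sum>j\<in>?G. cnj (cnj (a i x)) * cnj (a j x) * b i j)"
        by (rule psd_nonneg[OF insert.prems(2)])
      then show ?thesis by (simp only: complex_cnj_cnj)
    qed
    have "(\<Sum>i\<in>?G. \<Sum>j\<in>?G. a i j * b i j)
        = (\<Sum>i\<in>?G. \<Sum>j\<in>?G. a i x * cnj (a j x) * b i j) / of_real r + (\<Sum>i\<in>F. \<Sum>j\<in>F. a' i j * b i j)"
    proof -
      have e: "a i j * b i j = (a i x * cnj (a j x) * b i j) / of_real r + a' i j * b i j" if "i \<in> ?G" "j \<in> ?G" for i j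
        unfolding a'_def her[OF that(2) insertI1, symmetric] by (simp add: algebra_simps)
      have z: "a' x j = 0" "a' j x = 0" for j
        using r by (auto simp: a'_def axx)
      have "(\<Sum>i\<in>?G. \<Sum>j\<in>?G. a i j * b i j) = (\<Sum>i\<in>?G. \<Sum>j\<in>?G. (a i x * cnj (a j x) * b i j) / of_real r + a' i j * b i j)"
        by (intro sum.cong e refl)
      also have "\<dots> = (\<Sum>i\<in>?G. \<Sum>j\<in>?G. (a i x * cnj (a j x) * b i j) / of_real r) + (\<Sum>i\<in>?G. \<Sum>j\<in>?G. a' i j * b i j)"
        by (simp only: sum.distrib)
      also have "(\<Sum>i\<in>?G. \<Sum>j\<in>?G. a' i j * b i j) = (\<Sum>i\<in>F. \<Sum>j\<in>F. a' i j * b i j)"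
        unfolding split by (simp add: z)
      finally show ?thesis by (simp only: sum_divide_distrib)
    qed
    then show ?thesis
      using 1 2 r by (simp only: plus_complex.sel Re_divide_of_real) simp
  qed
qed simp

section \<open>An interpolation inequality for Hilbert-Schmidt norms\<close>

context hilbert
begin

lemma psd_gram:
  assumes A: "adj A A" and pos: "\<And>u. u \<in> H \<Longrightarrow> 0 \<le> Re (ip u (A u))" and F: "finite F" "x ` F \<subseteq> H"
  shows "psd F (\<lambda>i j. ip (x i) (A (x j)))"
  unfolding psd_def
proof (intro conjI ballI allI)
  have xH: "x i \<in> H" "A (x i) \<in> H" if "i \<in> F" for i
    using F that by (auto intro!: adj_mem(1)[OF A])
  show "ip (x j) (A (x i)) = cnj (ip (x i) (A (x j)))" if "i \<in> F" "j \<in> F" for i j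
    using A xH[OF that(1)] xH[OF that(2)] ip_cnj[of "A (x j)" "x i"] ip_cnj[of "x i" "A (x j)"]
    by (simp add: adj_def)
  fix c :: "'b \<Rightarrow> complex"
  obtain v where v: "v \<in> H" "\<And>w. w \<in> H \<Longrightarrow> ip w v = (\<Sum>i\<in>F. c i * ip w (x i))"
    using fin_comb[OF F] by blast
  have Av: "A v \<in> H" by (rule adj_mem(1)[OF A v(1)])
  \<comment> \<open>The combination \<open>v\<close> is known only through its inner products, so
    \<open>A\<close> is first moved away from it by self-adjointness.\<close>
  have "ip v (A v) = ip (A v) v" by (rule adj_ip[OF A v(1) v(1), symmetric])
  also have "\<dots> = (\<Sum>j\<in>F. c j * ip v (A (x j)))"
    unfolding v(2)[OF Av] by (intro sum.cong refl) (simp add: adj_ip[OF A v(1)] xH)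
  also have "\<dots> = (\<Sum>j\<in>F. c j * cnj (\<Sum>i\<in>F. c i * ip (A (x j)) (x i)))"
    using v xH by (intro sum.cong refl) (simp add: ip_cnj[of "A (x _)" v])
  also have "\<dots> = (\<Sum>j\<in>F. \<Sum>i\<in>F. cnj (c i) * c j * ip (x i) (A (x j)))"
    using xH by (intro sum.cong refl) (auto simp: sum_distrib_left ip_cnj[of "A (x _)" "x _"] intro!: sum.cong)
  also have "\<dots> = (\<Sum>i\<in>F. \<Sum>j\<in>F. cnj (c i) * c j * ip (x i) (A (x j)))"
    by (rule sum.swap)
  finally show "0 \<le> Re (\<Sum>i\<in>F. \<Sum>j\<in>F. cnj (c i) * c j * ip (x i) (A (x j)))"
    using pos[OF v(1)] by simp
qed

text \<open>A finite subset of the product need not be a square, but it lies in the square over the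
  set of all its coordinates. So squares are cofinal, and a negative limit would show on one of
  them.\<close>

lemma has_sum_square_nonneg:
  assumes S: "((\<lambda>(i, j). f i j) has_sum V) (E \<times> E)"
    and nn: "\<And>F. finite F \<Longrightarrow> F \<subseteq> E \<Longrightarrow> 0 \<le> Re (\<Sum>i\<in>F. \<Sum>j\<in>F. f i j)"
  shows "0 \<le> Re (V :: complex)"
proof (rule ccontr)
  assume neg: "\<not> 0 \<le> Re V"
  have "((\<lambda>G. Re (\<Sum>(i, j)\<in>G. f i j)) \<longlongrightarrow> Re V) (finite_subsets_at_top (E \<times> E))"
    using S unfolding has_sum_def by (intro tendsto_Re)
  then have "\<forall>\<^sub>F G in finite_subsets_at_top (E \<times> E). Re (\<Sum>(i, j)\<in>G. f i j) < 0"
    using neg by (intro order_tendstoD) auto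
  then obtain G where G: "finite G" "G \<subseteq> E \<times> E"
    "\<forall>G'. finite G' \<and> G \<subseteq> G' \<and> G' \<subseteq> E \<times> E \<longrightarrow> Re (\<Sum>(i, j)\<in>G'. f i j) < 0"
    unfolding eventually_finite_subsets_at_top by (elim exE conjE)
  define F where "F = fst ` G \<union> snd ` G"
  have F: "finite F" "F \<subseteq> E" using G by (auto simp: F_def)
  have "G \<subseteq> F \<times> F" by (force simp: F_def)
  then have "Re (\<Sum>(i, j)\<in>F \<times> F. f i j) < 0"
    using F by (intro G(3)[rule_format]) auto
  then show False
    using nn[OF F] by (simp add: sum.cartesian_product)
qed

text \<open>
  For a positive operator \<open>A\<close>, the form \<open>(X, Y) \<mapsto> tr (A X A Y)\<close> on symmetric operators is positive
  by the Schur product theorem; the claim is its Cauchy-Schwarz inequality at \<open>X = 1\<close>, \<open>Y = D\<^sup>2\<close>.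
\<close>

lemma hs_interpolation:
  assumes E: "onb E" and A: "adj A A" and pos: "\<And>u. u \<in> H \<Longrightarrow> 0 \<le> Re (ip u (A u))"
    and D: "adj D D" and D1: "\<And>u. u \<in> H \<Longrightarrow> nrm (D u) \<le> nrm u"
    and S1: "((\<lambda>e. (nrm (A e))\<^sup>2) has_sum S1) E"
    and S2: "((\<lambda>e. (nrm (D (A e)))\<^sup>2) has_sum S2) E"
    and S3: "((\<lambda>e. (nrm (D (A (D e))))\<^sup>2) has_sum S3) E"
  shows "S2 \<le> sqrt S1 * sqrt S3"
proof -
  have EH: "e \<in> H" if "e \<in> E" for e using E that by (auto simp: onb_def)
  note AH = adj_mem(1)[OF A] and DH = adj_mem(1)[OF D]
  note Asym = adj_ip[OF A] and Dsym = adj_ip[OF D]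

  have le: "(nrm (D u))\<^sup>2 \<le> (nrm u)\<^sup>2" if "u \<in> H" for u
    using D1[OF that] nrm_nonneg[OF DH[OF that]] by (rule power_mono)
  \<comment> \<open>A factor \<open>D\<close> on the left keeps a sum finite, being a contraction. A
    factor on the right is treated by \<open>adjsum\<close>, which passes to the adjoint.\<close>
  have Dsum: "(\<lambda>e. (nrm (D (x e)))\<^sup>2) summable_on E" if "(\<lambda>e. (nrm (x e))\<^sup>2) summable_on E" "x ` E \<subseteq> H" for x
    by (rule summable_on_comparison_test[OF that(1)]) (use that(2) le in auto)
  have adjsum: "(\<lambda>e. (nrm (Y e))\<^sup>2) summable_on E" if "adj X Y" "(\<lambda>e. (nrm (X e))\<^sup>2) summable_on E" for X Y
    using hs_adj[OF E E that(1)] that(2) unfolding summable_on_def by blast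
  define P where "P = D \<circ> D"
  have P: "adj P P" unfolding P_def by (rule adj_comp[OF D D])
  note PH = adj_mem(1)[OF P]
  have sA: "(\<lambda>e. (nrm (A e))\<^sup>2) summable_on E" using S1 by (auto simp: summable_on_def)
  have sDA: "(\<lambda>e. (nrm ((D \<circ> A) e))\<^sup>2) summable_on E" using S2 by (auto simp: summable_on_def)
  have aPA: "adj (P \<circ> A) (A \<circ> P)" by (rule adj_comp[OF P A])
  have aDA: "adj (D \<circ> A) (A \<circ> D)" by (rule adj_comp[OF D A])
  have sPA: "(\<lambda>e. (nrm ((P \<circ> A) e))\<^sup>2) summable_on E"
    using Dsum[OF sDA] EH AH DH by (auto simp: P_def)
  have sAP: "(\<lambda>e. (nrm ((A \<circ> P) e))\<^sup>2) summable_on E" by (rule adjsum[OF aPA sPA])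
  have aPAP: "adj (P \<circ> (A \<circ> P)) (P \<circ> (A \<circ> P))"
    using adj_comp[OF P adj_sym[OF aPA]] by (simp add: comp_assoc)
  have sPAP: "(\<lambda>e. (nrm ((P \<circ> (A \<circ> P)) e))\<^sup>2) summable_on E"
  proof -
    have "(\<lambda>e. (nrm (D ((A \<circ> P) e)))\<^sup>2) summable_on E"
      by (rule Dsum[OF sAP]) (use EH AH PH in auto)
    then have "(\<lambda>e. (nrm (D (D ((A \<circ> P) e))))\<^sup>2) summable_on E"
      by (rule Dsum) (use EH AH PH DH in auto)
    then show ?thesis by (simp add: P_def)
  qed
  define Q where "Q = D \<circ> (A \<circ> D)"
  have Q: "adj Q Q"
    unfolding Q_def using adj_comp[OF D adj_sym[OF aDA]] by (simp add: comp_assoc)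
  note QH = adj_mem(1)[OF Q]
  have sQ: "(\<lambda>e. (nrm (Q e))\<^sup>2) summable_on E" using S3 by (auto simp: summable_on_def Q_def)
  have aQD: "adj (Q \<circ> D) (D \<circ> Q)" by (rule adj_comp[OF Q D])
  have sDQ: "(\<lambda>e. (nrm ((D \<circ> Q) e))\<^sup>2) summable_on E"
    using Dsum[OF sQ] EH QH by auto
  have sQD: "(\<lambda>e. (nrm ((Q \<circ> D) e))\<^sup>2) summable_on E"
    by (rule adjsum[OF adj_sym[OF aQD] sDQ])
  have DDip: "ip u (P v) = ip (D u) (D v)" "ip (P u) v = ip (D u) (D v)" if "u \<in> H" "v \<in> H" for u v
    using that DH Dsym by (auto simp: P_def)
  \<comment> \<open>With P = D^2 the operator (t + P) A (t + P) equals t^2 A + t (A P + P A) + P A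
    P. The numbers \<open>V1\<close> to \<open>V4\<close> are the sums of its four terms multiplied
    entrywise by the conjugate matrix of \<open>A\<close>.\<close>
  obtain V1 where V1: "((\<lambda>(e', e). cnj (ip e (A e')) * ip e (A e')) has_sum V1) (E \<times> E)" "((\<lambda>e. ip (A e) (A e)) has_sum V1) E"
    using hs_trace_swap[OF E A A sA sA] by blast
  obtain V2 where V2: "((\<lambda>(e', e). cnj (ip e (A e')) * ip e ((P \<circ> A) e')) has_sum V2) (E \<times> E)" "((\<lambda>e. ip (A e) ((P \<circ> A) e)) has_sum V2) E"
    using hs_trace_swap[OF E A aPA sA sPA] by blast
  obtain V3 where V3: "((\<lambda>(e', e). cnj (ip e (A e')) * ip e ((A \<circ> P) e')) has_sum V3) (E \<times> E)" "((\<lambda>e. ip ((P \<circ> A) e) (A e)) has_sum V3) E"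
    using hs_trace_swap[OF E A adj_sym[OF aPA] sA sAP] by blast
  obtain V4 where V4: "((\<lambda>(e', e). cnj (ip e (A e')) * ip e ((P \<circ> (A \<circ> P)) e')) has_sum V4) (E \<times> E)" "((\<lambda>e. ip (A e) ((P \<circ> (A \<circ> P)) e)) has_sum V4) E"
    using hs_trace_swap[OF E A aPAP sA sPAP] by blast
  obtain V5 where V5: "((\<lambda>e. ip ((D \<circ> A) e) ((Q \<circ> D) e)) has_sum V5) E" "((\<lambda>e. ip ((D \<circ> Q) e) ((A \<circ> D) e)) has_sum V5) E"
    using hs_trace_swap[OF E aDA aQD sDA sQD] by blast
  have "Re V1 = S1"
  proof (rule has_sum_unique[OF has_sum_Re[OF V1(2)]])
    show "((\<lambda>e. Re (ip (A e) (A e))) has_sum S1) E"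
      by (rule has_sum_cong[THEN iffD1, OF _ S1]) (use EH AH in \<open>auto simp: nrm_sq\<close>)
  qed
  moreover have "Re V2 = S2"
  proof (rule has_sum_unique[OF has_sum_Re[OF V2(2)]])
    show "((\<lambda>e. Re (ip (A e) ((P \<circ> A) e))) has_sum S2) E"
      by (rule has_sum_cong[THEN iffD1, OF _ S2]) (use EH AH DH in \<open>auto simp: nrm_sq DDip\<close>)
  qed
  moreover have "Re V3 = S2"
  proof (rule has_sum_unique[OF has_sum_Re[OF V3(2)]])
    show "((\<lambda>e. Re (ip ((P \<circ> A) e) (A e))) has_sum S2) E"
      by (rule has_sum_cong[THEN iffD1, OF _ S2]) (use EH AH DH in \<open>auto simp: nrm_sq DDip\<close>)
  qed
  \<comment> \<open>\<open>V4\<close> is the trace of A P A P. To see D A D in it, one factor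
    \<open>D\<close> has to travel around the trace, which is the passage between the two sums for
    \<open>V5\<close>.\<close>
  moreover have "Re V4 = S3"
  proof -
    have "((\<lambda>e. ip ((D \<circ> A) e) ((Q \<circ> D) e)) has_sum V4) E"
    proof (rule has_sum_cong[THEN iffD1, OF _ V4(2)])
      fix e assume "e \<in> E"
      then have "e \<in> H" by (rule EH)
      then have "ip (A e) (P (A (P e))) = ip (D (A e)) (D (A (P e)))"
        by (intro DDip AH PH)
      then show "ip (A e) ((P \<circ> (A \<circ> P)) e) = ip ((D \<circ> A) e) ((Q \<circ> D) e)"
        by (simp add: Q_def P_def)
    qed
    then have "V4 = V5" using V5(1) has_sum_unique by blast
    moreover have "Re V5 = S3"
    proof (rule has_sum_unique[OF has_sum_Re[OF V5(2)]])
      show "((\<lambda>e. Re (ip ((D \<circ> Q) e) ((A \<circ> D) e))) has_sum S3) E"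
        by (rule has_sum_cong[THEN iffD1, OF _ S3]) (use EH AH DH QH in \<open>auto simp: nrm_sq Dsym Q_def\<close>)
    qed
    ultimately show ?thesis by simp
  qed
  \<comment> \<open>On a finite set of basis vectors, the matrices of \<open>A\<close> (conjugated)
    and of (t + P) A (t + P) are positive semidefinite, so the sum of their entrywise product is
    non-negative.\<close>
  moreover have quad: "0 \<le> Re (of_real (t\<^sup>2) * V1 + (of_real t * V3 + of_real t * V2) + V4)" for t
  proof (rule has_sum_square_nonneg)
    let ?f = "\<lambda>e' e. of_real (t\<^sup>2) * (cnj (ip e (A e')) * ip e (A e'))
      + (of_real t * (cnj (ip e (A e')) * ip e ((A \<circ> P) e')) + of_real t * (cnj (ip e (A e')) * ip e ((P \<circ> A) e')))
      + cnj (ip e (A e')) * ip e ((P \<circ> (A \<circ> P)) e')"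
    show "((\<lambda>(e', e). ?f e' e) has_sum (of_real (t\<^sup>2) * V1 + (of_real t * V3 + of_real t * V2) + V4)) (E \<times> E)"
      using has_sum_add[OF has_sum_add[OF has_sum_cmult_right[OF V1(1), of "of_real (t\<^sup>2)"]
        has_sum_add[OF has_sum_cmult_right[OF V3(1), of "of_real t"] has_sum_cmult_right[OF V2(1), of "of_real t"]]] V4(1)]
      by (simp add: case_prod_unfold)
    fix F assume F: "finite F" "F \<subseteq> E"
    define x where "x u = lc (of_real t) u 1 (P u)" for u
    have xH: "x u \<in> H" if "u \<in> H" for u using that PH by (simp add: x_def lc_closed)
    have FH: "F \<subseteq> H" using F EH by auto
    have "psd F (\<lambda>i j. ip i (A j))" using psd_gram[OF A pos F(1), of "\<lambda>i. i"] FH by simp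
    then have p1: "psd F (\<lambda>i j. cnj (ip i (A j)))" by (rule psd_cnj)
    have p2: "psd F (\<lambda>i j. ip (x i) (A (x j)))" by (rule psd_gram[OF A pos F(1)]) (use FH xH in auto)
    have "0 \<le> Re (\<Sum>i\<in>F. \<Sum>j\<in>F. cnj (ip i (A j)) * ip (x i) (A (x j)))"
      by (rule schur_product[OF F(1) p1 p2])
    also have "(\<Sum>i\<in>F. \<Sum>j\<in>F. cnj (ip i (A j)) * ip (x i) (A (x j))) = (\<Sum>e\<in>F. \<Sum>e'\<in>F. ?f e' e)"
    proof (intro sum.cong refl)
      fix e e' assume "e \<in> F" "e' \<in> F"
      then have e: "e \<in> H" "e' \<in> H" using FH by auto
      have "ip (x e) (A (x e')) = of_real (t\<^sup>2) * ip e (A e') + of_real t * ip e (A (P e')) + of_real t * ip e (P (A e')) + ip e (P (A (P e')))"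
      proof -
        have "ip (x e) (A (x e')) = ip (A (x e)) (x e')"
          using e xH Asym by simp
        also have "\<dots> = of_real t * ip (x e) (A e') + ip (x e) (A (P e'))"
          using e xH AH PH Asym by (simp add: x_def[of e'] ip_lc_right)
        also have "\<dots> = of_real t * (of_real t * ip e (A e') + ip e (P (A e'))) + (of_real t * ip e (A (P e')) + ip e (P (A (P e'))))"
        proof -
          have "ip (P e) w = ip e (P w)" if "w \<in> H" for w using DDip e that by simp
          then show ?thesis using e AH PH by (simp add: x_def ip_lc_left)
        qed
        finally show ?thesis by (simp add: power2_eq_square algebra_simps)
      qed
      then show "cnj (ip e (A e')) * ip (x e) (A (x e')) = ?f e' e"
        by (simp add: algebra_simps)
    qed
    also have "\<dots> = (\<Sum>e'\<in>F. \<Sum>e\<in>F. ?f e' e)" by (rule sum.swap)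
    finally show "0 \<le> Re (\<Sum>e'\<in>F. \<Sum>e\<in>F. ?f e' e)" .
  qed
  ultimately have q: "0 \<le> t\<^sup>2 * S1 + 2 * t * S2 + S3" for t
    using quad[of t] by (simp add: mult_ac)
  have S1nn: "0 \<le> S1" by (rule has_sum_nonneg[OF S1]) simp
  have S2nn: "0 \<le> S2" by (rule has_sum_nonneg[OF S2]) simp
  have S21: "S2 \<le> S1" by (rule has_sum_mono[OF S2 S1]) (use le EH AH in auto)
  \<comment> \<open>The quadratic in \<open>t\<close> is minimal at - S2 / S1. If \<open>S1\<close>
    vanishes then so does \<open>S2\<close>, because \<open>D\<close> is a contraction.\<close>
  have "S2\<^sup>2 \<le> S1 * S3"
  proof (cases "S1 = 0")
    case True
    then show ?thesis using S21 S2nn by simp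
  next
    case False
    then have "0 < S1" using S1nn by simp
    moreover have "0 \<le> (- S2 / S1)\<^sup>2 * S1 + 2 * (- S2 / S1) * S2 + S3" by (rule q)
    ultimately show ?thesis by (simp add: power2_eq_square field_simps)
  qed
  then have "S2 \<le> sqrt (S1 * S3)" by (rule real_le_rsqrt)
  then show ?thesis by (simp add: real_sqrt_mult)
qed

end

subsection \<open>Uniqueness of densities\<close>

text \<open>A smooth step from 0 to 1, written with \<open>powr\<close> so that the rules of
  \<open>slow\<close> generate it.\<close>

definition sg :: "real \<Rightarrow> real" where "sg u = (1 + u * (1 + u\<^sup>2) powr (- 1 / 2)) / 2"

lemma sg_eq: "sg u = (1 + u / sqrt (1 + u\<^sup>2)) / 2"
proof -
  have "(1 + u\<^sup>2) powr (- 1 / 2) = 1 / sqrt (1 + u\<^sup>2)"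
    by (simp add: powr_minus powr_half_sqrt inverse_eq_divide)
  then show ?thesis by (simp add: sg_def)
qed

lemma sg_minus: "sg (- u) = 1 - sg u"
  by (simp add: sg_eq field_simps)

lemma abs_sg_le: "\<bar>sg u\<bar> \<le> 1"
proof -
  have "\<bar>u\<bar> \<le> sqrt (1 + u\<^sup>2)" by (rule real_le_rsqrt) simp
  moreover have "0 < sqrt (1 + u\<^sup>2)" by (simp add: add_pos_nonneg)
  ultimately have "- 1 \<le> u / sqrt (1 + u\<^sup>2)" "u / sqrt (1 + u\<^sup>2) \<le> 1"
    by (auto simp: pos_le_divide_eq pos_divide_le_eq abs_le_iff)
  then show ?thesis by (simp add: sg_eq abs_le_iff)
qed

lemma sg_at_top: "(sg \<longlongrightarrow> 1) at_top"
proof -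
  have "((\<lambda>u. (1 + 1 / sqrt (1 + (inverse u)\<^sup>2)) / 2) \<longlongrightarrow> (1 + 1 / sqrt (1 + 0\<^sup>2)) / 2) at_top"
    by (intro tendsto_intros tendsto_inverse_0_at_top filterlim_ident) auto
  moreover have "\<forall>\<^sub>F u in at_top. (1 + 1 / sqrt (1 + (inverse u)\<^sup>2)) / 2 = sg u"
    using eventually_gt_at_top[of 0]
  proof eventually_elim
    case (elim u)
    have "sqrt (1 + u\<^sup>2) = sqrt (u\<^sup>2 * (1 + (inverse u)\<^sup>2))"
      using elim by (simp add: power2_eq_square field_simps)
    also have "\<dots> = u * sqrt (1 + (inverse u)\<^sup>2)"
      using elim by (simp add: real_sqrt_mult)
    finally show ?case using elim by (simp add: sg_eq)
  qed
  ultimately show ?thesis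
    by (auto elim: Lim_transform_eventually)
qed

text \<open>The argument n^2 t - n tends to plus infinity for t > 0 and to minus infinity for t
  \<le> 0. The shift by \<open>n\<close> takes care of t = 0, so the limit is the indicator of the
  open half-line at every point.\<close>

lemma sg_seq: "(\<lambda>n. sg ((real n)\<^sup>2 * t - real n)) \<longlonglongrightarrow> (if t > 0 then 1 else 0)"
proof (cases "t > 0")
  case True
  have "filterlim (\<lambda>n. real n * (- 1 + real n * t)) at_top sequentially"
    by (intro filterlim_at_top_mult_at_top filterlim_real_sequentially
        filterlim_tendsto_add_at_top[OF tendsto_const] filterlim_at_top_mult_tendsto_pos[OF tendsto_const True])
  from filterlim_compose[OF sg_at_top this] show ?thesis
    using True by (simp add: power2_eq_square algebra_simps)
next
  case False
  have "filterlim (\<lambda>n. - ((real n)\<^sup>2 * t - real n)) at_top sequentially"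
    by (rule filterlim_at_top_mono[OF filterlim_real_sequentially])
       (use False in \<open>auto intro!: always_eventually simp: mult_nonneg_nonpos\<close>)
  from filterlim_compose[OF sg_at_top this]
  have "(\<lambda>n. 1 - sg (- ((real n)\<^sup>2 * t - real n))) \<longlonglongrightarrow> 1 - 1"
    by (intro tendsto_intros)
  then show ?thesis
    unfolding sg_minus using False by simp
qed

lemma slow_prod: "finite I \<Longrightarrow> (\<And>i. i \<in> I \<Longrightarrow> slow (m i)) \<Longrightarrow> slow (\<lambda>x. \<Prod>i\<in>I. m i x)"
  by (induction I rule: finite_induct) (auto intro: slow_const slow_mult)

lemma slow_sg: "slow (\<lambda>x. of_real (sg (c * x $ i + d)))"
proof -
  have "slow (\<lambda>x. of_real c * of_real (x $ i) + of_real d)"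
    by (intro slow_add slow_mult slow_const slow_coord)
  then have u: "slow (\<lambda>x. of_real (c * x $ i + d))" by simp
  have "slow (\<lambda>x. 1 + of_real (c * x $ i + d) * of_real (c * x $ i + d))"
    by (intro slow_add slow_mult slow_const u)
  then have "slow (\<lambda>x. of_real (1 + (c * x $ i + d)\<^sup>2))"
    by (simp add: power2_eq_square)
  then have "slow (\<lambda>x. of_real ((1 + (c * x $ i + d)\<^sup>2) powr (- 1 / 2)))"
    by (rule slow_powr) simp
  then have "slow (\<lambda>x. of_real (1/2) * (1 + of_real (c * x $ i + d) * of_real ((1 + (c * x $ i + d)\<^sup>2) powr (- 1 / 2))))"
    by (intro slow_add slow_mult slow_const u)
  moreover have "(\<lambda>x. complex_of_real (sg (c * x $ i + d)))
      = (\<lambda>x. of_real (1/2) * (1 + of_real (c * x $ i + d) * of_real ((1 + (c * x $ i + d)\<^sup>2) powr (- 1 / 2))))"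
    by (simp add: sg_def)
  ultimately show ?thesis by simp
qed

text \<open>
  The functions \<open>m n\<close> below are smooth, bounded, and converge pointwise to the indicator of a box.
\<close>

lemma density_zero_schwartz:
  assumes [measurable]: "g \<in> borel_measurable borel"
    and int: "\<And>\<phi>. \<phi> \<in> schwartz \<Longrightarrow> integrable lborel (\<lambda>x. g x * \<phi> x)"
    and zero: "\<And>\<phi>. \<phi> \<in> schwartz \<Longrightarrow> (LINT x|lborel. g x * \<phi> x) = 0"
  shows "AE x in lborel. g x = 0"
proof -
  \<comment> \<open>The Gaussian factor makes the function integrable, so that its integrals over
    arbitrary Borel sets make sense, and it has no zeros.\<close>
  define h where "h x = g x * gauss x" for x
  have h: "integrable lborel h"
    unfolding h_def[abs_def] by (intro int gauss_schwartz)
  have [measurable]: "h \<in> borel_measurable borel" using borel_measurable_integrable[OF h] by simp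
  have hm: "(LINT x|lborel. m x * h x) = 0" if "slow m" for m
    using zero[OF schwartz_mult[OF that gauss_schwartz]] by (simp add: h_def mult.left_commute)
  have box0: "(LINT x|lborel. indicator (box a b) x *\<^sub>R h x) = 0" for a b :: space
  proof -
    define m where "m n x = (\<Prod>i\<in>UNIV. of_real (sg ((real n)\<^sup>2 * x $ i + (- (real n)\<^sup>2 * a $ i - real n))))
       * (\<Prod>i\<in>UNIV. complex_of_real (sg (- (real n)\<^sup>2 * x $ i + ((real n)\<^sup>2 * b $ i - real n))))" for n x
    have sl: "slow (m n)" for n
      unfolding m_def[abs_def] by (intro slow_mult slow_prod slow_sg) auto
    have le: "norm (m n x) \<le> 1" for n x
      unfolding m_def norm_mult prod_norm[symmetric]
      by (intro mult_le_one prod_le_1) (auto simp: abs_sg_le prod_nonneg)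
    have lim: "(\<lambda>n. m n x) \<longlonglongrightarrow> indicator (box a b) x" for x
    proof -
      have 1: "(real n)\<^sup>2 * x $ i + (- (real n)\<^sup>2 * a $ i - real n) = (real n)\<^sup>2 * (x $ i - a $ i) - real n"
        "- (real n)\<^sup>2 * x $ i + ((real n)\<^sup>2 * b $ i - real n) = (real n)\<^sup>2 * (b $ i - x $ i) - real n" for n i
        by (simp_all add: algebra_simps)
      have "(\<lambda>n. m n x) \<longlonglongrightarrow> (\<Prod>i\<in>UNIV. of_real (if x $ i - a $ i > 0 then 1 else 0))
          * (\<Prod>i\<in>UNIV. complex_of_real (if b $ i - x $ i > 0 then 1 else 0))"
        unfolding m_def 1 by (intro tendsto_mult tendsto_prod tendsto_of_real sg_seq)
      moreover have "(\<Prod>i\<in>UNIV. complex_of_real (if x $ i - a $ i > 0 then 1 else 0))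
          * (\<Prod>i\<in>UNIV. complex_of_real (if b $ i - x $ i > 0 then 1 else 0)) = indicator (box a b) x"
      proof (cases "x \<in> box a b")
        case True
        then show ?thesis by (simp add: mem_box_cart)
      next
        case False
        then obtain i where "\<not> (a $ i < x $ i \<and> x $ i < b $ i)" by (auto simp: mem_box_cart)
        then show ?thesis using False by (auto simp: prod_zero_iff)
      qed
      ultimately show ?thesis by simp
    qed
    have "(\<lambda>n. LINT x|lborel. m n x * h x) \<longlonglongrightarrow> (LINT x|lborel. indicator (box a b) x * h x)"
    proof (rule integral_dominated_convergence[where w = "\<lambda>x. norm (h x)"])
      show "integrable lborel (\<lambda>x. norm (h x))" by (rule integrable_norm[OF h])
      show "AE x in lborel. (\<lambda>n. m n x * h x) \<longlonglongrightarrow> indicator (box a b) x * h x"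
        by (intro AE_I2 tendsto_mult lim tendsto_const)
      show "AE x in lborel. norm (m n x * h x) \<le> norm (h x)" for n
        using mult_right_mono[OF le[of n] norm_ge_zero] by (auto simp: norm_mult)
      have "m n \<in> borel_measurable borel" for n
        using slow_differentiable[OF sl]
        by (intro borel_measurable_continuous_onI differentiable_imp_continuous_on)
           (auto simp: differentiable_on_def intro: differentiable_at_withinI)
      then show "(\<lambda>x. m n x * h x) \<in> borel_measurable lborel" for n by simp
    qed simp
    then have "(LINT x|lborel. indicator (box a b) x * h x) = 0"
      unfolding hm[OF sl] by (simp add: LIMSEQ_const_iff)
    moreover have "(\<lambda>x. indicator (box a b) x *\<^sub>R h x) = (\<lambda>x. indicator (box a b) x * h x)"
      by (auto simp: fun_eq_iff indicator_def)
    ultimately show ?thesis by simp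
  qed
  \<comment> \<open>Dynkin's argument: open boxes are stable under intersection and generate the
    Borel sets. The step to complements uses that the integral over the whole space vanishes, which
    is the case of the constant multiplier 1.\<close>
  have all0: "set_lebesgue_integral lborel A h = 0" if "A \<in> sets lborel" for A
  proof -
    have "A \<in> sigma_sets UNIV (range (\<lambda>(a, b). box a b :: space set))"
      using that by (simp add: borel_eq_box)
    note this' = this
    have "Int_stable (range (\<lambda>(a, b). box a b :: space set))"
      by (auto simp: Int_stable_def box_Int_box)
    moreover have "range (\<lambda>(a, b). box a b :: space set) \<subseteq> Pow UNIV" by simp
    ultimately show ?thesis
      using this'
    proof (induction rule: sigma_sets_induct_disjoint)
      case (basic A)
      then show ?case using box0 by (auto simp: set_lebesgue_integral_def)
    next
      case empty
      then show ?case by (simp add: set_lebesgue_integral_def)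
    next
      case (compl A)
      then have [measurable]: "A \<in> sets borel" by (simp add: borel_eq_box)
      have "set_lebesgue_integral lborel (UNIV - A) h = (LINT x|lborel. h x) - set_lebesgue_integral lborel A h"
      proof -
        have "(\<lambda>x. indicator (UNIV - A) x *\<^sub>R h x) = (\<lambda>x. h x - indicator A x *\<^sub>R h x)"
          by (auto simp: indicator_def)
        then show ?thesis
          unfolding set_lebesgue_integral_def
          by (simp add: Bochner_Integration.integral_diff h integrable_mult_indicator)
      qed
      then show ?case using compl hm[OF slow_const[of 1]] by simp
    next
      case (union A)
      have [measurable]: "A i \<in> sets borel" for i using union(2) by (auto simp: borel_eq_box)
      have "set_lebesgue_integral lborel (\<Union>i. A i) h = (\<Sum>i. set_lebesgue_integral lborel (A i) h)"
        by (rule lebesgue_integral_countable_add)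
           (use union(1) h in \<open>auto simp: disjoint_family_on_def set_integrable_def intro!: integrable_mult_indicator\<close>)
      then show ?case using union(3) by simp
    qed
  qed
  have "AE x in lborel. h x = 0"
    by (rule sigma_finite_measure.density_zero[OF sigma_finite_lborel h all0])
  then show ?thesis
    by (simp add: h_def gauss_def)
qed

lemma is_density_unique:
  assumes "is_density g T" "is_density g' T"
  shows "AE x in lborel. g x = g' x"
proof -
  have m: "g \<in> borel_measurable borel" "g' \<in> borel_measurable borel"
    and i: "\<And>\<phi>. \<phi> \<in> schwartz \<Longrightarrow> integrable lborel (\<lambda>x. g x * \<phi> x)"
      "\<And>\<phi>. \<phi> \<in> schwartz \<Longrightarrow> integrable lborel (\<lambda>x. g' x * \<phi> x)"
    and e: "fun_distr g = fun_distr g'"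
    using assms by (auto simp: is_density_def)
  have "AE x in lborel. g x - g' x = 0"
  proof (rule density_zero_schwartz)
    fix \<phi> :: "space \<Rightarrow> complex" assume \<phi>: "\<phi> \<in> schwartz"
    show "integrable lborel (\<lambda>x. (g x - g' x) * \<phi> x)"
      using i[OF \<phi>] by (simp add: left_diff_distrib)
    show "(LINT x|lborel. (g x - g' x) * \<phi> x) = 0"
      using i[OF \<phi>] fun_cong[OF e, of \<phi>] \<phi> by (simp add: left_diff_distrib fun_distr_def)
  qed (use m in simp)
  then show ?thesis by simp
qed

lemma is_density_density_of: "is_density g T \<Longrightarrow> is_density (density_of T) T"
  unfolding density_of_def by (rule someI[of "\<lambda>g. is_density g T"])

lemma density_of_AE: "is_density g T \<Longrightarrow> AE x in lborel. density_of T x = g x"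
  using is_density_unique is_density_density_of by blast

subsection \<open>Square-integrable functions\<close>

lemma L2_measurable [measurable_dest]: "f \<in> L2_fun \<Longrightarrow> f \<in> borel_measurable borel"
  by (simp add: L2_fun_def)

lemma L2_sq_integrable: "f \<in> L2_fun \<Longrightarrow> integrable lborel (\<lambda>x. (norm (f x))\<^sup>2)"
  by (simp add: L2_fun_def)

lemma L2_bound:
  assumes "g \<in> borel_measurable borel" "integrable lborel F" "AE x in lborel. (norm (g x))\<^sup>2 \<le> F x"
  shows "g \<in> L2_fun"
proof -
  have [measurable]: "g \<in> borel_measurable borel" by fact
  have "integrable lborel (\<lambda>x. (norm (g x))\<^sup>2)"
    by (rule Bochner_Integration.integrable_bound[OF assms(2)])
       (use assms(3) in \<open>auto elim!: eventually_mono intro: order_trans\<close>)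
  then show ?thesis by (simp add: L2_fun_def)
qed

lemma L2_mult_integrable:
  assumes "f \<in> L2_fun" "g \<in> L2_fun"
  shows "integrable lborel (\<lambda>x. f x * g x)"
proof (rule Bochner_Integration.integrable_bound)
  show "integrable lborel (\<lambda>x. (norm (f x))\<^sup>2 + (norm (g x))\<^sup>2)"
    by (intro Bochner_Integration.integrable_add L2_sq_integrable assms)
  have "norm (f x * g x) \<le> (norm (f x))\<^sup>2 + (norm (g x))\<^sup>2" for x
  proof -
    have "0 \<le> norm (f x) * norm (g x)" by simp
    then show ?thesis
      unfolding norm_mult using sum_squares_bound[of "norm (f x)" "norm (g x)"] by linarith
  qed
  then show "AE x in lborel. norm (f x * g x) \<le> norm ((norm (f x))\<^sup>2 + (norm (g x))\<^sup>2)"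
    by simp
qed (use assms in measurable)

lemma borel_measurable_cnj [measurable]: "cnj \<in> borel_measurable borel"
  by (intro borel_measurable_continuous_onI continuous_on_cnj continuous_on_id)

lemma L2_cnj: "f \<in> L2_fun \<Longrightarrow> (\<lambda>x. cnj (f x)) \<in> L2_fun"
  unfolding L2_fun_def by (auto intro: measurable_compose[OF _ borel_measurable_cnj])

lemma norm_sq_lc_le:
  fixes p q a b :: complex
  shows "(norm (a * p + b * q))\<^sup>2 \<le> 2 * (norm a)\<^sup>2 * (norm p)\<^sup>2 + 2 * (norm b)\<^sup>2 * (norm q)\<^sup>2"
proof -
  have "(norm (a * p + b * q))\<^sup>2 \<le> (norm a * norm p + norm b * norm q)\<^sup>2"
    using norm_triangle_ineq[of "a * p" "b * q"] by (intro power_mono) (auto simp: norm_mult)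
  also have "\<dots> \<le> 2 * (norm a * norm p)\<^sup>2 + 2 * (norm b * norm q)\<^sup>2"
    using sum_squares_bound[of "norm a * norm p" "norm b * norm q"] by (simp add: power2_sum)
  finally show ?thesis by (simp add: power_mult_distrib)
qed

lemma L2_lc:
  assumes "f \<in> L2_fun" "g \<in> L2_fun"
  shows "(\<lambda>x. a * f x + b * g x) \<in> L2_fun"
proof (rule L2_bound[where F = "\<lambda>x. 2 * (norm a)\<^sup>2 * (norm (f x))\<^sup>2 + 2 * (norm b)\<^sup>2 * (norm (g x))\<^sup>2"])
  show "integrable lborel (\<lambda>x. 2 * (norm a)\<^sup>2 * (norm (f x))\<^sup>2 + 2 * (norm b)\<^sup>2 * (norm (g x))\<^sup>2)"
    by (intro Bochner_Integration.integrable_add integrable_mult_right L2_sq_integrable assms)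
qed (use assms norm_sq_lc_le in \<open>auto intro: L2_measurable\<close>)

definition fip :: "(space \<Rightarrow> complex) \<Rightarrow> (space \<Rightarrow> complex) \<Rightarrow> complex" where
  "fip f g = (LINT x|lborel. cnj (f x) * g x)"

definition flc :: "complex \<Rightarrow> (space \<Rightarrow> complex) \<Rightarrow> complex \<Rightarrow> (space \<Rightarrow> complex) \<Rightarrow> space \<Rightarrow> complex" where
  "flc a f b g = (\<lambda>x. a * f x + b * g x)"

lemma fip_self: "Re (fip f f) = (LINT x|lborel. (norm (f x))\<^sup>2)"
proof -
  have "(\<lambda>x. cnj (f x) * f x) = (\<lambda>x. complex_of_real ((norm (f x))\<^sup>2))"
    unfolding complex_norm_square by (simp add: mult.commute)
  then have "fip f f = (LINT x|lborel. complex_of_real ((norm (f x))\<^sup>2))"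
    by (simp only: fip_def)
  also have "\<dots> = complex_of_real (LINT x|lborel. (norm (f x))\<^sup>2)"
    by (rule integral_complex_of_real)
  finally show ?thesis by (simp only: Re_complex_of_real)
qed

interpretation L2p: pre_hilbert L2_fun flc fip
proof
  show "L2_fun \<noteq> {}"
  proof -
    have "(\<lambda>x. 0) \<in> L2_fun" by (simp add: L2_fun_def)
    then show ?thesis by blast
  qed
  show "flc a u b v \<in> L2_fun" if "u \<in> L2_fun" "v \<in> L2_fun" for a u b v
    unfolding flc_def by (rule L2_lc[OF that])
  show "fip w (flc a u b v) = a * fip w u + b * fip w v"
    if "w \<in> L2_fun" "u \<in> L2_fun" "v \<in> L2_fun" for a b u v w
  proof -
    have "fip w (flc a u b v) = (LINT x|lborel. a * (cnj (w x) * u x) + b * (cnj (w x) * v x))"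
      unfolding fip_def flc_def by (simp add: algebra_simps)
    also have "\<dots> = a * fip w u + b * fip w v"
      unfolding fip_def using L2_mult_integrable[OF L2_cnj[OF that(1)] that(2)] L2_mult_integrable[OF L2_cnj[OF that(1)] that(3)]
      by simp
    finally show ?thesis .
  qed
  show "fip v u = cnj (fip u v)" for u v
    unfolding fip_def by (simp add: mult.commute flip: Bochner_Integration.integral_cnj)
  show "0 \<le> Re (fip u u)" for u
    unfolding fip_self by simp
qed

lemma L2p_nrm: "L2p.nrm f = sqrt (LINT x|lborel. (norm (f x))\<^sup>2)"
  by (simp add: L2p.nrm_def fip_self)

lemma L2p_nrm_sq: "(L2p.nrm f)\<^sup>2 = (LINT x|lborel. (norm (f x))\<^sup>2)"
  by (simp add: L2p_nrm)

lemma L2p_sub: "L2p.sub f g = (\<lambda>x. f x - g x)"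
  by (simp add: L2p.sub_def flc_def)

lemma nn_integral_L2: "f \<in> L2_fun \<Longrightarrow> (\<integral>\<^sup>+x. ennreal ((norm (f x))\<^sup>2) \<partial>lborel) = ennreal ((L2p.nrm f)\<^sup>2)"
  unfolding L2p_nrm_sq by (intro nn_integral_eq_integral L2_sq_integrable) auto

lemma L2_nn_bound:
  assumes "f \<in> borel_measurable borel" "(\<integral>\<^sup>+x. ennreal ((norm (f x))\<^sup>2) \<partial>lborel) \<le> ennreal (K\<^sup>2)" "0 \<le> K"
  shows "f \<in> L2_fun" "L2p.nrm f \<le> K"
proof -
  have [measurable]: "f \<in> borel_measurable borel" by fact
  have "integrable lborel (\<lambda>x. (norm (f x))\<^sup>2)"
    by (rule integrableI_nonneg) (use assms(2) in \<open>auto intro: le_less_trans\<close>)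
  then show f: "f \<in> L2_fun" by (simp add: L2_fun_def)
  have "ennreal ((L2p.nrm f)\<^sup>2) \<le> ennreal (K\<^sup>2)"
    using nn_integral_L2[OF f] assms(2) by simp
  then have "(L2p.nrm f)\<^sup>2 \<le> K\<^sup>2" by (simp add: ennreal_le_iff)
  then show "L2p.nrm f \<le> K" using assms(3) by (rule power2_le_imp_le)
qed

text \<open>The Riesz-Fischer theorem. Fast convergence of the steps gives a pointwise limit almost
  everywhere, and Fatou's lemma turns it into a limit in norm.\<close>

lemma L2_complete:
  assumes X: "\<And>n. X n \<in> L2_fun" and step: "\<And>n. L2p.nrm (\<lambda>x. X (Suc n) x - X n x) \<le> 2 * (1 / 2) ^ n"
  obtains l where "l \<in> L2_fun" "(\<lambda>n. L2p.nrm (\<lambda>x. X n x - l x)) \<longlonglongrightarrow> 0"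
proof -
  have [measurable]: "X n \<in> borel_measurable borel" for n by (rule L2_measurable[OF X])
  have dL2: "(\<lambda>x. X m x - X n x) \<in> L2_fun" for m n
    using L2p.sub_closed[OF X X, of m n] by (simp add: L2p_sub)
  \<comment> \<open>Subtracting the tail 4 * (1/2)^m makes the bound telescope in the
    induction.\<close>
  have tri: "L2p.nrm (\<lambda>x. X m x - X n x) \<le> 4 * (1 / 2) ^ n - 4 * (1 / 2) ^ m" if "n \<le> m" for m n
    using that
  proof (induction m rule: dec_induct)
    case base
    then show ?case by (simp add: L2p_nrm)
  next
    case (step m)
    have "L2p.nrm (\<lambda>x. X (Suc m) x - X n x) = L2p.nrm (flc 1 (\<lambda>x. X (Suc m) x - X m x) 1 (\<lambda>x. X m x - X n x))"
      by (simp add: flc_def)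
    also have "\<dots> \<le> norm (1::complex) * L2p.nrm (\<lambda>x. X (Suc m) x - X m x) + norm (1::complex) * L2p.nrm (\<lambda>x. X m x - X n x)"
      by (rule L2p.nrm_lc_le[OF dL2 dL2])
    also have "\<dots> \<le> 4 * (1 / 2) ^ n - 4 * (1 / 2) ^ Suc m"
      using step assms(2)[of m] by simp
    finally show ?case .
  qed
  define a where "a n x = norm (X (Suc n) x - X n x)" for n x
  have [measurable]: "a n \<in> borel_measurable borel" for n unfolding a_def[abs_def] by measurable
  \<comment> \<open>The weight 2^n uses up half of the available decay: the mean of the
    \<open>n\<close>-th term is at most 4 * (1/2)^n, still summable, and finiteness of the sum at
    \<open>x\<close> bounds the steps there by a geometric sequence with ratio the square root of
    1/2.\<close>
  have "(\<integral>\<^sup>+x. (\<Sum>n. ennreal (2 ^ n * (a n x)\<^sup>2)) \<partial>lborel) = (\<Sum>n. \<integral>\<^sup>+x. ennreal (2 ^ n * (a n x)\<^sup>2) \<partial>lborel)"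
    by (rule nn_integral_suminf) measurable
  also have "\<dots> \<le> (\<Sum>n. ennreal (4 * (1 / 2) ^ n))"
  proof (intro suminf_le allI)
    fix n
    have "(\<integral>\<^sup>+x. ennreal (2 ^ n * (a n x)\<^sup>2) \<partial>lborel) = ennreal (2 ^ n) * ennreal ((L2p.nrm (\<lambda>x. X (Suc n) x - X n x))\<^sup>2)"
      unfolding nn_integral_L2[OF dL2, symmetric] a_def by (simp add: ennreal_mult nn_integral_cmult)
    also have "\<dots> \<le> ennreal (2 ^ n) * ennreal ((2 * (1 / 2) ^ n)\<^sup>2)"
      using step[of n] by (intro mult_left_mono ennreal_leI power_mono) (auto intro: L2p.nrm_nonneg dL2)
    also have "\<dots> = ennreal (4 * (1 / 2) ^ n)"
    proof -
      have "(2::real) ^ n * (2 * (1 / 2) ^ n)\<^sup>2 = 4 * (1 / 2) ^ n"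
        by (simp add: power2_eq_square power_divide)
      then show ?thesis by (simp flip: ennreal_mult)
    qed
    finally show "(\<integral>\<^sup>+x. ennreal (2 ^ n * (a n x)\<^sup>2) \<partial>lborel) \<le> ennreal (4 * (1 / 2) ^ n)" .
  qed auto
  also have "\<dots> = ennreal (\<Sum>n. 4 * (1 / 2) ^ n)"
    by (intro suminf_ennreal2) (auto intro!: summable_mult summable_geometric)
  also have "\<dots> < \<infinity>" by simp
  finally have "AE x in lborel. (\<Sum>n. ennreal (2 ^ n * (a n x)\<^sup>2)) \<noteq> \<infinity>"
    by (intro nn_integral_PInf_AE) auto
  define l where "l x = lim (\<lambda>n. X n x)" for x
  have [measurable]: "l \<in> borel_measurable borel"
    unfolding l_def[abs_def] by (rule borel_measurable_lim_metric) simp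
  have lim: "AE x in lborel. (\<lambda>n. X n x) \<longlonglongrightarrow> l x"
    using \<open>AE x in lborel. (\<Sum>n. ennreal (2 ^ n * (a n x)\<^sup>2)) \<noteq> \<infinity>\<close>
  proof eventually_elim
    case (elim x)
    then obtain K where K: "(\<Sum>n. ennreal (2 ^ n * (a n x)\<^sup>2)) = ennreal K" "K \<ge> 0"
      by (cases "\<Sum>n. ennreal (2 ^ n * (a n x)\<^sup>2)") (auto simp: top_ennreal_def)
    have ab: "a n x \<le> sqrt K * (sqrt (1 / 2)) ^ n" for n
    proof (rule power2_le_imp_le)
      have "ennreal (2 ^ n * (a n x)\<^sup>2) \<le> ennreal K"
        using sum_le_suminf[of "\<lambda>n. ennreal (2 ^ n * (a n x)\<^sup>2)" "{n}"] K by simp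
      then have "2 ^ n * (a n x)\<^sup>2 \<le> K" using K by (simp add: ennreal_le_iff)
      then show "(a n x)\<^sup>2 \<le> (sqrt K * sqrt (1 / 2) ^ n)\<^sup>2"
      proof -
        have "(sqrt K * sqrt (1 / 2) ^ n)\<^sup>2 = K * ((sqrt (1 / 2))\<^sup>2) ^ n"
          by (simp only: power_mult_distrib power_mult[symmetric] mult.commute[of n 2] real_sqrt_pow2[OF K(2)])
        also have "\<dots> = K / 2 ^ n" by (simp add: power_divide)
        finally have e: "(sqrt K * sqrt (1 / 2) ^ n)\<^sup>2 = K / 2 ^ n" .
        show ?thesis unfolding e using \<open>2 ^ n * (a n x)\<^sup>2 \<le> K\<close> by (simp add: field_simps)
      qed
    qed (use K in simp)
    have "summable (\<lambda>n. X (Suc n) x - X n x)"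
    proof (rule summable_comparison_test'[where g = "\<lambda>n. sqrt K * (sqrt (1 / 2)) ^ n" and N = 0])
      have "sqrt (1 / 2) < 1" by (simp add: real_sqrt_divide)
      then show "summable (\<lambda>n. sqrt K * (sqrt (1 / 2)) ^ n)"
        by (intro summable_mult summable_geometric) simp
    qed (use ab in \<open>simp add: a_def\<close>)
    then have "convergent (\<lambda>n. \<Sum>k<n. X (Suc k) x - X k x)" by (simp add: summable_iff_convergent)
    then have "convergent (\<lambda>n. X n x - X 0 x)" by (simp only: sum_lessThan_telescope[of "\<lambda>n. X n x"])
    then have "convergent (\<lambda>n. X n x)" by (simp add: convergent_diff_const_right_iff)
    then show ?case unfolding l_def by (simp add: convergent_LIMSEQ_iff)
  qed
  have dist: "(\<lambda>x. X n x - l x) \<in> L2_fun \<and> L2p.nrm (\<lambda>x. X n x - l x) \<le> 4 * (1 / 2) ^ n" for n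
  proof -
    \<comment> \<open>Fatou's lemma in the second index; \<open>tri\<close> bounds the integrals
      uniformly.\<close>
    have "(\<integral>\<^sup>+x. ennreal ((norm (X n x - l x))\<^sup>2) \<partial>lborel) = (\<integral>\<^sup>+x. liminf (\<lambda>m. ennreal ((norm (X n x - X m x))\<^sup>2)) \<partial>lborel)"
    proof (rule nn_integral_cong_AE)
      show "AE x in lborel. ennreal ((norm (X n x - l x))\<^sup>2) = liminf (\<lambda>m. ennreal ((norm (X n x - X m x))\<^sup>2))"
        using lim
      proof eventually_elim
        case (elim x)
        then have "(\<lambda>m. ennreal ((norm (X n x - X m x))\<^sup>2)) \<longlonglongrightarrow> ennreal ((norm (X n x - l x))\<^sup>2)"
          by (intro tendsto_ennrealI tendsto_intros)
        then show ?case
          by (intro lim_imp_Liminf[symmetric]) auto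
      qed
    qed
    also have "\<dots> \<le> liminf (\<lambda>m. \<integral>\<^sup>+x. ennreal ((norm (X n x - X m x))\<^sup>2) \<partial>lborel)"
      by (rule nn_integral_liminf) measurable
    also have "\<dots> \<le> liminf (\<lambda>m. ennreal ((4 * (1 / 2) ^ n)\<^sup>2))"
    proof (rule Liminf_mono)
      show "\<forall>\<^sub>F m in sequentially. (\<integral>\<^sup>+x. ennreal ((norm (X n x - X m x))\<^sup>2) \<partial>lborel) \<le> ennreal ((4 * (1 / 2) ^ n)\<^sup>2)"
        using eventually_ge_at_top[of n]
      proof eventually_elim
        case (elim m)
        have "L2p.nrm (\<lambda>x. X m x - X n x) \<le> 4 * (1 / 2) ^ n"
        proof -
          have "0 \<le> (1 / 2 :: real) ^ m" by simp
          then show ?thesis using tri[OF elim] by linarith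
        qed
        then have "ennreal ((L2p.nrm (\<lambda>x. X m x - X n x))\<^sup>2) \<le> ennreal ((4 * (1 / 2) ^ n)\<^sup>2)"
          by (intro ennreal_leI power_mono L2p.nrm_nonneg dL2)
        then show ?case
          unfolding nn_integral_L2[OF dL2, symmetric] by (simp add: norm_minus_commute)
      qed
    qed
    also have "\<dots> = ennreal ((4 * (1 / 2) ^ n)\<^sup>2)" by (simp add: Liminf_const)
    finally have "(\<integral>\<^sup>+x. ennreal ((norm (X n x - l x))\<^sup>2) \<partial>lborel) \<le> ennreal ((4 * (1 / 2) ^ n)\<^sup>2)" .
    from L2_nn_bound[OF _ this] show ?thesis by simp
  qed
  have "(\<lambda>x. X 0 x - (X 0 x - l x)) \<in> L2_fun"
    using L2p.sub_closed[OF X[of 0] conjunct1[OF dist[of 0]]] by (simp add: L2p_sub)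
  then have "l \<in> L2_fun" by simp
  moreover have "(\<lambda>n. L2p.nrm (\<lambda>x. X n x - l x)) \<longlonglongrightarrow> 0"
  proof (rule Lim_null_comparison[where g = "\<lambda>n. 4 * (1 / 2) ^ n"])
    show "\<forall>\<^sub>F n in sequentially. norm (L2p.nrm (\<lambda>x. X n x - l x)) \<le> 4 * (1 / 2) ^ n"
      using dist L2p.nrm_nonneg by simp
    show "(\<lambda>n. 4 * (1 / 2) ^ n :: real) \<longlonglongrightarrow> 0"
      by (intro tendsto_mult_right_zero LIMSEQ_power_zero) simp
  qed
  ultimately show thesis by (rule that)
qed

interpretation L2h: hilbert L2_fun flc fip
proof
  fix X :: "nat \<Rightarrow> space \<Rightarrow> complex"
  assume X: "\<And>n. X n \<in> L2_fun"
    and step: "\<And>n. Re (fip (flc 1 (X (Suc n)) (- 1) (X n)) (flc 1 (X (Suc n)) (- 1) (X n))) \<le> 4 * (1 / 4) ^ n"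
  have "L2p.nrm (\<lambda>x. X (Suc n) x - X n x) \<le> 2 * (1 / 2) ^ n" for n
  proof -
    have "(2 * (1 / 2) ^ n)\<^sup>2 = 4 * (1 / 4 :: real) ^ n"
      by (simp add: power2_eq_square power_mult_distrib[symmetric])
    then have "(L2p.nrm (\<lambda>x. X (Suc n) x - X n x))\<^sup>2 \<le> (2 * (1 / 2) ^ n)\<^sup>2"
      unfolding L2p_nrm_sq fip_self[symmetric] using step[of n] by (simp add: flc_def)
    then show ?thesis by (rule power2_le_imp_le) simp
  qed
  from L2_complete[OF X this] obtain l where l: "l \<in> L2_fun" "(\<lambda>n. L2p.nrm (\<lambda>x. X n x - l x)) \<longlonglongrightarrow> 0"
    by blast
  have "(\<lambda>n. (L2p.nrm (\<lambda>x. X n x - l x))\<^sup>2) \<longlonglongrightarrow> 0\<^sup>2"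
    by (intro tendsto_power l)
  then have "(\<lambda>n. Re (fip (flc 1 (X n) (- 1) l) (flc 1 (X n) (- 1) l))) \<longlonglongrightarrow> 0"
    by (simp add: L2p_nrm_sq fip_self flc_def)
  then show "\<exists>l\<in>L2_fun. (\<lambda>n. Re (fip (flc 1 (X n) (- 1) l) (flc 1 (X n) (- 1) l))) \<longlonglongrightarrow> 0"
    using l(1) by blast
qed

subsection \<open>Plancherel's theorem\<close>

lemma schwartz_L2: "\<phi> \<in> schwartz \<Longrightarrow> \<phi> \<in> L2_fun"
proof -
  assume \<phi>: "\<phi> \<in> schwartz"
  obtain C where C: "\<And>x. norm (\<phi> x) \<le> C" "C > 0"
    using schwartz_bound[OF \<phi>, of 0] by (metis mult_1 power_0)
  show ?thesis
  proof (rule L2_bound[where F = "\<lambda>x. C * norm (\<phi> x)"])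
    show "integrable lborel (\<lambda>x. C * norm (\<phi> x))"
      by (intro integrable_mult_right integrable_norm schwartz_integrable \<phi>)
  qed (use C in \<open>auto simp: power2_eq_square intro!: mult_right_mono schwartz_measurable \<phi>\<close>)
qed

lemma fourier_isometry:
  assumes \<phi>: "\<phi> \<in> schwartz"
  shows "L2p.nrm (fourier \<phi>) = L2p.nrm \<phi>"
proof -
  have F: "fourier \<phi> \<in> schwartz" by (rule schwartz_fourier[OF \<phi>])
  have "fip (fourier \<phi>) (fourier \<phi>) = (LINT x|lborel. fourier (\<lambda>x. cnj (fourier \<phi> x)) x * \<phi> x)"
    unfolding fip_def by (rule fourier_swap) (intro schwartz_integrable schwartz_cnj F \<phi>)+
  also have "\<dots> = fip \<phi> \<phi>"
    by (simp add: fourier_cnj fourier_fourier[OF \<phi>] fip_def)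
  finally show ?thesis by (simp add: L2p.nrm_def)
qed

lemma L2_is_density:
  assumes "g \<in> L2_fun"
  shows "is_density g (fun_distr g)"
  using assms L2_mult_integrable[OF assms schwartz_L2] by (simp add: is_density_def L2_measurable)

text \<open>The transform of \<open>g\<close> is defined by duality: pairing \<open>g\<close> with
  transforms of Schwartz functions is bounded by the norm of \<open>g\<close>, as
  \<open>fourier\<close> is isometric there. The Schwartz space is not closed, which is why
  \<open>riesz\<close> allows arbitrary subspaces. The conjugations are due to the antilinear first
  argument of \<open>fip\<close>.\<close>

lemma plancherel_le:
  assumes g: "g \<in> L2_fun"
  obtains h where "h \<in> L2_fun" "L2p.nrm h \<le> L2p.nrm g"
    "\<And>\<psi>. \<psi> \<in> schwartz \<Longrightarrow> (LINT x|lborel. g x * fourier \<psi> x) = (LINT x|lborel. h x * \<psi> x)"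
proof -
  have gc: "(\<lambda>x. cnj (g x)) \<in> L2_fun" by (rule L2_cnj[OF g])
  define \<Lambda> where "\<Lambda> \<psi> = fip (\<lambda>x. cnj (g x)) (fourier \<psi>)" for \<psi>
  have FL: "fourier \<psi> \<in> L2_fun" if "\<psi> \<in> schwartz" for \<psi>
    by (rule schwartz_L2[OF schwartz_fourier[OF that]])
  obtain h where h: "h \<in> L2_fun" "\<And>\<psi>. \<psi> \<in> schwartz \<Longrightarrow> fip h \<psi> = \<Lambda> \<psi>" "L2p.nrm h \<le> L2p.nrm g"
  proof (rule L2h.riesz[of schwartz \<Lambda> "L2p.nrm g"])
    show "schwartz \<subseteq> L2_fun" using schwartz_L2 by blast
    show "schwartz \<noteq> {}" using gauss_schwartz by blast
    show "flc a u b v \<in> schwartz" if "u \<in> schwartz" "v \<in> schwartz" for a u b v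
      unfolding flc_def by (rule schwartz_lc[OF that])
    show "\<Lambda> (flc a u b v) = a * \<Lambda> u + b * \<Lambda> v" if "u \<in> schwartz" "v \<in> schwartz" for a u b v
    proof -
      have "fourier (flc a u b v) = flc a (fourier u) b (fourier v)"
      proof
        fix \<xi>
        have "(LINT x|lborel. cis (- (x \<bullet> \<xi>)) * (a * u x + b * v x))
            = (LINT x|lborel. a * (cis (- (x \<bullet> \<xi>)) * u x) + b * (cis (- (x \<bullet> \<xi>)) * v x))"
          by (simp add: algebra_simps)
        also have "\<dots> = a * (LINT x|lborel. cis (- (x \<bullet> \<xi>)) * u x) + b * (LINT x|lborel. cis (- (x \<bullet> \<xi>)) * v x)"
          using cis_mult_integrable_minus[OF schwartz_integrable[OF that(1)]]
            cis_mult_integrable_minus[OF schwartz_integrable[OF that(2)]] by simp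
        finally show "fourier (flc a u b v) \<xi> = flc a (fourier u) b (fourier v) \<xi>"
          by (simp add: fourier_eq flc_def algebra_simps)
      qed
      then show ?thesis
        unfolding \<Lambda>_def by (simp add: L2p.ip_lc_right gc FL that)
    qed
    show "norm (\<Lambda> v) \<le> L2p.nrm g * L2p.nrm v" if "v \<in> schwartz" for v
    proof -
      have "L2p.nrm (\<lambda>x. cnj (g x)) = L2p.nrm g" by (simp add: L2p_nrm)
      then show ?thesis
        using L2p.Cauchy_Schwarz[OF gc FL[OF that]] by (simp add: \<Lambda>_def fourier_isometry[OF that])
    qed
    show "0 \<le> L2p.nrm g" by (rule L2p.nrm_nonneg[OF g])
  qed (rule that)
  show thesis
  proof (rule that)
    show "(\<lambda>x. cnj (h x)) \<in> L2_fun" by (rule L2_cnj[OF h(1)])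
    show "L2p.nrm (\<lambda>x. cnj (h x)) \<le> L2p.nrm g" using h(3) by (simp add: L2p_nrm)
    show "(LINT x|lborel. g x * fourier \<psi> x) = (LINT x|lborel. cnj (h x) * \<psi> x)" if "\<psi> \<in> schwartz" for \<psi>
      using h(2)[OF that] by (simp add: \<Lambda>_def fip_def)
  qed
qed

lemma L2_nrm_cong:
  assumes "f \<in> L2_fun" "g \<in> L2_fun" "AE x in lborel. f x = g x"
  shows "L2p.nrm f = L2p.nrm g"
proof -
  have [measurable]: "f \<in> borel_measurable borel" "g \<in> borel_measurable borel"
    using assms by (auto intro: L2_measurable)
  have "(LINT x|lborel. (norm (f x))\<^sup>2) = (LINT x|lborel. (norm (g x))\<^sup>2)"
    by (rule integral_cong_AE) (use assms(3) in auto)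
  then show ?thesis by (simp add: L2p_nrm)
qed

lemma L2_reflect:
  assumes "f \<in> L2_fun"
  shows "(\<lambda>x. f (- x)) \<in> L2_fun" "L2p.nrm (\<lambda>x. f (- x)) = L2p.nrm f"
proof -
  have [measurable]: "f \<in> borel_measurable borel" by (rule L2_measurable[OF assms])
  show "(\<lambda>x. f (- x)) \<in> L2_fun"
    using integrable_reflect[OF L2_sq_integrable[OF assms]] by (simp add: L2_fun_def)
  show "L2p.nrm (\<lambda>x. f (- x)) = L2p.nrm f"
    using integral_reflect[of "\<lambda>x. (norm (f x))\<^sup>2"] by (simp add: L2p_nrm)
qed

text \<open>The transform does not increase the norm, and applied twice it is the reflection, which
  preserves the norm. So neither application can decrease it.\<close>

lemma plancherel:
  assumes g: "g \<in> L2_fun"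
  obtains h where "h \<in> L2_fun" "L2p.nrm h = L2p.nrm g"
    "\<And>\<psi>. \<psi> \<in> schwartz \<Longrightarrow> (LINT x|lborel. g x * fourier \<psi> x) = (LINT x|lborel. h x * \<psi> x)"
proof -
  obtain h where h: "h \<in> L2_fun" "L2p.nrm h \<le> L2p.nrm g"
    "\<And>\<psi>. \<psi> \<in> schwartz \<Longrightarrow> (LINT x|lborel. g x * fourier \<psi> x) = (LINT x|lborel. h x * \<psi> x)"
    using plancherel_le[OF g] by blast
  obtain k where k: "k \<in> L2_fun" "L2p.nrm k \<le> L2p.nrm h"
    "\<And>\<psi>. \<psi> \<in> schwartz \<Longrightarrow> (LINT x|lborel. h x * fourier \<psi> x) = (LINT x|lborel. k x * \<psi> x)"
    using plancherel_le[OF h(1)] by blast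
  have [measurable]: "g \<in> borel_measurable borel" by (rule L2_measurable[OF g])
  have "fun_distr k = fun_distr (\<lambda>x. g (- x))"
  proof
    fix \<psi>
    show "fun_distr k \<psi> = fun_distr (\<lambda>x. g (- x)) \<psi>"
    proof (cases "\<psi> \<in> schwartz")
      case True
      then have [measurable]: "\<psi> \<in> borel_measurable borel" by (rule schwartz_measurable)
      have "(LINT x|lborel. k x * \<psi> x) = (LINT x|lborel. g x * \<psi> (- x))"
        using k(3)[OF True] h(3)[OF schwartz_fourier[OF True]] by (simp add: fourier_fourier[OF True])
      also have "\<dots> = (LINT x|lborel. g (- x) * \<psi> x)"
        using integral_reflect[of "\<lambda>x. g (- x) * \<psi> x"] by simp
      finally show ?thesis using True by (simp add: fun_distr_def)
    qed (simp add: fun_distr_def)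
  qed
  then have "AE x in lborel. k x = g (- x)"
    using is_density_unique[OF L2_is_density[OF k(1)]] L2_is_density[OF L2_reflect(1)[OF g]] by simp
  then have "L2p.nrm k = L2p.nrm g"
    using L2_nrm_cong[OF k(1) L2_reflect(1)[OF g]] L2_reflect(2)[OF g] by simp
  then have "L2p.nrm h = L2p.nrm g" using h(2) k(2) by simp
  then show thesis using that h(1,3) by blast
qed

text \<open>The preimage of \<open>h\<close> is the reflection of its transform.\<close>

lemma plancherel_surj:
  assumes h: "h \<in> L2_fun"
  obtains g where "g \<in> L2_fun"
    "\<And>\<psi>. \<psi> \<in> schwartz \<Longrightarrow> (LINT x|lborel. g x * fourier \<psi> x) = (LINT x|lborel. h x * \<psi> x)"
proof -
  obtain k where k: "k \<in> L2_fun" "L2p.nrm k = L2p.nrm h"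
    "\<And>\<psi>. \<psi> \<in> schwartz \<Longrightarrow> (LINT x|lborel. h x * fourier \<psi> x) = (LINT x|lborel. k x * \<psi> x)"
    using plancherel[OF h] by blast
  have [measurable]: "k \<in> borel_measurable borel" by (rule L2_measurable[OF k(1)])
  show thesis
  proof (rule that)
    show "(\<lambda>x. k (- x)) \<in> L2_fun" by (rule L2_reflect(1)[OF k(1)])
    fix \<psi> :: "space \<Rightarrow> complex" assume \<psi>: "\<psi> \<in> schwartz"
    have r: "(\<lambda>x. \<psi> (- x)) \<in> schwartz" by (rule schwartz_reflect[OF \<psi>])
    have [measurable]: "fourier \<psi> \<in> borel_measurable borel"
      by (rule schwartz_measurable[OF schwartz_fourier[OF \<psi>]])
    have "(LINT x|lborel. k (- x) * fourier \<psi> x) = (LINT x|lborel. k x * fourier (\<lambda>x. \<psi> (- x)) x)"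
      using integral_reflect[of "\<lambda>x. k x * fourier \<psi> (- x)"]
      by (simp add: fourier_reflect[OF schwartz_measurable[OF \<psi>]])
    also have "\<dots> = (LINT x|lborel. h x * \<psi> x)"
      using k(3)[OF schwartz_fourier[OF r]] by (simp add: fourier_fourier[OF r])
    finally show "(LINT x|lborel. k (- x) * fourier \<psi> x) = (LINT x|lborel. h x * \<psi> x)" .
  qed
qed

subsection \<open>Sobolev spaces on the Fourier side\<close>

definition jm :: "real \<Rightarrow> (space \<Rightarrow> complex) \<Rightarrow> space \<Rightarrow> complex" where
  "jm t g = (\<lambda>\<xi>. of_real (J t \<xi>) * g \<xi>)"

text \<open>The Fourier side of the Sobolev space of order \<open>t\<close>: a weighted space of
  functions, not of classes.\<close>

definition Hs :: "real \<Rightarrow> (space \<Rightarrow> complex) set" where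
  "Hs t = {g. jm t g \<in> L2_fun}"

lemma jm_jm: "jm r (jm q g) = jm (r + q) g"
  by (simp add: jm_def J_add mult.assoc)

lemma jm_0 [simp]: "jm 0 g = g"
  by (simp add: jm_def)

lemma jm_flc: "jm t (flc a g b h) = flc a (jm t g) b (jm t h)"
  by (simp add: jm_def flc_def algebra_simps)

lemma jm_measurable: "g \<in> borel_measurable borel \<Longrightarrow> jm t g \<in> borel_measurable borel"
  unfolding jm_def by measurable

lemma Hs_measurable: "g \<in> Hs t \<Longrightarrow> g \<in> borel_measurable borel"
  using jm_measurable[of "jm t g" "- t"] by (simp add: Hs_def jm_jm L2_measurable)

lemma Hs_0: "Hs 0 = L2_fun"
  by (simp add: Hs_def)

lemma Hs_jm: "jm r g \<in> Hs t \<longleftrightarrow> g \<in> Hs (t + r)"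
  by (simp add: Hs_def jm_jm)

lemma Hs_flc: "g \<in> Hs t \<Longrightarrow> h \<in> Hs t \<Longrightarrow> flc a g b h \<in> Hs t"
  by (simp add: Hs_def jm_flc L2p.lc_closed)

lemma L2_nrm_mono:
  assumes "f \<in> borel_measurable borel" "h \<in> L2_fun" "0 \<le> c" "AE x in lborel. norm (f x) \<le> c * norm (h x)"
  shows "f \<in> L2_fun" "L2p.nrm f \<le> c * L2p.nrm h"
proof -
  have "(\<integral>\<^sup>+x. ennreal ((norm (f x))\<^sup>2) \<partial>lborel) \<le> (\<integral>\<^sup>+x. ennreal (c\<^sup>2) * ennreal ((norm (h x))\<^sup>2) \<partial>lborel)"
  proof (rule nn_integral_mono_AE)
    show "AE x in lborel. ennreal ((norm (f x))\<^sup>2) \<le> ennreal (c\<^sup>2) * ennreal ((norm (h x))\<^sup>2)"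
      using assms(4)
    proof eventually_elim
      case (elim x)
      then have "(norm (f x))\<^sup>2 \<le> (c * norm (h x))\<^sup>2" by (intro power_mono) auto
      then show ?case by (simp add: power_mult_distrib ennreal_leI flip: ennreal_mult)
    qed
  qed
  also have "\<dots> = ennreal (c\<^sup>2) * ennreal ((L2p.nrm h)\<^sup>2)"
    using assms(2) by (simp add: nn_integral_cmult nn_integral_L2 L2_measurable)
  also have "\<dots> = ennreal ((c * L2p.nrm h)\<^sup>2)"
    by (simp add: power_mult_distrib ennreal_mult)
  finally have le: "(\<integral>\<^sup>+x. ennreal ((norm (f x))\<^sup>2) \<partial>lborel) \<le> ennreal ((c * L2p.nrm h)\<^sup>2)" .
  have "0 \<le> c * L2p.nrm h" using assms(2,3) by (simp add: L2p.nrm_nonneg)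
  from L2_nn_bound[OF assms(1) le this] show "f \<in> L2_fun" "L2p.nrm f \<le> c * L2p.nrm h" by auto
qed

lemma Hs_mono:
  assumes "g \<in> Hs t" "r \<le> t"
  shows "g \<in> Hs r" "L2p.nrm (jm r g) \<le> L2p.nrm (jm t g)"
proof -
  have "AE x in lborel. norm (jm r g x) \<le> 1 * norm (jm t g x)"
    using J_mono[OF assms(2)] by (intro AE_I2) (auto simp: jm_def norm_mult intro!: mult_right_mono)
  from L2_nrm_mono[OF jm_measurable[OF Hs_measurable[OF assms(1)]] _ _ this] assms(1)
  show "g \<in> Hs r" "L2p.nrm (jm r g) \<le> L2p.nrm (jm t g)" by (auto simp: Hs_def)
qed

lemma J_L2: "r > 3 / 2 \<Longrightarrow> (\<lambda>\<xi>. of_real (J (- r) \<xi>)) \<in> L2_fun"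
  using J_integrable[of "2 * r"] by (simp add: L2_fun_def J_sq')

lemma schwartz_jm: "\<phi> \<in> schwartz \<Longrightarrow> jm t \<phi> \<in> schwartz"
  unfolding jm_def by (rule schwartz_mult[OF slow_J])

lemma Hs_mult_integrable:
  assumes "g \<in> Hs t" "h \<in> Hs (- t)"
  shows "integrable lborel (\<lambda>x. g x * h x)"
proof -
  have "(\<lambda>x. jm t g x * jm (- t) h x) = (\<lambda>x. g x * h x)"
  proof
    fix x
    have "complex_of_real (J t x) * of_real (J (- t) x) = 1"
      by (simp only: of_real_mult[symmetric] J_minus_mult(2) of_real_1)
    then show "jm t g x * jm (- t) h x = g x * h x"
      unfolding jm_def by (simp add: algebra_simps)
  qed
  then show ?thesis
    using L2_mult_integrable[of "jm t g" "jm (- t) h"] assms by (simp add: Hs_def)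
qed

lemma schwartz_Hs: "\<phi> \<in> schwartz \<Longrightarrow> \<phi> \<in> Hs t"
  by (simp add: Hs_def schwartz_L2 schwartz_jm)

lemma J_le_power:
  assumes "r \<le> real n"
  shows "J r \<xi> \<le> (1 + norm \<xi>) ^ n"
proof -
  have p: "0 < 1 + norm \<xi>" by (simp add: add_pos_nonneg)
  have "J r \<xi> \<le> J (real n) \<xi>" by (rule J_mono[OF assms])
  also have "\<dots> \<le> ((1 + norm \<xi>)\<^sup>2) powr (real n / 2)"
    unfolding J_def by (intro powr_mono2) (auto simp: power2_sum)
  also have "(1 + norm \<xi>)\<^sup>2 = (1 + norm \<xi>) powr 2"
    using powr_realpow[OF p, of 2] by simp
  also have "((1 + norm \<xi>) powr 2) powr (real n / 2) = (1 + norm \<xi>) powr real n"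
    by (subst powr_powr) simp
  also have "\<dots> = (1 + norm \<xi>) ^ n" using p by (simp add: powr_realpow)
  finally show ?thesis .
qed

lemma fourier_flc:
  assumes "integrable lborel u" "integrable lborel v"
  shows "fourier (flc a u b v) = flc a (fourier u) b (fourier v)"
proof
  fix \<xi>
  have "(LINT x|lborel. cis (- (x \<bullet> \<xi>)) * (a * u x + b * v x))
      = (LINT x|lborel. a * (cis (- (x \<bullet> \<xi>)) * u x) + b * (cis (- (x \<bullet> \<xi>)) * v x))"
    by (simp add: algebra_simps)
  also have "\<dots> = a * (LINT x|lborel. cis (- (x \<bullet> \<xi>)) * u x) + b * (LINT x|lborel. cis (- (x \<bullet> \<xi>)) * v x)"
    using cis_mult_integrable_minus[OF assms(1)] cis_mult_integrable_minus[OF assms(2)] by simp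
  finally show "fourier (flc a u b v) \<xi> = flc a (fourier u) b (fourier v) \<xi>"
    by (simp add: fourier_eq flc_def algebra_simps)
qed

lemma inv_fourier_flc:
  "integrable lborel u \<Longrightarrow> integrable lborel v \<Longrightarrow> inv_fourier (flc a u b v) = flc a (inv_fourier u) b (inv_fourier v)"
  by (rule ext) (simp add: inv_fourier_fourier fourier_flc, simp add: flc_def inv_fourier_fourier)

text \<open>\<open>lift g\<close> is the distribution with Fourier transform \<open>g\<close>.\<close>

definition lift :: "(space \<Rightarrow> complex) \<Rightarrow> distr" where
  "lift g = (\<lambda>\<phi>. if \<phi> \<in> schwartz then LINT \<xi>|lborel. g \<xi> * inv_fourier \<phi> \<xi> else 0)"

definition ft :: "distr \<Rightarrow> space \<Rightarrow> complex" where
  "ft T = density_of (fourier_distr T)"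

text \<open>Cauchy-Schwarz with the weights of order \<open>t\<close> and \<open>- t\<close> leaves
  a weighted norm of the inverse transform of \<phi>, for which \<open>fourier_seminorm\<close>
  gives a pointwise bound.\<close>

lemma lift_tempered:
  assumes g: "g \<in> Hs t"
  shows "tempered (lift g)"
proof -
  obtain n :: nat where n: "- t \<le> real n" using real_arch_simple by blast
  \<comment> \<open>\<open>n\<close> powers dominate the weight \<open>J (- t)\<close>, and four
    more leave the square-integrable factor \<open>J (- 4)\<close>.\<close>
  define N where "N = n + 4"
  define K where "K = 4 ^ N * norm cF * K4"
  define C where "C = L2p.nrm (jm t g) * (K * L2p.nrm (\<lambda>\<xi>. of_real (J (- 4) \<xi>)))"
  have gi: "integrable lborel (\<lambda>\<xi>. g \<xi> * inv_fourier \<phi> \<xi>)" if "\<phi> \<in> schwartz" for \<phi>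
    by (rule Hs_mult_integrable[OF g schwartz_Hs[OF schwartz_inv_fourier[OF that]]])
  have "lift g (\<lambda>x. a * \<phi> x + b * \<psi> x) = a * lift g \<phi> + b * lift g \<psi>"
    if "\<phi> \<in> schwartz" "\<psi> \<in> schwartz" for \<phi> \<psi> a b
  proof -
    have "inv_fourier (\<lambda>x. a * \<phi> x + b * \<psi> x) = flc a (inv_fourier \<phi>) b (inv_fourier \<psi>)"
      using inv_fourier_flc[OF schwartz_integrable[OF that(1)] schwartz_integrable[OF that(2)], of a b] by (simp add: flc_def)
    then have "lift g (\<lambda>x. a * \<phi> x + b * \<psi> x) = (LINT \<xi>|lborel. a * (g \<xi> * inv_fourier \<phi> \<xi>) + b * (g \<xi> * inv_fourier \<psi> \<xi>))"
      using schwartz_lc[OF that, of a b] by (simp add: lift_def flc_def algebra_simps)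
    also have "\<dots> = a * lift g \<phi> + b * lift g \<psi>"
      using gi that by (simp add: lift_def)
    finally show ?thesis .
  qed
  moreover have "norm (lift g \<phi>) \<le> C * B"
    if \<phi>: "\<phi> \<in> schwartz" and B: "\<forall>is x. length is \<le> N \<longrightarrow> (1 + norm x) ^ N * norm (partials is \<phi> x) \<le> B" for \<phi> B
  proof -
    have "0 \<le> (1 + norm (0::space)) ^ N * norm (partials [] \<phi> 0)" by simp
    also have "\<dots> \<le> B" using B[rule_format, of "[]" 0] by simp
    finally have B0: "0 \<le> B" .
    have K0: "0 \<le> K" unfolding K_def using K4_nonneg by simp
    have "norm (jm (- t) (inv_fourier \<phi>) \<xi>) \<le> (K * B) * norm (complex_of_real (J (- 4) \<xi>))" for \<xi>
    proof -
      have "(1 + norm \<xi>) ^ 4 * norm (jm (- t) (inv_fourier \<phi>) \<xi>) \<le> (1 + norm \<xi>) ^ 4 * ((1 + norm \<xi>) ^ n * norm (inv_fourier \<phi> \<xi>))"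
        unfolding jm_def norm_mult using J_le_power[OF n, of \<xi>] by (intro mult_left_mono mult_right_mono) auto
      also have "\<dots> = (1 + norm (- \<xi>)) ^ N * norm (fourier \<phi> (- \<xi>))"
        by (simp add: N_def power_add inv_fourier_fourier)
      also have "\<dots> \<le> K * B"
        unfolding K_def by (rule fourier_seminorm[OF \<phi>]) (use B in \<open>auto simp: N_def\<close>)
      finally show ?thesis by (simp add: J4_bound)
    qed
    then have "L2p.nrm (jm (- t) (inv_fourier \<phi>)) \<le> (K * B) * L2p.nrm (\<lambda>\<xi>. of_real (J (- 4) \<xi>))"
      using K0 B0 schwartz_measurable[OF schwartz_jm[OF schwartz_inv_fourier[OF \<phi>]]]
      by (intro L2_nrm_mono(2) J_L2) auto
    moreover have "norm (lift g \<phi>) \<le> L2p.nrm (jm t g) * L2p.nrm (jm (- t) (inv_fourier \<phi>))"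
    proof -
      have "lift g \<phi> = fip (\<lambda>x. cnj (jm t g x)) (jm (- t) (inv_fourier \<phi>))"
        using \<phi> J_minus_mult(2)[of t] by (simp add: lift_def fip_def jm_def mult_ac of_real_mult[symmetric] del: of_real_mult)
      moreover have "L2p.nrm (\<lambda>x. cnj (jm t g x)) = L2p.nrm (jm t g)" by (simp add: L2p_nrm)
      ultimately show ?thesis
        using L2p.Cauchy_Schwarz[OF L2_cnj schwartz_L2[OF schwartz_jm[OF schwartz_inv_fourier[OF \<phi>]]], of "jm t g" "- t"] g
        by (simp add: Hs_def)
    qed
    moreover have "0 \<le> L2p.nrm (jm t g)" using g by (simp add: Hs_def L2p.nrm_nonneg)
    ultimately have "norm (lift g \<phi>) \<le> L2p.nrm (jm t g) * ((K * B) * L2p.nrm (\<lambda>\<xi>. of_real (J (- 4) \<xi>)))"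
      by (meson mult_left_mono order_trans)
    then show ?thesis by (simp add: C_def mult_ac)
  qed
  ultimately show ?thesis
    unfolding tempered_def
    by - (intro conjI exI[of _ C] exI[of _ N]; (blast | simp add: lift_def))
qed

lemma lift_is_density:
  assumes g: "g \<in> Hs t"
  shows "is_density g (fourier_distr (lift g))"
proof -
  have "fourier_distr (lift g) = fun_distr g"
    by (rule ext) (simp add: fourier_distr_def lift_def fun_distr_def schwartz_fourier fourier_inversion)
  then show ?thesis
    using Hs_measurable[OF g] Hs_mult_integrable[OF g schwartz_Hs] by (simp add: is_density_def)
qed

lemma integrable_Hs_iff:
  assumes "g \<in> borel_measurable borel"
  shows "integrable lborel (\<lambda>\<xi>. (1 + (norm \<xi>)\<^sup>2) powr t * (norm (g \<xi>))\<^sup>2) \<longleftrightarrow> g \<in> Hs t"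
  using jm_measurable[OF assms, of t]
  by (simp add: Hs_def L2_fun_def jm_def norm_mult power_mult_distrib J_sq)

lemma lift_sobolev: "g \<in> Hs t \<Longrightarrow> lift g \<in> sobolev t"
  unfolding sobolev_def using lift_tempered lift_is_density integrable_Hs_iff[OF Hs_measurable] by blast

lemma ft_lift: "g \<in> Hs t \<Longrightarrow> AE \<xi> in lborel. ft (lift g) \<xi> = g \<xi>"
  unfolding ft_def by (rule density_of_AE[OF lift_is_density])

lemma lift_cong:
  assumes "g \<in> Hs t" "h \<in> Hs r" "AE \<xi> in lborel. g \<xi> = h \<xi>"
  shows "lift g = lift h"
proof
  fix \<phi>
  have [measurable]: "g \<in> borel_measurable borel" "h \<in> borel_measurable borel"
    using assms Hs_measurable by auto
  show "lift g \<phi> = lift h \<phi>"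
  proof (cases "\<phi> \<in> schwartz")
    case True
    then have [measurable]: "inv_fourier \<phi> \<in> borel_measurable borel"
      by (intro schwartz_measurable schwartz_inv_fourier)
    show ?thesis
      using True assms(3) unfolding lift_def by (auto intro!: integral_cong_AE)
  qed (simp add: lift_def)
qed

lemma Hs_cong:
  assumes "g \<in> Hs t" "h \<in> borel_measurable borel" "AE \<xi> in lborel. g \<xi> = h \<xi>"
  shows "h \<in> Hs t" "L2p.nrm (jm t h) = L2p.nrm (jm t g)"
proof -
  have "AE \<xi> in lborel. norm (jm t h \<xi>) \<le> 1 * norm (jm t g \<xi>)"
    using assms(3) by eventually_elim (simp add: jm_def)
  then show *: "h \<in> Hs t"
    using L2_nrm_mono(1)[OF jm_measurable[OF assms(2)], of "jm t g" 1 t] assms(1) by (simp add: Hs_def)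
  show "L2p.nrm (jm t h) = L2p.nrm (jm t g)"
    by (rule L2_nrm_cong) (use * assms(1,3) in \<open>auto simp: Hs_def jm_def elim!: eventually_mono\<close>)
qed

text \<open>This moves everything to concrete functions on the Fourier side. On Schwartz functions
  \<open>T\<close> is recovered from the density of its transform by inversion; elsewhere both sides
  vanish by the normalisation of distributions, so that equality is literal.\<close>

lemma sobolev_cases:
  assumes "T \<in> sobolev t"
  obtains g where "g \<in> Hs t" "T = lift g"
proof -
  obtain g where T: "tempered T" and g: "is_density g (fourier_distr T)"
    "integrable lborel (\<lambda>\<xi>. (1 + (norm \<xi>)\<^sup>2) powr t * (norm (g \<xi>))\<^sup>2)"
    using assms by (auto simp: sobolev_def)
  have [measurable]: "g \<in> borel_measurable borel" using g by (simp add: is_density_def)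
  have gH: "g \<in> Hs t" using g(2) integrable_Hs_iff[of g t] by simp
  have "T = lift g"
  proof
    fix \<phi>
    show "T \<phi> = lift g \<phi>"
    proof (cases "\<phi> \<in> schwartz")
      case True
      have "T \<phi> = fourier_distr T (inv_fourier \<phi>)"
        using True by (simp add: fourier_distr_def schwartz_inv_fourier fourier_inversion')
      also have "\<dots> = fun_distr g (inv_fourier \<phi>)" using g(1) by (simp add: is_density_def)
      finally show ?thesis using True by (simp add: fun_distr_def lift_def schwartz_inv_fourier)
    next
      case False
      then show ?thesis using T by (simp add: tempered_def lift_def)
    qed
  qed
  then show thesis using that gH by blast
qed

lemma sobolev_norm_lift:
  assumes "g \<in> Hs t"
  shows "sobolev_norm r (lift g) = L2p.nrm (jm r g)"
proof -
  have [measurable]: "g \<in> borel_measurable borel" by (rule Hs_measurable[OF assms])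
  have d: "is_density (ft (lift g)) (fourier_distr (lift g))"
    unfolding ft_def by (rule is_density_density_of[OF lift_is_density[OF assms]])
  then have [measurable]: "ft (lift g) \<in> borel_measurable borel" by (simp add: is_density_def)
  have "(LINT \<xi>|lborel. (1 + (norm \<xi>)\<^sup>2) powr r * (norm (ft (lift g) \<xi>))\<^sup>2) = (LINT \<xi>|lborel. (norm (jm r g \<xi>))\<^sup>2)"
    by (rule integral_cong_AE)
       (use ft_lift[OF assms] in \<open>auto simp: jm_def norm_mult power_mult_distrib J_sq elim!: eventually_mono\<close>)
  then show ?thesis
    unfolding sobolev_norm_def L2p_nrm ft_def by simp
qed

lemma lift_flc:
  assumes "g \<in> Hs t" "h \<in> Hs t"
  shows "lift (flc a g b h) = (\<lambda>\<phi>. a * lift g \<phi> + b * lift h \<phi>)"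
proof
  fix \<phi>
  show "lift (flc a g b h) \<phi> = a * lift g \<phi> + b * lift h \<phi>"
  proof (cases "\<phi> \<in> schwartz")
    case True
    have i: "integrable lborel (\<lambda>\<xi>. g \<xi> * inv_fourier \<phi> \<xi>)" "integrable lborel (\<lambda>\<xi>. h \<xi> * inv_fourier \<phi> \<xi>)"
      by (intro Hs_mult_integrable[OF assms(1)] Hs_mult_integrable[OF assms(2)] schwartz_Hs schwartz_inv_fourier True)+
    have "lift (flc a g b h) \<phi> = (LINT \<xi>|lborel. a * (g \<xi> * inv_fourier \<phi> \<xi>) + b * (h \<xi> * inv_fourier \<phi> \<xi>))"
      using True by (simp add: lift_def flc_def algebra_simps)
    also have "\<dots> = a * lift g \<phi> + b * lift h \<phi>"
      using True i by (simp add: lift_def)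
    finally show ?thesis .
  qed (simp add: lift_def)
qed

lemma bessel_lift:
  assumes "g \<in> Hs t"
  shows "bessel r (lift g) = lift (jm r g)"
proof
  fix \<phi>
  show "bessel r (lift g) \<phi> = lift (jm r g) \<phi>"
  proof (cases "\<phi> \<in> schwartz")
    case True
    define \<psi> where "\<psi> = jm r (fourier \<phi>)"
    have \<psi>: "\<psi> \<in> schwartz" unfolding \<psi>_def by (intro schwartz_jm schwartz_fourier True)
    have b: "bessel_schwartz r \<phi> = inv_fourier \<psi>"
      by (simp add: bessel_schwartz_def \<psi>_def jm_def J_def)
    have "inv_fourier (inv_fourier \<psi>) \<xi> = of_real (J r \<xi>) * inv_fourier \<phi> \<xi>" for \<xi>
      by (simp add: inv_fourier_fourier[of "inv_fourier \<psi>"] fourier_inversion'[OF \<psi>]) (simp add: \<psi>_def jm_def inv_fourier_fourier)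
    then show ?thesis
      using True schwartz_inv_fourier[OF \<psi>] by (simp add: bessel_def lift_def b jm_def mult_ac)
  qed (simp add: bessel_def lift_def)
qed

lemma fun_distr_lift:
  assumes f: "f \<in> L2_fun"
  obtains h where "h \<in> L2_fun" "fun_distr f = lift h" "L2p.nrm h = L2p.nrm f"
proof -
  obtain h where h: "h \<in> L2_fun" "L2p.nrm h = L2p.nrm f"
    "\<And>\<psi>. \<psi> \<in> schwartz \<Longrightarrow> (LINT x|lborel. f x * fourier \<psi> x) = (LINT x|lborel. h x * \<psi> x)"
    using plancherel[OF f] by blast
  have "fun_distr f = lift h"
    using h(3)[OF schwartz_inv_fourier] by (auto simp: fun_eq_iff fun_distr_def lift_def fourier_inversion')
  then show thesis using that h by blast
qed

lemma lift_fun_distr: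
  assumes h: "h \<in> L2_fun"
  obtains f where "f \<in> L2_fun" "lift h = fun_distr f"
proof -
  obtain f where f: "f \<in> L2_fun"
    "\<And>\<psi>. \<psi> \<in> schwartz \<Longrightarrow> (LINT x|lborel. f x * fourier \<psi> x) = (LINT x|lborel. h x * \<psi> x)"
    using plancherel_surj[OF h] by blast
  have "lift h = fun_distr f"
    using f(2)[OF schwartz_inv_fourier] by (auto simp: fun_eq_iff fun_distr_def lift_def fourier_inversion')
  then show thesis using that f by blast
qed

lemma lift_L2_iff: "lift ` L2_fun = L2"
proof
  show "lift ` L2_fun \<subseteq> L2"
  proof
    fix T assume "T \<in> lift ` L2_fun"
    then obtain h where "h \<in> L2_fun" "T = lift h" by blast
    then show "T \<in> L2" unfolding L2_def using lift_fun_distr[of h] by blast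
  qed
  show "L2 \<subseteq> lift ` L2_fun"
  proof
    fix T assume "T \<in> L2"
    then obtain f where "f \<in> L2_fun" "T = fun_distr f" unfolding L2_def by blast
    then show "T \<in> lift ` L2_fun" using fun_distr_lift[of f] by blast
  qed
qed

lemma sobolev_0: "sobolev 0 = L2"
  unfolding lift_L2_iff[symmetric] using lift_sobolev[of _ 0] by (auto simp: Hs_0 elim!: sobolev_cases)



text \<open>Plancherel's theorem for the representative that \<open>density_of\<close> happens to
  pick: \<open>h\<close> lives on the Fourier side, the density on the side of positions.\<close>

lemma density_of_lift:
  assumes h: "h \<in> L2_fun"
  shows "density_of (lift h) \<in> L2_fun" "fun_distr (density_of (lift h)) = lift h"
    "L2p.nrm (density_of (lift h)) = L2p.nrm h"
proof -
  obtain f where f: "f \<in> L2_fun" "lift h = fun_distr f" using lift_fun_distr[OF h] by blast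
  have d: "is_density f (lift h)" unfolding f(2) by (rule L2_is_density[OF f(1)])
  have d': "is_density (density_of (lift h)) (lift h)" by (rule is_density_density_of[OF d])
  then show "fun_distr (density_of (lift h)) = lift h" by (simp add: is_density_def)
  have m: "density_of (lift h) \<in> borel_measurable borel" using d' by (simp add: is_density_def)
  have ae: "AE x in lborel. f x = density_of (lift h) x"
    using density_of_AE[OF d] by (rule eventually_mono) simp
  then show L: "density_of (lift h) \<in> L2_fun"
    using Hs_cong(1)[of f 0 "density_of (lift h)"] f(1) m by (simp add: Hs_0)
  obtain k where k: "k \<in> L2_fun" "fun_distr f = lift k" "L2p.nrm k = L2p.nrm f"
    using fun_distr_lift[OF f(1)] by blast
  have "AE x in lborel. k x = h x"
    using is_density_unique[OF lift_is_density[of k 0] , of h] lift_is_density[of h 0] k h f(2) by (simp add: Hs_0)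
  then have "L2p.nrm k = L2p.nrm h" by (rule L2_nrm_cong[OF k(1) h])
  then show "L2p.nrm (density_of (lift h)) = L2p.nrm h"
    using L2_nrm_cong[OF f(1) L ae] k(3) by simp
qed

text \<open>Polarisation: all combinations of the two pairs have equal norms, and the cross terms
  for the coefficients 1 and \<i> determine the inner product.\<close>

lemma fip_density_of_lift:
  assumes h: "h \<in> L2_fun" and k: "k \<in> L2_fun"
  shows "fip (density_of (lift h)) (density_of (lift k)) = fip h k"
proof -
  note dh = density_of_lift[OF h] and dk = density_of_lift[OF k]
  have nrm: "L2p.nrm (flc a (density_of (lift h)) b (density_of (lift k))) = L2p.nrm (flc a h b k)" for a b
  proof -
    have hk: "flc a h b k \<in> L2_fun" by (rule L2p.lc_closed[OF h k])
    have D: "flc a (density_of (lift h)) b (density_of (lift k)) \<in> L2_fun" by (rule L2p.lc_closed[OF dh(1) dk(1)])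
    have "fun_distr (flc a (density_of (lift h)) b (density_of (lift k)))
        = (\<lambda>\<phi>. a * fun_distr (density_of (lift h)) \<phi> + b * fun_distr (density_of (lift k)) \<phi>)"
    proof
      fix \<phi>
      show "fun_distr (flc a (density_of (lift h)) b (density_of (lift k))) \<phi>
        = a * fun_distr (density_of (lift h)) \<phi> + b * fun_distr (density_of (lift k)) \<phi>"
      proof (cases "\<phi> \<in> schwartz")
        case True
        have "(LINT x|lborel. flc a (density_of (lift h)) b (density_of (lift k)) x * \<phi> x)
          = (LINT x|lborel. a * (density_of (lift h) x * \<phi> x) + b * (density_of (lift k) x * \<phi> x))"
          by (simp add: flc_def algebra_simps)
        then show ?thesis
          using True L2_mult_integrable[OF dh(1) schwartz_L2[OF True]] L2_mult_integrable[OF dk(1) schwartz_L2[OF True]]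
          by (simp add: fun_distr_def)
      qed (simp add: fun_distr_def)
    qed
    also have "\<dots> = lift (flc a h b k)"
      using lift_flc[of h 0 k a b] h k by (simp add: Hs_0 dh(2) dk(2))
    finally have "is_density (flc a (density_of (lift h)) b (density_of (lift k))) (lift (flc a h b k))"
      using L2_is_density[OF D] by simp
    from density_of_AE[OF this] have "AE x in lborel. flc a (density_of (lift h)) b (density_of (lift k)) x = density_of (lift (flc a h b k)) x"
      by (rule eventually_mono) simp
    then show ?thesis
      using L2_nrm_cong[OF D density_of_lift(1)[OF hk]] density_of_lift(3)[OF hk] by simp
  qed
  have "Re (b * fip (density_of (lift h)) (density_of (lift k))) = Re (b * fip h k)" for b
    using arg_cong[OF nrm[of 1 b], of power2]
    unfolding L2p.nrm_sq_lc[OF dh(1) dk(1)] L2p.nrm_sq_lc[OF h k] dh(3) dk(3)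
    by (simp add: power2_eq_square[of "L2p.nrm _"])
  from this[of 1] this[of \<i>] show ?thesis by (simp add: complex_eq_iff)
qed

section \<open>Vector-valued spaces on the Fourier side\<close>

definition lift4 :: "(4 \<Rightarrow> space \<Rightarrow> complex) \<Rightarrow> distr4" where
  "lift4 g = (\<chi> i. lift (g i))"

lemma lift4_nth [simp]: "lift4 g $ i = lift (g i)"
  by (simp add: lift4_def)

lemma sobolev4_iff: "u \<in> sobolev4 t \<longleftrightarrow> (\<exists>g. (\<forall>i. g i \<in> Hs t) \<and> u = lift4 g)"
proof
  assume "u \<in> sobolev4 t"
  then have "\<forall>i. \<exists>g. g \<in> Hs t \<and> u $ i = lift g"
    unfolding sobolev4_def by (metis (mono_tags, lifting) mem_Collect_eq sobolev_cases)
  then obtain g where "\<forall>i. g i \<in> Hs t \<and> u $ i = lift (g i)" by metis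
  then show "\<exists>g. (\<forall>i. g i \<in> Hs t) \<and> u = lift4 g"
    by (intro exI[of _ g]) (simp add: vec_eq_iff)
qed (auto simp: sobolev4_def lift_sobolev)

lemma L2_4_sobolev: "L2_4 = sobolev4 0"
  by (simp add: L2_4_def sobolev4_def sobolev_0)

lemma sobolev4_cases:
  assumes "u \<in> sobolev4 t"
  obtains g where "\<And>i. g i \<in> Hs t" "u = lift4 g"
  using assms sobolev4_iff by blast

lemma L2_4_cases:
  assumes "u \<in> L2_4"
  obtains g where "\<And>i. g i \<in> L2_fun" "u = lift4 g"
  using assms unfolding L2_4_sobolev sobolev4_iff Hs_0 by blast

lemma lift4_sobolev4: "(\<And>i. g i \<in> Hs t) \<Longrightarrow> lift4 g \<in> sobolev4 t"
  using sobolev4_iff by blast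

lemma lift4_L2_4: "(\<And>i. g i \<in> L2_fun) \<Longrightarrow> lift4 g \<in> L2_4"
  unfolding L2_4_sobolev by (rule lift4_sobolev4) (simp add: Hs_0)

lemma lincomb_lift4:
  "(\<And>i. g i \<in> Hs t) \<Longrightarrow> (\<And>i. h i \<in> Hs t) \<Longrightarrow> lincomb a (lift4 g) b (lift4 h) = lift4 (\<lambda>i. flc a (g i) b (h i))"
  by (simp add: vec_eq_iff lincomb_def lift_flc[of "g _" t "h _"])

lemma bessel4_lift4: "(\<And>i. g i \<in> Hs t) \<Longrightarrow> bessel4 r (lift4 g) = lift4 (\<lambda>i. jm r (g i))"
  by (simp add: vec_eq_iff bessel4_def bessel_lift[of "g _" t])

lemma sobolev4_norm_lift4:
  "(\<And>i. g i \<in> Hs t) \<Longrightarrow> sobolev4_norm r (lift4 g) = sqrt (\<Sum>i\<in>UNIV. (L2p.nrm (jm r (g i)))\<^sup>2)"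
  by (simp add: sobolev4_norm_def sobolev_norm_lift[of "g _" t])

lemma L2_inner_lift4:
  "(\<And>i. g i \<in> L2_fun) \<Longrightarrow> (\<And>i. h i \<in> L2_fun) \<Longrightarrow> L2_inner (lift4 g) (lift4 h) = (\<Sum>i\<in>UNIV. fip (g i) (h i))"
  unfolding L2_inner_def fip_def[symmetric] by (simp add: fip_density_of_lift)

lemma L2_norm_lift4:
  "(\<And>i. g i \<in> L2_fun) \<Longrightarrow> L2_norm (lift4 g) = sqrt (\<Sum>i\<in>UNIV. (L2p.nrm (g i))\<^sup>2)"
  unfolding L2_norm_def L2p_nrm_sq[symmetric] by (simp add: density_of_lift)

lemma bessel4_mem: "u \<in> sobolev4 t \<Longrightarrow> bessel4 r u \<in> sobolev4 (t - r)"
  by (elim sobolev4_cases) (auto simp: bessel4_lift4[of _ t] Hs_jm intro!: lift4_sobolev4)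

lemma bessel4_bessel4: "u \<in> sobolev4 t \<Longrightarrow> bessel4 r (bessel4 q u) = bessel4 (r + q) u"
  by (elim sobolev4_cases) (simp add: bessel4_lift4[of _ t] bessel4_lift4[of _ "t - q"] Hs_jm jm_jm)

lemma bessel4_lincomb:
  assumes "u \<in> sobolev4 t" "v \<in> sobolev4 t"
  shows "bessel4 r (lincomb a u b v) = lincomb a (bessel4 r u) b (bessel4 r v)"
proof -
  obtain g h where *: "\<And>i. g i \<in> Hs t" "u = lift4 g" "\<And>i. h i \<in> Hs t" "v = lift4 h"
    using assms by (elim sobolev4_cases) blast
  then show ?thesis
    by (simp add: lincomb_lift4[of _ t] lincomb_lift4[of _ "t - r"] bessel4_lift4[of _ t] Hs_flc Hs_jm jm_flc)
qed

lemma bessel4_norm: "u \<in> sobolev4 t \<Longrightarrow> sobolev4_norm q (bessel4 r u) = sobolev4_norm (q + r) u"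
  by (elim sobolev4_cases)
     (simp add: bessel4_lift4[of _ t] sobolev4_norm_lift4[of _ t] sobolev4_norm_lift4[of _ "t - r"] Hs_jm jm_jm)

lemma L2_norm_sobolev: "u \<in> L2_4 \<Longrightarrow> L2_norm u = sobolev4_norm 0 u"
  by (elim L2_4_cases) (simp add: L2_norm_lift4 sobolev4_norm_lift4[of _ 0] Hs_0)

lemma sobolev4_lincomb: "u \<in> sobolev4 t \<Longrightarrow> v \<in> sobolev4 t \<Longrightarrow> lincomb a u b v \<in> sobolev4 t"
proof -
  assume "u \<in> sobolev4 t" "v \<in> sobolev4 t"
  then obtain g h where *: "\<And>i. g i \<in> Hs t" "u = lift4 g" "\<And>i. h i \<in> Hs t" "v = lift4 h"
    by (elim sobolev4_cases) blast
  then show ?thesis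
    by (simp add: lincomb_lift4[of _ t] lift4_sobolev4 Hs_flc)
qed

lemma sobolev4_mono: "r \<le> t \<Longrightarrow> sobolev4 t \<subseteq> sobolev4 r"
proof
  fix u assume "r \<le> t" "u \<in> sobolev4 t"
  then obtain g where g: "\<And>i. g i \<in> Hs t" "u = lift4 g" using sobolev4_cases[of u t] by blast
  show "u \<in> sobolev4 r"
    unfolding g(2) by (rule lift4_sobolev4[OF Hs_mono(1)[OF g(1) \<open>r \<le> t\<close>]])
qed

lemma sobolev4_norm_mono:
  assumes "u \<in> sobolev4 t" "r \<le> t"
  shows "sobolev4_norm r u \<le> sobolev4_norm t u"
proof -
  obtain g where g: "\<And>i. g i \<in> Hs t" "u = lift4 g" using sobolev4_cases[OF assms(1)] by blast
  have "(L2p.nrm (jm r (g i)))\<^sup>2 \<le> (L2p.nrm (jm t (g i)))\<^sup>2" for i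
    using Hs_mono[OF g(1) assms(2), of i] by (intro power_mono L2p.nrm_nonneg) (auto simp: Hs_def)
  then show ?thesis
    unfolding g(2) sobolev4_norm_lift4[OF g(1)] by (intro real_sqrt_le_mono sum_mono)
qed

interpretation V4: hilbert L2_4 lincomb L2_inner
proof
  show "L2_4 \<noteq> {}"
    using lift4_L2_4[of "\<lambda>_. gauss"] schwartz_L2[OF gauss_schwartz] by blast
  show "lincomb a u b v \<in> L2_4" if "u \<in> L2_4" "v \<in> L2_4" for a u b v
    using that unfolding L2_4_sobolev by (rule sobolev4_lincomb)
  show "L2_inner w (lincomb a u b v) = a * L2_inner w u + b * L2_inner w v"
    if w: "w \<in> L2_4" and u: "u \<in> L2_4" and v: "v \<in> L2_4" for a b u v w
  proof -
    obtain f where f: "\<And>i. f i \<in> L2_fun" "w = lift4 f" using L2_4_cases[OF w] by blast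
    obtain g where g: "\<And>i. g i \<in> L2_fun" "u = lift4 g" using L2_4_cases[OF u] by blast
    obtain h where h: "\<And>i. h i \<in> L2_fun" "v = lift4 h" using L2_4_cases[OF v] by blast
    show ?thesis
      by (simp add: f g h lincomb_lift4[of _ 0] Hs_0 L2_inner_lift4 L2p.lc_closed L2p.ip_lc_right sum.distrib sum_distrib_left)
  qed
  show "L2_inner v u = cnj (L2_inner u v)" if u: "u \<in> L2_4" and v: "v \<in> L2_4" for u v
  proof -
    obtain g where g: "\<And>i. g i \<in> L2_fun" "u = lift4 g" using L2_4_cases[OF u] by blast
    obtain h where h: "\<And>i. h i \<in> L2_fun" "v = lift4 h" using L2_4_cases[OF v] by blast
    show ?thesis
      by (simp add: g h L2_inner_lift4 L2p.ip_cnj[of "g _" "h _"])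
  qed
  have ReL: "Re (L2_inner (lift4 g) (lift4 g)) = (\<Sum>i\<in>UNIV. (L2p.nrm (g i))\<^sup>2)" if "\<And>i. g i \<in> L2_fun" for g
    using that by (simp add: L2_inner_lift4 L2p.nrm_sq)
  show "0 \<le> Re (L2_inner u u)" if u: "u \<in> L2_4" for u
    using u by (elim L2_4_cases) (simp add: ReL sum_nonneg)
  fix X :: "nat \<Rightarrow> distr4"
  assume X: "\<And>n. X n \<in> L2_4"
    and step: "\<And>n. Re (L2_inner (lincomb 1 (X (Suc n)) (- 1) (X n)) (lincomb 1 (X (Suc n)) (- 1) (X n))) \<le> 4 * (1 / 4) ^ n"
  have "\<forall>n. \<exists>g. (\<forall>i. g i \<in> L2_fun) \<and> X n = lift4 g"
    using X unfolding L2_4_sobolev sobolev4_iff Hs_0 by blast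
  then obtain G where G: "\<And>n i. G n i \<in> L2_fun" "\<And>n. X n = lift4 (G n)" by metis
  have sub: "(\<lambda>x. f x - g x) \<in> L2_fun" if "f \<in> L2_fun" "g \<in> L2_fun" for f g
    using L2p.sub_closed[OF that] by (simp add: L2p_sub)
  have diff: "lincomb 1 (lift4 g) (- 1) (lift4 h) = lift4 (\<lambda>i x. g i x - h i x)" if "\<And>i. g i \<in> L2_fun" "\<And>i. h i \<in> L2_fun" for g h
    using that lincomb_lift4[of g 0 h 1 "- 1"] by (simp add: Hs_0 flc_def)
  have "\<forall>i. \<exists>l. l \<in> L2_fun \<and> (\<lambda>n. L2p.nrm (\<lambda>x. G n i x - l x)) \<longlonglongrightarrow> 0"
  proof
    fix i
    have "L2p.nrm (\<lambda>x. G (Suc n) i x - G n i x) \<le> 2 * (1 / 2) ^ n" for n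
    proof (rule power2_le_imp_le)
      have "(L2p.nrm (\<lambda>x. G (Suc n) i x - G n i x))\<^sup>2 \<le> (\<Sum>i\<in>UNIV. (L2p.nrm (\<lambda>x. G (Suc n) i x - G n i x))\<^sup>2)"
        by (rule member_le_sum) auto
      also have "\<dots> \<le> 4 * (1 / 4) ^ n"
        using step[of n] by (simp add: G diff ReL sub)
      also have "\<dots> = (2 * (1 / 2) ^ n)\<^sup>2"
        by (simp add: power2_eq_square power_mult_distrib[symmetric])
      finally show "(L2p.nrm (\<lambda>x. G (Suc n) i x - G n i x))\<^sup>2 \<le> (2 * (1 / 2) ^ n)\<^sup>2" .
    qed simp
    from this show "\<exists>l. l \<in> L2_fun \<and> (\<lambda>n. L2p.nrm (\<lambda>x. G n i x - l x)) \<longlonglongrightarrow> 0"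
      by (rule L2_complete[of "\<lambda>n. G n i", OF G(1)]) blast
  qed
  from choice[OF this] obtain l where l': "\<forall>i. l i \<in> L2_fun \<and> (\<lambda>n. L2p.nrm (\<lambda>x. G n i x - l i x)) \<longlonglongrightarrow> 0" ..
  have l: "\<And>i. l i \<in> L2_fun" "\<And>i. (\<lambda>n. L2p.nrm (\<lambda>x. G n i x - l i x)) \<longlonglongrightarrow> 0"
    using l' by (simp_all only:)
  have "(\<lambda>n. \<Sum>i\<in>UNIV. (L2p.nrm (\<lambda>x. G n i x - l i x))\<^sup>2) \<longlonglongrightarrow> (\<Sum>i\<in>(UNIV::4 set). 0\<^sup>2)"
    by (intro tendsto_sum tendsto_power l)
  then have "(\<lambda>n. Re (L2_inner (lincomb 1 (X n) (- 1) (lift4 l)) (lincomb 1 (X n) (- 1) (lift4 l)))) \<longlonglongrightarrow> 0"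
    by (simp add: G diff l ReL sub)
  then show "\<exists>l\<in>L2_4. (\<lambda>n. Re (L2_inner (lincomb 1 (X n) (- 1) l) (lincomb 1 (X n) (- 1) l))) \<longlonglongrightarrow> 0"
    using lift4_L2_4[of l] l(1) by blast
qed

lemma V4_nrm: "V4.nrm u = L2_norm u"
  unfolding V4.nrm_def L2_norm_def L2_inner_def
  by (simp add: fip_self[unfolded fip_def])

text \<open>The two notions differ only in the completeness clause, and for distributions a null
  vector is literally zero: functions that agree almost everywhere have the same
  \<open>lift\<close>.\<close>

lemma onb_iff: "orthonormal_basis E \<longleftrightarrow> V4.onb E"
proof -
  have "L2_norm u = 0 \<longleftrightarrow> u = (\<chi> i. (\<lambda>\<phi>. 0))" if u: "u \<in> L2_4" for u
  proof -
    obtain g where g: "\<And>i. g i \<in> L2_fun" "u = lift4 g" using L2_4_cases[OF u] by blast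
    have z: "(\<lambda>x. 0) \<in> L2_fun" "lift (\<lambda>x. 0) = (\<lambda>\<phi>. 0)" by (simp add: L2_fun_def, rule ext, simp add: lift_def)
    have "lift (g i) = (\<lambda>\<phi>. 0) \<longleftrightarrow> L2p.nrm (g i) = 0" for i
    proof
      assume "lift (g i) = (\<lambda>\<phi>. 0)"
      then have "AE x in lborel. g i x = 0"
        using ft_lift[of "g i" 0] ft_lift[of "\<lambda>x. 0" 0] z g(1) by (auto simp: Hs_0 elim: eventually_elim2)
      then have "L2p.nrm (g i) = L2p.nrm (\<lambda>x. 0)" by (intro L2_nrm_cong g z)
      then show "L2p.nrm (g i) = 0" by (simp add: L2p_nrm)
    next
      assume "L2p.nrm (g i) = 0"
      then have "(LINT x|lborel. (norm (g i x))\<^sup>2) = 0" by (simp add: L2p_nrm)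
      then have "AE x in lborel. g i x = 0"
        using L2_sq_integrable[OF g(1)] by (subst (asm) integral_nonneg_eq_0_iff_AE) auto
      then show "lift (g i) = (\<lambda>\<phi>. 0)"
        using lift_cong[of "g i" 0 "\<lambda>x. 0" 0] g(1) z by (simp add: Hs_0)
    qed
    then show ?thesis
      unfolding g(2) L2_norm_lift4[OF g(1)] by (simp add: sum_nonneg_eq_0_iff vec_eq_iff)
  qed
  then show ?thesis
    unfolding orthonormal_basis_def V4.onb_def V4_nrm by (auto simp: imp_conjL)
qed

subsection \<open>Convolution estimates\<close>

lemma L2_affine:
  assumes "f \<in> L2_fun" "\<bar>c\<bar> = 1"
  shows "(\<lambda>x. f (t + c *\<^sub>R x)) \<in> L2_fun" "L2p.nrm (\<lambda>x. f (t + c *\<^sub>R x)) = L2p.nrm f"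
proof -
  have [measurable]: "f \<in> borel_measurable borel" by (rule L2_measurable[OF assms(1)])
  show "(\<lambda>x. f (t + c *\<^sub>R x)) \<in> L2_fun"
    using integrable_affine[OF assms(2) L2_sq_integrable[OF assms(1)], of t] by (simp add: L2_fun_def)
  show "L2p.nrm (\<lambda>x. f (t + c *\<^sub>R x)) = L2p.nrm f"
    using integral_affine[OF assms(2), of "\<lambda>x. (norm (f x))\<^sup>2" t] by (simp add: L2p_nrm)
qed

lemmas L2_diff = L2_affine[where c = "-1", simplified]

lemma nn_integral_diff_swap:
  fixes f g :: "space \<Rightarrow> ennreal"
  assumes [measurable]: "f \<in> borel_measurable borel" "g \<in> borel_measurable borel"
  shows "(\<integral>\<^sup>+y. f (x - y) * g y \<partial>lborel) = (\<integral>\<^sup>+y. g (x - y) * f y \<partial>lborel)"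
  using nn_integral_affine[of "-1" "\<lambda>y. f (x - y) * g y" x] by (simp add: mult.commute)

lemma nn_CS_L2:
  assumes "f \<in> L2_fun" "g \<in> L2_fun"
  shows "(\<integral>\<^sup>+x. ennreal (norm (f x) * norm (g x)) \<partial>lborel) \<le> ennreal (L2p.nrm f * L2p.nrm g)"
proof -
  have [measurable]: "f \<in> borel_measurable borel" "g \<in> borel_measurable borel" using assms L2_measurable by auto
  have f: "(\<lambda>x. complex_of_real (norm (f x))) \<in> L2_fun" and g: "(\<lambda>x. complex_of_real (norm (g x))) \<in> L2_fun"
    using assms by (simp_all add: L2_fun_def)
  have i: "integrable lborel (\<lambda>x. norm (f x) * norm (g x))"
    using integrable_norm[OF L2_mult_integrable[OF f g]] by (simp add: norm_mult)
  have n: "L2p.nrm (\<lambda>x. complex_of_real (norm (f x))) = L2p.nrm f" "L2p.nrm (\<lambda>x. complex_of_real (norm (g x))) = L2p.nrm g"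
    by (simp_all add: L2p_nrm)
  have "fip (\<lambda>x. complex_of_real (norm (f x))) (\<lambda>x. complex_of_real (norm (g x))) = complex_of_real (LINT x|lborel. norm (f x) * norm (g x))"
    unfolding fip_def integral_complex_of_real[symmetric] by simp
  then have "\<bar>LINT x|lborel. norm (f x) * norm (g x)\<bar> \<le> L2p.nrm f * L2p.nrm g"
    using L2p.Cauchy_Schwarz[OF f g] n by simp
  then show ?thesis
    using i by (subst nn_integral_eq_integral) (auto intro!: ennreal_leI)
qed

lemma nn_CS:
  fixes u v :: "space \<Rightarrow> real"
  assumes [measurable]: "u \<in> borel_measurable borel" "v \<in> borel_measurable borel"
    and nn: "\<And>x. 0 \<le> u x" "\<And>x. 0 \<le> v x" and fin: "(\<integral>\<^sup>+x. ennreal ((u x)\<^sup>2) \<partial>lborel) < \<infinity>"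
  shows "(\<integral>\<^sup>+x. ennreal (u x * v x) \<partial>lborel)\<^sup>2 \<le> (\<integral>\<^sup>+x. ennreal ((u x)\<^sup>2) \<partial>lborel) * (\<integral>\<^sup>+x. ennreal ((v x)\<^sup>2) \<partial>lborel)"
proof (cases "(\<integral>\<^sup>+x. ennreal ((v x)\<^sup>2) \<partial>lborel) < \<infinity>")
  case True
  have "integrable lborel (\<lambda>x. (u x)\<^sup>2)" "integrable lborel (\<lambda>x. (v x)\<^sup>2)"
    using fin True by (auto intro!: integrableI_nonneg)
  then have L: "(\<lambda>x. complex_of_real (u x)) \<in> L2_fun" "(\<lambda>x. complex_of_real (v x)) \<in> L2_fun"
    by (simp_all add: L2_fun_def)
  have "(\<integral>\<^sup>+x. ennreal (u x * v x) \<partial>lborel)\<^sup>2 \<le> (ennreal (L2p.nrm (\<lambda>x. complex_of_real (u x)) * L2p.nrm (\<lambda>x. complex_of_real (v x))))\<^sup>2"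
    using nn_CS_L2[OF L] nn by (intro power_mono) auto
  also have "\<dots> = ennreal ((L2p.nrm (\<lambda>x. complex_of_real (u x)))\<^sup>2) * ennreal ((L2p.nrm (\<lambda>x. complex_of_real (v x)))\<^sup>2)"
    by (simp add: ennreal_power L2p.nrm_nonneg L power_mult_distrib ennreal_mult)
  also have "\<dots> = (\<integral>\<^sup>+x. ennreal ((u x)\<^sup>2) \<partial>lborel) * (\<integral>\<^sup>+x. ennreal ((v x)\<^sup>2) \<partial>lborel)"
    by (simp add: nn_integral_L2[OF L(1), symmetric] nn_integral_L2[OF L(2), symmetric])
  finally show ?thesis .
next
  case False
  then have inf: "(\<integral>\<^sup>+x. ennreal ((v x)\<^sup>2) \<partial>lborel) = \<infinity>" by (simp add: less_top[symmetric])
  show ?thesis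
  proof (cases "(\<integral>\<^sup>+x. ennreal ((u x)\<^sup>2) \<partial>lborel) = 0")
    case True
    then have "AE x in lborel. ennreal ((u x)\<^sup>2) = 0" by (subst (asm) nn_integral_0_iff_AE) auto
    then have "AE x in lborel. ennreal (u x * v x) = 0"
      by eventually_elim (use nn in \<open>simp add: ennreal_eq_0_iff\<close>)
    then have "(\<integral>\<^sup>+x. ennreal (u x * v x) \<partial>lborel) = 0" by (subst nn_integral_0_iff_AE) auto
    then show ?thesis by simp
  qed (simp add: inf ennreal_mult_top)
qed

text \<open>The convolution of absolute values, with values in \<open>ennreal\<close> so that
  estimates can precede any proof of integrability.\<close>

definition nconv :: "(space \<Rightarrow> complex) \<Rightarrow> (space \<Rightarrow> complex) \<Rightarrow> space \<Rightarrow> ennreal" where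
  "nconv a b \<xi> = (\<integral>\<^sup>+\<eta>. ennreal (norm (a (\<xi> - \<eta>)) * norm (b \<eta>)) \<partial>lborel)"

lemma nconv_commute:
  assumes "a \<in> borel_measurable borel" "b \<in> borel_measurable borel"
  shows "nconv a b = nconv b a"
  unfolding nconv_def
  using nn_integral_diff_swap[of "\<lambda>x. ennreal (norm (a x))" "\<lambda>x. ennreal (norm (b x))"] assms
  by (simp add: fun_eq_iff ennreal_mult)

lemma nconv_measurable:
  assumes [measurable]: "a \<in> borel_measurable borel" "b \<in> borel_measurable borel"
  shows "nconv a b \<in> borel_measurable borel"
  unfolding nconv_def[abs_def] by measurable

lemma nconv_le_L2:
  assumes "a \<in> L2_fun" "b \<in> L2_fun"
  shows "nconv a b \<xi> \<le> ennreal (L2p.nrm a * L2p.nrm b)"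
  using nn_CS_L2[OF L2_diff(1)[OF assms(1), of \<xi>] assms(2)] L2_diff(2)[OF assms(1), of \<xi>]
  by (simp add: nconv_def)

text \<open>Split the absolute value of \<open>a\<close> into two square roots, apply Cauchy-Schwarz
  at each \<xi>, and integrate over \<xi> by Tonelli's theorem.\<close>

lemma young:
  assumes a: "integrable lborel a" and b: "b \<in> L2_fun"
  shows "(\<integral>\<^sup>+\<xi>. (nconv a b \<xi>)\<^sup>2 \<partial>lborel) \<le> ennreal (((LINT x|lborel. norm (a x)) * L2p.nrm b)\<^sup>2)"
proof -
  have [measurable]: "a \<in> borel_measurable borel" using borel_measurable_integrable[OF a] by simp
  have [measurable]: "b \<in> borel_measurable borel" by (rule L2_measurable[OF b])
  define A where "A = (LINT x|lborel. norm (a x))"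
  have A: "(\<integral>\<^sup>+x. ennreal (norm (a x)) \<partial>lborel) = ennreal A"
    unfolding A_def by (rule nn_integral_eq_integral[OF integrable_norm[OF a]]) simp
  have A0: "0 \<le> A" unfolding A_def by (rule Bochner_Integration.integral_nonneg) simp
  have Axi: "(\<integral>\<^sup>+\<eta>. ennreal (norm (a (\<xi> - \<eta>))) \<partial>lborel) = ennreal A" for \<xi>
    using nn_integral_affine[of "-1" "\<lambda>x. ennreal (norm (a x))" \<xi>] by (simp add: A)
  have Aeta: "(\<integral>\<^sup>+\<xi>. ennreal (norm (a (\<xi> - \<eta>))) \<partial>lborel) = ennreal A" for \<eta>
    using nn_integral_affine[of 1 "\<lambda>x. ennreal (norm (a x))" "- \<eta>"] by (simp add: A)
  have pt: "(nconv a b \<xi>)\<^sup>2 \<le> ennreal A * (\<integral>\<^sup>+\<eta>. ennreal (norm (a (\<xi> - \<eta>)) * (norm (b \<eta>))\<^sup>2) \<partial>lborel)" for \<xi>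
  proof -
    have "(\<integral>\<^sup>+\<eta>. ennreal (sqrt (norm (a (\<xi> - \<eta>))) * (sqrt (norm (a (\<xi> - \<eta>))) * norm (b \<eta>))) \<partial>lborel)\<^sup>2
        \<le> (\<integral>\<^sup>+\<eta>. ennreal ((sqrt (norm (a (\<xi> - \<eta>))))\<^sup>2) \<partial>lborel) * (\<integral>\<^sup>+\<eta>. ennreal ((sqrt (norm (a (\<xi> - \<eta>))) * norm (b \<eta>))\<^sup>2) \<partial>lborel)"
      by (rule nn_CS) (auto simp: Axi)
    then show ?thesis
      by (simp add: nconv_def mult.assoc[symmetric] power_mult_distrib Axi)
  qed
  have "(\<integral>\<^sup>+\<xi>. (nconv a b \<xi>)\<^sup>2 \<partial>lborel) \<le> (\<integral>\<^sup>+\<xi>. ennreal A * (\<integral>\<^sup>+\<eta>. ennreal (norm (a (\<xi> - \<eta>)) * (norm (b \<eta>))\<^sup>2) \<partial>lborel) \<partial>lborel)"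
    by (intro nn_integral_mono pt)
  also have "\<dots> = ennreal A * (\<integral>\<^sup>+\<xi>. (\<integral>\<^sup>+\<eta>. ennreal (norm (a (\<xi> - \<eta>)) * (norm (b \<eta>))\<^sup>2) \<partial>lborel) \<partial>lborel)"
    by (rule nn_integral_cmult) measurable
  also have "(\<integral>\<^sup>+\<xi>. (\<integral>\<^sup>+\<eta>. ennreal (norm (a (\<xi> - \<eta>)) * (norm (b \<eta>))\<^sup>2) \<partial>lborel) \<partial>lborel)
      = (\<integral>\<^sup>+\<eta>. (\<integral>\<^sup>+\<xi>. ennreal (norm (a (\<xi> - \<eta>)) * (norm (b \<eta>))\<^sup>2) \<partial>lborel) \<partial>lborel)"
    by (rule lborel_pair.Fubini'[symmetric]) measurable
  also have "\<dots> = (\<integral>\<^sup>+\<eta>. ennreal A * ennreal ((norm (b \<eta>))\<^sup>2) \<partial>lborel)"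
    by (simp add: ennreal_mult nn_integral_multc Aeta)
  also have "\<dots> = ennreal A * ennreal ((L2p.nrm b)\<^sup>2)"
    by (simp add: nn_integral_cmult nn_integral_L2[OF b])
  also have "ennreal A * (ennreal A * ennreal ((L2p.nrm b)\<^sup>2)) = ennreal ((A * L2p.nrm b)\<^sup>2)"
    using A0 by (simp add: power2_eq_square ennreal_mult'[symmetric] mult_ac)
  finally show ?thesis by (simp add: A_def)
qed

lemma norm_integral_le_nn:
  fixes f :: "space \<Rightarrow> complex"
  shows "ennreal (norm (LINT x|lborel. f x)) \<le> (\<integral>\<^sup>+x. ennreal (norm (f x)) \<partial>lborel)"
proof (cases "integrable lborel f")
  case True
  then show ?thesis by (rule integral_norm_bound_ennreal)
qed (simp add: not_integrable_integral_eq)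

text \<open>A triangle inequality with the crude constant 2, which comes from comparing the sum with
  twice the maximum; all of it stays within non-negative integrals, and square-integrability of
  \<open>w\<close> is part of the result.\<close>

lemma L2_sum_bound:
  fixes Y1 Y2 :: "space \<Rightarrow> ennreal"
  assumes w: "w \<in> borel_measurable borel" and [measurable]: "Y1 \<in> borel_measurable borel" "Y2 \<in> borel_measurable borel"
    and le: "\<And>x. ennreal (norm (w x :: complex)) \<le> Y1 x + Y2 x"
    and A: "(\<integral>\<^sup>+x. (Y1 x)\<^sup>2 \<partial>lborel) \<le> ennreal (A\<^sup>2)" "0 \<le> A" and B: "(\<integral>\<^sup>+x. (Y2 x)\<^sup>2 \<partial>lborel) \<le> ennreal (B\<^sup>2)" "0 \<le> B"
  shows "w \<in> L2_fun" "L2p.nrm w \<le> 2 * (A + B)"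
proof -
  have pt: "ennreal ((norm (w x))\<^sup>2) \<le> 4 * (Y1 x)\<^sup>2 + 4 * (Y2 x)\<^sup>2" for x
  proof -
    have "ennreal ((norm (w x))\<^sup>2) = (ennreal (norm (w x)))\<^sup>2" by (simp add: ennreal_power)
    also have "\<dots> \<le> (2 * max (Y1 x) (Y2 x))\<^sup>2"
    proof (rule power_mono)
      have "Y1 x + Y2 x \<le> max (Y1 x) (Y2 x) + max (Y1 x) (Y2 x)" by (intro add_mono) auto
      then show "ennreal (norm (w x)) \<le> 2 * max (Y1 x) (Y2 x)"
        unfolding mult_2 by (rule order_trans[OF le])
    qed simp
    also have "\<dots> = 4 * (max (Y1 x) (Y2 x))\<^sup>2" by (simp add: power_mult_distrib)
    also have "\<dots> \<le> 4 * ((Y1 x)\<^sup>2 + (Y2 x)\<^sup>2)" by (intro mult_left_mono) (auto simp: max_def)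
    finally show ?thesis by (simp add: distrib_left)
  qed
  have "(\<integral>\<^sup>+x. ennreal ((norm (w x))\<^sup>2) \<partial>lborel) \<le> (\<integral>\<^sup>+x. 4 * (Y1 x)\<^sup>2 + 4 * (Y2 x)\<^sup>2 \<partial>lborel)"
    by (intro nn_integral_mono pt)
  also have "\<dots> = 4 * (\<integral>\<^sup>+x. (Y1 x)\<^sup>2 \<partial>lborel) + 4 * (\<integral>\<^sup>+x. (Y2 x)\<^sup>2 \<partial>lborel)"
    by (simp add: nn_integral_add nn_integral_cmult)
  also have "\<dots> \<le> 4 * ennreal (A\<^sup>2) + 4 * ennreal (B\<^sup>2)"
    by (intro add_mono mult_left_mono A B) auto
  also have "\<dots> = ennreal (4 * A\<^sup>2 + 4 * B\<^sup>2)"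
  proof -
    have "(4::ennreal) = ennreal 4" by simp
    show ?thesis
      unfolding \<open>(4::ennreal) = ennreal 4\<close> by (subst ennreal_plus) (auto simp: ennreal_mult)
  qed
  also have "\<dots> \<le> ennreal ((2 * (A + B))\<^sup>2)"
    using A(2) B(2) by (intro ennreal_leI) (simp add: power2_eq_square algebra_simps)
  finally have "(\<integral>\<^sup>+x. ennreal ((norm (w x))\<^sup>2) \<partial>lborel) \<le> ennreal ((2 * (A + B))\<^sup>2)" .
  from L2_nn_bound[OF w this] A(2) B(2) show "w \<in> L2_fun" "L2p.nrm w \<le> 2 * (A + B)" by auto
qed

section \<open>Weights under convolution\<close>

lemma J_sum_le: "0 \<le> s \<Longrightarrow> J s (a + b) \<le> 2 powr s * (J s a + J s b)"
proof -
  assume s: "0 \<le> s"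
  define m where "m = max (norm a) (norm b)"
  have "norm (a + b) \<le> 2 * m" using norm_triangle_ineq[of a b] by (simp add: m_def)
  then have "(norm (a + b))\<^sup>2 \<le> (2 * m)\<^sup>2" by (intro power_mono) auto
  then have "1 + (norm (a + b))\<^sup>2 \<le> 4 * (1 + m\<^sup>2)" by (simp add: power_mult_distrib)
  then have "J s (a + b) \<le> (4 * (1 + m\<^sup>2)) powr (s / 2)"
    unfolding J_def using s by (intro powr_mono2) auto
  also have "\<dots> = 2 powr s * (1 + m\<^sup>2) powr (s / 2)"
  proof -
    have "(4::real) powr (s / 2) = (2 powr 2) powr (s / 2)" by simp
    also have "\<dots> = 2 powr s" by (subst powr_powr) simp
    finally show ?thesis by (subst powr_mult) auto
  qed
  also have "(1 + m\<^sup>2) powr (s / 2) \<le> J s a + J s b"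
    by (cases "norm a \<le> norm b") (simp_all add: m_def J_def max_def)
  finally show ?thesis by simp
qed

text \<open>Peetre's inequality. It is weaker than \<open>J_sum_le\<close> in growth but
  multiplicative, so it separates the variables at a fixed frequency.\<close>

lemma J_peetre: "0 \<le> s \<Longrightarrow> J s (a + b) \<le> 2 powr s * (J s a * J s b)"
proof -
  assume s: "0 \<le> s"
  have "1 + (norm (a + b))\<^sup>2 \<le> 4 * ((1 + (norm a)\<^sup>2) * (1 + (norm b)\<^sup>2))"
  proof -
    have "(norm (a + b))\<^sup>2 \<le> (norm a + norm b)\<^sup>2" by (intro power_mono norm_triangle_ineq) simp
    also have "\<dots> \<le> 2 * (norm a)\<^sup>2 + 2 * (norm b)\<^sup>2"
      using sum_squares_bound[of "norm a" "norm b"] by (simp add: power2_sum)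
    finally have le: "(norm (a + b))\<^sup>2 \<le> 2 * (norm a)\<^sup>2 + 2 * (norm b)\<^sup>2" .
    have "0 \<le> (norm a)\<^sup>2 * (norm b)\<^sup>2" "0 \<le> (norm a)\<^sup>2" "0 \<le> (norm b)\<^sup>2" by auto
    moreover have "4 * ((1 + (norm a)\<^sup>2) * (1 + (norm b)\<^sup>2))
        = 4 + 4 * (norm a)\<^sup>2 + 4 * (norm b)\<^sup>2 + 4 * ((norm a)\<^sup>2 * (norm b)\<^sup>2)"
      by (simp add: algebra_simps)
    ultimately show ?thesis using le by linarith
  qed
  then have "J s (a + b) \<le> (4 * ((1 + (norm a)\<^sup>2) * (1 + (norm b)\<^sup>2))) powr (s / 2)"
    unfolding J_def using s by (intro powr_mono2) auto
  also have "\<dots> = 4 powr (s / 2) * (J s a * J s b)"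
    by (simp add: powr_mult J_def)
  also have "(4::real) powr (s / 2) = (2 powr 2) powr (s / 2)" by simp
  also have "\<dots> = 2 powr s" by (subst powr_powr) simp
  finally show ?thesis .
qed

definition CL1 :: "real \<Rightarrow> real" where
  "CL1 r = L2p.nrm (\<lambda>\<xi>. of_real (J (- r) \<xi>))"

lemma CL1_nonneg: "0 \<le> CL1 r"
  unfolding CL1_def by (simp add: L2p_nrm)

lemma Hs_L1:
  assumes r: "3 / 2 < r" and g: "g \<in> Hs r"
  shows "integrable lborel g" "(LINT x|lborel. norm (g x)) \<le> CL1 r * L2p.nrm (jm r g)"
proof -
  have [measurable]: "g \<in> borel_measurable borel" by (rule Hs_measurable[OF g])
  have J: "(\<lambda>\<xi>. complex_of_real (J (- r) \<xi>)) \<in> L2_fun" by (rule J_L2[OF r])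
  have "norm (complex_of_real (J (- r) x)) * norm (jm r g x) = norm (g x)" for x
    using J_minus_mult(1)[of r x] by (simp add: jm_def norm_mult mult.assoc[symmetric])
  then have le: "(\<integral>\<^sup>+x. ennreal (norm (g x)) \<partial>lborel) \<le> ennreal (CL1 r * L2p.nrm (jm r g))"
    using nn_CS_L2[OF J, of "jm r g"] g by (simp add: Hs_def CL1_def)
  then show i: "integrable lborel g"
    by (intro integrableI_bounded) (auto intro: le_less_trans)
  have "0 \<le> L2p.nrm (jm r g)" by (simp add: L2p_nrm)
  then show "(LINT x|lborel. norm (g x)) \<le> CL1 r * L2p.nrm (jm r g)"
    using le nn_integral_eq_integral[OF integrable_norm[OF i]] CL1_nonneg by (simp add: ennreal_le_iff)
qed

text \<open>The Fourier side of the product of two functions; \<open>cF\<close> is due to the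
  unitary normalisation.\<close>

definition cv :: "(space \<Rightarrow> complex) \<Rightarrow> (space \<Rightarrow> complex) \<Rightarrow> space \<Rightarrow> complex" where
  "cv F g \<xi> = cF * (LINT \<eta>|lborel. F (\<xi> - \<eta>) * g \<eta>)"

lemma cv_measurable:
  assumes [measurable]: "F \<in> borel_measurable borel" "g \<in> borel_measurable borel"
  shows "cv F g \<in> borel_measurable borel"
  unfolding cv_def[abs_def] by measurable

lemma norm_cv_le: "ennreal (norm (cv F g \<xi>)) \<le> ennreal (norm cF) * nconv F g \<xi>"
proof -
  have "ennreal (norm (cv F g \<xi>)) = ennreal (norm cF) * ennreal (norm (LINT \<eta>|lborel. F (\<xi> - \<eta>) * g \<eta>))"
    by (simp add: cv_def norm_mult ennreal_mult)
  also have "\<dots> \<le> ennreal (norm cF) * nconv F g \<xi>"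
    unfolding nconv_def using norm_integral_le_nn[of "\<lambda>\<eta>. F (\<xi> - \<eta>) * g \<eta>"]
    by (intro mult_left_mono) (auto simp: norm_mult)
  finally show ?thesis .
qed



lemma nconv_weight:
  assumes [measurable]: "F \<in> borel_measurable borel" "g \<in> borel_measurable borel"
    "F1 \<in> borel_measurable borel" "g1 \<in> borel_measurable borel" "F2 \<in> borel_measurable borel" "g2 \<in> borel_measurable borel"
    and c: "0 \<le> c" "0 \<le> d1" "0 \<le> d2"
    and le: "\<And>\<eta>. c * (norm (F (\<xi> - \<eta>)) * norm (g \<eta>)) \<le> d1 * (norm (F1 (\<xi> - \<eta>)) * norm (g1 \<eta>)) + d2 * (norm (F2 (\<xi> - \<eta>)) * norm (g2 \<eta>))"
  shows "ennreal c * nconv F g \<xi> \<le> ennreal d1 * nconv F1 g1 \<xi> + ennreal d2 * nconv F2 g2 \<xi>"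
proof -
  have "ennreal c * nconv F g \<xi> = (\<integral>\<^sup>+\<eta>. ennreal (c * (norm (F (\<xi> - \<eta>)) * norm (g \<eta>))) \<partial>lborel)"
    unfolding nconv_def using c by (simp add: ennreal_mult' nn_integral_cmult)
  also have "\<dots> \<le> (\<integral>\<^sup>+\<eta>. ennreal (d1 * (norm (F1 (\<xi> - \<eta>)) * norm (g1 \<eta>)) + d2 * (norm (F2 (\<xi> - \<eta>)) * norm (g2 \<eta>))) \<partial>lborel)"
    by (intro nn_integral_mono ennreal_leI le)
  also have "\<dots> = ennreal d1 * nconv F1 g1 \<xi> + ennreal d2 * nconv F2 g2 \<xi>"
    unfolding nconv_def using c by (simp add: ennreal_plus nn_integral_add ennreal_mult' nn_integral_cmult)
  finally show ?thesis .
qed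

lemma norm_jm: "norm (jm r g \<xi>) = J r \<xi> * norm (g \<xi>)"
  by (simp add: jm_def norm_mult)

lemma nn_sq_cmult:
  assumes "0 \<le> c" "0 \<le> A" "Y \<in> borel_measurable lborel" "(\<integral>\<^sup>+\<xi>. (Y \<xi>)\<^sup>2 \<partial>lborel) \<le> ennreal (A\<^sup>2)"
  shows "(\<integral>\<^sup>+\<xi>. (ennreal c * Y \<xi>)\<^sup>2 \<partial>lborel) \<le> ennreal ((c * A)\<^sup>2)"
proof -
  have "(\<integral>\<^sup>+\<xi>. (ennreal c * Y \<xi>)\<^sup>2 \<partial>lborel) = (ennreal c)\<^sup>2 * (\<integral>\<^sup>+\<xi>. (Y \<xi>)\<^sup>2 \<partial>lborel)"
    using assms(3) by (simp add: power_mult_distrib nn_integral_cmult)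
  also have "\<dots> \<le> (ennreal c)\<^sup>2 * ennreal (A\<^sup>2)" by (intro mult_left_mono assms) simp
  also have "\<dots> = ennreal ((c * A)\<^sup>2)"
    using assms by (simp add: ennreal_power power_mult_distrib ennreal_mult)
  finally show ?thesis .
qed

text \<open>The weight falls on one of the two factors by \<open>J_sum_le\<close>. The other factor
  is integrable because s > 3/2, and Young's inequality applies.\<close>

lemma cv_Hs:
  assumes s: "3 / 2 < s" and F: "F \<in> Hs s" and g: "g \<in> Hs s"
  shows "cv F g \<in> Hs s" "L2p.nrm (jm s (cv F g)) \<le> (4 * (norm cF * 2 powr s) * CL1 s) * L2p.nrm (jm s F) * L2p.nrm (jm s g)"
proof -
  have Fm[measurable]: "F \<in> borel_measurable borel" "g \<in> borel_measurable borel" using F g Hs_measurable by auto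
  have Jm[measurable]: "jm s F \<in> borel_measurable borel" "jm s g \<in> borel_measurable borel"
    by (intro jm_measurable Fm)+
  note mm = nconv_measurable[OF Jm(1) Fm(2)] nconv_measurable[OF Fm(1) Jm(2)]
  define c where "c = norm cF * 2 powr s"
  have c0: "0 \<le> c" by (simp add: c_def)
  define N where "N = L2p.nrm (jm s F)"
  define N' where "N' = L2p.nrm (jm s g)"
  have N0: "0 \<le> N" "0 \<le> N'" by (simp_all add: N_def N'_def L2p_nrm)
  have bound: "ennreal (norm (jm s (cv F g) \<xi>)) \<le> ennreal c * nconv (jm s F) g \<xi> + ennreal c * nconv F (jm s g) \<xi>" for \<xi>
  proof -
    have "ennreal (norm (jm s (cv F g) \<xi>)) = ennreal (J s \<xi>) * ennreal (norm (cv F g \<xi>))"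
      by (simp add: norm_jm ennreal_mult)
    also have "\<dots> \<le> ennreal (J s \<xi>) * (ennreal (norm cF) * nconv F g \<xi>)"
      by (intro mult_left_mono norm_cv_le) simp
    also have "\<dots> = ennreal (J s \<xi> * norm cF) * nconv F g \<xi>"
      by (simp add: ennreal_mult mult.assoc)
    also have "\<dots> \<le> ennreal c * nconv (jm s F) g \<xi> + ennreal c * nconv F (jm s g) \<xi>"
    proof (rule nconv_weight)
      fix \<eta>
      have "J s \<xi> \<le> 2 powr s * (J s (\<xi> - \<eta>) + J s \<eta>)"
        using J_sum_le[of s "\<xi> - \<eta>" \<eta>] s by simp
      then have "J s \<xi> * (norm cF * (norm (F (\<xi> - \<eta>)) * norm (g \<eta>)))
          \<le> (2 powr s * (J s (\<xi> - \<eta>) + J s \<eta>)) * (norm cF * (norm (F (\<xi> - \<eta>)) * norm (g \<eta>)))"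
        by (intro mult_right_mono) auto
      then show "J s \<xi> * norm cF * (norm (F (\<xi> - \<eta>)) * norm (g \<eta>))
        \<le> c * (norm (jm s F (\<xi> - \<eta>)) * norm (g \<eta>)) + c * (norm (F (\<xi> - \<eta>)) * norm (jm s g \<eta>))"
        by (simp add: norm_jm c_def algebra_simps)
    qed (use c0 in auto)
    finally show ?thesis .
  qed
  have L: "jm s F \<in> L2_fun" "jm s g \<in> L2_fun" using F g by (simp_all add: Hs_def)
  have "(\<integral>\<^sup>+\<xi>. (nconv (jm s F) g \<xi>)\<^sup>2 \<partial>lborel) \<le> ennreal (((LINT x|lborel. norm (g x)) * N)\<^sup>2)"
    using young[OF Hs_L1(1)[OF s g] L(1)] nconv_commute[OF Jm(1) Fm(2)] by (simp add: N_def)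
  also have "\<dots> \<le> ennreal ((CL1 s * N' * N)\<^sup>2)"
    using Hs_L1(2)[OF s g] N0 by (intro ennreal_leI power_mono mult_right_mono) (auto simp: N'_def)
  finally have 1: "(\<integral>\<^sup>+\<xi>. (ennreal c * nconv (jm s F) g \<xi>)\<^sup>2 \<partial>lborel) \<le> ennreal ((c * (CL1 s * N' * N))\<^sup>2)"
    using c0 CL1_nonneg[of s] N0 mm by (intro nn_sq_cmult) auto
  have "(\<integral>\<^sup>+\<xi>. (nconv F (jm s g) \<xi>)\<^sup>2 \<partial>lborel) \<le> ennreal (((LINT x|lborel. norm (F x)) * N')\<^sup>2)"
    using young[OF Hs_L1(1)[OF s F] L(2)] by (simp add: N'_def)
  also have "\<dots> \<le> ennreal ((CL1 s * N * N')\<^sup>2)"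
    using Hs_L1(2)[OF s F] N0 by (intro ennreal_leI power_mono mult_right_mono) (auto simp: N_def)
  finally have 2: "(\<integral>\<^sup>+\<xi>. (ennreal c * nconv F (jm s g) \<xi>)\<^sup>2 \<partial>lborel) \<le> ennreal ((c * (CL1 s * N * N'))\<^sup>2)"
    using c0 CL1_nonneg[of s] N0 mm by (intro nn_sq_cmult) auto
  have m: "jm s (cv F g) \<in> borel_measurable borel" by (intro jm_measurable cv_measurable Fm)
  note R = L2_sum_bound[OF m _ _ bound 1 _ 2]
  show "cv F g \<in> Hs s"
    unfolding Hs_def using c0 CL1_nonneg[of s] N0 mm by (auto intro!: R(1))
  have "L2p.nrm (jm s (cv F g)) \<le> 2 * (c * (CL1 s * N' * N) + c * (CL1 s * N * N'))"
    using c0 CL1_nonneg[of s] N0 mm by (intro R(2)) auto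
  then show "L2p.nrm (jm s (cv F g)) \<le> (4 * (norm cF * 2 powr s) * CL1 s) * L2p.nrm (jm s F) * L2p.nrm (jm s g)"
    unfolding c_def[symmetric] N_def[symmetric] N'_def[symmetric] by (simp add: algebra_simps)
qed

text \<open>The quotient of the weights at \<eta> and \<xi> is at most 2^s times 1 plus the quotient
  of those at \<xi> - \<eta> and \<xi>. For the first term \<open>F\<close> is integrable and
  Young's inequality applies. For the second the convolution of two square-integrable functions is
  bounded, and the remaining \<open>J (- s) \<xi>\<close> is square-integrable.\<close>

lemma cv_Hs_minus:
  assumes s: "3 / 2 < s" and F: "F \<in> Hs s" and g: "g \<in> Hs (- s)"
  shows "cv F g \<in> Hs (- s)" "L2p.nrm (jm (- s) (cv F g)) \<le> (4 * (norm cF * 2 powr s) * CL1 s) * L2p.nrm (jm s F) * L2p.nrm (jm (- s) g)"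
proof -
  have Fm[measurable]: "F \<in> borel_measurable borel" "g \<in> borel_measurable borel" using F g Hs_measurable by auto
  define G where "G = jm (- s) g"
  have Jm[measurable]: "jm s F \<in> borel_measurable borel" "G \<in> borel_measurable borel"
    unfolding G_def by (intro jm_measurable Fm)+
  note mm[measurable] = nconv_measurable[OF Jm(1) Jm(2)] nconv_measurable[OF Fm(1) Jm(2)]
  have L: "jm s F \<in> L2_fun" "G \<in> L2_fun" using F g by (simp_all add: Hs_def G_def)
  have gG: "norm (g \<eta>) = J s \<eta> * norm (G \<eta>)" for \<eta>
    using J_minus_mult(2)[of s \<eta>] by (simp add: G_def norm_jm mult.assoc[symmetric])
  define c where "c = norm cF * 2 powr s"
  have c0: "0 \<le> c" by (simp add: c_def)
  define N where "N = L2p.nrm (jm s F)"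
  define N' where "N' = L2p.nrm G"
  have N0: "0 \<le> N" "0 \<le> N'" by (simp_all add: N_def N'_def L2p_nrm)
  define Y where "Y \<xi> = ennreal (J (- s) \<xi>) * nconv (jm s F) G \<xi>" for \<xi>
  have Ym[measurable]: "Y \<in> borel_measurable borel" unfolding Y_def[abs_def] by measurable
  have bound: "ennreal (norm (jm (- s) (cv F g) \<xi>)) \<le> ennreal c * nconv F G \<xi> + ennreal c * Y \<xi>" for \<xi>
  proof -
    have "ennreal (norm (jm (- s) (cv F g) \<xi>)) = ennreal (J (- s) \<xi>) * ennreal (norm (cv F g \<xi>))"
      by (simp add: norm_jm ennreal_mult)
    also have "\<dots> \<le> ennreal (J (- s) \<xi>) * (ennreal (norm cF) * nconv F g \<xi>)"
      by (intro mult_left_mono norm_cv_le) simp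
    also have "\<dots> = ennreal (J (- s) \<xi> * norm cF) * nconv F g \<xi>"
      by (simp add: ennreal_mult mult.assoc)
    also have "\<dots> \<le> ennreal c * nconv F G \<xi> + ennreal (c * J (- s) \<xi>) * nconv (jm s F) G \<xi>"
    proof (rule nconv_weight)
      fix \<eta>
      have "J s \<eta> \<le> 2 powr s * (J s \<xi> + J s (\<xi> - \<eta>))"
        using J_sum_le[of s \<xi> "- (\<xi> - \<eta>)"] J_uminus[of s "\<xi> - \<eta>"] s by (simp del: minus_diff_eq J_uminus)
      then have "J (- s) \<xi> * J s \<eta> \<le> J (- s) \<xi> * (2 powr s * (J s \<xi> + J s (\<xi> - \<eta>)))"
        by (intro mult_left_mono) auto
      also have "\<dots> = 2 powr s * (J (- s) \<xi> * J s \<xi>) + 2 powr s * J (- s) \<xi> * J s (\<xi> - \<eta>)"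
        by (simp add: algebra_simps)
      finally have "J (- s) \<xi> * J s \<eta> \<le> 2 powr s + 2 powr s * J (- s) \<xi> * J s (\<xi> - \<eta>)"
        by (simp add: J_minus_mult)
      then have "(J (- s) \<xi> * J s \<eta>) * (norm cF * (norm (F (\<xi> - \<eta>)) * norm (G \<eta>)))
          \<le> (2 powr s + 2 powr s * J (- s) \<xi> * J s (\<xi> - \<eta>)) * (norm cF * (norm (F (\<xi> - \<eta>)) * norm (G \<eta>)))"
        by (intro mult_right_mono) auto
      then show "J (- s) \<xi> * norm cF * (norm (F (\<xi> - \<eta>)) * norm (g \<eta>))
        \<le> c * (norm (F (\<xi> - \<eta>)) * norm (G \<eta>)) + c * J (- s) \<xi> * (norm (jm s F (\<xi> - \<eta>)) * norm (G \<eta>))"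
        by (simp add: norm_jm gG c_def algebra_simps)
    qed (use c0 in auto)
    also have "\<dots> = ennreal c * nconv F G \<xi> + ennreal c * Y \<xi>"
      unfolding Y_def using c0 by (simp add: ennreal_mult mult.assoc)
    finally show ?thesis .
  qed
  have "(\<integral>\<^sup>+\<xi>. (Y \<xi>)\<^sup>2 \<partial>lborel) \<le> (\<integral>\<^sup>+\<xi>. ennreal ((N * N')\<^sup>2) * ennreal ((norm (complex_of_real (J (- s) \<xi>)))\<^sup>2) \<partial>lborel)"
  proof (rule nn_integral_mono)
    fix \<xi>
    have "(Y \<xi>)\<^sup>2 \<le> (ennreal (J (- s) \<xi>) * ennreal (N * N'))\<^sup>2"
      unfolding Y_def N_def N'_def by (intro power_mono mult_left_mono nconv_le_L2 L) auto
    also have "\<dots> = ennreal ((N * N')\<^sup>2) * ennreal ((norm (complex_of_real (J (- s) \<xi>)))\<^sup>2)"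
      using N0 by (simp add: power_mult_distrib ennreal_power ennreal_mult mult.commute)
    finally show "(Y \<xi>)\<^sup>2 \<le> ennreal ((N * N')\<^sup>2) * ennreal ((norm (complex_of_real (J (- s) \<xi>)))\<^sup>2)" .
  qed
  also have "\<dots> = ennreal ((N * N')\<^sup>2) * ennreal ((CL1 s)\<^sup>2)"
    unfolding CL1_def nn_integral_L2[OF J_L2[OF s], symmetric] by (rule nn_integral_cmult) measurable
  also have "\<dots> = ennreal ((CL1 s * N * N')\<^sup>2)"
    by (simp add: power_mult_distrib ennreal_mult mult_ac)
  finally have 1: "(\<integral>\<^sup>+\<xi>. (ennreal c * Y \<xi>)\<^sup>2 \<partial>lborel) \<le> ennreal ((c * (CL1 s * N * N'))\<^sup>2)"
    using c0 CL1_nonneg[of s] N0 by (intro nn_sq_cmult) auto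
  have "(\<integral>\<^sup>+\<xi>. (nconv F G \<xi>)\<^sup>2 \<partial>lborel) \<le> ennreal (((LINT x|lborel. norm (F x)) * N')\<^sup>2)"
    using young[OF Hs_L1(1)[OF s F] L(2)] by (simp add: N'_def)
  also have "\<dots> \<le> ennreal ((CL1 s * N * N')\<^sup>2)"
    using Hs_L1(2)[OF s F] N0 by (intro ennreal_leI power_mono mult_right_mono) (auto simp: N_def)
  finally have 2: "(\<integral>\<^sup>+\<xi>. (ennreal c * nconv F G \<xi>)\<^sup>2 \<partial>lborel) \<le> ennreal ((c * (CL1 s * N * N'))\<^sup>2)"
    using c0 CL1_nonneg[of s] N0 mm by (intro nn_sq_cmult) auto
  have m: "jm (- s) (cv F g) \<in> borel_measurable borel" by (intro jm_measurable cv_measurable Fm)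
  note R = L2_sum_bound[OF m _ _ bound 2 _ 1]
  show "cv F g \<in> Hs (- s)"
    unfolding Hs_def using c0 CL1_nonneg[of s] N0 mm by (auto intro!: R(1))
  have "L2p.nrm (jm (- s) (cv F g)) \<le> 2 * (c * (CL1 s * N * N') + c * (CL1 s * N * N'))"
    using c0 CL1_nonneg[of s] N0 mm by (intro R(2)) auto
  then show "L2p.nrm (jm (- s) (cv F g)) \<le> (4 * (norm cF * 2 powr s) * CL1 s) * L2p.nrm (jm s F) * L2p.nrm (jm (- s) g)"
    unfolding c_def[symmetric] N_def[symmetric] G_def[symmetric] N'_def[symmetric] by (simp add: algebra_simps)
qed

subsection \<open>Multiplication as a convolution\<close>

lemma cF_nonzero: "cF \<noteq> 0"
  by (simp add: cF_def)

lemma Hs_norm: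
  assumes "g \<in> Hs t"
  shows "(\<lambda>x. complex_of_real (norm (g x))) \<in> Hs t" "L2p.nrm (jm t (\<lambda>x. complex_of_real (norm (g x)))) = L2p.nrm (jm t g)"
proof -
  have [measurable]: "g \<in> borel_measurable borel" by (rule Hs_measurable[OF assms])
  have "jm t (\<lambda>x. complex_of_real (norm (g x))) \<in> borel_measurable borel" by (intro jm_measurable) measurable
  then show "(\<lambda>x. complex_of_real (norm (g x))) \<in> Hs t"
    using L2_sq_integrable[of "jm t g"] assms by (simp add: Hs_def L2_fun_def norm_jm)
  show "L2p.nrm (jm t (\<lambda>x. complex_of_real (norm (g x)))) = L2p.nrm (jm t g)"
    by (simp add: L2p_nrm norm_jm)
qed

text \<open>Peetre's inequality moves the weights onto the factors at the cost of a constant that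
  depends on \<xi>; so the convolution integral converges at every frequency, not only at almost
  all.\<close>

lemma nconv_finite:
  assumes s: "0 \<le> s" and F: "F \<in> Hs s" and g: "g \<in> Hs (- s)"
  shows "nconv F g \<xi> < \<infinity>"
proof -
  have Fm: "F \<in> borel_measurable borel" "g \<in> borel_measurable borel" using F g Hs_measurable by auto
  have L: "jm s F \<in> L2_fun" "jm (- s) g \<in> L2_fun" using F g by (simp_all add: Hs_def)
  have "ennreal 1 * nconv F g \<xi> \<le> ennreal (2 powr s * J s \<xi>) * nconv (jm s F) (jm (- s) g) \<xi> + ennreal 0 * nconv F g \<xi>"
  proof (rule nconv_weight)
    fix \<eta>
    have "J s \<eta> \<le> 2 powr s * (J s \<xi> * J s (\<xi> - \<eta>))"
      using J_peetre[OF s, of \<xi> "- (\<xi> - \<eta>)"] J_uminus[of s "\<xi> - \<eta>"] by (simp del: minus_diff_eq J_uminus)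
    then have "J s \<eta> * (norm (F (\<xi> - \<eta>)) * (J (- s) \<eta> * norm (g \<eta>)))
        \<le> (2 powr s * (J s \<xi> * J s (\<xi> - \<eta>))) * (norm (F (\<xi> - \<eta>)) * (J (- s) \<eta> * norm (g \<eta>)))"
      by (intro mult_right_mono) auto
    moreover have "J s \<eta> * (norm (F (\<xi> - \<eta>)) * (J (- s) \<eta> * norm (g \<eta>))) = (J s \<eta> * J (- s) \<eta>) * (norm (F (\<xi> - \<eta>)) * norm (g \<eta>))"
      by (simp only: mult_ac)
    ultimately have "norm (F (\<xi> - \<eta>)) * norm (g \<eta>) \<le> (2 powr s * (J s \<xi> * J s (\<xi> - \<eta>))) * (norm (F (\<xi> - \<eta>)) * (J (- s) \<eta> * norm (g \<eta>)))"
      by (simp only: J_minus_mult mult_1)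
    then show "1 * (norm (F (\<xi> - \<eta>)) * norm (g \<eta>))
        \<le> 2 powr s * J s \<xi> * (norm (jm s F (\<xi> - \<eta>)) * norm (jm (- s) g \<eta>)) + 0 * (norm (F (\<xi> - \<eta>)) * norm (g \<eta>))"
      by (simp add: norm_jm mult_ac)
  qed (use Fm in \<open>auto intro: jm_measurable\<close>)
  also have "\<dots> \<le> ennreal (2 powr s * J s \<xi>) * ennreal (L2p.nrm (jm s F) * L2p.nrm (jm (- s) g))"
    using nconv_le_L2[OF L, of \<xi>] by (simp add: mult_left_mono)
  also have "\<dots> < \<infinity>" by (simp add: ennreal_mult_less_top)
  finally show ?thesis by simp
qed

text \<open>Justifies the interchanges of integrals below: \<open>cv_Hs_minus\<close> is applied to
  absolute values and the result is paired with \<open>h\<close>. The second form is the first one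
  after the substitution \<eta> = \<zeta> - \<xi>.\<close>

lemma triple_integrable:
  assumes s: "3 / 2 < s" and F: "F \<in> Hs s" and g: "g \<in> Hs (- s)" and h: "h \<in> Hs s"
  shows "integrable (lborel \<Otimes>\<^sub>M lborel) (\<lambda>(\<zeta>, \<xi>). F (\<zeta> - \<xi>) * g \<xi> * h \<zeta>)"
    and "integrable (lborel \<Otimes>\<^sub>M lborel) (\<lambda>(\<xi>, \<eta>). F \<eta> * g \<xi> * h (\<xi> + \<eta>))"
proof -
  have [measurable]: "F \<in> borel_measurable borel" "g \<in> borel_measurable borel" "h \<in> borel_measurable borel"
    using F g h Hs_measurable by auto
  note nconv_measurable[measurable]
  define F' where "F' = (\<lambda>x. complex_of_real (norm (F x)))"
  define g' where "g' = (\<lambda>x. complex_of_real (norm (g x)))"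
  \<comment> \<open>For absolute values \<open>cv\<close> is \<open>nconv\<close> up to the
    constant. This is how a bound for the former shows that a non-negative integral is
    finite.\<close>
  have cv': "ennreal (norm (cv F' g' \<zeta>)) = ennreal (norm cF) * nconv F g \<zeta>" for \<zeta>
  proof -
    have fin: "nconv F g \<zeta> < \<infinity>" by (rule nconv_finite[OF _ F g]) (use s in simp)
    have i: "integrable lborel (\<lambda>\<xi>. norm (F (\<zeta> - \<xi>)) * norm (g \<xi>))"
      using fin unfolding nconv_def by (intro integrableI_nonneg) auto
    have "(LINT \<xi>|lborel. F' (\<zeta> - \<xi>) * g' \<xi>) = complex_of_real (LINT \<xi>|lborel. norm (F (\<zeta> - \<xi>)) * norm (g \<xi>))"
      unfolding F'_def g'_def integral_complex_of_real[symmetric] by simp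
    moreover have "0 \<le> (LINT \<xi>|lborel. norm (F (\<zeta> - \<xi>)) * norm (g \<xi>))"
      by (rule Bochner_Integration.integral_nonneg) simp
    ultimately have "ennreal (norm (cv F' g' \<zeta>)) = ennreal (norm cF) * ennreal (LINT \<xi>|lborel. norm (F (\<zeta> - \<xi>)) * norm (g \<xi>))"
      by (simp add: cv_def norm_mult ennreal_mult)
    also have "ennreal (LINT \<xi>|lborel. norm (F (\<zeta> - \<xi>)) * norm (g \<xi>)) = nconv F g \<zeta>"
      unfolding nconv_def using i by (intro nn_integral_eq_integral[symmetric]) auto
    finally show ?thesis .
  qed
  have "cv F' g' \<in> Hs (- s)"
    unfolding F'_def g'_def by (intro cv_Hs_minus(1)[OF s] Hs_norm F g)
  then have "(\<integral>\<^sup>+\<zeta>. ennreal (norm (jm (- s) (cv F' g') \<zeta>) * norm (jm s h \<zeta>)) \<partial>lborel) < \<infinity>"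
    using nn_CS_L2[of "jm (- s) (cv F' g')" "jm s h"] h by (auto simp: Hs_def intro: le_less_trans)
  moreover have "norm (jm (- s) (cv F' g') \<zeta>) * norm (jm s h \<zeta>) = norm (cv F' g' \<zeta>) * norm (h \<zeta>)" for \<zeta>
    using J_minus_mult(1)[of s \<zeta>] by (simp add: norm_jm)
  ultimately have "(\<integral>\<^sup>+\<zeta>. ennreal (norm (cv F' g' \<zeta>)) * ennreal (norm (h \<zeta>)) \<partial>lborel) < \<infinity>"
    by (simp add: ennreal_mult)
  then have "(\<integral>\<^sup>+\<zeta>. ennreal (norm cF) * (nconv F g \<zeta> * ennreal (norm (h \<zeta>))) \<partial>lborel) < \<infinity>"
    unfolding cv' by (simp add: mult.assoc)
  then have "ennreal (norm cF) * (\<integral>\<^sup>+\<zeta>. nconv F g \<zeta> * ennreal (norm (h \<zeta>)) \<partial>lborel) < \<infinity>"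
    by (subst (asm) nn_integral_cmult) auto
  then have fin: "(\<integral>\<^sup>+\<zeta>. nconv F g \<zeta> * ennreal (norm (h \<zeta>)) \<partial>lborel) < \<infinity>"
    using cF_nonzero by (auto simp: ennreal_mult_less_top)
  have eq: "nconv F g \<zeta> * ennreal (norm (h \<zeta>)) = (\<integral>\<^sup>+\<xi>. ennreal (norm (F (\<zeta> - \<xi>) * g \<xi> * h \<zeta>)) \<partial>lborel)" for \<zeta>
    unfolding nconv_def by (subst nn_integral_multc[symmetric]) (auto simp: norm_mult ennreal_mult)
  show "integrable (lborel \<Otimes>\<^sub>M lborel) (\<lambda>(\<zeta>, \<xi>). F (\<zeta> - \<xi>) * g \<xi> * h \<zeta>)"
  proof (rule integrableI_bounded)
    have "(\<integral>\<^sup>+p. ennreal (norm (case p of (\<zeta>, \<xi>) \<Rightarrow> F (\<zeta> - \<xi>) * g \<xi> * h \<zeta>)) \<partial>(lborel \<Otimes>\<^sub>M lborel))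
        = (\<integral>\<^sup>+\<zeta>. \<integral>\<^sup>+\<xi>. ennreal (norm (F (\<zeta> - \<xi>) * g \<xi> * h \<zeta>)) \<partial>lborel \<partial>lborel)"
      by (subst lborel.nn_integral_fst[symmetric]) auto
    then show "(\<integral>\<^sup>+p. ennreal (norm (case p of (\<zeta>, \<xi>) \<Rightarrow> F (\<zeta> - \<xi>) * g \<xi> * h \<zeta>)) \<partial>(lborel \<Otimes>\<^sub>M lborel)) < \<infinity>"
      using fin unfolding eq by simp
  qed measurable
  show "integrable (lborel \<Otimes>\<^sub>M lborel) (\<lambda>(\<xi>, \<eta>). F \<eta> * g \<xi> * h (\<xi> + \<eta>))"
  proof (rule integrableI_bounded)
    have "(\<integral>\<^sup>+p. ennreal (norm (case p of (\<xi>, \<eta>) \<Rightarrow> F \<eta> * g \<xi> * h (\<xi> + \<eta>))) \<partial>(lborel \<Otimes>\<^sub>M lborel))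
        = (\<integral>\<^sup>+\<xi>. \<integral>\<^sup>+\<eta>. ennreal (norm (F \<eta> * g \<xi> * h (\<xi> + \<eta>))) \<partial>lborel \<partial>lborel)"
      by (subst lborel.nn_integral_fst[symmetric]) auto
    also have "\<dots> = (\<integral>\<^sup>+\<xi>. \<integral>\<^sup>+\<zeta>. ennreal (norm (F (\<zeta> - \<xi>) * g \<xi> * h \<zeta>)) \<partial>lborel \<partial>lborel)"
    proof (rule nn_integral_cong)
      fix \<xi>
      show "(\<integral>\<^sup>+\<eta>. ennreal (norm (F \<eta> * g \<xi> * h (\<xi> + \<eta>))) \<partial>lborel) = (\<integral>\<^sup>+\<zeta>. ennreal (norm (F (\<zeta> - \<xi>) * g \<xi> * h \<zeta>)) \<partial>lborel)"
        using nn_integral_affine[of 1 "\<lambda>\<zeta>. ennreal (norm (F (\<zeta> - \<xi>) * g \<xi> * h \<zeta>))" \<xi>] by simp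
    qed
    also have "\<dots> = (\<integral>\<^sup>+\<zeta>. \<integral>\<^sup>+\<xi>. ennreal (norm (F (\<zeta> - \<xi>) * g \<xi> * h \<zeta>)) \<partial>lborel \<partial>lborel)"
      by (rule lborel_pair.Fubini'[symmetric]) measurable
    finally show "(\<integral>\<^sup>+p. ennreal (norm (case p of (\<xi>, \<eta>) \<Rightarrow> F \<eta> * g \<xi> * h (\<xi> + \<eta>))) \<partial>(lborel \<Otimes>\<^sub>M lborel)) < \<infinity>"
      using fin unfolding eq by simp
  qed measurable
qed

lemma cv_pairing:
  assumes s: "3 / 2 < s" and F: "F \<in> Hs s" and g: "g \<in> Hs (- s)" and h: "h \<in> Hs s"
  shows "(LINT \<zeta>|lborel. cv F g \<zeta> * h \<zeta>) = cF * (LINT \<xi>|lborel. g \<xi> * (LINT \<zeta>|lborel. F (\<zeta> - \<xi>) * h \<zeta>))"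
proof -
  have "(LINT \<zeta>|lborel. cv F g \<zeta> * h \<zeta>) = cF * (LINT \<zeta>|lborel. LINT \<xi>|lborel. F (\<zeta> - \<xi>) * g \<xi> * h \<zeta>)"
    unfolding cv_def by (simp add: mult.assoc flip: Bochner_Integration.integral_mult_left_zero)
  also have "(LINT \<zeta>|lborel. LINT \<xi>|lborel. F (\<zeta> - \<xi>) * g \<xi> * h \<zeta>) = (LINT \<xi>|lborel. LINT \<zeta>|lborel. F (\<zeta> - \<xi>) * g \<xi> * h \<zeta>)"
    using lborel_pair.Fubini_integral[OF triple_integrable(1)[OF assms]] by simp
  also have "\<dots> = (LINT \<xi>|lborel. g \<xi> * (LINT \<zeta>|lborel. F (\<zeta> - \<xi>) * h \<zeta>))"
    by (simp add: mult_ac flip: Bochner_Integration.integral_mult_right_zero)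
  finally show ?thesis .
qed

lemma inv_fourier_swap:
  assumes h: "integrable lborel h" and F: "integrable lborel F"
  shows "(LINT x|lborel. h x * inv_fourier F x) = (LINT \<eta>|lborel. F \<eta> * inv_fourier h \<eta>)"
proof -
  have m: "h \<in> borel_measurable borel" using borel_measurable_integrable[OF h] by simp
  have [measurable]: "h \<in> borel_measurable borel" "fourier F \<in> borel_measurable borel"
    using m fourier_measurable[OF F] by auto
  have "(LINT x|lborel. h x * fourier F (- x)) = (LINT x|lborel. h (- x) * fourier F x)"
    using integral_reflect[of "\<lambda>x. h x * fourier F (- x)"] by simp
  also have "\<dots> = (LINT \<eta>|lborel. fourier (\<lambda>x. h (- x)) \<eta> * F \<eta>)"
    by (rule fourier_swap[OF integrable_reflect[OF h] F])
  finally show ?thesis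
    by (simp add: inv_fourier_fourier fourier_reflect[OF m] mult.commute)
qed

text \<open>The inverse transform of an integrable \<open>F\<close> is a bounded function with the
  same distribution as \<open>f\<close>, and densities are unique up to null sets.\<close>

lemma L1_representative:
  assumes f: "f \<in> L2_fun" and F: "integrable lborel F" and eq: "fun_distr f = lift F"
  shows "AE x in lborel. f x = inv_fourier F x"
proof -
  have [measurable]: "inv_fourier F \<in> borel_measurable borel"
    using fourier_measurable[OF F] by (simp add: inv_fourier_fourier[abs_def])
  have b: "norm (inv_fourier F x) \<le> norm cF * (LINT x|lborel. norm (F x))" for x
    unfolding inv_fourier_fourier by (rule fourier_norm_le[OF F])
  have "is_density (inv_fourier F) (lift F)"
    unfolding is_density_def
  proof (intro conjI ballI)
    fix \<phi> :: "space \<Rightarrow> complex" assume \<phi>: "\<phi> \<in> schwartz"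
    show "integrable lborel (\<lambda>x. inv_fourier F x * \<phi> x)"
      using schwartz_measurable[OF \<phi>] b
      by (intro Bochner_Integration.integrable_bound[OF integrable_mult_right[OF schwartz_integrable[OF \<phi>], of "of_real (norm cF * (LINT x|lborel. norm (F x)))"]])
         (auto simp: norm_mult intro!: mult_right_mono order_trans[OF b] abs_ge_self)
  next
    show "lift F = fun_distr (inv_fourier F)"
    proof
      fix \<phi>
      show "lift F \<phi> = fun_distr (inv_fourier F) \<phi>"
        using inv_fourier_swap[OF _ F, of \<phi>] schwartz_integrable[of \<phi>]
        by (simp add: lift_def fun_distr_def mult.commute)
    qed
  qed simp
  then show ?thesis
    using is_density_unique[OF L2_is_density[OF f]] eq by simp
qed

text \<open>Each clause of \<open>mult\<close>, tested against \<open>\<phi> = fourier h\<close>,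
  leads to the same double integral of F \<eta>, g \<xi> and h (\<xi> + \<eta>), which is the test
  of the convolution. Thus the case distinction in \<open>mult\<close> disappears on the Fourier
  side.\<close>

lemma mult_lift:
  assumes s: "3 / 2 < s" and f: "f \<in> L2_fun" and F: "F \<in> Hs s" and eq: "fun_distr f = lift F" and g: "g \<in> Hs (- s)"
  shows "mult f (lift g) = lift (cv F g)"
proof
  fix \<phi>
  have F1: "integrable lborel F" by (rule Hs_L1(1)[OF s F])
  have [measurable]: "F \<in> borel_measurable borel" "g \<in> borel_measurable borel" "f \<in> borel_measurable borel"
    using F g f Hs_measurable L2_measurable by auto
  have fF: "AE x in lborel. f x = inv_fourier F x" by (rule L1_representative[OF f F1 eq])
  have [measurable]: "inv_fourier F \<in> borel_measurable borel"
    using fourier_measurable[OF F1] by (simp add: inv_fourier_fourier[abs_def])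
  show "mult f (lift g) \<phi> = lift (cv F g) \<phi>"
  proof (cases "\<phi> \<in> schwartz")
    case True
    define h where "h = inv_fourier \<phi>"
    have h: "h \<in> schwartz" unfolding h_def by (rule schwartz_inv_fourier[OF True])
    have Fh: "fourier h = \<phi>" unfolding h_def by (rule fourier_inversion'[OF True])
    have [measurable]: "\<phi> \<in> borel_measurable borel" "h \<in> borel_measurable borel"
      using True h schwartz_measurable by auto
    have "lift (cv F g) \<phi> = cF * (LINT \<xi>|lborel. g \<xi> * (LINT \<zeta>|lborel. F (\<zeta> - \<xi>) * h \<zeta>))"
      using cv_pairing[OF s F g schwartz_Hs[OF h]] True by (simp add: lift_def h_def)
    also have "\<dots> = cF * (LINT \<xi>|lborel. g \<xi> * (LINT \<eta>|lborel. F \<eta> * h (\<xi> + \<eta>)))"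
      using integral_affine[of 1 "\<lambda>\<zeta>. F (\<zeta> - \<xi>) * h \<zeta>" \<xi> for \<xi>] by simp
    finally have R: "lift (cv F g) \<phi> = cF * (LINT \<xi>|lborel. g \<xi> * (LINT \<eta>|lborel. F \<eta> * h (\<xi> + \<eta>)))" .
    show ?thesis
    proof (cases "lift g \<in> L2")
      case False
      \<comment> \<open>Replace \<open>f\<close> by the inverse transform of \<open>F\<close> and
        move the transform to the other factor; there the modulation by
        \<open>cis (x \<bullet> \<xi>)\<close> becomes a translation of \<open>h\<close>.\<close>
      have "fourier (\<lambda>x. f x * \<phi> x) (- \<xi>) = cF * (LINT \<eta>|lborel. F \<eta> * h (\<xi> + \<eta>))" for \<xi>
      proof -
        have "(LINT x|lborel. cis (- (x \<bullet> (- \<xi>))) * (f x * \<phi> x)) = (LINT x|lborel. (cis (x \<bullet> \<xi>) * \<phi> x) * inv_fourier F x)"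
          by (rule integral_cong_AE) (use fF in \<open>auto elim!: eventually_mono\<close>)
        also have "\<dots> = (LINT \<eta>|lborel. F \<eta> * inv_fourier (\<lambda>x. cis (x \<bullet> \<xi>) * \<phi> x) \<eta>)"
          by (rule inv_fourier_swap[OF cis_mult_integrable[OF schwartz_integrable[OF True]] F1])
        also have "inv_fourier (\<lambda>x. cis (x \<bullet> \<xi>) * \<phi> x) = (\<lambda>\<eta>. h (\<xi> + \<eta>))"
        proof
          fix \<eta>
          have "cis (\<eta> \<bullet> x) * (cis (x \<bullet> \<xi>) * \<phi> x) = cis ((\<xi> + \<eta>) \<bullet> x) * \<phi> x" for x
            by (simp add: mult.assoc[symmetric] cis_mult inner_add_left inner_add_right inner_commute add.commute)
          then show "inv_fourier (\<lambda>x. cis (x \<bullet> \<xi>) * \<phi> x) \<eta> = h (\<xi> + \<eta>)"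
            unfolding h_def inv_fourier_eq by (simp only:)
        qed
        finally show ?thesis unfolding fourier_eq by simp
      qed
      note four = this
      have "mult f (lift g) \<phi> = (LINT \<xi>|lborel. ft (lift g) \<xi> * (cF * (LINT \<eta>|lborel. F \<eta> * h (\<xi> + \<eta>))))"
        using False True by (simp add: mult_def pairing_def four ft_def)
      also have "\<dots> = (LINT \<xi>|lborel. g \<xi> * (cF * (LINT \<eta>|lborel. F \<eta> * h (\<xi> + \<eta>))))"
      proof (rule integral_cong_AE)
        have "is_density (ft (lift g)) (fourier_distr (lift g))"
          unfolding ft_def by (rule is_density_density_of[OF lift_is_density[OF g]])
        then have [measurable]: "ft (lift g) \<in> borel_measurable borel" by (simp add: is_density_def)
        show "(\<lambda>\<xi>. ft (lift g) \<xi> * (cF * (LINT \<eta>|lborel. F \<eta> * h (\<xi> + \<eta>)))) \<in> borel_measurable lborel"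
          by measurable
        show "AE \<xi> in lborel. ft (lift g) \<xi> * (cF * (LINT \<eta>|lborel. F \<eta> * h (\<xi> + \<eta>))) = g \<xi> * (cF * (LINT \<eta>|lborel. F \<eta> * h (\<xi> + \<eta>)))"
          using ft_lift[OF g] by eventually_elim simp
      qed measurable
      also have "\<dots> = lift (cv F g) \<phi>"
        unfolding R by (simp add: mult.left_commute)
      finally show ?thesis .
    next
      case True': True
      then obtain k where k: "k \<in> L2_fun" "lift g = lift k" unfolding lift_L2_iff[symmetric] by blast
      define d where "d = density_of (lift g)"
      have d: "d \<in> L2_fun" "fun_distr d = lift g" unfolding d_def k(2) by (intro density_of_lift[OF k(1)])+
      have [measurable]: "d \<in> borel_measurable borel" by (rule L2_measurable[OF d(1)])
      have dphi: "integrable lborel (\<lambda>x. d x * \<phi> x)" by (rule L2_mult_integrable[OF d(1) schwartz_L2[OF True]])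
      \<comment> \<open>For square-integrable \<open>g\<close> the product \<open>d \<phi>\<close>
        is integrable, so the transform can be moved from \<open>F\<close> to it. The value at
        \<eta> is the distribution \<open>lift g\<close> tested with the transform of a translate of
        \<open>h\<close>.\<close>
      have "mult f (lift g) \<phi> = (LINT x|lborel. (f x * d x) * \<phi> x)"
        using True' True by (simp add: mult_def fun_distr_def d_def)
      also have "\<dots> = (LINT x|lborel. (d x * \<phi> x) * inv_fourier F x)"
        by (rule integral_cong_AE) (use fF in \<open>auto elim!: eventually_mono\<close>)
      also have "\<dots> = (LINT \<eta>|lborel. F \<eta> * inv_fourier (\<lambda>x. d x * \<phi> x) \<eta>)"
        by (rule inv_fourier_swap[OF dphi F1])
      also have "inv_fourier (\<lambda>x. d x * \<phi> x) \<eta> = cF * (LINT \<xi>|lborel. g \<xi> * h (\<xi> + \<eta>))" for \<eta>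
      proof -
        have ht: "(\<lambda>y. h (y + \<eta>)) \<in> schwartz" by (rule schwartz_translate[OF h])
        have "(LINT x|lborel. cis (\<eta> \<bullet> x) * (d x * \<phi> x)) = (LINT x|lborel. d x * fourier (\<lambda>y. h (y + \<eta>)) x)"
          by (simp add: fourier_translate[OF schwartz_measurable[OF h]] Fh mult_ac)
        also have "\<dots> = fun_distr d (fourier (\<lambda>y. h (y + \<eta>)))"
          using schwartz_fourier[OF ht] by (simp add: fun_distr_def)
        also have "\<dots> = (LINT \<xi>|lborel. g \<xi> * h (\<xi> + \<eta>))"
          unfolding d(2) using schwartz_fourier[OF ht] by (simp add: lift_def fourier_inversion[OF ht])
        finally show ?thesis by (simp add: inv_fourier_eq)
      qed
      then have "(LINT \<eta>|lborel. F \<eta> * inv_fourier (\<lambda>x. d x * \<phi> x) \<eta>) = cF * (LINT \<eta>|lborel. LINT \<xi>|lborel. F \<eta> * g \<xi> * h (\<xi> + \<eta>))"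
        by (simp add: mult.left_commute[of _ cF] mult.assoc)
      also have "(LINT \<eta>|lborel. LINT \<xi>|lborel. F \<eta> * g \<xi> * h (\<xi> + \<eta>)) = (LINT \<xi>|lborel. LINT \<eta>|lborel. F \<eta> * g \<xi> * h (\<xi> + \<eta>))"
        using lborel_pair.Fubini_integral[OF triple_integrable(2)[OF s F g schwartz_Hs[OF h]]] by simp
      also have "\<dots> = (LINT \<xi>|lborel. g \<xi> * (LINT \<eta>|lborel. F \<eta> * h (\<xi> + \<eta>)))"
        by (simp add: mult_ac flip: Bochner_Integration.integral_mult_right_zero)
      finally show ?thesis unfolding R .
    qed
  qed (simp add: mult_def lift_def fun_distr_def)
qed

lemma sobolev_fun_cases:
  assumes "f \<in> sobolev_fun s"
  obtains F where "f \<in> L2_fun" "F \<in> Hs s" "fun_distr f = lift F" "sobolev_norm s (fun_distr f) = L2p.nrm (jm s F)"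
proof -
  have f: "f \<in> L2_fun" "fun_distr f \<in> sobolev s" using assms by (auto simp: sobolev_fun_def)
  obtain F where "F \<in> Hs s" "fun_distr f = lift F" using sobolev_cases[OF f(2)] by blast
  then show thesis using that f sobolev_norm_lift[of F s s] by metis
qed

text \<open>\<open>real_of_ereal\<close> sends infinite values to 0, so the essential supremum has
  to be shown finite. The integral of the absolute value of \<open>F\<close> bounds it from above,
  and it is at least 0 because Lebesgue measure is not zero.\<close>

lemma Linf_bound:
  assumes s: "3 / 2 < s" and f: "f \<in> L2_fun" and F: "F \<in> Hs s" and eq: "fun_distr f = lift F"
  shows "0 \<le> Linf_norm f" "AE x in lborel. norm (f x) \<le> Linf_norm f"
proof -
  have F1: "integrable lborel F" by (rule Hs_L1(1)[OF s F])
  have [measurable]: "f \<in> borel_measurable borel" by (rule L2_measurable[OF f])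
  define K where "K = norm cF * (LINT x|lborel. norm (F x))"
  have "AE x in lborel. ereal (norm (f x)) \<le> ereal K"
    using L1_representative[OF f F1 eq]
    by eventually_elim (simp add: K_def inv_fourier_fourier fourier_norm_le[OF F1])
  then have up: "esssup lborel (\<lambda>x. ereal (norm (f x))) \<le> ereal K"
    by (intro esssup_I) auto
  have ae: "AE x in lborel. ereal (norm (f x)) \<le> esssup lborel (\<lambda>x. ereal (norm (f x)))"
    by (rule esssup_AE)
  have "ae_filter (lborel :: space measure) \<noteq> bot"
    by (simp add: ae_filter_eq_bot_iff emeasure_lborel_UNIV)
  moreover have "AE x in (lborel :: space measure). 0 \<le> esssup lborel (\<lambda>x. ereal (norm (f x)))"
    using ae by eventually_elim (rule order_trans[of _ "ereal (norm (f _))"], auto)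
  ultimately have low: "0 \<le> esssup lborel (\<lambda>x. ereal (norm (f x)))"
    by (simp add: eventually_const)
  show "0 \<le> Linf_norm f" unfolding Linf_norm_def using low by (rule real_of_ereal_pos)
  have "ereal (Linf_norm f) = esssup lborel (\<lambda>x. ereal (norm (f x)))"
    unfolding Linf_norm_def using low up by (cases "esssup lborel (\<lambda>x. ereal (norm (f x)))") auto
  then show "AE x in lborel. norm (f x) \<le> Linf_norm f"
    using ae by (simp flip: ereal_less_eq(3))
qed

text \<open>The supremum norm enters here, by Plancherel's theorem on both sides of pointwise
  multiplication. It bounds convolution with \<open>F\<close> as an operator and says nothing about
  the size of \<open>F\<close>.\<close>

lemma cv_Linf:
  assumes s: "3 / 2 < s" and f: "f \<in> L2_fun" and F: "F \<in> Hs s" and eq: "fun_distr f = lift F" and g: "g \<in> L2_fun"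
  shows "cv F g \<in> L2_fun" "L2p.nrm (cv F g) \<le> Linf_norm f * L2p.nrm g"
proof -
  have gH: "g \<in> Hs (- s)" using Hs_mono(1)[of g 0 "- s"] g s by (simp add: Hs_0)
  define d where "d = density_of (lift g)"
  have d: "d \<in> L2_fun" "fun_distr d = lift g" "L2p.nrm d = L2p.nrm g"
    unfolding d_def by (intro density_of_lift[OF g])+
  have [measurable]: "f \<in> borel_measurable borel" "d \<in> borel_measurable borel" using f d L2_measurable by auto
  note L = Linf_bound[OF s f F eq]
  have ae: "AE x in lborel. norm (f x * d x) \<le> Linf_norm f * norm (d x)"
    using L(2) by eventually_elim (simp add: norm_mult mult_right_mono)
  have fd: "(\<lambda>x. f x * d x) \<in> L2_fun" "L2p.nrm (\<lambda>x. f x * d x) \<le> Linf_norm f * L2p.nrm d"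
    by (rule L2_nrm_mono[OF _ d(1) L(1) ae]; simp)+
  obtain k where k: "k \<in> L2_fun" "fun_distr (\<lambda>x. f x * d x) = lift k" "L2p.nrm k = L2p.nrm (\<lambda>x. f x * d x)"
    using fun_distr_lift[OF fd(1)] by blast
  have "lift g \<in> L2" using g unfolding lift_L2_iff[symmetric] by blast
  then have "lift (cv F g) = lift k"
    unfolding mult_lift[OF s f F eq gH, symmetric] k(2)[symmetric] by (simp add: mult_def d_def)
  then have "is_density (cv F g) (fourier_distr (lift k))"
    using lift_is_density[OF cv_Hs_minus(1)[OF s F gH]] by simp
  then have "AE \<xi> in lborel. k \<xi> = cv F g \<xi>"
    using is_density_unique[OF lift_is_density[of k 0]] k(1) by (simp add: Hs_0)
  from Hs_cong[of k 0, OF _ _ this] k(1) cv_measurable[OF Hs_measurable[OF F] L2_measurable[OF g]]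
  have "cv F g \<in> L2_fun" "L2p.nrm (cv F g) = L2p.nrm k" by (simp_all add: Hs_0)
  then show "cv F g \<in> L2_fun" "L2p.nrm (cv F g) \<le> Linf_norm f * L2p.nrm g"
    using k(3) fd(2) d(3) by auto
qed

lemma lift_cnj:
  assumes f: "f \<in> L2_fun" and F: "F \<in> Hs s" and eq: "fun_distr f = lift F"
  shows "fun_distr (\<lambda>x. cnj (f x)) = lift (\<lambda>\<eta>. cnj (F (- \<eta>)))" "(\<lambda>\<eta>. cnj (F (- \<eta>))) \<in> Hs s"
    "L2p.nrm (jm s (\<lambda>\<eta>. cnj (F (- \<eta>)))) = L2p.nrm (jm s F)"
proof -
  have [measurable]: "F \<in> borel_measurable borel" by (rule Hs_measurable[OF F])
  show "fun_distr (\<lambda>x. cnj (f x)) = lift (\<lambda>\<eta>. cnj (F (- \<eta>)))"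
  proof
    fix \<phi>
    show "fun_distr (\<lambda>x. cnj (f x)) \<phi> = lift (\<lambda>\<eta>. cnj (F (- \<eta>))) \<phi>"
    proof (cases "\<phi> \<in> schwartz")
      case True
      have [measurable]: "fourier \<phi> \<in> borel_measurable borel" by (rule schwartz_measurable[OF schwartz_fourier[OF True]])
      have "(LINT x|lborel. cnj (f x) * \<phi> x) = cnj (LINT x|lborel. f x * cnj (\<phi> x))"
        by (simp flip: Bochner_Integration.integral_cnj)
      also have "(LINT x|lborel. f x * cnj (\<phi> x)) = (LINT \<eta>|lborel. F \<eta> * inv_fourier (\<lambda>x. cnj (\<phi> x)) \<eta>)"
        using fun_cong[OF eq, of "\<lambda>x. cnj (\<phi> x)"] schwartz_cnj[OF True] by (simp add: fun_distr_def lift_def)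
      also have "cnj \<dots> = (LINT \<eta>|lborel. cnj (F \<eta>) * fourier \<phi> \<eta>)"
        by (simp add: inv_fourier_fourier fourier_cnj flip: Bochner_Integration.integral_cnj)
      also have "\<dots> = (LINT \<eta>|lborel. cnj (F (- \<eta>)) * inv_fourier \<phi> \<eta>)"
        using integral_reflect[of "\<lambda>\<eta>. cnj (F \<eta>) * fourier \<phi> \<eta>"] by (simp add: inv_fourier_fourier)
      finally show ?thesis using True by (simp add: fun_distr_def lift_def)
    qed (simp add: fun_distr_def lift_def)
  qed
  have j: "jm s (\<lambda>\<eta>. cnj (F (- \<eta>))) = (\<lambda>\<eta>. cnj (jm s F (- \<eta>)))" by (simp add: jm_def)
  have L: "jm s F \<in> L2_fun" using F by (simp add: Hs_def)
  show "(\<lambda>\<eta>. cnj (F (- \<eta>))) \<in> Hs s"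
    unfolding Hs_def mem_Collect_eq j by (rule L2_cnj[OF L2_reflect(1)[OF L]])
  show "L2p.nrm (jm s (\<lambda>\<eta>. cnj (F (- \<eta>)))) = L2p.nrm (jm s F)"
    unfolding j using L2_reflect(2)[OF L] by (simp add: L2p_nrm)
qed

text \<open>Conjugating \<open>f\<close> reflects and conjugates \<open>F\<close>, which transposes
  the convolution kernel. So this is \<open>cv_pairing\<close> with the conjugate of
  \<open>jm (- s) u\<close> as the test function.\<close>

lemma cv_adjoint:
  assumes s: "3 / 2 < s" and F: "F \<in> Hs s" and u: "u \<in> L2_fun" and v: "v \<in> L2_fun"
  shows "fip (jm s (cv (\<lambda>\<eta>. cnj (F (- \<eta>))) (jm (- s) u))) v = fip u (jm (- s) (cv F (jm s v)))"
proof -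
  define h where "h = (\<lambda>\<eta>. cnj (jm (- s) u \<eta>))"
  define g where "g = jm s v"
  have g: "g \<in> Hs (- s)" unfolding g_def using v by (simp add: Hs_jm Hs_0)
  have "jm s h = (\<lambda>x. cnj (u x))"
    unfolding h_def jm_def by (simp add: mult.assoc[symmetric] of_real_mult[symmetric] J_minus_mult del: of_real_mult)
  then have h: "h \<in> Hs s" using L2_cnj[OF u] by (simp add: Hs_def)
  have "fip u (jm (- s) (cv F g)) = (LINT \<zeta>|lborel. cv F g \<zeta> * h \<zeta>)"
    unfolding fip_def h_def jm_def by (simp add: mult_ac)
  also have "\<dots> = cF * (LINT \<xi>|lborel. g \<xi> * (LINT \<zeta>|lborel. F (\<zeta> - \<xi>) * h \<zeta>))"
    by (rule cv_pairing[OF s F g h])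
  also have "\<dots> = fip (jm s (cv (\<lambda>\<eta>. cnj (F (- \<eta>))) (jm (- s) u))) v"
  proof -
    have "cnj (jm s (cv (\<lambda>\<eta>. cnj (F (- \<eta>))) (jm (- s) u)) \<xi>) * v \<xi> = cF * (g \<xi> * (LINT \<zeta>|lborel. F (\<zeta> - \<xi>) * h \<zeta>))" for \<xi>
    proof -
      have "cnj (LINT \<eta>|lborel. cnj (F (- (\<xi> - \<eta>))) * jm (- s) u \<eta>) = (LINT \<zeta>|lborel. F (\<zeta> - \<xi>) * h \<zeta>)"
        by (simp add: h_def flip: Bochner_Integration.integral_cnj)
      moreover have "cnj cF = cF" by (simp add: cF_def)
      ultimately show ?thesis
        unfolding jm_def[of s] cv_def g_def by (simp add: mult_ac)
    qed
    then show ?thesis unfolding fip_def by simp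
  qed
  finally show ?thesis unfolding g_def by simp
qed

subsection \<open>A product estimate of Kato-Ponce type\<close>

lemma ennreal_mult_le_squares: "x * y \<le> x\<^sup>2 + (y\<^sup>2 :: ennreal)"
proof -
  have "x * y \<le> max x y * max x y" by (intro mult_mono) auto
  also have "\<dots> \<le> x\<^sup>2 + y\<^sup>2" by (auto simp: max_def power2_eq_square)
  finally show ?thesis .
qed

text \<open>
  Schur multipliers: if convolution with \<open>F\<close> is bounded by \<open>M\<close> on square-integrable functions
  and \<open>m \<xi> \<eta> = \<integral> A y \<xi> B y \<eta> dy\<close>, then inserting \<open>m\<close> into the convolution costs at most
  \<open>sup\<^sub>\<xi> |A \<cdot> \<xi>| sup\<^sub>\<eta> |B \<cdot> \<eta>|\<close>: for each \<open>y\<close> apply the bound to \<open>A y w\<close> and \<open>B y G\<close>.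
\<close>

lemma schur_multiplier:
  fixes A B :: "space \<Rightarrow> space \<Rightarrow> real"
  assumes F: "integrable lborel F" and M: "0 \<le> M" "\<And>h. h \<in> L2_fun \<Longrightarrow> cv F h \<in> L2_fun \<and> L2p.nrm (cv F h) \<le> M * L2p.nrm h"
    and Am[measurable]: "(\<lambda>p. A (fst p) (snd p)) \<in> borel_measurable (borel \<Otimes>\<^sub>M borel)"
    and Bm[measurable]: "(\<lambda>p. B (fst p) (snd p)) \<in> borel_measurable (borel \<Otimes>\<^sub>M borel)"
    and nn: "\<And>y \<xi>. 0 \<le> A y \<xi>" "\<And>y \<xi>. 0 \<le> B y \<xi>"
    and a: "0 < a" "\<And>\<xi>. (\<integral>\<^sup>+y. ennreal ((A y \<xi>)\<^sup>2) \<partial>lborel) \<le> ennreal a"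
    and b: "0 < b" "\<And>\<eta>. (\<integral>\<^sup>+y. ennreal ((B y \<eta>)\<^sup>2) \<partial>lborel) \<le> ennreal b"
    and w: "w \<in> L2_fun" and G: "G \<in> L2_fun"
    and weq: "\<And>\<xi>. w \<xi> = cF * (LINT \<eta>|lborel. of_real (LINT y|lborel. A y \<xi> * B y \<eta>) * F (\<xi> - \<eta>) * G \<eta>)"
  shows "L2p.nrm w \<le> M * sqrt (a * b) * L2p.nrm G"
proof -
  have [measurable]: "F \<in> borel_measurable borel" using borel_measurable_integrable[OF F] by simp
  have [measurable]: "w \<in> borel_measurable borel" "G \<in> borel_measurable borel" using w G L2_measurable by auto
  have A1[measurable]: "A y \<in> borel_measurable borel" "(\<lambda>y. A y \<xi>) \<in> borel_measurable borel" for y \<xi>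
    using measurable_compose[OF _ Am, of "\<lambda>x. (y, x)" borel] measurable_compose[OF _ Am, of "\<lambda>x. (x, \<xi>)" borel] by simp_all
  have B1[measurable]: "B y \<in> borel_measurable borel" "(\<lambda>y. B y \<xi>) \<in> borel_measurable borel" for y \<xi>
    using measurable_compose[OF _ Bm, of "\<lambda>x. (y, x)" borel] measurable_compose[OF _ Bm, of "\<lambda>x. (x, \<xi>)" borel] by simp_all
  note nconv_measurable[measurable]
  define X where "X = L2p.nrm w"
  define Z where "Z = L2p.nrm G"
  have X0: "0 \<le> X" "0 \<le> Z" by (simp_all add: X_def Z_def L2p_nrm)
  \<comment> \<open>The norm of \<open>w\<close> is found by pairing \<open>w\<close> with itself.
    \<Phi> is the integrand of this pairing in the multiplier variable \<open>y\<close> and the pair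
    p of \<xi> and \<eta>.\<close>
  define \<Phi> where "\<Phi> y p = cnj (w (fst p)) * F (fst p - snd p) * G (snd p) * of_real (A y (fst p) * B y (snd p))" for y p
  have [measurable]: "(\<lambda>x. A (fst x) (fst (snd x))) \<in> borel_measurable (borel \<Otimes>\<^sub>M (borel \<Otimes>\<^sub>M (borel :: space measure)))"
    using measurable_compose[OF _ Am, of "\<lambda>x. (fst x, fst (snd x))" "borel \<Otimes>\<^sub>M (borel \<Otimes>\<^sub>M (borel :: space measure))"] by simp
  have [measurable]: "(\<lambda>x. B (fst x) (snd (snd x))) \<in> borel_measurable (borel \<Otimes>\<^sub>M ((borel :: space measure) \<Otimes>\<^sub>M borel))"
    using measurable_compose[OF _ Bm, of "\<lambda>x. (fst x, snd (snd x))" "borel \<Otimes>\<^sub>M ((borel :: space measure) \<Otimes>\<^sub>M borel)"] by simp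
  have [measurable]: "case_prod \<Phi> \<in> borel_measurable (borel \<Otimes>\<^sub>M (borel \<Otimes>\<^sub>M borel))"
    unfolding \<Phi>_def by measurable
  have [measurable]: "\<Phi> y \<in> borel_measurable (borel \<Otimes>\<^sub>M borel)" for y
    unfolding \<Phi>_def by measurable
  have \<Phi>m: "case_prod \<Phi> \<in> borel_measurable (lborel \<Otimes>\<^sub>M (lborel :: (space \<times> space) measure))"
    unfolding lborel_prod[symmetric] \<Phi>_def by measurable
  have AB: "(\<integral>\<^sup>+y. ennreal (A y \<xi> * B y \<eta>) \<partial>lborel) \<le> ennreal (a + b)" for \<xi> \<eta>
  proof -
    have "(\<integral>\<^sup>+y. ennreal (A y \<xi> * B y \<eta>) \<partial>lborel) \<le> (\<integral>\<^sup>+y. ennreal ((A y \<xi>)\<^sup>2) + ennreal ((B y \<eta>)\<^sup>2) \<partial>lborel)"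
    proof (rule nn_integral_mono)
      fix y
      have "A y \<xi> * B y \<eta> \<le> (A y \<xi>)\<^sup>2 + (B y \<eta>)\<^sup>2"
        using sum_squares_bound[of "A y \<xi>" "B y \<eta>"] mult_nonneg_nonneg[OF nn, of y \<xi> y \<eta>] by linarith
      then show "ennreal (A y \<xi> * B y \<eta>) \<le> ennreal ((A y \<xi>)\<^sup>2) + ennreal ((B y \<eta>)\<^sup>2)"
        by (simp add: ennreal_leI flip: ennreal_plus)
    qed
    also have "\<dots> \<le> ennreal a + ennreal b"
      by (subst nn_integral_add) (auto intro!: add_mono a b)
    finally show ?thesis using a(1) b(1) by simp
  qed
  \<comment> \<open>The norm bound \<open>M\<close> says nothing about absolute values. Absolute
    convergence comes instead from Young's inequality, since \<open>F\<close> is integrable; its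
    size does not enter the result.\<close>
  have wFG: "(\<integral>\<^sup>+p. ennreal (norm (w (fst p)) * (norm (F (fst p - snd p)) * norm (G (snd p)))) \<partial>(lborel \<Otimes>\<^sub>M lborel)) < \<infinity>"
  proof -
    have "(\<integral>\<^sup>+p. ennreal (norm (w (fst p)) * (norm (F (fst p - snd p)) * norm (G (snd p)))) \<partial>(lborel \<Otimes>\<^sub>M lborel))
        = (\<integral>\<^sup>+\<xi>. \<integral>\<^sup>+\<eta>. ennreal (norm (w \<xi>)) * ennreal (norm (F (\<xi> - \<eta>)) * norm (G \<eta>)) \<partial>lborel \<partial>lborel)"
      by (subst lborel.nn_integral_fst[symmetric]) (auto simp: ennreal_mult)
    also have "\<dots> = (\<integral>\<^sup>+\<xi>. ennreal (norm (w \<xi>)) * nconv F G \<xi> \<partial>lborel)"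
      by (simp add: nconv_def nn_integral_cmult)
    also have "\<dots> \<le> (\<integral>\<^sup>+\<xi>. ennreal ((norm (w \<xi>))\<^sup>2) + (nconv F G \<xi>)\<^sup>2 \<partial>lborel)"
      using ennreal_mult_le_squares by (intro nn_integral_mono) (simp add: ennreal_power[symmetric])
    also have "\<dots> = ennreal (X\<^sup>2) + (\<integral>\<^sup>+\<xi>. (nconv F G \<xi>)\<^sup>2 \<partial>lborel)"
      unfolding X_def nn_integral_L2[OF w, symmetric] by (rule nn_integral_add) measurable
    also have "\<dots> < \<infinity>"
      using young[OF F G] by (auto intro: le_less_trans)
    finally show ?thesis .
  qed
  have \<Phi>n: "norm (\<Phi> y p) = (norm (w (fst p)) * (norm (F (fst p - snd p)) * norm (G (snd p)))) * (A y (fst p) * B y (snd p))" for y p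
    unfolding \<Phi>_def by (simp add: nn norm_mult)
  have \<Phi>i: "integrable (lborel \<Otimes>\<^sub>M (lborel :: (space \<times> space) measure)) (case_prod \<Phi>)"
  proof (rule integrableI_bounded[OF \<Phi>m])
    have "(\<integral>\<^sup>+z. ennreal (norm (case_prod \<Phi> z)) \<partial>(lborel \<Otimes>\<^sub>M (lborel :: (space \<times> space) measure)))
        = (\<integral>\<^sup>+p. \<integral>\<^sup>+y. ennreal (norm (\<Phi> y p)) \<partial>lborel \<partial>lborel)"
      using \<Phi>m by (subst lborel_pair.nn_integral_snd[symmetric]) auto
    also have "\<dots> \<le> (\<integral>\<^sup>+p. ennreal (norm (w (fst p)) * (norm (F (fst p - snd p)) * norm (G (snd p)))) * ennreal (a + b) \<partial>lborel)"
    proof (rule nn_integral_mono)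
      fix p :: "space \<times> space"
      have "(\<integral>\<^sup>+y. ennreal (norm (\<Phi> y p)) \<partial>lborel)
          = ennreal (norm (w (fst p)) * (norm (F (fst p - snd p)) * norm (G (snd p)))) * (\<integral>\<^sup>+y. ennreal (A y (fst p) * B y (snd p)) \<partial>lborel)"
        unfolding \<Phi>n using nn by (subst nn_integral_cmult[symmetric]) (auto simp: ennreal_mult')
      then show "(\<integral>\<^sup>+y. ennreal (norm (\<Phi> y p)) \<partial>lborel) \<le> ennreal (norm (w (fst p)) * (norm (F (fst p - snd p)) * norm (G (snd p)))) * ennreal (a + b)"
        using AB by (simp add: mult_left_mono)
    qed
    also have "\<dots> = (\<integral>\<^sup>+p. ennreal (norm (w (fst p)) * (norm (F (fst p - snd p)) * norm (G (snd p)))) * ennreal (a + b) \<partial>(lborel \<Otimes>\<^sub>M lborel))"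
      by (simp only: lborel_prod)
    also have "\<dots> < \<infinity>"
      using wFG by (subst nn_integral_multc) (auto simp: ennreal_mult_less_top)
    finally show "(\<integral>\<^sup>+z. ennreal (norm (case_prod \<Phi> z)) \<partial>(lborel \<Otimes>\<^sub>M (lborel :: (space \<times> space) measure))) < \<infinity>" .
  qed
  have fw: "fip w w = cF * (LINT y|lborel. LINT p|lborel. \<Phi> y p)"
  proof -
    have "integrable (lborel :: (space \<times> space) measure) (\<lambda>p. LINT y|lborel. \<Phi> y p)"
      by (rule lborel_pair.integrable_snd[OF \<Phi>i])
    then have i2: "integrable (lborel \<Otimes>\<^sub>M lborel) (\<lambda>p. LINT y|lborel. \<Phi> y p)"
      by (simp only: lborel_prod)
    have "fip w w = (LINT \<xi>|lborel. cF * (LINT \<eta>|lborel. LINT y|lborel. \<Phi> y (\<xi>, \<eta>)))"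
      unfolding fip_def
    proof (rule Bochner_Integration.integral_cong[OF refl])
      fix \<xi>
      have "cnj (w \<xi>) * w \<xi> = cF * (LINT \<eta>|lborel. cnj (w \<xi>) * (of_real (LINT y|lborel. A y \<xi> * B y \<eta>) * F (\<xi> - \<eta>) * G \<eta>))"
        by (subst (2) weq) simp
      also have "(\<lambda>\<eta>. cnj (w \<xi>) * (of_real (LINT y|lborel. A y \<xi> * B y \<eta>) * F (\<xi> - \<eta>) * G \<eta>)) = (\<lambda>\<eta>. LINT y|lborel. \<Phi> y (\<xi>, \<eta>))"
      proof
        fix \<eta>
        have "(LINT y|lborel. \<Phi> y (\<xi>, \<eta>)) = (cnj (w \<xi>) * F (\<xi> - \<eta>) * G \<eta>) * (LINT y|lborel. complex_of_real (A y \<xi> * B y \<eta>))"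
          unfolding \<Phi>_def by simp
        also have "(LINT y|lborel. complex_of_real (A y \<xi> * B y \<eta>)) = of_real (LINT y|lborel. A y \<xi> * B y \<eta>)"
          by (rule integral_complex_of_real)
        finally show "cnj (w \<xi>) * (of_real (LINT y|lborel. A y \<xi> * B y \<eta>) * F (\<xi> - \<eta>) * G \<eta>) = (LINT y|lborel. \<Phi> y (\<xi>, \<eta>))"
          by (simp add: mult_ac)
      qed
      finally show "cnj (w \<xi>) * w \<xi> = cF * (LINT \<eta>|lborel. LINT y|lborel. \<Phi> y (\<xi>, \<eta>))" .
    qed
    also have "\<dots> = cF * (LINT \<xi>|lborel. LINT \<eta>|lborel. LINT y|lborel. \<Phi> y (\<xi>, \<eta>))" by simp
    also have "(LINT \<xi>|lborel. LINT \<eta>|lborel. LINT y|lborel. \<Phi> y (\<xi>, \<eta>)) = (LINT p|(lborel \<Otimes>\<^sub>M lborel). LINT y|lborel. \<Phi> y p)"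
      using lborel_pair.integral_fst'[OF i2] by simp
    also have "\<dots> = (LINT p|lborel. LINT y|lborel. \<Phi> y p)"
      by (simp only: lborel_prod)
    also have "\<dots> = (LINT y|lborel. LINT p|lborel. \<Phi> y p)"
      by (rule lborel_pair.Fubini_integral[OF \<Phi>i])
    finally show ?thesis .
  qed
  define P where "P y = (\<integral>\<^sup>+\<xi>. ennreal ((A y \<xi>)\<^sup>2) * ennreal ((norm (w \<xi>))\<^sup>2) \<partial>lborel)" for y
  define Q where "Q y = (\<integral>\<^sup>+\<xi>. ennreal ((B y \<xi>)\<^sup>2) * ennreal ((norm (G \<xi>))\<^sup>2) \<partial>lborel)" for y
  have [measurable]: "P \<in> borel_measurable borel" "Q \<in> borel_measurable borel"
    unfolding P_def[abs_def] Q_def[abs_def] by measurable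
  have P: "(\<integral>\<^sup>+y. P y \<partial>lborel) \<le> ennreal (a * X\<^sup>2)"
  proof -
    have "(\<integral>\<^sup>+y. P y \<partial>lborel) = (\<integral>\<^sup>+\<xi>. \<integral>\<^sup>+y. ennreal ((A y \<xi>)\<^sup>2) * ennreal ((norm (w \<xi>))\<^sup>2) \<partial>lborel \<partial>lborel)"
      unfolding P_def by (rule lborel_pair.Fubini'[symmetric]) measurable
    also have "\<dots> = (\<integral>\<^sup>+\<xi>. (\<integral>\<^sup>+y. ennreal ((A y \<xi>)\<^sup>2) \<partial>lborel) * ennreal ((norm (w \<xi>))\<^sup>2) \<partial>lborel)"
      by (simp add: nn_integral_multc)
    also have "\<dots> \<le> (\<integral>\<^sup>+\<xi>. ennreal a * ennreal ((norm (w \<xi>))\<^sup>2) \<partial>lborel)"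
      by (intro nn_integral_mono mult_right_mono a) simp
    also have "\<dots> = ennreal (a * X\<^sup>2)"
      using a(1) by (simp add: nn_integral_cmult nn_integral_L2[OF w] X_def ennreal_mult)
    finally show ?thesis .
  qed
  have Q: "(\<integral>\<^sup>+y. Q y \<partial>lborel) \<le> ennreal (b * Z\<^sup>2)"
  proof -
    have "(\<integral>\<^sup>+y. Q y \<partial>lborel) = (\<integral>\<^sup>+\<xi>. \<integral>\<^sup>+y. ennreal ((B y \<xi>)\<^sup>2) * ennreal ((norm (G \<xi>))\<^sup>2) \<partial>lborel \<partial>lborel)"
      unfolding Q_def by (rule lborel_pair.Fubini'[symmetric]) measurable
    also have "\<dots> = (\<integral>\<^sup>+\<xi>. (\<integral>\<^sup>+y. ennreal ((B y \<xi>)\<^sup>2) \<partial>lborel) * ennreal ((norm (G \<xi>))\<^sup>2) \<partial>lborel)"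
      by (simp add: nn_integral_multc)
    also have "\<dots> \<le> (\<integral>\<^sup>+\<xi>. ennreal b * ennreal ((norm (G \<xi>))\<^sup>2) \<partial>lborel)"
      by (intro nn_integral_mono mult_right_mono b) simp
    also have "\<dots> = ennreal (b * Z\<^sup>2)"
      using b(1) by (simp add: nn_integral_cmult nn_integral_L2[OF G] Z_def ennreal_mult)
    finally show ?thesis .
  qed
  have en: "ennreal (u * p + v * q) = ennreal u * ennreal p + ennreal v * ennreal q"
    if "0 \<le> u" "0 \<le> p" "0 \<le> v" "0 \<le> q" for u p v q :: real
    using that by (simp add: ennreal_mult)
  have PQfin: "AE y in lborel. P y \<noteq> \<infinity>" "AE y in lborel. Q y \<noteq> \<infinity>"
  proof -
    have "(\<integral>\<^sup>+y. P y \<partial>lborel) < \<infinity>" "(\<integral>\<^sup>+y. Q y \<partial>lborel) < \<infinity>"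
      using le_less_trans[OF P] le_less_trans[OF Q] by simp_all
    then have "(\<integral>\<^sup>+y. P y \<partial>lborel) \<noteq> \<infinity>" "(\<integral>\<^sup>+y. Q y \<partial>lborel) \<noteq> \<infinity>" by auto
    moreover have "P \<in> borel_measurable lborel" "Q \<in> borel_measurable lborel"
      unfolding P_def[abs_def] Q_def[abs_def] by measurable
    ultimately show "AE y in lborel. P y \<noteq> \<infinity>" "AE y in lborel. Q y \<noteq> \<infinity>"
      by - (rule nn_integral_PInf_AE; assumption)+
  qed
  \<comment> \<open>The product of the two norms is split with a parameter \<open>t\<close> by the
    arithmetic-geometric inequality instead of Cauchy-Schwarz in \<open>y\<close>; then
    \<open>P\<close> and \<open>Q\<close> occur linearly and can be integrated. For almost every
    \<open>y\<close> both are finite, so that the bound \<open>M\<close> is applicable.\<close>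
  have pt: "AE y in lborel. ennreal (norm (cF * (LINT p|lborel. \<Phi> y p))) \<le> ennreal (M * t / 2) * P y + ennreal (M / (2 * t)) * Q y"
    if t: "0 < t" for t :: real
    using PQfin lborel_pair.AE_integrable_fst[OF \<Phi>i]
  proof eventually_elim
    case (elim y)
    define h where "h \<xi> = of_real (A y \<xi>) * w \<xi>" for \<xi>
    define k where "k \<xi> = of_real (B y \<xi>) * G \<xi>" for \<xi>
    have hm[measurable]: "h \<in> borel_measurable borel" "k \<in> borel_measurable borel"
      unfolding h_def[abs_def] k_def[abs_def] by measurable
    have Py: "(\<integral>\<^sup>+\<xi>. ennreal ((norm (h \<xi>))\<^sup>2) \<partial>lborel) = P y" and Qy: "(\<integral>\<^sup>+\<xi>. ennreal ((norm (k \<xi>))\<^sup>2) \<partial>lborel) = Q y"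
      by (simp_all add: P_def Q_def h_def k_def norm_mult power_mult_distrib ennreal_mult)
    have hL: "h \<in> L2_fun"
      using elim(1) Py by (auto simp: L2_fun_def less_top intro!: integrableI_nonneg)
    have kL: "k \<in> L2_fun"
      using elim(2) Qy by (auto simp: L2_fun_def less_top intro!: integrableI_nonneg)
    have i: "integrable (lborel \<Otimes>\<^sub>M lborel) (\<Phi> y)"
      using elim(3) by (simp only: lborel_prod)
    have "cF * (LINT p|lborel. \<Phi> y p) = cF * (LINT p|(lborel \<Otimes>\<^sub>M lborel). \<Phi> y p)"
      by (simp only: lborel_prod)
    also have "(LINT p|(lborel \<Otimes>\<^sub>M lborel). \<Phi> y p) = (LINT \<xi>|lborel. LINT \<eta>|lborel. \<Phi> y (\<xi>, \<eta>))"
      using lborel_pair.integral_fst'[OF i] by simp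
    also have "cF * \<dots> = fip h (cv F k)"
    proof -
      have "(LINT \<eta>|lborel. \<Phi> y (\<xi>, \<eta>)) = cnj (h \<xi>) * (LINT \<eta>|lborel. F (\<xi> - \<eta>) * k \<eta>)" for \<xi>
        unfolding \<Phi>_def h_def k_def by (subst Bochner_Integration.integral_mult_right_zero[symmetric]) (simp add: mult_ac)
      then show ?thesis
        unfolding fip_def cv_def by (subst Bochner_Integration.integral_mult_right_zero[symmetric]) (simp add: mult_ac)
    qed
    finally have "norm (cF * (LINT p|lborel. \<Phi> y p)) \<le> L2p.nrm h * L2p.nrm (cv F k)"
      using L2p.Cauchy_Schwarz[OF hL, of "cv F k"] M(2)[OF kL] by simp
    also have "\<dots> \<le> L2p.nrm h * (M * L2p.nrm k)"
      using M(2)[OF kL] by (intro mult_left_mono L2p.nrm_nonneg hL) auto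
    also have "\<dots> = M * (L2p.nrm h * L2p.nrm k)" by simp
    also have "\<dots> \<le> M * (t / 2 * (L2p.nrm h)\<^sup>2 + 1 / (2 * t) * (L2p.nrm k)\<^sup>2)"
    proof (rule mult_left_mono[OF _ M(1)])
      have "0 \<le> (t * L2p.nrm h - L2p.nrm k)\<^sup>2 / (2 * t)" using t by simp
      also have "\<dots> = t / 2 * (L2p.nrm h)\<^sup>2 + 1 / (2 * t) * (L2p.nrm k)\<^sup>2 - L2p.nrm h * L2p.nrm k"
        using t by (simp add: power2_diff power_mult_distrib field_simps) (simp add: power2_eq_square)
      finally show "L2p.nrm h * L2p.nrm k \<le> t / 2 * (L2p.nrm h)\<^sup>2 + 1 / (2 * t) * (L2p.nrm k)\<^sup>2" by simp
    qed
    also have "\<dots> = M * t / 2 * (L2p.nrm h)\<^sup>2 + M / (2 * t) * (L2p.nrm k)\<^sup>2"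
      by (simp add: algebra_simps)
    finally have "ennreal (norm (cF * (LINT p|lborel. \<Phi> y p))) \<le> ennreal (M * t / 2 * (L2p.nrm h)\<^sup>2 + M / (2 * t) * (L2p.nrm k)\<^sup>2)"
      by (rule ennreal_leI)
    also have "\<dots> = ennreal (M * t / 2) * ennreal ((L2p.nrm h)\<^sup>2) + ennreal (M / (2 * t)) * ennreal ((L2p.nrm k)\<^sup>2)"
      by (rule en) (use M(1) t in auto)
    finally show ?case
      by (simp only: nn_integral_L2[OF hL, symmetric] nn_integral_L2[OF kL, symmetric] Py Qy)
  qed
  have main: "X\<^sup>2 \<le> M * t / 2 * (a * X\<^sup>2) + M / (2 * t) * (b * Z\<^sup>2)" if t: "0 < t" for t
  proof -
    have "ennreal (X\<^sup>2) = ennreal (norm (fip w w))"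
      using L2p.ip_self[OF w] by (simp add: X_def norm_power L2p.nrm_nonneg[OF w])
    also have "\<dots> \<le> (\<integral>\<^sup>+y. ennreal (norm (cF * (LINT p|lborel. \<Phi> y p))) \<partial>lborel)"
      unfolding fw using norm_integral_le_nn[of "\<lambda>y. cF * (LINT p|lborel. \<Phi> y p)"] by simp
    also have "\<dots> \<le> (\<integral>\<^sup>+y. ennreal (M * t / 2) * P y + ennreal (M / (2 * t)) * Q y \<partial>lborel)"
      by (rule nn_integral_mono_AE[OF pt[OF t]])
    also have "\<dots> = ennreal (M * t / 2) * (\<integral>\<^sup>+y. P y \<partial>lborel) + ennreal (M / (2 * t)) * (\<integral>\<^sup>+y. Q y \<partial>lborel)"
      by (simp add: nn_integral_add nn_integral_cmult)
    also have "\<dots> \<le> ennreal (M * t / 2) * ennreal (a * X\<^sup>2) + ennreal (M / (2 * t)) * ennreal (b * Z\<^sup>2)"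
      by (intro add_mono mult_left_mono P Q) auto
    also have "\<dots> = ennreal (M * t / 2 * (a * X\<^sup>2) + M / (2 * t) * (b * Z\<^sup>2))"
      by (rule en[symmetric]) (use M(1) t a(1) b(1) in auto)
    finally show ?thesis
      using M(1) t a(1) b(1) by (subst (asm) ennreal_le_iff) auto
  qed
  have "X\<^sup>2 \<le> M\<^sup>2 * (a * b) * Z\<^sup>2"
  proof (cases "M = 0")
    case True
    then show ?thesis using main[of 1] by simp
  next
    case False
    then have "0 < M" using M(1) by simp
    then have "M * (1 / (M * a)) / 2 * (a * X\<^sup>2) + M / (2 * (1 / (M * a))) * (b * Z\<^sup>2) = X\<^sup>2 / 2 + M\<^sup>2 * (a * b) * Z\<^sup>2 / 2"
      using a(1) by (simp add: field_simps power2_eq_square)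
    moreover have "0 < 1 / (M * a)" using \<open>0 < M\<close> a(1) by simp
    \<comment> \<open>The choice t = 1 / (M a) makes the first term half of the left-hand side,
      which absorbs it.\<close>
    ultimately show ?thesis using main[of "1 / (M * a)"] by linarith
  qed
  also have "\<dots> = (M * sqrt (a * b) * Z)\<^sup>2"
    using a(1) b(1) by (simp add: power_mult_distrib)
  finally have "X \<le> M * sqrt (a * b) * Z"
    by (rule power2_le_imp_le) (use M(1) a(1) b(1) X0 in auto)
  then show ?thesis by (simp add: X_def Z_def)
qed

section \<open>Comparison of weights at nearby frequencies\<close>

lemma J_powr: "J s \<xi> = J 1 \<xi> powr s"
  by (simp add: J_def powr_powr)

lemma J_1: "J 1 \<xi> = sqrt (1 + (norm \<xi>)\<^sup>2)"
  by (simp add: J_def powr_half_sqrt)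

lemma J_1_lipschitz: "J 1 \<xi> \<le> J 1 \<eta> + norm (\<xi> - \<eta>)"
proof -
  have "norm \<xi> \<le> norm \<eta> + norm (\<xi> - \<eta>)" using norm_triangle_ineq[of \<eta> "\<xi> - \<eta>"] by simp
  then have "(norm \<xi>)\<^sup>2 \<le> (norm \<eta> + norm (\<xi> - \<eta>))\<^sup>2" by (intro power_mono) auto
  moreover have "norm \<eta> \<le> sqrt (1 + (norm \<eta>)\<^sup>2)" by (rule real_le_rsqrt) simp
  then have "norm \<eta> * norm (\<xi> - \<eta>) \<le> sqrt (1 + (norm \<eta>)\<^sup>2) * norm (\<xi> - \<eta>)" by (rule mult_right_mono) simp
  ultimately have "1 + (norm \<xi>)\<^sup>2 \<le> (sqrt (1 + (norm \<eta>)\<^sup>2) + norm (\<xi> - \<eta>))\<^sup>2"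
    by (simp add: power2_sum)
  then show ?thesis unfolding J_1 by (intro real_le_lsqrt) auto
qed

lemma norm_le_J_1: "norm \<xi> \<le> J 1 \<xi>"
  unfolding J_1 by (rule real_le_rsqrt) simp

lemma J_compare:
  assumes "0 \<le> s" "0 \<le> K" "J 1 \<xi> \<le> K * J 1 \<eta>"
  shows "J s \<xi> \<le> K powr s * J s \<eta>" "J (- s) \<eta> \<le> K powr s * J (- s) \<xi>"
proof -
  have "J 1 \<xi> powr s \<le> (K * J 1 \<eta>) powr s"
    using assms by (intro powr_mono2) auto
  then show le: "J s \<xi> \<le> K powr s * J s \<eta>"
    unfolding J_powr[of s \<xi>] J_powr[of s \<eta>] using assms(2) by (simp add: powr_mult)
  have "J (- s) \<xi> * J (- s) \<eta> * J s \<xi> \<le> J (- s) \<xi> * J (- s) \<eta> * (K powr s * J s \<eta>)"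
    by (intro mult_left_mono le) auto
  then show "J (- s) \<eta> \<le> K powr s * J (- s) \<xi>"
    unfolding J_minus by (simp add: field_simps)
qed

lemma nn_integral_ball:
  "0 \<le> r \<Longrightarrow> (\<integral>\<^sup>+y. ennreal (if norm (x - y) \<le> r then 1 else 0) \<partial>lborel) = ennreal (unit_ball_vol 3 * r ^ 3)" for x :: space
proof -
  assume r: "0 \<le> r"
  have "(\<integral>\<^sup>+y. ennreal (if norm (x - y) \<le> r then 1 else 0) \<partial>lborel) = (\<integral>\<^sup>+y. indicator (cball x r) y \<partial>lborel)"
    by (intro nn_integral_cong) (auto simp: indicator_def dist_norm)
  also have "\<dots> = emeasure lborel (cball x r)" by simp
  also have "\<dots> = ennreal (unit_ball_vol 3 * r ^ 3)"
    using emeasure_cball[OF r, of x] by simp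
  finally show ?thesis .
qed

text \<open>The hypothesis on \<open>M\<close> keeps this estimate on the Fourier side: the supremum
  norm enters only as a bound for convolution with \<open>F\<close>. Near the diagonal the quotient
  of the weights is realised as an average over auxiliary frequencies \<open>y\<close>, which puts
  it into the product form that \<open>schur_multiplier\<close> needs.\<close>

lemma kato_ponce:
  assumes s': "3 / 2 < s'" "s' \<le> s"
  obtains C where "0 < C"
    "\<And>F g M. F \<in> Hs s \<Longrightarrow> g \<in> Hs s \<Longrightarrow> 0 \<le> M \<Longrightarrow>
      (\<And>h. h \<in> L2_fun \<Longrightarrow> cv F h \<in> L2_fun \<and> L2p.nrm (cv F h) \<le> M * L2p.nrm h) \<Longrightarrow>
      L2p.nrm (jm s (cv F g)) \<le> C * (L2p.nrm (jm s F) * L2p.nrm (jm s' g) + M * L2p.nrm (jm s g))"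
proof -
  have s: "3 / 2 < s" "0 \<le> s" using s' by auto
  define \<omega> where "\<omega> = unit_ball_vol 3"
  have \<omega>: "0 < \<omega>" unfolding \<omega>_def by simp
  \<comment> \<open>\<alpha> and \<beta> are the indicators of balls around \<xi> and \<eta> with
    radii proportional to the weights. Their overlap depends on both frequencies jointly, although
    the integrand in \<open>y\<close> is a product.\<close>
  define \<alpha> where "\<alpha> y \<xi> = (if norm (\<xi> - y) \<le> 2 / 3 * J 1 \<xi> then 1 else 0 :: real)" for y \<xi> :: space
  define \<beta> where "\<beta> y \<eta> = (if norm (\<eta> - y) \<le> 1 / 4 * J 1 \<eta> then 1 else 0 :: real)" for y \<eta> :: space
  define v where "v \<eta> = \<omega> * (1 / 4 * J 1 \<eta>) ^ 3" for \<eta>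
  have v: "0 < v \<eta>" for \<eta> unfolding v_def using \<omega> J_pos by simp
  \<comment> \<open>The powers \<open>J (- q) y\<close> and \<open>J q y\<close> cancel in the
    product. The exponent is the one for which \<open>A\<close> has bounded square integral: weight
    2s - 2q = - 3 against the volume of a ball, which grows with the third power.\<close>
  define q where "q = s + 3 / 2"
  have q: "0 \<le> 2 * q" using s by (simp add: q_def)
  define A where "A y \<xi> = \<alpha> y \<xi> * J s \<xi> * J (- q) y" for y \<xi>
  define B where "B y \<eta> = \<beta> y \<eta> * J (- s) \<eta> * J q y / v \<eta>" for y \<eta>
  \<comment> \<open>The fraction of the ball around \<eta> that lies in the ball around \<xi>, a
    number between 0 and 1.\<close>
  define \<theta> where "\<theta> \<xi> \<eta> = (LINT y|lborel. \<alpha> y \<xi> * \<beta> y \<eta>) / v \<eta>" for \<xi> \<eta>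
  have [measurable]: "(\<lambda>p. \<alpha> (fst p) (snd p)) \<in> borel_measurable (borel \<Otimes>\<^sub>M borel)" "(\<lambda>p. \<beta> (fst p) (snd p)) \<in> borel_measurable (borel \<Otimes>\<^sub>M borel)"
    unfolding \<alpha>_def \<beta>_def by measurable
  have [measurable]: "v \<in> borel_measurable borel" unfolding v_def[abs_def] by measurable
  have Am: "(\<lambda>p. A (fst p) (snd p)) \<in> borel_measurable (borel \<Otimes>\<^sub>M borel)" and Bm: "(\<lambda>p. B (fst p) (snd p)) \<in> borel_measurable (borel \<Otimes>\<^sub>M borel)"
    unfolding A_def B_def by measurable
  have \<alpha>\<beta>m: "(\<lambda>y. \<alpha> y \<xi> * \<beta> y \<eta>) \<in> borel_measurable borel" for \<xi> \<eta>
    unfolding \<alpha>_def \<beta>_def by measurable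
  have \<theta>m[measurable]: "\<theta> \<xi> \<in> borel_measurable borel" for \<xi>
    unfolding \<theta>_def[abs_def] \<alpha>_def \<beta>_def by measurable
  have ABnn: "0 \<le> A y \<xi>" "0 \<le> B y \<xi>" for y \<xi>
    unfolding A_def B_def \<alpha>_def \<beta>_def using v[of \<xi>] by auto
  have AB: "(LINT y|lborel. A y \<xi> * B y \<eta>) = J s \<xi> * J (- s) \<eta> * \<theta> \<xi> \<eta>" for \<xi> \<eta>
  proof -
    have "A y \<xi> * B y \<eta> = (J s \<xi> * J (- s) \<eta> / v \<eta>) * (\<alpha> y \<xi> * \<beta> y \<eta>)" for y
    proof -
      have "A y \<xi> * B y \<eta> = (J s \<xi> * J (- s) \<eta> / v \<eta>) * (\<alpha> y \<xi> * \<beta> y \<eta>) * (J (- q) y * J q y)"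
        unfolding A_def B_def by (simp add: field_simps)
      then show ?thesis by (simp add: J_minus_mult)
    qed
    then show ?thesis by (simp add: \<theta>_def)
  qed
  have \<beta>int: "(\<integral>\<^sup>+y. ennreal (\<beta> y \<eta>) \<partial>lborel) = ennreal (v \<eta>)" for \<eta>
    unfolding \<beta>_def v_def \<omega>_def by (rule nn_integral_ball) simp
  have \<beta>i: "integrable lborel (\<lambda>y. \<beta> y \<eta>)" "(LINT y|lborel. \<beta> y \<eta>) = v \<eta>" for \<eta>
  proof -
    have m: "(\<lambda>y. \<beta> y \<eta>) \<in> borel_measurable lborel" unfolding \<beta>_def by measurable
    show i: "integrable lborel (\<lambda>y. \<beta> y \<eta>)"
      by (rule integrableI_nonneg[OF m]) (auto simp: \<beta>int, simp add: \<beta>_def)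
    have "ennreal (LINT y|lborel. \<beta> y \<eta>) = ennreal (v \<eta>)"
      unfolding \<beta>int[symmetric] by (rule nn_integral_eq_integral[OF i, symmetric]) (simp add: \<beta>_def)
    moreover have "0 \<le> (LINT y|lborel. \<beta> y \<eta>)" by (rule Bochner_Integration.integral_nonneg) (simp add: \<beta>_def)
    ultimately show "(LINT y|lborel. \<beta> y \<eta>) = v \<eta>" using v[of \<eta>] by (simp add: less_imp_le)
  qed
  have \<theta>01: "0 \<le> \<theta> \<xi> \<eta>" "\<theta> \<xi> \<eta> \<le> 1" for \<xi> \<eta>
  proof -
    have "0 \<le> (LINT y|lborel. \<alpha> y \<xi> * \<beta> y \<eta>)"
      by (rule Bochner_Integration.integral_nonneg) (simp add: \<alpha>_def \<beta>_def)
    then show "0 \<le> \<theta> \<xi> \<eta>" unfolding \<theta>_def using v[of \<eta>] by simp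
    have "(LINT y|lborel. \<alpha> y \<xi> * \<beta> y \<eta>) \<le> (LINT y|lborel. \<beta> y \<eta>)"
    proof (rule integral_mono)
      show "integrable lborel (\<lambda>y. \<alpha> y \<xi> * \<beta> y \<eta>)"
        by (rule Bochner_Integration.integrable_bound[OF \<beta>i(1)[of \<eta>]]) (use \<alpha>\<beta>m in \<open>auto simp: \<alpha>_def \<beta>_def\<close>)
    qed (rule \<beta>i(1), simp add: \<alpha>_def \<beta>_def)
    then show "\<theta> \<xi> \<eta> \<le> 1" unfolding \<theta>_def \<beta>i using v[of \<eta>] by simp
  qed
  \<comment> \<open>For such frequencies a point \<open>y\<close> of the small ball has distance at
    most half of \<open>J 1 \<eta>\<close> from \<xi>, and \<open>J 1 \<eta>\<close> is at most 4/3
    of \<open>J 1 \<xi>\<close>. This is where the radius 2/3 comes from.\<close>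
  have \<theta>1: "\<theta> \<xi> \<eta> = 1" if near: "norm (\<xi> - \<eta>) \<le> 1 / 4 * J 1 \<eta>" for \<xi> \<eta>
  proof -
    have "\<alpha> y \<xi> * \<beta> y \<eta> = \<beta> y \<eta>" for y
    proof (cases "norm (\<eta> - y) \<le> 1 / 4 * J 1 \<eta>")
      case True
      have "norm (\<xi> - y) \<le> norm (\<xi> - \<eta>) + norm (\<eta> - y)" using norm_triangle_ineq[of "\<xi> - \<eta>" "\<eta> - y"] by simp
      moreover have "J 1 \<eta> \<le> J 1 \<xi> + norm (\<xi> - \<eta>)" using J_1_lipschitz[of \<eta> \<xi>] by (simp add: norm_minus_commute)
      ultimately have "norm (\<xi> - y) \<le> 2 / 3 * J 1 \<xi>" using near True by argo
      then show ?thesis by (simp add: \<alpha>_def)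
    qed (simp add: \<beta>_def)
    then have "(\<lambda>y. \<alpha> y \<xi> * \<beta> y \<eta>) = (\<lambda>y. \<beta> y \<eta>)" by (rule ext)
    then show ?thesis unfolding \<theta>_def using \<beta>i(2)[of \<eta>] v[of \<eta>] by (simp only:) simp
  qed
  have J3: "J 3 \<xi> = J 1 \<xi> ^ 3" for \<xi>
    using J_powr[of 3 \<xi>] powr_realpow[OF J_pos, of 1 \<xi> 3] by simp
  \<comment> \<open>On the ball around \<xi> one has J 1 \<xi> \<le> 3 J 1 y, as two thirds of the
    left side are absorbed; the other factor comes from the volume of the ball.\<close>
  define a where "a = 3 powr (2 * q) * (\<omega> * (2 / 3) ^ 3)"
  have a: "0 < a" using \<omega> by (simp add: a_def)
  have Aint: "(\<integral>\<^sup>+y. ennreal ((A y \<xi>)\<^sup>2) \<partial>lborel) \<le> ennreal a" for \<xi>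
  proof -
    have pt: "(A y \<xi>)\<^sup>2 \<le> (3 powr (2 * q) * J (- 3) \<xi>) * \<alpha> y \<xi>" for y
    proof (cases "norm (\<xi> - y) \<le> 2 / 3 * J 1 \<xi>")
      case True
      have "J 1 \<xi> \<le> 3 * J 1 y" using J_1_lipschitz[of \<xi> y] True by argo
      then have "J (- (2 * q)) y \<le> 3 powr (2 * q) * J (- (2 * q)) \<xi>" by (intro J_compare(2) q) auto
      then have "J (2 * s) \<xi> * J (- (2 * q)) y \<le> J (2 * s) \<xi> * (3 powr (2 * q) * J (- (2 * q)) \<xi>)"
        by (intro mult_left_mono) auto
      also have "\<dots> = 3 powr (2 * q) * (J (2 * s) \<xi> * J (- (2 * q)) \<xi>)" by simp
      also have "J (2 * s) \<xi> * J (- (2 * q)) \<xi> = J (- 3) \<xi>"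
        unfolding J_add[symmetric] by (simp add: q_def)
      finally show ?thesis using True by (simp add: A_def \<alpha>_def power_mult_distrib J_sq')
    qed (simp add: A_def \<alpha>_def)
    have "(\<integral>\<^sup>+y. ennreal ((A y \<xi>)\<^sup>2) \<partial>lborel) \<le> (\<integral>\<^sup>+y. ennreal (3 powr (2 * q) * J (- 3) \<xi>) * ennreal (\<alpha> y \<xi>) \<partial>lborel)"
      using pt by (intro nn_integral_mono) (simp add: \<alpha>_def ennreal_leI flip: ennreal_mult)
    also have "\<dots> = ennreal (3 powr (2 * q) * J (- 3) \<xi>) * (\<integral>\<^sup>+y. ennreal (\<alpha> y \<xi>) \<partial>lborel)"
      by (rule nn_integral_cmult) (simp add: \<alpha>_def)
    also have "(\<integral>\<^sup>+y. ennreal (\<alpha> y \<xi>) \<partial>lborel) = ennreal (\<omega> * (2 / 3 * J 1 \<xi>) ^ 3)"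
      unfolding \<alpha>_def \<omega>_def by (rule nn_integral_ball) simp
    also have "ennreal (3 powr (2 * q) * J (- 3) \<xi>) * ennreal (\<omega> * (2 / 3 * J 1 \<xi>) ^ 3) = ennreal a"
    proof -
      have "3 powr (2 * q) * J (- 3) \<xi> * (\<omega> * (2 / 3 * J 1 \<xi>) ^ 3) = a * (J (- 3) \<xi> * J 3 \<xi>)"
        unfolding a_def J3 power_mult_distrib by simp
      then show ?thesis using \<omega> by (simp add: J_minus_mult flip: ennreal_mult)
    qed
    finally show ?thesis .
  qed
  \<comment> \<open>On the ball around \<eta> one has J 1 y \<le> 5/4 J 1 \<eta>, and 64/\<omega> is
    the quotient of \<open>J 3 \<eta>\<close> and the volume \<open>v \<eta>\<close>.\<close>
  define b where "b = (5 / 4) powr (2 * q) * 64 / \<omega>"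
  have b: "0 < b" using \<omega> by (simp add: b_def)
  have Bint: "(\<integral>\<^sup>+y. ennreal ((B y \<eta>)\<^sup>2) \<partial>lborel) \<le> ennreal b" for \<eta>
  proof -
    have pt: "(B y \<eta>)\<^sup>2 \<le> ((5 / 4) powr (2 * q) * J 3 \<eta> / (v \<eta>)\<^sup>2) * \<beta> y \<eta>" for y
    proof (cases "norm (\<eta> - y) \<le> 1 / 4 * J 1 \<eta>")
      case True
      have "J 1 y \<le> 5 / 4 * J 1 \<eta>" using J_1_lipschitz[of y \<eta>] True by (simp add: norm_minus_commute)
      then have "J (2 * q) y \<le> (5 / 4) powr (2 * q) * J (2 * q) \<eta>" by (intro J_compare(1) q) auto
      then have "J (- (2 * s)) \<eta> * J (2 * q) y \<le> J (- (2 * s)) \<eta> * ((5 / 4) powr (2 * q) * J (2 * q) \<eta>)"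
        by (intro mult_left_mono) auto
      also have "\<dots> = (5 / 4) powr (2 * q) * (J (- (2 * s)) \<eta> * J (2 * q) \<eta>)" by simp
      also have "J (- (2 * s)) \<eta> * J (2 * q) \<eta> = J 3 \<eta>"
        unfolding J_add[symmetric] by (simp add: q_def)
      finally have "J (- (2 * s)) \<eta> * J (2 * q) y / (v \<eta>)\<^sup>2 \<le> (5 / 4) powr (2 * q) * J 3 \<eta> / (v \<eta>)\<^sup>2"
        by (rule divide_right_mono) simp
      then show ?thesis using True by (simp add: B_def \<beta>_def power_mult_distrib power_divide J_sq')
    qed (simp add: B_def \<beta>_def)
    have "(\<integral>\<^sup>+y. ennreal ((B y \<eta>)\<^sup>2) \<partial>lborel) \<le> (\<integral>\<^sup>+y. ennreal ((5 / 4) powr (2 * q) * J 3 \<eta> / (v \<eta>)\<^sup>2) * ennreal (\<beta> y \<eta>) \<partial>lborel)"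
      using pt by (intro nn_integral_mono) (simp add: \<beta>_def ennreal_leI flip: ennreal_mult)
    also have "\<dots> = ennreal ((5 / 4) powr (2 * q) * J 3 \<eta> / (v \<eta>)\<^sup>2) * (\<integral>\<^sup>+y. ennreal (\<beta> y \<eta>) \<partial>lborel)"
      by (rule nn_integral_cmult) (simp add: \<beta>_def)
    also have "\<dots> = ennreal b"
    proof -
      have vJ: "v \<eta> * 64 = \<omega> * J 3 \<eta>" unfolding v_def J3 power_mult_distrib by (simp add: power_divide)
      have "(5 / 4) powr (2 * q) * J 3 \<eta> / (v \<eta>)\<^sup>2 * v \<eta> = (5 / 4) powr (2 * q) * (J 3 \<eta> / v \<eta>)"
        using v[of \<eta>] by (simp add: power2_eq_square)
      also have "J 3 \<eta> / v \<eta> = 64 / \<omega>" using vJ v[of \<eta>] \<omega> by (simp add: field_simps)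
      finally have "(5 / 4) powr (2 * q) * J 3 \<eta> / (v \<eta>)\<^sup>2 * v \<eta> = b" by (simp add: b_def)
      then show ?thesis unfolding \<beta>int using v[of \<eta>] by (subst ennreal_mult[symmetric]) auto
    qed
    finally show ?thesis .
  qed
  define d where "d = norm cF * 5 powr s"
  have d: "0 \<le> d" by (simp add: d_def)
  define C where "C = sqrt (a * b) + 2 * d * CL1 s' + 1"
  have C0: "0 < C"
    unfolding C_def using d CL1_nonneg[of s'] a b by (intro add_nonneg_pos add_nonneg_nonneg mult_nonneg_nonneg) auto
  show thesis
  proof (rule that[OF C0])
    fix F g M
    assume F: "F \<in> Hs s" and g: "g \<in> Hs s" and M: "0 \<le> M"
      "\<And>h. h \<in> L2_fun \<Longrightarrow> cv F h \<in> L2_fun \<and> L2p.nrm (cv F h) \<le> M * L2p.nrm h"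
    have Fm[measurable]: "F \<in> borel_measurable borel" "g \<in> borel_measurable borel" using F g Hs_measurable by auto
    have Jm: "jm s F \<in> borel_measurable borel" "jm s g \<in> borel_measurable borel" by (intro jm_measurable Fm)+
    have g': "g \<in> Hs s'" by (rule Hs_mono(1)[OF g s'(2)])
    have gminus: "g \<in> Hs (- s)" by (rule Hs_mono(1)[OF g]) (use s in simp)
    define G where "G = jm s g"
    have G: "G \<in> L2_fun" using g by (simp add: G_def Hs_def)
    define w where "w = jm s (cv F g)"
    have w: "w \<in> L2_fun" using cv_Hs(1)[OF s(1) F g] by (simp add: w_def Hs_def)
    define w1 where "w1 \<xi> = cF * (LINT \<eta>|lborel. of_real (J s \<xi> * \<theta> \<xi> \<eta>) * (F (\<xi> - \<eta>) * g \<eta>))" for \<xi>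
    define w2 where "w2 \<xi> = cF * (LINT \<eta>|lborel. of_real (J s \<xi> * (1 - \<theta> \<xi> \<eta>)) * (F (\<xi> - \<eta>) * g \<eta>))" for \<xi>
    have Fg: "integrable lborel (\<lambda>\<eta>. F (\<xi> - \<eta>) * g \<eta>)" for \<xi>
      using nconv_finite[OF s(2) F gminus, of \<xi>] by (intro integrableI_bounded) (auto simp: nconv_def norm_mult)
    have \<theta>Fg: "integrable lborel (\<lambda>\<eta>. of_real (J s \<xi> * \<theta> \<xi> \<eta>) * (F (\<xi> - \<eta>) * g \<eta>))" for \<xi>
    proof (rule Bochner_Integration.integrable_bound[OF integrable_mult_right[OF Fg, of "of_real (J s \<xi>)"]])
      show "AE \<eta> in lborel. norm (of_real (J s \<xi> * \<theta> \<xi> \<eta>) * (F (\<xi> - \<eta>) * g \<eta>)) \<le> norm (of_real (J s \<xi>) * (F (\<xi> - \<eta>) * g \<eta>))"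
        using \<theta>01 by (auto simp: norm_mult intro!: mult_right_mono mult_left_le)
    qed measurable
    have w12: "w \<xi> = w1 \<xi> + w2 \<xi>" for \<xi>
    proof -
      have "w2 \<xi> = cF * (LINT \<eta>|lborel. of_real (J s \<xi>) * (F (\<xi> - \<eta>) * g \<eta>) - of_real (J s \<xi> * \<theta> \<xi> \<eta>) * (F (\<xi> - \<eta>) * g \<eta>))"
        unfolding w2_def by (simp add: algebra_simps)
      also have "\<dots> = cF * ((LINT \<eta>|lborel. of_real (J s \<xi>) * (F (\<xi> - \<eta>) * g \<eta>)) - (LINT \<eta>|lborel. of_real (J s \<xi> * \<theta> \<xi> \<eta>) * (F (\<xi> - \<eta>) * g \<eta>)))"
        by (subst Bochner_Integration.integral_diff[OF integrable_mult_right[OF Fg] \<theta>Fg]) simp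
      also have "\<dots> = w \<xi> - w1 \<xi>"
        unfolding w_def w1_def jm_def cv_def Bochner_Integration.integral_mult_right_zero
        by (simp add: right_diff_distrib mult.left_commute)
      finally show ?thesis by simp
    qed
    have [measurable]: "w1 \<in> borel_measurable borel" "w2 \<in> borel_measurable borel"
      unfolding w1_def[abs_def] w2_def[abs_def] \<theta>_def[abs_def] \<alpha>_def \<beta>_def by measurable
    \<comment> \<open>Away from the diagonal J 1 \<eta> is below 4 |\<xi> - \<eta>|, and one more
      |\<xi> - \<eta>| leads from \<eta> to \<xi>; hence 5. Near the diagonal the left side
      vanishes.\<close>
    have far: "J s \<xi> * (1 - \<theta> \<xi> \<eta>) \<le> 5 powr s * J s (\<xi> - \<eta>)" for \<xi> \<eta>
    proof (cases "norm (\<xi> - \<eta>) \<le> 1 / 4 * J 1 \<eta>")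
      case False
      then have "J 1 \<xi> \<le> 5 * norm (\<xi> - \<eta>)" using J_1_lipschitz[of \<xi> \<eta>] by argo
      then have "J 1 \<xi> \<le> 5 * J 1 (\<xi> - \<eta>)" using norm_le_J_1[of "\<xi> - \<eta>"] by argo
      then have "J s \<xi> \<le> 5 powr s * J s (\<xi> - \<eta>)" by (intro J_compare(1) s) auto
      moreover have "J s \<xi> * (1 - \<theta> \<xi> \<eta>) \<le> J s \<xi> * 1" using \<theta>01 by (intro mult_left_mono) auto
      ultimately show ?thesis by linarith
    qed (simp add: \<theta>1)
    have bound: "ennreal (norm (w2 \<xi>)) \<le> ennreal d * nconv (jm s F) g \<xi> + 0" for \<xi>
    proof -
      have "ennreal (norm (w2 \<xi>)) \<le> ennreal (norm cF) * (\<integral>\<^sup>+\<eta>. ennreal (norm (of_real (J s \<xi> * (1 - \<theta> \<xi> \<eta>)) * (F (\<xi> - \<eta>) * g \<eta>))) \<partial>lborel)"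
        unfolding w2_def norm_mult[of cF] by (simp only: ennreal_mult norm_ge_zero) (intro mult_left_mono norm_integral_le_nn, simp)
      also have "\<dots> \<le> ennreal (norm cF) * (\<integral>\<^sup>+\<eta>. ennreal (5 powr s) * ennreal (norm (jm s F (\<xi> - \<eta>)) * norm (g \<eta>)) \<partial>lborel)"
      proof (intro mult_left_mono nn_integral_mono)
        fix \<eta>
        have "norm (of_real (J s \<xi> * (1 - \<theta> \<xi> \<eta>)) * (F (\<xi> - \<eta>) * g \<eta>)) = (J s \<xi> * (1 - \<theta> \<xi> \<eta>)) * (norm (F (\<xi> - \<eta>)) * norm (g \<eta>))"
          using \<theta>01[of \<xi> \<eta>] by (simp only: norm_mult norm_of_real) (simp add: abs_mult J_nonneg)
        also have "\<dots> \<le> (5 powr s * J s (\<xi> - \<eta>)) * (norm (F (\<xi> - \<eta>)) * norm (g \<eta>))"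
          by (intro mult_right_mono far) auto
        finally show "ennreal (norm (of_real (J s \<xi> * (1 - \<theta> \<xi> \<eta>)) * (F (\<xi> - \<eta>) * g \<eta>))) \<le> ennreal (5 powr s) * ennreal (norm (jm s F (\<xi> - \<eta>)) * norm (g \<eta>))"
          by (simp add: norm_jm mult.assoc ennreal_leI flip: ennreal_mult)
      qed simp
      also have "\<dots> = ennreal d * nconv (jm s F) g \<xi>"
        unfolding nconv_def d_def using Jm by (subst nn_integral_cmult) (auto simp: ennreal_mult mult.assoc)
      finally show ?thesis by simp
    qed
    define N where "N = L2p.nrm (jm s F)"
    define N' where "N' = L2p.nrm (jm s' g)"
    have N0: "0 \<le> N" "0 \<le> N'" "0 \<le> L2p.nrm G" by (simp_all add: N_def N'_def L2p_nrm)
    have L: "jm s F \<in> L2_fun" using F by (simp add: Hs_def)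
    \<comment> \<open>All of the weight is on \<open>F\<close>. From \<open>g\<close> only
      integrability is used, and this costs merely its norm of order \<open>s'\<close>.\<close>
    have "(\<integral>\<^sup>+\<xi>. (nconv (jm s F) g \<xi>)\<^sup>2 \<partial>lborel) \<le> ennreal (((LINT x|lborel. norm (g x)) * N)\<^sup>2)"
      using young[OF Hs_L1(1)[OF s'(1) g'] L] nconv_commute[OF Jm(1) Fm(2)] by (simp add: N_def)
    also have "\<dots> \<le> ennreal ((CL1 s' * N' * N)\<^sup>2)"
      using Hs_L1(2)[OF s'(1) g'] N0 by (intro ennreal_leI power_mono mult_right_mono) (auto simp: N'_def)
    finally have 1: "(\<integral>\<^sup>+\<xi>. (ennreal d * nconv (jm s F) g \<xi>)\<^sup>2 \<partial>lborel) \<le> ennreal ((d * (CL1 s' * N' * N))\<^sup>2)"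
      using d CL1_nonneg[of s'] N0 nconv_measurable[OF Jm(1) Fm(2)] by (intro nn_sq_cmult) auto
    have w2: "w2 \<in> L2_fun" "L2p.nrm w2 \<le> 2 * (d * (CL1 s' * N' * N) + 0)"
      using d CL1_nonneg[of s'] N0 nconv_measurable[OF Jm(1) Fm(2)]
      by (intro L2_sum_bound[OF _ _ _ bound 1, where B = 0]; simp)+
    \<comment> \<open>\<open>schur_multiplier\<close> presupposes square-integrability, which for
      the near part is obtained as a difference of the whole and the far part.\<close>
    have w1: "w1 \<in> L2_fun"
    proof -
      have "w1 = L2p.sub w w2" by (simp add: L2p_sub w12 fun_eq_iff)
      then show ?thesis using L2p.sub_closed[OF w w2(1)] by simp
    qed
    have "w1 \<xi> = cF * (LINT \<eta>|lborel. of_real (LINT y|lborel. A y \<xi> * B y \<eta>) * F (\<xi> - \<eta>) * G \<eta>)" for \<xi>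
    proof -
      have "of_real (LINT y|lborel. A y \<xi> * B y \<eta>) * F (\<xi> - \<eta>) * G \<eta> = of_real (J s \<xi> * \<theta> \<xi> \<eta>) * (F (\<xi> - \<eta>) * g \<eta>)" for \<eta>
      proof -
        have "of_real (LINT y|lborel. A y \<xi> * B y \<eta>) * F (\<xi> - \<eta>) * G \<eta>
            = (complex_of_real (J (- s) \<eta> * J s \<eta>)) * (of_real (J s \<xi> * \<theta> \<xi> \<eta>) * (F (\<xi> - \<eta>) * g \<eta>))"
          unfolding AB G_def jm_def by (simp add: mult_ac)
        then show ?thesis unfolding J_minus_mult by simp
      qed
      from this show ?thesis unfolding w1_def by (simp only:)
    qed
    then have "L2p.nrm w1 \<le> M * sqrt (a * b) * L2p.nrm G"
      using schur_multiplier[OF Hs_L1(1)[OF s(1) F] M Am Bm ABnn a Aint b Bint w1 G] by blast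
    moreover have "L2p.nrm w \<le> L2p.nrm w1 + L2p.nrm w2"
    proof -
      have "w = flc 1 w1 1 w2" by (simp add: flc_def w12 fun_eq_iff)
      then show ?thesis using L2p.nrm_lc_le[OF w1 w2(1), of 1 1] by simp
    qed
    ultimately have "L2p.nrm w \<le> sqrt (a * b) * (M * L2p.nrm G) + (2 * d * CL1 s') * (N * N')"
      using w2(2) by (simp add: mult_ac)
    also have "\<dots> \<le> C * (M * L2p.nrm G) + C * (N * N')"
      unfolding C_def using d CL1_nonneg[of s'] a b M(1) N0 by (intro add_mono mult_right_mono) auto
    finally show "L2p.nrm (jm s (cv F g)) \<le> C * (L2p.nrm (jm s F) * L2p.nrm (jm s' g) + M * L2p.nrm (jm s g))"
      unfolding w_def G_def N_def N'_def by (simp add: distrib_left)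
  qed
qed

subsection \<open>Multiplication and Bessel potentials on vector-valued spaces\<close>

abbreviation sobolev_bounded :: "real \<Rightarrow> real \<Rightarrow> (distr4 \<Rightarrow> distr4) \<Rightarrow> bool" where
  "sobolev_bounded t r \<equiv> bounded_operator (sobolev4 t) (sobolev4_norm t) (sobolev4 r) (sobolev4_norm r)"

lemma sobolev4_norm_nonneg: "0 \<le> sobolev4_norm t u"
  by (simp add: sobolev4_norm_def sum_nonneg)

lemma sobolev_bounded_comp:
  assumes "sobolev_bounded t r A" "sobolev_bounded r q B"
  shows "sobolev_bounded t q (B \<circ> A)"
proof -
  obtain C where "\<forall>u\<in>sobolev4 t. sobolev4_norm r (A u) \<le> C * sobolev4_norm t u"
    using assms(1) unfolding bounded_operator_def by (elim conjE exE)
  note C = bspec[OF this]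
  obtain D where "\<forall>u\<in>sobolev4 r. sobolev4_norm q (B u) \<le> D * sobolev4_norm r u"
    using assms(2) unfolding bounded_operator_def by (elim conjE exE)
  note D = bspec[OF this]
  have m: "A u \<in> sobolev4 r" if "u \<in> sobolev4 t" for u
    using assms(1) that unfolding bounded_operator_def image_subset_iff by simp
  have "sobolev4_norm q (B (A u)) \<le> (\<bar>D\<bar> * C) * sobolev4_norm t u" if u: "u \<in> sobolev4 t" for u
  proof -
    have "sobolev4_norm q (B (A u)) \<le> \<bar>D\<bar> * sobolev4_norm r (A u)"
      using D[OF m[OF u]] mult_right_mono[OF abs_ge_self[of D] sobolev4_norm_nonneg[of r "A u"]] by linarith
    also have "\<dots> \<le> \<bar>D\<bar> * (C * sobolev4_norm t u)"
      by (intro mult_left_mono C u) simp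
    finally show ?thesis by simp
  qed
  moreover have "B v \<in> sobolev4 q" if "v \<in> sobolev4 r" for v
    using assms(2) that unfolding bounded_operator_def image_subset_iff by simp
  moreover have "A (lincomb a u b v) = lincomb a (A u) b (A v)" if "u \<in> sobolev4 t" "v \<in> sobolev4 t" for a u b v
    using assms(1) that unfolding bounded_operator_def by simp
  moreover have "B (lincomb a u b v) = lincomb a (B u) b (B v)" if "u \<in> sobolev4 r" "v \<in> sobolev4 r" for a u b v
    using assms(2) that unfolding bounded_operator_def by simp
  ultimately show ?thesis
    unfolding bounded_operator_def using m by (intro conjI exI[of _ "\<bar>D\<bar> * C"]) auto
qed

lemma sobolev_bounded_bessel4: "sobolev_bounded t (t - r) (bessel4 r)"
  unfolding bounded_operator_def
  by (auto simp: bessel4_mem bessel4_lincomb bessel4_norm intro!: exI[of _ 1])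

lemma sobolev_bounded_L2:
  "sobolev_bounded 0 0 A \<longleftrightarrow> bounded_operator L2_4 L2_norm L2_4 L2_norm A"
  unfolding bounded_operator_def L2_4_sobolev[symmetric]
  by (rule conj_cong[OF refl] conj_cong[OF refl] arg_cong[of _ _ Ex] ext ball_cong refl)+
     (auto simp: L2_norm_sobolev image_subset_iff)

lemma L2_inner_bessel4:
  assumes u: "u \<in> sobolev4 t" and v: "v \<in> sobolev4 t" and t: "0 \<le> t" "r \<le> t"
  shows "L2_inner (bessel4 r u) v = L2_inner u (bessel4 r v)"
proof -
  obtain g where g: "\<And>i. g i \<in> Hs t" "u = lift4 g" using sobolev4_cases[OF u] by blast
  obtain h where h: "\<And>i. h i \<in> Hs t" "v = lift4 h" using sobolev4_cases[OF v] by blast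
  have L: "x \<in> L2_fun" "jm r x \<in> L2_fun" if "x \<in> Hs t" for x
    using Hs_mono(1)[OF that t(1)] Hs_mono(1)[OF that t(2)] by (simp_all add: Hs_0 Hs_def)
  have "fip (jm r x) y = fip x (jm r y)" for x y
    by (simp add: fip_def jm_def mult_ac)
  then show ?thesis
    by (simp add: g h L L2_inner_lift4 bessel4_lift4[of _ t])
qed

lemma sqrt_sum4_le:
  fixes x :: "4 \<Rightarrow> real"
  assumes "\<And>i. 0 \<le> x i" "\<And>i. x i \<le> b"
  shows "sqrt (\<Sum>i\<in>UNIV. (x i)\<^sup>2) \<le> 2 * b"
proof (rule real_le_lsqrt)
  have "(\<Sum>i\<in>UNIV. (x i)\<^sup>2) \<le> (\<Sum>i\<in>(UNIV :: 4 set). b\<^sup>2)"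
    by (intro sum_mono power_mono assms)
  then show "(\<Sum>i\<in>UNIV. (x i)\<^sup>2) \<le> (2 * b)\<^sup>2" by (simp add: power_mult_distrib)
  show "0 \<le> 2 * b" using order_trans[OF assms] by simp
qed

lemma le_sqrt_sum4:
  fixes x :: "4 \<Rightarrow> real"
  shows "x i \<le> sqrt (\<Sum>i\<in>UNIV. (x i)\<^sup>2)"
  by (rule real_le_rsqrt) (rule member_le_sum, auto)

lemma cv_flc:
  assumes s: "0 \<le> s" and F: "F \<in> Hs s" and g: "g \<in> Hs (- s)" and h: "h \<in> Hs (- s)"
  shows "cv F (flc a g b h) = flc a (cv F g) b (cv F h)"
proof
  fix \<xi>
  have [measurable]: "F \<in> borel_measurable borel" "g \<in> borel_measurable borel" "h \<in> borel_measurable borel"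
    using F g h Hs_measurable by auto
  have i: "integrable lborel (\<lambda>\<eta>. F (\<xi> - \<eta>) * x \<eta>)" if [measurable]: "x \<in> borel_measurable borel" and x: "x \<in> Hs (- s)" for x
    using nconv_finite[OF s F x, of \<xi>] by (intro integrableI_bounded) (auto simp: nconv_def norm_mult)
  have "(LINT \<eta>|lborel. F (\<xi> - \<eta>) * flc a g b h \<eta>) = (LINT \<eta>|lborel. a * (F (\<xi> - \<eta>) * g \<eta>) + b * (F (\<xi> - \<eta>) * h \<eta>))"
    by (simp add: flc_def algebra_simps)
  also have "\<dots> = a * (LINT \<eta>|lborel. F (\<xi> - \<eta>) * g \<eta>) + b * (LINT \<eta>|lborel. F (\<xi> - \<eta>) * h \<eta>)"
    by (subst Bochner_Integration.integral_add) (auto intro!: integrable_mult_right i g h)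
  finally show "cv F (flc a g b h) \<xi> = flc a (cv F g) b (cv F h) \<xi>"
    by (simp add: cv_def flc_def[of _ "cv F g"] algebra_simps)
qed

locale sobolev_multiplier =
  fixes s :: real and f F :: "space \<Rightarrow> complex"
  assumes s: "3 / 2 < s" and f: "f \<in> L2_fun" and F: "F \<in> Hs s" and fun_distr_eq: "fun_distr f = lift F"
begin

lemma conjugate: "sobolev_multiplier s (\<lambda>x. cnj (f x)) (\<lambda>\<eta>. cnj (F (- \<eta>)))"
  using s L2_cnj[OF f] lift_cnj[OF f F fun_distr_eq] by unfold_locales auto

lemma mult4_lift4: "(\<And>i. g i \<in> Hs (- s)) \<Longrightarrow> mult4 f (lift4 g) = lift4 (\<lambda>i. cv F (g i))"
  by (simp add: vec_eq_iff mult4_def mult_lift[OF s f F fun_distr_eq])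

text \<open>Order \<open>s\<close> serves the product with \<Gamma> on the right of
  \<open>f\<close>, where \<open>f\<close> acts on the range of \<Gamma>; order \<open>- s\<close>
  serves the other product, where \<open>f\<close> acts before \<Gamma>.\<close>

lemma sobolev_bounded_mult4:
  assumes t: "t = s \<or> t = - s"
  shows "sobolev_bounded t t (mult4 f)"
proof -
  define K where "K = (4 * (norm cF * 2 powr s) * CL1 s) * L2p.nrm (jm s F)"
  have K: "0 \<le> K" by (simp add: K_def CL1_nonneg L2p_nrm)
  have minus: "g \<in> Hs (- s)" if "g \<in> Hs t" for g
    using Hs_mono(1)[OF that, of "- s"] t s by auto
  have b: "cv F g \<in> Hs t" "L2p.nrm (jm t (cv F g)) \<le> K * L2p.nrm (jm t g)" if "g \<in> Hs t" for g
    using t cv_Hs[OF s F, of g] cv_Hs_minus[OF s F, of g] that unfolding K_def by auto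
  have "sobolev4_norm t (mult4 f u) \<le> (2 * K) * sobolev4_norm t u \<and> mult4 f u \<in> sobolev4 t" if u: "u \<in> sobolev4 t" for u
  proof -
    obtain g where g: "\<And>i. g i \<in> Hs t" "u = lift4 g" using sobolev4_cases[OF u] by blast
    have "L2p.nrm (jm t (cv F (g i))) \<le> K * sobolev4_norm t u" for i
    proof -
      have "L2p.nrm (jm t (g i)) \<le> sobolev4_norm t u"
        unfolding g(2) sobolev4_norm_lift4[OF g(1)] by (rule le_sqrt_sum4)
      then show ?thesis using order_trans[OF b(2)[OF g(1)[of i]] mult_left_mono[OF _ K]] by blast
    qed
    then have "sqrt (\<Sum>i\<in>UNIV. (L2p.nrm (jm t (cv F (g i))))\<^sup>2) \<le> 2 * (K * sobolev4_norm t u)"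
      by (intro sqrt_sum4_le) (auto simp: L2p_nrm)
    then show ?thesis
      using b(1)[OF g(1)] by (simp add: g(2) mult4_lift4 minus g(1) sobolev4_norm_lift4[of _ t] lift4_sobolev4)
  qed
  moreover have "mult4 f (lincomb a u b v) = lincomb a (mult4 f u) b (mult4 f v)"
    if u: "u \<in> sobolev4 t" and v: "v \<in> sobolev4 t" for a b u v
  proof -
    obtain g where g: "\<And>i. g i \<in> Hs t" "u = lift4 g" using sobolev4_cases[OF u] by blast
    obtain h where h: "\<And>i. h i \<in> Hs t" "v = lift4 h" using sobolev4_cases[OF v] by blast
    show ?thesis
      using s by (simp add: g h lincomb_lift4[of _ t] mult4_lift4 minus Hs_flc b(1) cv_flc[OF _ F])
  qed
  ultimately show ?thesis
    unfolding bounded_operator_def by (auto intro!: exI[of _ "2 * K"])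
qed

lemma mult4_adjoint:
  "V4.adj (bessel4 (- s) \<circ> mult4 f \<circ> bessel4 s) (bessel4 s \<circ> mult4 (\<lambda>x. cnj (f x)) \<circ> bessel4 (- s))"
proof -
  interpret c: sobolev_multiplier s "\<lambda>x. cnj (f x)" "\<lambda>\<eta>. cnj (F (- \<eta>))" by (rule conjugate)
  have R': "(bessel4 (- s) \<circ> mult4 f \<circ> bessel4 s) (lift4 g) = lift4 (\<lambda>i. jm (- s) (cv F (jm s (g i))))"
    "jm (- s) (cv F (jm s (g i))) \<in> L2_fun" if g: "\<And>i. g i \<in> L2_fun" for g i
  proof -
    have g': "jm s (g i) \<in> Hs (- s)" for i using g by (simp add: Hs_jm Hs_0)
    note m = cv_Hs_minus(1)[OF s F g']
    show "(bessel4 (- s) \<circ> mult4 f \<circ> bessel4 s) (lift4 g) = lift4 (\<lambda>i. jm (- s) (cv F (jm s (g i))))"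
      using g by (simp add: bessel4_lift4[of _ 0] Hs_0 mult4_lift4 g' bessel4_lift4[OF m])
    show "jm (- s) (cv F (jm s (g i))) \<in> L2_fun" for i using m by (simp add: Hs_def)
  qed
  have R: "(bessel4 s \<circ> mult4 (\<lambda>x. cnj (f x)) \<circ> bessel4 (- s)) (lift4 g) = lift4 (\<lambda>i. jm s (cv (\<lambda>\<eta>. cnj (F (- \<eta>))) (jm (- s) (g i))))"
    "jm s (cv (\<lambda>\<eta>. cnj (F (- \<eta>))) (jm (- s) (g i))) \<in> L2_fun" if g: "\<And>i. g i \<in> L2_fun" for g i
  proof -
    have g': "jm (- s) (g i) \<in> Hs s" for i using g by (simp add: Hs_jm Hs_0)
    have g'': "jm (- s) (g i) \<in> Hs (- s)" for i using Hs_mono(1)[OF g', of "- s"] s by simp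
    note m = cv_Hs(1)[OF s c.F g']
    show "(bessel4 s \<circ> mult4 (\<lambda>x. cnj (f x)) \<circ> bessel4 (- s)) (lift4 g) = lift4 (\<lambda>i. jm s (cv (\<lambda>\<eta>. cnj (F (- \<eta>))) (jm (- s) (g i))))"
      using g by (simp add: bessel4_lift4[of _ 0] Hs_0 c.mult4_lift4 g'' bessel4_lift4[OF m])
    show "jm s (cv (\<lambda>\<eta>. cnj (F (- \<eta>))) (jm (- s) (g i))) \<in> L2_fun" for i using m by (simp add: Hs_def)
  qed
  show ?thesis
    unfolding V4.adj_def
  proof (intro conjI ballI subsetI)
    fix u v assume u: "u \<in> L2_4" and v: "v \<in> L2_4"
    obtain g where g: "\<And>i. g i \<in> L2_fun" "u = lift4 g" using L2_4_cases[OF u] by blast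
    obtain h where h: "\<And>i. h i \<in> L2_fun" "v = lift4 h" using L2_4_cases[OF v] by blast
    show "L2_inner ((bessel4 s \<circ> mult4 (\<lambda>x. cnj (f x)) \<circ> bessel4 (- s)) u) v = L2_inner u ((bessel4 (- s) \<circ> mult4 f \<circ> bessel4 s) v)"
    proof -
      have m: "jm s (cv (\<lambda>\<eta>. cnj (F (- \<eta>))) (jm (- s) (g i))) \<in> L2_fun" "jm (- s) (cv F (jm s (h i))) \<in> L2_fun" for i
        by (rule R(2), rule g(1)) (rule R'(2), rule h(1))
      show ?thesis
        unfolding g(2) h(2) R(1)[OF g(1)] R'(1)[OF h(1)] L2_inner_lift4[OF m(1) h(1)] L2_inner_lift4[OF g(1) m(2)]
        by (simp add: g(1) h(1) cv_adjoint[OF s F])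
    qed
  next
    fix w assume "w \<in> (bessel4 (- s) \<circ> mult4 f \<circ> bessel4 s) ` L2_4"
    then obtain u where u: "u \<in> L2_4" "w = (bessel4 (- s) \<circ> mult4 f \<circ> bessel4 s) u" by blast
    obtain g where g: "\<And>i. g i \<in> L2_fun" "u = lift4 g" using L2_4_cases[OF u(1)] by blast
    show "w \<in> L2_4" unfolding u(2) g(2) R'(1)[OF g(1)] by (rule lift4_L2_4[OF R'(2)[OF g(1)]])
  next
    fix w assume "w \<in> (bessel4 s \<circ> mult4 (\<lambda>x. cnj (f x)) \<circ> bessel4 (- s)) ` L2_4"
    then obtain u where u: "u \<in> L2_4" "w = (bessel4 s \<circ> mult4 (\<lambda>x. cnj (f x)) \<circ> bessel4 (- s)) u" by blast
    obtain g where g: "\<And>i. g i \<in> L2_fun" "u = lift4 g" using L2_4_cases[OF u(1)] by blast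
    show "w \<in> L2_4" unfolding u(2) g(2) R(1)[OF g(1)] by (rule lift4_L2_4[OF R(2)[OF g(1)]])
  qed
qed

end

text \<open>With g = \<open>jm (- s) u\<close> the norms of orders \<open>s\<close> and
  \<open>s'\<close> of \<open>g\<close> become those of \<open>u\<close> and of its Bessel potential
  of negative order \<open>s' - s\<close>. Passing from four components to the vector costs a factor
  2.\<close>

lemma mult4_kato_ponce:
  assumes "3 / 2 < s'" "s' \<le> s"
  obtains C where "0 < C"
    "\<And>f F u. sobolev_multiplier s f F \<Longrightarrow> u \<in> L2_4 \<Longrightarrow>
      L2_norm ((bessel4 s \<circ> mult4 f \<circ> bessel4 (- s)) u)
      \<le> C * (L2p.nrm (jm s F) * L2_norm (bessel4 (s' - s) u) + Linf_norm f * L2_norm u)"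
proof -
  obtain C where C: "0 < C" and kp: "\<And>F g M. F \<in> Hs s \<Longrightarrow> g \<in> Hs s \<Longrightarrow> 0 \<le> M \<Longrightarrow>
      (\<And>h. h \<in> L2_fun \<Longrightarrow> cv F h \<in> L2_fun \<and> L2p.nrm (cv F h) \<le> M * L2p.nrm h) \<Longrightarrow>
      L2p.nrm (jm s (cv F g)) \<le> C * (L2p.nrm (jm s F) * L2p.nrm (jm s' g) + M * L2p.nrm (jm s g))"
    using kato_ponce[OF assms] by blast
  have est: "L2_norm ((bessel4 s \<circ> mult4 f \<circ> bessel4 (- s)) u)
      \<le> 2 * C * (L2p.nrm (jm s F) * L2_norm (bessel4 (s' - s) u) + Linf_norm f * L2_norm u)"
    if m: "sobolev_multiplier s f F" and u: "u \<in> L2_4" for f F u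
  proof -
    interpret sobolev_multiplier s f F by (rule m)
    obtain g where g: "\<And>i. g i \<in> L2_fun" "u = lift4 g" using L2_4_cases[OF u] by blast
    have h: "jm (- s) (g i) \<in> Hs s" for i using g by (simp add: Hs_jm Hs_0)
    have h': "jm (- s) (g i) \<in> Hs (- s)" for i using Hs_mono(1)[OF h, of "- s"] s by simp
    have D: "jm (s' - s) (g i) \<in> L2_fun" for i
      using Hs_mono(1)[of "g i" 0 "s' - s"] g assms by (simp add: Hs_0 Hs_def)
    note cvm = cv_Hs(1)[OF s F h]
    have Ru: "(bessel4 s \<circ> mult4 f \<circ> bessel4 (- s)) u = lift4 (\<lambda>i. jm s (cv F (jm (- s) (g i))))"
      using g by (simp add: bessel4_lift4[of _ 0] Hs_0 mult4_lift4 h' bessel4_lift4[OF cvm])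
    note L0 = Linf_bound(1)[OF s f F fun_distr_eq]
    have "L2p.nrm (jm s (cv F (jm (- s) (g i))))
        \<le> C * (L2p.nrm (jm s F) * L2_norm (bessel4 (s' - s) u) + Linf_norm f * L2_norm u)" for i
    proof -
      have "L2p.nrm (jm s (cv F (jm (- s) (g i))))
          \<le> C * (L2p.nrm (jm s F) * L2p.nrm (jm (s' - s) (g i)) + Linf_norm f * L2p.nrm (g i))"
        using kp[OF F h[of i] L0] cv_Linf[OF s f F fun_distr_eq] by (simp add: jm_jm)
      also have "\<dots> \<le> C * (L2p.nrm (jm s F) * L2_norm (bessel4 (s' - s) u) + Linf_norm f * L2_norm u)"
      proof (intro mult_left_mono add_mono L0)
        show "L2p.nrm (jm (s' - s) (g i)) \<le> L2_norm (bessel4 (s' - s) u)"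
          using le_sqrt_sum4[of "\<lambda>i. L2p.nrm (jm (s' - s) (g i))" i] g D
          by (simp add: bessel4_lift4[of _ 0] Hs_0 L2_norm_lift4)
        show "L2p.nrm (g i) \<le> L2_norm u"
          using le_sqrt_sum4[of "\<lambda>i. L2p.nrm (g i)" i] g by (simp add: L2_norm_lift4)
      qed (use C in \<open>auto simp: L2p_nrm\<close>)
      finally show ?thesis .
    qed
    then have "sqrt (\<Sum>i\<in>UNIV. (L2p.nrm (jm s (cv F (jm (- s) (g i)))))\<^sup>2)
        \<le> 2 * (C * (L2p.nrm (jm s F) * L2_norm (bessel4 (s' - s) u) + Linf_norm f * L2_norm u))"
      by (intro sqrt_sum4_le) (auto simp: L2p_nrm)
    then show ?thesis
      using cvm unfolding Ru by (simp add: L2_norm_lift4 Hs_def)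
  qed
  show thesis by (rule that[of "2 * C"]) (use C est in auto)
qed

subsection \<open>Hilbert-Schmidt operators on square-integrable functions\<close>

lemma bounded_adj:
  assumes "bounded_operator L2_4 L2_norm L2_4 L2_norm A"
  obtains B where "V4.adj A B"
proof -
  obtain C where C: "\<forall>u\<in>L2_4. L2_norm (A u) \<le> C * L2_norm u"
    using assms unfolding bounded_operator_def by (elim conjE exE)
  show thesis
  proof (rule V4.adj_exists[of A C])
    show "A ` L2_4 \<subseteq> L2_4" using assms by (simp add: bounded_operator_def)
    show "A (lincomb a u b v) = lincomb a (A u) b (A v)" if "u \<in> L2_4" "v \<in> L2_4" for u v a b
      using assms that unfolding bounded_operator_def by simp
    show "V4.nrm (A u) \<le> C * V4.nrm u" if "u \<in> L2_4" for u
      unfolding V4_nrm using C that by simp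
  qed (rule that)
qed

lemma some_orthonormal_basis:
  assumes "orthonormal_basis E"
  shows "orthonormal_basis (SOME E. orthonormal_basis E)"
  using assms by (rule someI[of orthonormal_basis])

lemma orthonormal_basis_L2: "orthonormal_basis E \<Longrightarrow> E \<subseteq> L2_4"
  by (simp add: orthonormal_basis_def)

text \<open>The norm is a sum over a basis chosen by \<open>SOME\<close>. The basis at hand shows
  that the choice is a basis, and independence of the basis transfers the sum.\<close>

lemma hilbert_schmidt_norm_eq:
  assumes E: "orthonormal_basis E" and AB: "V4.adj A B" and S: "((\<lambda>e. (L2_norm (A e))\<^sup>2) has_sum S) E"
  shows "hilbert_schmidt_norm A = sqrt S"
proof -
  have "((\<lambda>e. (V4.nrm (A e))\<^sup>2) has_sum S) (SOME E. orthonormal_basis E)"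
    by (rule V4.hs_basis[OF iffD1[OF onb_iff E] iffD1[OF onb_iff some_orthonormal_basis[OF E]] AB S[folded V4_nrm]])
  then show ?thesis
    unfolding hilbert_schmidt_norm_def by (simp add: V4_nrm infsumI)
qed

lemma hilbert_schmidt_norm_cong:
  assumes "orthonormal_basis E" "\<And>u. u \<in> L2_4 \<Longrightarrow> A u = B u"
  shows "hilbert_schmidt_norm A = hilbert_schmidt_norm B"
proof -
  have sub: "(SOME E. orthonormal_basis E) \<subseteq> L2_4"
    by (rule orthonormal_basis_L2[OF some_orthonormal_basis[OF assms(1)]])
  have "(\<Sum>\<^sub>\<infinity>e\<in>(SOME E. orthonormal_basis E). (L2_norm (A e))\<^sup>2) = (\<Sum>\<^sub>\<infinity>e\<in>(SOME E. orthonormal_basis E). (L2_norm (B e))\<^sup>2)"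
    by (rule infsum_cong) (simp only: assms(2)[OF subsetD[OF sub]])
  then show ?thesis unfolding hilbert_schmidt_norm_def by (simp only:)
qed

lemma hilbert_schmidt_cases:
  assumes "hilbert_schmidt A"
  obtains E B where "orthonormal_basis E" "V4.adj A B" "0 \<le> hilbert_schmidt_norm A"
    "((\<lambda>e. (L2_norm (A e))\<^sup>2) has_sum (hilbert_schmidt_norm A)\<^sup>2) E"
proof -
  obtain E where E: "orthonormal_basis E" "(\<lambda>e. (L2_norm (A e))\<^sup>2) summable_on E"
    and b: "bounded_operator L2_4 L2_norm L2_4 L2_norm A"
    using assms unfolding hilbert_schmidt_def by blast
  obtain B where B: "V4.adj A B" by (rule bounded_adj[OF b])
  define S where "S = (\<Sum>\<^sub>\<infinity>e\<in>E. (L2_norm (A e))\<^sup>2)"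
  have S: "((\<lambda>e. (L2_norm (A e))\<^sup>2) has_sum S) E" "0 \<le> S"
    unfolding S_def using E(2) by (auto intro: has_sum_infsum infsum_nonneg)
  have "hilbert_schmidt_norm A = sqrt S" by (rule hilbert_schmidt_norm_eq[OF E(1) B S(1)])
  then show thesis using that[OF E(1) B] S by simp
qed

text \<open>Carries the estimate of \<open>mult4_kato_ponce\<close> for single vectors over to
  Hilbert-Schmidt sums.\<close>

lemma square_sum_bound:
  fixes x y z :: "'i \<Rightarrow> real"
  assumes x: "((\<lambda>e. (x e)\<^sup>2) has_sum S1) E" and y: "((\<lambda>e. (y e)\<^sup>2) has_sum S2) E"
    and z: "\<And>e. e \<in> E \<Longrightarrow> 0 \<le> z e" "\<And>e. e \<in> E \<Longrightarrow> z e \<le> a * y e + b * x e"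
    and ab: "0 \<le> a" "0 \<le> b"
  obtains S where "((\<lambda>e. (z e)\<^sup>2) has_sum S) E" "sqrt S \<le> 2 * (a * sqrt S2 + b * sqrt S1)"
proof -
  have S12: "0 \<le> S1" "0 \<le> S2" using has_sum_nonneg[OF x] has_sum_nonneg[OF y] by auto
  define T where "T = 2 * a\<^sup>2 * S2 + 2 * b\<^sup>2 * S1"
  have le: "(z e)\<^sup>2 \<le> 2 * a\<^sup>2 * (y e)\<^sup>2 + 2 * b\<^sup>2 * (x e)\<^sup>2" if "e \<in> E" for e
  proof -
    have "(z e)\<^sup>2 \<le> (a * y e + b * x e)\<^sup>2" using z[OF that] by (intro power_mono) auto
    also have "\<dots> \<le> 2 * (a * y e)\<^sup>2 + 2 * (b * x e)\<^sup>2"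
      using sum_squares_bound[of "a * y e" "b * x e"] by (simp add: power2_sum)
    finally show ?thesis by (simp add: power_mult_distrib)
  qed
  have T: "((\<lambda>e. 2 * a\<^sup>2 * (y e)\<^sup>2 + 2 * b\<^sup>2 * (x e)\<^sup>2) has_sum T) E"
    unfolding T_def by (intro has_sum_add has_sum_cmult_right x y)
  have sm: "(\<lambda>e. (z e)\<^sup>2) summable_on E"
    by (rule summable_on_comparison_test[OF has_sum_imp_summable[OF T] le]) auto
  define S where "S = (\<Sum>\<^sub>\<infinity>e\<in>E. (z e)\<^sup>2)"
  have S: "((\<lambda>e. (z e)\<^sup>2) has_sum S) E" unfolding S_def using sm by (rule has_sum_infsum)
  have "S \<le> T" by (rule has_sum_mono[OF S T le])
  also have "T \<le> 2 * (a * sqrt S2 + b * sqrt S1)\<^sup>2"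
    using S12 ab by (simp add: T_def power2_sum power_mult_distrib)
  also have "\<dots> \<le> (2 * (a * sqrt S2 + b * sqrt S1))\<^sup>2"
    unfolding power_mult_distrib[of 2] by simp
  finally have "sqrt S \<le> 2 * (a * sqrt S2 + b * sqrt S1)"
    using ab S12 by (intro real_le_lsqrt) auto
  with S show thesis by (rule that)
qed

subsection \<open>Non-negative operators\<close>

text \<open>Cutting off the frequencies above \<open>n\<close> puts a square-integrable function
  into every Sobolev space, and the cut-offs converge by dominated convergence.\<close>

lemma sobolev4_dense:
  assumes u: "u \<in> L2_4" and t: "0 \<le> t"
  obtains X where "\<And>n. X n \<in> sobolev4 t" "V4.conv X u"
proof -
  obtain g where g: "\<And>i. g i \<in> L2_fun" "u = lift4 g" using L2_4_cases[OF u] by blast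
  have gm[measurable]: "g i \<in> borel_measurable borel" for i using g(1) L2_measurable by auto
  define c where "c n i = (\<lambda>\<xi>. if norm \<xi> \<le> real n then g i \<xi> else 0)" for n i
  have [measurable]: "c n i \<in> borel_measurable borel" for n i unfolding c_def by measurable
  have "jm t (c n i) \<in> L2_fun" for n i
  proof (rule L2_nrm_mono(1)[OF _ g(1)])
    show "jm t (c n i) \<in> borel_measurable borel" by (rule jm_measurable) measurable
    show "AE \<xi> in lborel. norm (jm t (c n i) \<xi>) \<le> (1 + (real n)\<^sup>2) powr (t / 2) * norm (g i \<xi>)"
    proof (rule always_eventually, rule allI)
      show "norm (jm t (c n i) \<xi>) \<le> (1 + (real n)\<^sup>2) powr (t / 2) * norm (g i \<xi>)" for \<xi>
        using t by (auto simp: norm_jm c_def J_def intro!: mult_right_mono powr_mono2 power_mono)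
    qed
  qed simp
  then have c: "c n i \<in> Hs t" for n i by (simp add: Hs_def)
  have cL: "c n i \<in> L2_fun" for n i using Hs_mono(1)[OF c t] by (simp add: Hs_0)
  have lim: "(\<lambda>n. (L2p.nrm (flc 1 (c n i) (- 1) (g i)))\<^sup>2) \<longlonglongrightarrow> 0" for i
  proof -
    have "(\<lambda>n. LINT \<xi>|lborel. (norm (flc 1 (c n i) (- 1) (g i) \<xi>))\<^sup>2) \<longlonglongrightarrow> (LINT \<xi>|(lborel :: space measure). 0)"
    proof (rule integral_dominated_convergence[where w = "\<lambda>\<xi>. (norm (g i \<xi>))\<^sup>2"])
      show "integrable lborel (\<lambda>\<xi>. (norm (g i \<xi>))\<^sup>2)" using g(1) by (simp add: L2_fun_def)
      show "AE \<xi> in lborel. (\<lambda>n. (norm (flc 1 (c n i) (- 1) (g i) \<xi>))\<^sup>2) \<longlonglongrightarrow> 0"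
      proof (rule always_eventually, rule allI)
        fix \<xi> :: space
        have "\<forall>\<^sub>F n in sequentially. norm \<xi> \<le> real n"
          using eventually_ge_at_top[of "nat \<lceil>norm \<xi>\<rceil>"] by eventually_elim linarith
        then show "(\<lambda>n. (norm (flc 1 (c n i) (- 1) (g i) \<xi>))\<^sup>2) \<longlonglongrightarrow> 0"
          by (rule tendsto_eventually[OF eventually_mono]) (simp add: flc_def c_def)
      qed
      show "AE \<xi> in lborel. norm ((norm (flc 1 (c n i) (- 1) (g i) \<xi>))\<^sup>2) \<le> (norm (g i \<xi>))\<^sup>2" for n
        by (rule always_eventually) (simp add: flc_def c_def)
    qed (simp_all add: flc_def)
    then show ?thesis by (simp add: L2p_nrm_sq)
  qed
  show thesis
  proof (rule that)
    show "lift4 (c n) \<in> sobolev4 t" for n by (rule lift4_sobolev4[OF c])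
    have "V4.nrm (V4.sub (lift4 (c n)) u) = sqrt (\<Sum>i\<in>UNIV. (L2p.nrm (flc 1 (c n i) (- 1) (g i)))\<^sup>2)" for n
      unfolding V4_nrm V4.sub_def g(2)
      using cL g(1) by (simp add: lincomb_lift4[of _ 0] Hs_0 L2_norm_lift4 L2p.lc_closed)
    moreover have "(\<lambda>n. sqrt (\<Sum>i\<in>UNIV. (L2p.nrm (flc 1 (c n i) (- 1) (g i)))\<^sup>2)) \<longlonglongrightarrow> sqrt (\<Sum>i\<in>(UNIV :: 4 set). 0)"
      by (intro tendsto_real_sqrt tendsto_sum lim)
    ultimately show "V4.conv (\<lambda>n. lift4 (c n)) u" by (simp add: V4.conv_def)
  qed
qed

lemma bounded_operator_mem: "bounded_operator X nX Y nY A \<Longrightarrow> u \<in> X \<Longrightarrow> A u \<in> Y"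
  unfolding bounded_operator_def image_subset_iff by simp

lemma bounded_operator_lincomb:
  "bounded_operator X nX Y nY A \<Longrightarrow> u \<in> X \<Longrightarrow> v \<in> X \<Longrightarrow> A (lincomb a u b v) = lincomb a (A u) b (A v)"
  unfolding bounded_operator_def by simp

lemma form_continuous:
  assumes A: "bounded_operator L2_4 L2_norm L2_4 L2_norm A"
    and X: "\<And>n. X n \<in> L2_4" "V4.conv X u" and u: "u \<in> L2_4"
  shows "(\<lambda>n. L2_inner (X n) (A (X n))) \<longlonglongrightarrow> L2_inner u (A u)"
proof -
  obtain C where "\<forall>u\<in>L2_4. L2_norm (A u) \<le> C * L2_norm u"
    using A unfolding bounded_operator_def by (elim conjE exE)
  note C = bspec[OF this, unfolded V4_nrm[symmetric]]
  note mem = bounded_operator_mem[OF A]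
  define d where "d n = V4.nrm (V4.sub (X n) u)" for n
  have d: "d \<longlonglongrightarrow> 0" using X(2) by (simp add: V4.conv_def d_def[abs_def])
  have Au: "A (V4.sub (X n) u) = V4.sub (A (X n)) (A u)" for n
    unfolding V4.sub_def by (rule bounded_operator_lincomb[OF A X(1) u])
  have d0: "0 \<le> d n" for n unfolding d_def by (intro V4.nrm_nonneg V4.sub_closed X u)
  have bd: "norm (L2_inner (X n) (A (X n)) - L2_inner u (A u)) \<le> ((V4.nrm u + d n) * C + V4.nrm (A u)) * d n" for n
  proof -
    have "L2_inner (X n) (A (X n)) - L2_inner u (A u)
        = L2_inner (X n) (V4.sub (A (X n)) (A u)) + L2_inner (V4.sub (X n) u) (A u)"
      using X u mem by (simp add: V4.ip_sub_right V4.ip_sub_left)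
    also have "norm \<dots> \<le> V4.nrm (X n) * V4.nrm (V4.sub (A (X n)) (A u)) + d n * V4.nrm (A u)"
      unfolding d_def by (intro norm_triangle_le add_mono V4.Cauchy_Schwarz V4.sub_closed X u mem)
    also have "V4.nrm (X n) * V4.nrm (V4.sub (A (X n)) (A u)) \<le> (V4.nrm u + d n) * (C * d n)"
    proof (rule mult_mono)
      show "V4.nrm (X n) \<le> V4.nrm u + d n" unfolding d_def by (rule V4.nrm_sub_le[OF X(1) u])
      show "V4.nrm (V4.sub (A (X n)) (A u)) \<le> C * d n"
        unfolding Au[symmetric] d_def by (rule C) (intro V4.sub_closed X u)
      show "0 \<le> V4.nrm u + d n" using V4.nrm_nonneg[OF u] d0[of n] by simp
      show "0 \<le> V4.nrm (V4.sub (A (X n)) (A u))" by (intro V4.nrm_nonneg V4.sub_closed X u mem)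
    qed
    finally show ?thesis by (simp add: algebra_simps)
  qed
  have "(\<lambda>n. ((V4.nrm u + d n) * C + V4.nrm (A u)) * d n) \<longlonglongrightarrow> ((V4.nrm u + 0) * C + V4.nrm (A u)) * 0"
    by (intro tendsto_intros d)
  then have lim: "(\<lambda>n. ((V4.nrm u + d n) * C + V4.nrm (A u)) * d n) \<longlonglongrightarrow> 0" by simp
  have "(\<lambda>n. L2_inner (X n) (A (X n)) - L2_inner u (A u)) \<longlonglongrightarrow> 0"
    by (rule Lim_null_comparison[OF always_eventually lim]) (rule allI, rule bd)
  then show ?thesis by (rule LIM_zero_cancel)
qed

text \<open>Polarisation: expand the form at u + b v for b = 1 and b = \<i>, where it is
  real.\<close>

lemma self_adjoint_if_real_form:
  assumes A: "bounded_operator L2_4 L2_norm L2_4 L2_norm A"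
    and re: "\<And>u. u \<in> L2_4 \<Longrightarrow> Im (L2_inner u (A u)) = 0"
  shows "V4.adj A A"
proof -
  note mem = bounded_operator_mem[OF A]
  have "L2_inner (A u) v = L2_inner u (A v)" if u: "u \<in> L2_4" and v: "v \<in> L2_4" for u v
  proof -
    define x where "x = L2_inner u (A v)"
    define y where "y = L2_inner v (A u)"
    have q: "L2_inner (lincomb 1 u b v) (A (lincomb 1 u b v))
        = L2_inner u (A u) + cnj b * b * L2_inner v (A v) + (b * x + cnj b * y)" for b
      using u v mem by (simp add: bounded_operator_lincomb[OF A] V4.ip_lc_left V4.ip_lc_right V4.lc_closed x_def y_def algebra_simps)
    have "Im (b * x + cnj b * y) = 0" if "cnj b * b = 1" for b
      using re[of "lincomb 1 u b v"] re[OF u] re[OF v] u v that unfolding q by (simp add: V4.lc_closed)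
    from this[of 1] this[of \<i>] have "x = cnj y" by (simp add: complex_eq_iff)
    then show ?thesis
      unfolding x_def y_def using V4.ip_cnj[OF v mem[OF u]] by simp
  qed
  then show ?thesis using mem by (auto simp: V4.adj_def)
qed

lemma bessel4_0: "u \<in> sobolev4 t \<Longrightarrow> bessel4 0 u = u"
  by (elim sobolev4_cases) (simp add: bessel4_lift4[of _ t])

lemma bounded_bessel4_conj:
  assumes "sobolev_bounded (- s) s \<Gamma>"
  shows "bounded_operator L2_4 L2_norm L2_4 L2_norm (bessel4 s \<circ> \<Gamma> \<circ> bessel4 s)"
proof -
  have "sobolev_bounded 0 (- s) (bessel4 s)" using sobolev_bounded_bessel4[of 0 s] by simp
  moreover have "sobolev_bounded s 0 (bessel4 s)" using sobolev_bounded_bessel4[of s s] by simp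
  ultimately show ?thesis
    unfolding sobolev_bounded_L2[symmetric] by (blast intro: sobolev_bounded_comp assms)
qed

text \<open>For square-integrable \<open>u\<close> the vector \<open>bessel4 s u\<close> in general
  lies only in the space of order \<open>- s\<close>, where the sign of \<Gamma> is not given. For
  \<open>u\<close> of order \<open>s\<close> it is square-integrable, and the outer potential can be
  moved to the other argument of the inner product. Density and continuity of the form give the
  rest.\<close>

lemma nonneg_bessel4_conj:
  assumes s: "0 \<le> s" and \<Gamma>: "sobolev_bounded (- s) s \<Gamma>" and nn: "nonneg_operator \<Gamma>" and u: "u \<in> L2_4"
  shows "Im (L2_inner u ((bessel4 s \<circ> \<Gamma> \<circ> bessel4 s) u)) = 0" "0 \<le> Re (L2_inner u ((bessel4 s \<circ> \<Gamma> \<circ> bessel4 s) u))"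
proof -
  let ?A = "bessel4 s \<circ> \<Gamma> \<circ> bessel4 s"
  obtain X where X: "\<And>n. X n \<in> sobolev4 s" "V4.conv X u" using sobolev4_dense[OF u s] by blast
  have XL: "X n \<in> L2_4" for n using X(1) sobolev4_mono[OF s] by (auto simp: L2_4_sobolev)
  have form: "L2_inner (X n) (?A (X n)) = L2_inner (bessel4 s (X n)) (\<Gamma> (bessel4 s (X n)))"
    and mem: "bessel4 s (X n) \<in> L2_4" for n
  proof -
    show b: "bessel4 s (X n) \<in> L2_4"
      using bessel4_mem[OF X(1), of s] by (simp add: L2_4_sobolev)
    then have "bessel4 s (X n) \<in> sobolev4 (- s)"
      using sobolev4_mono[of "- s" 0] s by (auto simp: L2_4_sobolev)
    from L2_inner_bessel4[OF X(1) bounded_operator_mem[OF \<Gamma> this] s order_refl]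
    show "L2_inner (X n) (?A (X n)) = L2_inner (bessel4 s (X n)) (\<Gamma> (bessel4 s (X n)))" by simp
  qed
  note lim = form_continuous[OF bounded_bessel4_conj[OF \<Gamma>] XL X(2) u]
  have n: "Im (L2_inner (X n) (?A (X n))) = 0" "0 \<le> Re (L2_inner (X n) (?A (X n)))" for n
    unfolding form using nn mem[of n] by (simp_all add: nonneg_operator_def)
  show "Im (L2_inner u (?A u)) = 0"
    using tendsto_Im[OF lim] unfolding n by (simp add: LIMSEQ_const_iff)
  show "0 \<le> Re (L2_inner u (?A u))"
    by (rule LIMSEQ_le_const[OF tendsto_Re[OF lim]]) (use n in blast)
qed

text \<open>A common form of the two cases, stated for \<open>A\<close> and an adjoint
  \<open>B\<close> because the two products with \<open>f\<close> use one each. For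
  \<open>s' = s\<close> the extra potential is the identity and \<open>B\<close> need not be
  \<open>A\<close>; for \<open>s' < s\<close> positivity makes \<open>A\<close> self-adjoint, and
  \<open>B\<close> is taken to be \<open>A\<close>.\<close>

lemma frakH_interpolation:
  assumes s: "0 \<le> s'" "s' \<le> s" and \<Gamma>: "\<Gamma> \<in> frakH s" and nn: "s' < s \<longrightarrow> nonneg_operator \<Gamma>"
  obtains E B S S' where "orthonormal_basis E" "V4.adj (bessel4 s \<circ> \<Gamma> \<circ> bessel4 s) B" "0 \<le> frakH_norm s \<Gamma>"
    "((\<lambda>e. (L2_norm ((bessel4 s \<circ> \<Gamma> \<circ> bessel4 s) e))\<^sup>2) has_sum (frakH_norm s \<Gamma>)\<^sup>2) E"
    "((\<lambda>e. (L2_norm (B e))\<^sup>2) has_sum (frakH_norm s \<Gamma>)\<^sup>2) E"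
    "((\<lambda>e. (L2_norm (bessel4 (s' - s) ((bessel4 s \<circ> \<Gamma> \<circ> bessel4 s) e)))\<^sup>2) has_sum S) E"
    "((\<lambda>e. (L2_norm (bessel4 (s' - s) (B e)))\<^sup>2) has_sum S') E"
    "sqrt S \<le> sqrt (frakH_norm s \<Gamma>) * sqrt (frakH_norm s' \<Gamma>)"
    "sqrt S' \<le> sqrt (frakH_norm s \<Gamma>) * sqrt (frakH_norm s' \<Gamma>)"
proof -
  define A where "A = bessel4 s \<circ> \<Gamma> \<circ> bessel4 s"
  define h where "h = frakH_norm s \<Gamma>"
  have \<Gamma>b: "sobolev_bounded (- s) s \<Gamma>" and hs: "hilbert_schmidt A"
    using \<Gamma> by (simp_all add: frakH_def A_def)
  have h: "h = hilbert_schmidt_norm A" by (simp add: h_def A_def frakH_norm_def)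
  obtain E B where E: "orthonormal_basis E" and AB: "V4.adj A B" and h0: "0 \<le> h"
    and SA: "((\<lambda>e. (L2_norm (A e))\<^sup>2) has_sum h\<^sup>2) E"
    unfolding h using hilbert_schmidt_cases[OF hs] by blast
  have oE: "V4.onb E" using E by (simp add: onb_iff)
  have EL: "E \<subseteq> L2_4" by (rule orthonormal_basis_L2[OF E])
  show thesis
  proof (cases "s' = s")
    case True
    have SB: "((\<lambda>e. (L2_norm (B e))\<^sup>2) has_sum h\<^sup>2) E"
      using V4.hs_adj[OF oE oE AB] SA by (simp add: V4_nrm)
    have id: "bessel4 (s' - s) u = u" if "u \<in> L2_4" for u
      using bessel4_0[of u 0] that True by (simp add: L2_4_sobolev)
    have "A e \<in> L2_4" "B e \<in> L2_4" if "e \<in> E" for e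
      using V4.adj_mem[OF AB] EL that by auto
    then have SD: "((\<lambda>e. (L2_norm (bessel4 (s' - s) (A e)))\<^sup>2) has_sum h\<^sup>2) E"
      "((\<lambda>e. (L2_norm (bessel4 (s' - s) (B e)))\<^sup>2) has_sum h\<^sup>2) E"
      using SA SB by (simp_all add: id cong: has_sum_cong)
    show thesis
      by (rule that[OF E AB[unfolded A_def] _ SA[unfolded A_def h_def] SB[unfolded h_def] SD[unfolded A_def]])
         (use h0 True in \<open>simp_all add: h_def\<close>)
  next
    case False
    then have nn': "nonneg_operator \<Gamma>" using s nn by simp
    define D where "D = bessel4 (s' - s)"
    have s0: "0 \<le> s" using s by simp
    have AA: "V4.adj A A"
      unfolding A_def by (rule self_adjoint_if_real_form[OF bounded_bessel4_conj[OF \<Gamma>b] nonneg_bessel4_conj(1)[OF s0 \<Gamma>b nn']])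
    have DL: "D u \<in> L2_4" "L2_norm (D u) \<le> L2_norm u" if u: "u \<in> L2_4" for u
    proof -
      have u': "u \<in> sobolev4 0" using u by (simp add: L2_4_sobolev)
      show m: "D u \<in> L2_4"
        using bessel4_mem[OF u', of "s' - s"] sobolev4_mono[of 0 "s - s'"] s unfolding D_def by (auto simp: L2_4_sobolev)
      have "L2_norm (D u) = sobolev4_norm (s' - s) u"
        using bessel4_norm[OF u', of 0 "s' - s"] L2_norm_sobolev[OF m] by (simp add: D_def)
      also have "\<dots> \<le> L2_norm u"
        using sobolev4_norm_mono[OF u', of "s' - s"] s L2_norm_sobolev[OF u] by simp
      finally show "L2_norm (D u) \<le> L2_norm u" .
    qed
    have DD: "V4.adj D D"
      unfolding V4.adj_def using DL(1) L2_inner_bessel4[of _ 0 _ "s' - s"] s by (auto simp: D_def L2_4_sobolev)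
    have AL: "A u \<in> L2_4" if "u \<in> L2_4" for u using V4.adj_mem(1)[OF AA that] .
    have le: "(L2_norm (D u))\<^sup>2 \<le> (L2_norm u)\<^sup>2" if "u \<in> L2_4" for u
      using DL(2)[OF that] V4.nrm_nonneg[OF DL(1)[OF that]] by (intro power_mono) (auto simp: V4_nrm)
    define S where "S = (\<Sum>\<^sub>\<infinity>e\<in>E. (L2_norm (D (A e)))\<^sup>2)"
    have S: "((\<lambda>e. (L2_norm (D (A e)))\<^sup>2) has_sum S) E"
      unfolding S_def
      by (rule has_sum_infsum, rule summable_on_comparison_test[OF has_sum_imp_summable[OF SA]]) (use EL le AL in auto)
    have "((\<lambda>e. (V4.nrm ((A \<circ> D) e))\<^sup>2) has_sum S) E"
      by (rule V4.hs_adj[OF oE oE V4.adj_comp[OF DD AA]]) (simp add: V4_nrm S)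
    then have "((\<lambda>e. (L2_norm (A (D e)))\<^sup>2) has_sum S) E" by (simp add: V4_nrm)
    note SAD = has_sum_imp_summable[OF this]
    define T where "T = (\<Sum>\<^sub>\<infinity>e\<in>E. (L2_norm (D (A (D e))))\<^sup>2)"
    have T: "((\<lambda>e. (L2_norm (D (A (D e))))\<^sup>2) has_sum T) E"
      unfolding T_def
      by (rule has_sum_infsum, rule summable_on_comparison_test[OF SAD]) (use EL le AL DL in auto)
    \<comment> \<open>The potentials of order \<open>s' - s\<close> on both sides lower the order of
      the conjugation from \<open>s\<close> to \<open>s'\<close>. The two operators agree on
      square-integrable functions, which is enough as all basis vectors are such.\<close>
    have "frakH_norm s' \<Gamma> = hilbert_schmidt_norm (D \<circ> A \<circ> D)"
      unfolding frakH_norm_def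
    proof (rule hilbert_schmidt_norm_cong[OF E])
      fix u assume "u \<in> L2_4"
      then have u: "u \<in> sobolev4 0" by (simp add: L2_4_sobolev)
      have "bessel4 s (D u) = bessel4 s' u"
        unfolding D_def bessel4_bessel4[OF u] by simp
      moreover have "bessel4 s' u \<in> sobolev4 (- s)"
        using bessel4_mem[OF u, of s'] sobolev4_mono[of "- s" "- s'"] s by auto
      from bounded_operator_mem[OF \<Gamma>b this]
      have "D (bessel4 s (\<Gamma> (bessel4 s' u))) = bessel4 s' (\<Gamma> (bessel4 s' u))"
        unfolding D_def by (simp add: bessel4_bessel4)
      ultimately show "(bessel4 s' \<circ> \<Gamma> \<circ> bessel4 s') u = (D \<circ> A \<circ> D) u"
        by (simp add: A_def)
    qed
    also have "\<dots> = sqrt T"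
      using T by (intro hilbert_schmidt_norm_eq[OF E V4.adj_comp[OF V4.adj_comp[OF DD AA] DD]]) simp
    finally have h': "frakH_norm s' \<Gamma> = sqrt T" .
    have "S \<le> sqrt (h\<^sup>2) * sqrt T"
    proof (rule V4.hs_interpolation[OF oE AA _ DD])
      show "0 \<le> Re (L2_inner u (A u))" if "u \<in> L2_4" for u
        unfolding A_def by (rule nonneg_bessel4_conj(2)[OF s0 \<Gamma>b nn' that])
    qed (use DL SA S T in \<open>simp_all add: V4_nrm\<close>)
    then have "S \<le> h * frakH_norm s' \<Gamma>" using h0 by (simp add: h')
    then have le: "sqrt S \<le> sqrt h * sqrt (frakH_norm s' \<Gamma>)"
      unfolding real_sqrt_mult[symmetric] by (rule real_sqrt_le_mono)
    show thesis
      by (rule that[OF E AA[unfolded A_def] h0[unfolded h_def] SA[unfolded A_def h_def] SA[unfolded A_def h_def]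
            S[unfolded A_def D_def] S[unfolded A_def D_def] le[unfolded h_def] le[unfolded h_def]])
  qed
qed

lemma frakH_multiplier:
  assumes m: "sobolev_multiplier s f F" and s': "0 \<le> s'" "s' \<le> s"
    and \<Gamma>: "\<Gamma> \<in> frakH s" and nn: "s' < s \<longrightarrow> nonneg_operator \<Gamma>"
    and C: "0 < C" "\<And>f F u. sobolev_multiplier s f F \<Longrightarrow> u \<in> L2_4 \<Longrightarrow>
      L2_norm ((bessel4 s \<circ> mult4 f \<circ> bessel4 (- s)) u)
      \<le> C * (L2p.nrm (jm s F) * L2_norm (bessel4 (s' - s) u) + Linf_norm f * L2_norm u)"
  defines "Q \<equiv> 2 * C * (L2p.nrm (jm s F) * sqrt (frakH_norm s \<Gamma>) * sqrt (frakH_norm s' \<Gamma>) + Linf_norm f * frakH_norm s \<Gamma>)"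
  shows "mult4 f \<circ> \<Gamma> \<in> frakH s" "frakH_norm s (mult4 f \<circ> \<Gamma>) \<le> Q"
    and "\<Gamma> \<circ> mult4 f \<in> frakH s" "frakH_norm s (\<Gamma> \<circ> mult4 f) \<le> Q"
proof -
  interpret sobolev_multiplier s f F by (rule m)
  interpret c: sobolev_multiplier s "\<lambda>x. cnj (f x)" "\<lambda>\<eta>. cnj (F (- \<eta>))" by (rule conjugate)
  define A where "A = bessel4 s \<circ> \<Gamma> \<circ> bessel4 s"
  define h where "h = frakH_norm s \<Gamma>"
  define h' where "h' = frakH_norm s' \<Gamma>"
  define N where "N = L2p.nrm (jm s F)"
  define L where "L = Linf_norm f"
  have N0: "0 \<le> N" by (simp add: N_def L2p_nrm)
  have L0: "0 \<le> L" unfolding L_def by (rule Linf_bound(1)[OF s f F fun_distr_eq])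
  obtain E B S S' where E: "orthonormal_basis E" and AB: "V4.adj A B" and h0: "0 \<le> h"
    and SA: "((\<lambda>e. (L2_norm (A e))\<^sup>2) has_sum h\<^sup>2) E"
    and SB: "((\<lambda>e. (L2_norm (B e))\<^sup>2) has_sum h\<^sup>2) E"
    and SDA: "((\<lambda>e. (L2_norm (bessel4 (s' - s) (A e)))\<^sup>2) has_sum S) E"
    and SDB: "((\<lambda>e. (L2_norm (bessel4 (s' - s) (B e)))\<^sup>2) has_sum S') E"
    and le: "sqrt S \<le> sqrt h * sqrt h'" "sqrt S' \<le> sqrt h * sqrt h'"
    unfolding h_def h'_def A_def by (rule frakH_interpolation[OF s' \<Gamma> nn])
  have EL: "E \<subseteq> L2_4" by (rule orthonormal_basis_L2[OF E])
  have oE: "V4.onb E" using E by (simp add: onb_iff)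
  have \<Gamma>b: "sobolev_bounded (- s) s \<Gamma>" using \<Gamma> by (simp add: frakH_def)
  define R where "R = bessel4 s \<circ> mult4 f \<circ> bessel4 (- s)"
  define R' where "R' = bessel4 (- s) \<circ> mult4 f \<circ> bessel4 s"
  define Rc where "Rc = bessel4 s \<circ> mult4 (\<lambda>x. cnj (f x)) \<circ> bessel4 (- s)"
  have R'Rc: "V4.adj R' Rc" unfolding R'_def Rc_def by (rule mult4_adjoint)
  have L2n: "0 \<le> L2_norm u" for u by (simp add: L2_norm_def sum_nonneg)

  have Q: "2 * ((C * N) * sqrt T + (C * L) * sqrt (h\<^sup>2)) \<le> Q" if "sqrt T \<le> sqrt h * sqrt h'" for T
  proof -
    have "(C * N) * sqrt T \<le> (C * N) * (sqrt h * sqrt h')"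
      using C(1) N0 that by (intro mult_left_mono) auto
    then show ?thesis
      using h0 by (simp add: Q_def h_def[symmetric] h'_def[symmetric] N_def[symmetric] L_def[symmetric] algebra_simps)
  qed
  obtain T where T: "((\<lambda>e. (L2_norm (R (A e)))\<^sup>2) has_sum T) E"
    "sqrt T \<le> 2 * ((C * N) * sqrt S + (C * L) * sqrt (h\<^sup>2))"
  proof (rule square_sum_bound[OF SA SDA])
    show "L2_norm (R (A e)) \<le> C * N * L2_norm (bessel4 (s' - s) (A e)) + C * L * L2_norm (A e)" if "e \<in> E" for e
    proof -
      have "A e \<in> L2_4" using V4.adj_mem(1)[OF AB] EL that by auto
      from C(2)[OF m this] show ?thesis by (simp add: R_def N_def L_def algebra_simps)
    qed
  qed (use C(1) N0 L0 L2n in auto)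
  have nc: "L2p.nrm (jm s (\<lambda>\<eta>. cnj (F (- \<eta>)))) = N" "Linf_norm (\<lambda>x. cnj (f x)) = L"
    using lift_cnj(3)[OF f F fun_distr_eq] by (simp_all add: N_def L_def Linf_norm_def)
  obtain T' where T': "((\<lambda>e. (L2_norm (Rc (B e)))\<^sup>2) has_sum T') E"
    "sqrt T' \<le> 2 * ((C * N) * sqrt S' + (C * L) * sqrt (h\<^sup>2))"
  proof (rule square_sum_bound[OF SB SDB])
    show "L2_norm (Rc (B e)) \<le> C * N * L2_norm (bessel4 (s' - s) (B e)) + C * L * L2_norm (B e)" if "e \<in> E" for e
    proof -
      have "B e \<in> L2_4" using V4.adj_mem(2)[OF AB] EL that by auto
      from C(2)[OF conjugate this] show ?thesis by (simp add: Rc_def nc algebra_simps)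
    qed
  qed (use C(1) N0 L0 L2n in auto)

  \<comment> \<open>It suffices to identify the conjugated operator with some \<open>Y\<close> on
    square-integrable functions and to know the sum of \<open>Y\<close> over one basis.\<close>
  have finish: "X \<in> frakH s \<and> frakH_norm s X = sqrt V"
    if X: "sobolev_bounded (- s) s X"
      and eq: "\<And>u. u \<in> L2_4 \<Longrightarrow> (bessel4 s \<circ> X \<circ> bessel4 s) u = Y u"
      and V: "((\<lambda>e. (L2_norm (Y e))\<^sup>2) has_sum V) E" for X Y V
  proof -
    have V': "((\<lambda>e. (L2_norm ((bessel4 s \<circ> X \<circ> bessel4 s) e))\<^sup>2) has_sum V) E"
      using V by (rule has_sum_cong[THEN iffD2, rotated]) (simp only: eq[OF subsetD[OF EL]])
    note b = bounded_bessel4_conj[OF X]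
    obtain Z where Z: "V4.adj (bessel4 s \<circ> X \<circ> bessel4 s) Z" by (rule bounded_adj[OF b])
    have "hilbert_schmidt (bessel4 s \<circ> X \<circ> bessel4 s)"
      unfolding hilbert_schmidt_def using b E has_sum_imp_summable[OF V'] by blast
    moreover have "hilbert_schmidt_norm (bessel4 s \<circ> X \<circ> bessel4 s) = sqrt V"
      by (rule hilbert_schmidt_norm_eq[OF E Z]) (rule V')
    ultimately show ?thesis
      using X by (simp add: frakH_def frakH_norm_def)
  qed

  have b1: "sobolev_bounded (- s) s (mult4 f \<circ> \<Gamma>)"
    by (rule sobolev_bounded_comp[OF \<Gamma>b sobolev_bounded_mult4]) simp
  \<comment> \<open>The potentials of orders \<open>s\<close> and \<open>- s\<close> inserted
    between \<open>f\<close> and \<Gamma> cancel, since \<Gamma> maps into the space of order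
    \<open>s\<close>.\<close>
  have e1: "(bessel4 s \<circ> (mult4 f \<circ> \<Gamma>) \<circ> bessel4 s) u = R (A u)" if u: "u \<in> L2_4" for u
  proof -
    have "bessel4 s u \<in> sobolev4 (- s)" using bessel4_mem[of u 0 s] u by (simp add: L2_4_sobolev)
    note w = bounded_operator_mem[OF \<Gamma>b this]
    show ?thesis by (simp add: R_def A_def bessel4_bessel4[OF w] bessel4_0[OF w])
  qed
  have b2: "sobolev_bounded (- s) s (\<Gamma> \<circ> mult4 f)"
    by (rule sobolev_bounded_comp[OF sobolev_bounded_mult4 \<Gamma>b]) simp
  have e2: "(bessel4 s \<circ> (\<Gamma> \<circ> mult4 f) \<circ> bessel4 s) u = (A \<circ> R') u" if u: "u \<in> L2_4" for u
  proof -
    have "bessel4 s u \<in> sobolev4 (- s)" using bessel4_mem[of u 0 s] u by (simp add: L2_4_sobolev)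
    then have w: "mult4 f (bessel4 s u) \<in> sobolev4 (- s)"
      by (rule bounded_operator_mem[OF sobolev_bounded_mult4, rotated]) simp
    show ?thesis by (simp add: R'_def A_def bessel4_bessel4[OF w] bessel4_0[OF w])
  qed
  \<comment> \<open>The composition of \<open>Rc\<close> and \<open>B\<close> is an adjoint of that
    of \<open>A\<close> and \<open>R'\<close>, hence has the same Hilbert-Schmidt sum, and the
    product estimate was applied to \<open>Rc\<close>.\<close>
  have "((\<lambda>e. (V4.nrm ((A \<circ> R') e))\<^sup>2) has_sum T') E"
    by (rule V4.hs_adj[OF oE oE V4.adj_sym[OF V4.adj_comp[OF AB R'Rc]]]) (simp add: V4_nrm T'(1))
  then have s2: "((\<lambda>e. (L2_norm ((A \<circ> R') e))\<^sup>2) has_sum T') E" by (simp only: V4_nrm)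
  note 1 = finish[OF b1 e1 T(1)] and 2 = finish[OF b2 e2 s2]
  show "mult4 f \<circ> \<Gamma> \<in> frakH s" "\<Gamma> \<circ> mult4 f \<in> frakH s" using 1 2 by blast+
  show "frakH_norm s (mult4 f \<circ> \<Gamma>) \<le> Q" "frakH_norm s (\<Gamma> \<circ> mult4 f) \<le> Q"
    using 1 2 order_trans[OF T(2) Q[OF le(1)]] order_trans[OF T'(2) Q[OF le(2)]] by simp_all
qed

theorem lemma3p3:
  fixes s :: real
  assumes "s > 3/2"
  shows
    "(\<forall>\<Gamma>\<in>frakH s. \<forall>f\<in>sobolev_fun s.
        \<Gamma> \<circ> mult4 f \<in> frakH s \<and> mult4 f \<circ> \<Gamma> \<in> frakH s) \<and>
     (\<forall>s'::real. 3/2 < s' \<and> s' \<le> s \<longrightarrow>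
        (\<exists>c::real. c > 0 \<and>
          (\<forall>f\<in>sobolev_fun s. \<forall>\<Gamma>\<in>frakH s. (s' < s \<longrightarrow> nonneg_operator \<Gamma>) \<longrightarrow>
             frakH_norm s (mult4 f \<circ> \<Gamma>) + frakH_norm s (\<Gamma> \<circ> mult4 f)
             \<le> c * (sobolev_norm s (fun_distr f) * sqrt (frakH_norm s \<Gamma>) * sqrt (frakH_norm s' \<Gamma>)
                    + Linf_norm f * frakH_norm s \<Gamma>))))"
proof -
  have mult: "\<exists>F. sobolev_multiplier s f F \<and> sobolev_norm s (fun_distr f) = L2p.nrm (jm s F)"
    if f: "f \<in> sobolev_fun s" for f
  proof -
    obtain F where "f \<in> L2_fun" "F \<in> Hs s" "fun_distr f = lift F" "sobolev_norm s (fun_distr f) = L2p.nrm (jm s F)"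
      using sobolev_fun_cases[OF f] by blast
    then show ?thesis using assms by (intro exI[of _ F]) (simp add: sobolev_multiplier_def)
  qed
  have "\<Gamma> \<circ> mult4 f \<in> frakH s \<and> mult4 f \<circ> \<Gamma> \<in> frakH s" if \<Gamma>: "\<Gamma> \<in> frakH s" and f: "f \<in> sobolev_fun s" for \<Gamma> f
  proof -
    obtain C where C: "0 < C" "\<And>f F u. sobolev_multiplier s f F \<Longrightarrow> u \<in> L2_4 \<Longrightarrow>
      L2_norm ((bessel4 s \<circ> mult4 f \<circ> bessel4 (- s)) u)
      \<le> C * (L2p.nrm (jm s F) * L2_norm (bessel4 (s - s) u) + Linf_norm f * L2_norm u)"
      using mult4_kato_ponce[OF assms order_refl] by blast
    obtain F where F: "sobolev_multiplier s f F" using mult[OF f] by blast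
    \<comment> \<open>Membership is the case \<open>s' = s\<close> of the estimate, in which the
      condition on the sign of \<Gamma> is vacuous.\<close>
    have "0 \<le> s" "s < s \<longrightarrow> nonneg_operator \<Gamma>" using assms by simp_all
    note E = frakH_multiplier(1,3)[OF F this(1) order_refl \<Gamma> this(2) C(1)]
    show ?thesis
      by (intro conjI E(2) E(1); rule C(2))
  qed
  moreover have "\<exists>c>0. \<forall>f\<in>sobolev_fun s. \<forall>\<Gamma>\<in>frakH s. (s' < s \<longrightarrow> nonneg_operator \<Gamma>) \<longrightarrow>
      frakH_norm s (mult4 f \<circ> \<Gamma>) + frakH_norm s (\<Gamma> \<circ> mult4 f)
      \<le> c * (sobolev_norm s (fun_distr f) * sqrt (frakH_norm s \<Gamma>) * sqrt (frakH_norm s' \<Gamma>) + Linf_norm f * frakH_norm s \<Gamma>)"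
    if s': "3 / 2 < s'" "s' \<le> s" for s'
  proof -
    obtain C where C: "0 < C" "\<And>f F u. sobolev_multiplier s f F \<Longrightarrow> u \<in> L2_4 \<Longrightarrow>
      L2_norm ((bessel4 s \<circ> mult4 f \<circ> bessel4 (- s)) u)
      \<le> C * (L2p.nrm (jm s F) * L2_norm (bessel4 (s' - s) u) + Linf_norm f * L2_norm u)"
      using mult4_kato_ponce[OF s'] by blast
    show ?thesis
    \<comment> \<open>Each of the two products contributes 2 * C.\<close>
    proof (intro exI[of _ "4 * C"] conjI ballI impI)
      fix f \<Gamma> assume f: "f \<in> sobolev_fun s" and \<Gamma>: "\<Gamma> \<in> frakH s" "s' < s \<longrightarrow> nonneg_operator \<Gamma>"
      obtain F where F: "sobolev_multiplier s f F" "sobolev_norm s (fun_distr f) = L2p.nrm (jm s F)"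
        using mult[OF f] by blast
      have s'0: "0 \<le> s'" using s' by simp
      let ?Q = "2 * C * (L2p.nrm (jm s F) * sqrt (frakH_norm s \<Gamma>) * sqrt (frakH_norm s' \<Gamma>) + Linf_norm f * frakH_norm s \<Gamma>)"
      have "frakH_norm s (mult4 f \<circ> \<Gamma>) \<le> ?Q"
        by (rule frakH_multiplier(2)[OF F(1) s'0 s'(2) \<Gamma> C(1)]) (rule C(2))
      moreover have "frakH_norm s (\<Gamma> \<circ> mult4 f) \<le> ?Q"
        by (rule frakH_multiplier(4)[OF F(1) s'0 s'(2) \<Gamma> C(1)]) (rule C(2))
      ultimately show "frakH_norm s (mult4 f \<circ> \<Gamma>) + frakH_norm s (\<Gamma> \<circ> mult4 f)
        \<le> 4 * C * (sobolev_norm s (fun_distr f) * sqrt (frakH_norm s \<Gamma>) * sqrt (frakH_norm s' \<Gamma>) + Linf_norm f * frakH_norm s \<Gamma>)"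
        unfolding F(2) by linarith
    qed (use C in simp)
  qed
  ultimately show ?thesis by blast
qed

end
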